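(* Assume $\beta=\alpha/2$ with $\alpha\in(0,1)$. Let $\mathcal C_0\subset\mathbb X_{\alpha,\alpha/2}$ be a weak-strong uniqueness class of the skeleton equation such that its $\mathcal I$-closure $\mathcal C=\overline{\mathcal C_0}^{\mathcal I}$ contains non-empty time-reversible subsets. Let $\mathcal R\subset\mathcal C$ satisfy $\mathcal R=\mathfrak T_T\mathcal R$. Suppose that $\theta\in\mathcal R$ is a weak solution of $$\partial_t\theta=-\Lambda^{2\alpha}\theta-R^\perp\theta\cdot\nabla\theta+\Lambda^{\alpha}g$$ for some $g\in L^2([0,T];L^2(\mathbb T^2))$. Then the kinetic energy equality holds: $$\frac12\|\theta(T)\|_{L^2(\mathbb T^2)}^2+\int_0^T\|\theta(s)\|_{H^\alpha(\mathbb T^2)}^2\,ds=\frac12\|\theta(0)\|_{L^2(\mathbb T^2)}^2+\int_0^T\langle\Lambda^\alpha\theta,g\rangle\,ds.$$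
   Context: $\mathbb T^2=\mathbb R^2/\mathbb Z^2$, $T>0$ fixed. $H$ is the space of real mean-zero functions in $L^2(\mathbb T^2)$, $\langle\cdot,\cdot\rangle$ the $L^2$ inner product (also used for duality pairings). For $r\in\mathbb R$, $H^r(\mathbb T^2)$ is the space of mean-zero distributions with $\|f\|_{H^r}^2=\sum_{k\ne0}|2\pi k|^{2r}|\hat f(k)|^2<\infty$ (so $H^0=H$); $H^\infty=\bigcap_{r>0}H^r$; a subscript $w$ means weak topology. $\Lambda=(-\Delta)^{1/2}$, $R_j=\partial_j\Lambda^{-1}$, $R^\perp\theta=(-R_2\theta,R_1\theta)$. $$\mathbb X_{\alpha,\alpha/2}=L^2([0,T];H)\cap L^2_w([0,T];H^{\alpha})\cap C([0,T];H_w)$$ with the intersection topology. The time-reversal operator is $(\mathfrak T_T\theta)(t)=-\theta(T-t)$; a set $\mathcal R$ is time-reversible if $\mathcal R=\mathfrak T_T\mathcal R$. Nonlinearity. $[\Lambda,\partial_i\varphi]h:=\Lambda(\partial_i\varphi\,h)-\partial_i\varphi\,\Lambda h$, and $R^\perp\theta\cdot\nabla\theta=\nabla\cdot(\theta R^\perp\theta)$ is defined by $\langle R^\perp\theta\cdot\nabla\theta,\varphi\rangle:=-\frac12\langle R_2\theta,[\Lambda,\partial_1\varphi]\Lambda^{-1}\theta\rangle+\frac12\langle R_1\theta,[\Lambda,\partial_2\varphi]\Lambda^{-1}\theta\rangle$ for $\varphi\in H^\infty$ (equal to $-\int\theta R^\perp\theta\cdot\nabla\varphi\,dx$ for smooth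 $\theta$). A weak solution of the skeleton equation $\partial_t\theta=-\Lambda^{2\alpha}\theta-R^\perp\theta\cdot\nabla\theta+\Lambda^{\alpha}g$ with initial data $\theta_0\in H$ is $\theta\in L^\infty([0,T];H)\cap L^2([0,T];H^{\alpha})\cap C([0,T];H_w)$ such that for all $\varphi\in C^\infty([0,T];H^\infty)$, $t\in[0,T]$, $$\langle\theta(t),\varphi(t)\rangle=\langle\theta_0,\varphi(0)\rangle+\int_0^t\big(\langle\theta,\partial_s\varphi\rangle-\langle\theta,\Lambda^{2\alpha}\varphi\rangle-\langle R^\perp\theta\cdot\nabla\theta,\varphi\rangle+\langle\Lambda^{\alpha}\varphi,g\rangle\big)\,ds.$$ Rate function: for $\theta\in\mathbb X_{\alpha,\alpha/2}$, $\mathcal I(\theta)=\|\theta(0)\|_H^2+\mathcal I_{dyna}(\theta)$, where $\mathcal I_{dyna}(\theta)=\frac12\|\partial_t\theta+\Lambda^{2\alpha}\theta+R^\perp\theta\cdot\nabla\theta\|^2_{L^2([0,T];H^{-\alpha})}$; equivalently $\frac12\inf\|g\|^2_{L^2([0,T];H)}$ over all $g\in L^2([0,T];H)$ for which $\theta$ is a weak solution of the skeleton equation ($+\infty$ if there is none). $\mathcal C_0\subset\mathbb X_{\alpha,\alpha/2}$ is a weak-strong uniqueness class if for every $g\in L^2([0,T];L^2(\mathbb T^2))$ and any two weak solutions $\theta_1,\theta_2$ with control $g$ and $\theta_1(0)=\theta_2(0)$, one has $\theta_1=\theta_2$ whenever $\theta_1\in\mathcal C_0$ and $\theta_2$ satisfies,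 for every $t\in[0,T]$, $\frac12\|\theta_2(t)\|_{H}^2+\int_0^t\|\theta_2\|_{H^{\alpha}}^2ds\le\frac12\|\theta_2(0)\|_{H}^2+\int_0^t\langle\Lambda^{\alpha}\theta_2,g\rangle ds$. Its $\mathcal I$-closure $\overline{\mathcal C_0}^{\mathcal I}$ is the set of $\theta\in\mathbb X_{\alpha,\alpha/2}$ for which there are $\theta^{(n)}\in\mathcal C_0$ with $\theta^{(n)}\to\theta$ in $\mathbb X_{\alpha,\alpha/2}$ and $\mathcal I(\theta^{(n)})\to\mathcal I(\theta)$. *)

theory Defs
  imports "HOL-Analysis.Analysis"
begin

section \<open>The Hilbert space of real square-integrable functions on the torus\<close>

text \<open>The torus is represented by the fundamental domain \<open>[0,1)\<times>[0,1)\<close> of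
  \<open>\<real>\<^sup>2/\<int>\<^sup>2\<close> with Lebesgue measure.\<close>

definition torus :: "(real \<times> real) measure" where
  "torus = restrict_space lborel ({0..<1} \<times> {0..<1})"

definition sq_integrable :: "(real \<times> real \<Rightarrow> real) \<Rightarrow> bool" where
  "sq_integrable f \<longleftrightarrow> f \<in> borel_measurable torus \<and> integrable torus (\<lambda>x. (f x)\<^sup>2)"

definition L2_rel :: "(real \<times> real \<Rightarrow> real) \<Rightarrow> (real \<times> real \<Rightarrow> real) \<Rightarrow> bool" where
  "L2_rel f g \<longleftrightarrow> sq_integrable f \<and> sq_integrable g \<and> (AE x in torus. f x = g x)"

lemma sq_integrable_zero: "sq_integrable (\<lambda>x. 0)"
  by (simp add: sq_integrable_def)

lemma sq_integrable_scale: "sq_integrable f \<Longrightarrow> sq_integrable (\<lambda>x. c * f x)"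
  unfolding sq_integrable_def power_mult_distrib
  by (auto intro!: borel_measurable_times Bochner_Integration.integrable_mult_right)

lemma sq_integrable_mult:
  assumes "sq_integrable f" "sq_integrable g"
  shows "integrable torus (\<lambda>x. f x * g x)"
proof (rule Bochner_Integration.integrable_bound)
  show "integrable torus (\<lambda>x. (f x)\<^sup>2 + (g x)\<^sup>2)"
    using assms by (auto simp: sq_integrable_def)
  show "(\<lambda>x. f x * g x) \<in> borel_measurable torus"
    using assms by (auto simp: sq_integrable_def)
  have "\<bar>a * b\<bar> \<le> a\<^sup>2 + b\<^sup>2" for a b :: real
    using sum_squares_bound[of "\<bar>a\<bar>" "\<bar>b\<bar>"] mult_nonneg_nonneg[of "\<bar>a\<bar>" "\<bar>b\<bar>"]
    by (simp add: abs_mult del: mult_nonneg_nonneg)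
  then show "AE x in torus. norm (f x * g x) \<le> norm ((f x)\<^sup>2 + (g x)\<^sup>2)"
    by (auto intro!: AE_I2)
qed

lemma sq_integrable_add:
  assumes "sq_integrable f" "sq_integrable g"
  shows "sq_integrable (\<lambda>x. f x + g x)"
proof -
  have "integrable torus (\<lambda>x. (f x)\<^sup>2 + (g x)\<^sup>2 + 2 * (f x * g x))"
    using assms sq_integrable_mult[OF assms] by (auto simp: sq_integrable_def)
  then show ?thesis
    using assms by (auto simp: sq_integrable_def power2_sum mult.assoc)
qed

quotient_type torus_L2 = "real \<times> real \<Rightarrow> real" / partial: L2_rel
proof (rule part_equivpI)
  show "\<exists>f. L2_rel f f"
    by (rule exI[of _ "\<lambda>x. 0"]) (simp add: L2_rel_def sq_integrable_zero)
  show "symp L2_rel"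
    by (auto simp: symp_def L2_rel_def)
  show "transp L2_rel"
    by (auto simp: transp_def L2_rel_def)
qed

instantiation torus_L2 :: real_inner
begin

lift_definition zero_torus_L2 :: torus_L2 is "\<lambda>x. 0"
  by (simp add: L2_rel_def sq_integrable_zero)

lift_definition plus_torus_L2 :: "torus_L2 \<Rightarrow> torus_L2 \<Rightarrow> torus_L2" is "\<lambda>f g x. f x + g x"
  by (auto simp: L2_rel_def sq_integrable_add)

lift_definition scaleR_torus_L2 :: "real \<Rightarrow> torus_L2 \<Rightarrow> torus_L2" is "\<lambda>c f x. c * f x"
  by (auto simp: L2_rel_def sq_integrable_scale)

lift_definition inner_torus_L2 :: "torus_L2 \<Rightarrow> torus_L2 \<Rightarrow> real"
  is "\<lambda>f g. \<integral>x. f x * g x \<partial>torus"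
  by (rule integral_cong_AE) (auto simp: L2_rel_def sq_integrable_def)

definition "uminus_torus_L2 (f :: torus_L2) = (-1) *\<^sub>R f"
definition "minus_torus_L2 (f :: torus_L2) g = f + (-1) *\<^sub>R g"
definition "norm_torus_L2 (f :: torus_L2) = sqrt (inner f f)"
definition "dist_torus_L2 (f :: torus_L2) g = norm (f - g)"
definition "sgn_torus_L2 (f :: torus_L2) = inverse (norm f) *\<^sub>R f"
definition "(uniformity :: (torus_L2 \<times> torus_L2) filter) =
  (INF e\<in>{0<..}. principal {(x, y). dist x y < e})"
definition "open (U :: torus_L2 set) =
  (\<forall>x\<in>U. eventually (\<lambda>(x', y). x' = x \<longrightarrow> y \<in> U) uniformity)"

instance
proof
  fix f g h :: torus_L2 and c d :: real
  show "f + g + h = f + (g + h)"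
    by transfer (auto simp: L2_rel_def sq_integrable_add add.assoc)
  show "f + g = g + f"
    by transfer (auto simp: L2_rel_def sq_integrable_add add.commute)
  show "0 + f = f"
    by transfer (auto simp: L2_rel_def)
  show "- f + f = 0"
    unfolding uminus_torus_L2_def
    by transfer (auto simp: L2_rel_def sq_integrable_zero)
  show "f - g = f + - g"
    by (simp add: minus_torus_L2_def uminus_torus_L2_def)
  show "c *\<^sub>R (f + g) = c *\<^sub>R f + c *\<^sub>R g"
    by transfer (auto simp: L2_rel_def distrib_left intro!: sq_integrable_add sq_integrable_scale)
  show "(c + d) *\<^sub>R f = c *\<^sub>R f + d *\<^sub>R f"
    by transfer (auto simp: L2_rel_def distrib_right intro!: sq_integrable_add sq_integrable_scale)
  show "c *\<^sub>R d *\<^sub>R f = (c * d) *\<^sub>R f"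
    by transfer (auto simp: L2_rel_def mult.assoc[symmetric] intro!: sq_integrable_scale)
  show "1 *\<^sub>R f = f"
    by transfer (auto simp: L2_rel_def)
  show "sgn f = inverse (norm f) *\<^sub>R f"
    by (simp add: sgn_torus_L2_def)
  show "dist f g = norm (f - g)"
    by (simp add: dist_torus_L2_def)
  show "(uniformity :: (torus_L2 \<times> torus_L2) filter) =
      (INF e\<in>{0<..}. principal {(x, y). dist x y < e})"
    by (simp add: uniformity_torus_L2_def)
  show "open U = (\<forall>x\<in>U. eventually (\<lambda>(x', y). x' = x \<longrightarrow> y \<in> U) uniformity)"
    for U :: "torus_L2 set"
    by (simp add: open_torus_L2_def)
  show "inner f g = inner g f"
    by transfer (simp add: mult.commute)
  show "inner (f + g) h = inner f h + inner g h"
    by transfer (auto simp: L2_rel_def distrib_right sq_integrable_mult)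
  show "inner (c *\<^sub>R f) g = c * inner f g"
    by transfer (auto simp: L2_rel_def mult.assoc)
  show "0 \<le> inner f f"
    by transfer (auto intro!: Bochner_Integration.integral_nonneg)
  show "inner f f = 0 \<longleftrightarrow> f = 0"
  proof (transfer)
    fix f assume f: "L2_rel f f"
    then have "((\<integral>x. f x * f x \<partial>torus) = 0) \<longleftrightarrow> (AE x in torus. f x * f x = 0)"
      by (intro integral_nonneg_eq_0_iff_AE) (auto simp: L2_rel_def sq_integrable_mult)
    also have "\<dots> \<longleftrightarrow> L2_rel f (\<lambda>x. 0)"
      using f by (auto simp: L2_rel_def sq_integrable_zero)
    finally show "((\<integral>x. f x * f x \<partial>torus) = 0) = L2_rel f (\<lambda>x. 0)" .
  qed
  show "norm f = sqrt (inner f f)"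
    by (simp add: norm_torus_L2_def)
qed

end

text \<open>Pointwise product of two classes; it is \<open>0\<close> by convention if the product is not
  square-integrable. It is only used below when one factor is a derivative of an element of
  \<open>H\<^sup>\<infinity>\<close>, hence bounded.\<close>

lift_definition L2_mult :: "torus_L2 \<Rightarrow> torus_L2 \<Rightarrow> torus_L2"
  is "\<lambda>f g. if sq_integrable (\<lambda>x. f x * g x) then (\<lambda>x. f x * g x) else (\<lambda>x. 0)"
proof -
  fix f f' g g' assume fg: "L2_rel f f'" "L2_rel g g'"
  have m: "(\<lambda>x. f x * g x) \<in> borel_measurable torus" "(\<lambda>x. f' x * g' x) \<in> borel_measurable torus"
    using fg by (auto simp: L2_rel_def sq_integrable_def)
  have e: "AE x in torus. f x * g x = f' x * g' x"
    using fg by (auto simp: L2_rel_def)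
  have "integrable torus (\<lambda>x. (f x * g x)\<^sup>2) \<longleftrightarrow> integrable torus (\<lambda>x. (f' x * g' x)\<^sup>2)"
    using m e by (intro Bochner_Integration.integrable_cong_AE) auto
  then show "L2_rel (if sq_integrable (\<lambda>x. f x * g x) then (\<lambda>x. f x * g x) else (\<lambda>x. 0))
     (if sq_integrable (\<lambda>x. f' x * g' x) then (\<lambda>x. f' x * g' x) else (\<lambda>x. 0))"
    using m e by (auto simp: L2_rel_def sq_integrable_zero sq_integrable_def)
qed

section \<open>Fourier multipliers and Sobolev spaces\<close>

lift_definition fourier :: "torus_L2 \<Rightarrow> int \<times> int \<Rightarrow> complex"
  is "\<lambda>f k. \<integral>x. complex_of_real (f x) *
        cis (- 2 * pi * (real_of_int (fst k) * fst x + real_of_int (snd k) * snd x)) \<partial>torus"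
proof -
  fix f g :: "real \<times> real \<Rightarrow> real" assume fg: "L2_rel f g"
  have c: "(\<lambda>x :: real \<times> real. cis (- 2 * pi * (a * fst x + b * snd x))) \<in> borel_measurable torus"
    for a b :: real
  proof -
    have "continuous_on UNIV (\<lambda>x :: real \<times> real. cis (- 2 * pi * (a * fst x + b * snd x)))"
      by (intro continuous_intros)
    then have "(\<lambda>x :: real \<times> real. cis (- 2 * pi * (a * fst x + b * snd x))) \<in> borel_measurable lborel"
      by (simp add: borel_measurable_continuous_onI)
    then show ?thesis
      unfolding torus_def by (rule measurable_restrict_space1)
  qed
  have "f \<in> borel_measurable torus" "g \<in> borel_measurable torus" "AE x in torus. f x = g x"
    using fg by (auto simp: L2_rel_def sq_integrable_def)
  then show "(\<lambda>k. \<integral>x. complex_of_real (f x) *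
        cis (- 2 * pi * (real_of_int (fst k) * fst x + real_of_int (snd k) * snd x)) \<partial>torus) =
      (\<lambda>k. \<integral>x. complex_of_real (g x) *
        cis (- 2 * pi * (real_of_int (fst k) * fst x + real_of_int (snd k) * snd x)) \<partial>torus)"
    by (intro ext integral_cong_AE borel_measurable_times borel_measurable_of_real c) auto
qed

text \<open>\<open>fourier_mult m f\<close> is meaningful whenever \<open>m k * fourier f k\<close> is the coefficient family of
  a (necessarily unique) real \<open>L\<^sup>2\<close> function.\<close>

definition fourier_mult :: "(int \<times> int \<Rightarrow> complex) \<Rightarrow> torus_L2 \<Rightarrow> torus_L2" where
  "fourier_mult m f = (THE h. \<forall>k. fourier h k = m k * fourier f k)"

definition freq :: "int \<times> int \<Rightarrow> real" where
  "freq k = 2 * pi * sqrt ((real_of_int (fst k))\<^sup>2 + (real_of_int (snd k))\<^sup>2)"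

definition kcomp :: "nat \<Rightarrow> int \<times> int \<Rightarrow> int" where
  "kcomp j k = (if j = 1 then fst k else snd k)"

text \<open>\<open>\<Lambda>\<^sup>r\<close> annihilates the zero mode for every real \<open>r\<close>; \<open>\<Lambda>\<^sup>0\<close> is the identity on
  mean-zero functions.\<close>

definition Lam :: "real \<Rightarrow> torus_L2 \<Rightarrow> torus_L2" where
  "Lam r = fourier_mult (\<lambda>k. if k = (0, 0) then 0 else complex_of_real (freq k powr r))"

definition pd :: "nat \<Rightarrow> torus_L2 \<Rightarrow> torus_L2" where
  "pd j = fourier_mult (\<lambda>k. \<i> * complex_of_real (2 * pi * real_of_int (kcomp j k)))"

definition riesz :: "nat \<Rightarrow> torus_L2 \<Rightarrow> torus_L2" where
  "riesz j f = pd j (Lam (-1) f)"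

definition H0 :: "torus_L2 set" where
  "H0 = {f. fourier f (0, 0) = 0}"

text \<open>Only \<open>r \<ge> 0\<close> is used, so that elements of \<open>H\<^sup>r\<close> are functions.\<close>

definition Hs :: "real \<Rightarrow> torus_L2 set" where
  "Hs r = {f \<in> H0. (\<lambda>k. freq k powr (2 * r) * (cmod (fourier f k))\<^sup>2) summable_on (- {(0, 0)})}"

definition norm_Hs :: "real \<Rightarrow> torus_L2 \<Rightarrow> real" where
  "norm_Hs r f = sqrt (\<Sum>\<^sub>\<infinity>k\<in>- {(0, 0)}. freq k powr (2 * r) * (cmod (fourier f k))\<^sup>2)"

definition Hinf :: "torus_L2 set" where
  "Hinf = (\<Inter>r\<in>{0<..}. Hs r)"

section \<open>The nonlinearity\<close>

definition commutator :: "nat \<Rightarrow> torus_L2 \<Rightarrow> torus_L2 \<Rightarrow> torus_L2" where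
  "commutator i \<phi> h = Lam 1 (L2_mult (pd i \<phi>) h) - L2_mult (pd i \<phi>) (Lam 1 h)"

definition nonlin :: "torus_L2 \<Rightarrow> torus_L2 \<Rightarrow> real" where
  "nonlin \<theta> \<phi> =
     - (1/2) * inner (riesz 2 \<theta>) (commutator 1 \<phi> (Lam (-1) \<theta>))
     + (1/2) * inner (riesz 1 \<theta>) (commutator 2 \<phi> (Lam (-1) \<theta>))"

section \<open>Function spaces in time\<close>

text \<open>Since \<open>L\<^sup>2(\<bbbT>\<^sup>2)\<close> is separable, Borel measurability is strong measurability. Elements of
  these spaces are represented by functions of time rather than by classes.\<close>

definition L2T :: "real \<Rightarrow> (real \<Rightarrow> torus_L2) set" where
  "L2T T = {g \<in> borel_measurable (lebesgue_on {0..T}).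
     integrable (lebesgue_on {0..T}) (\<lambda>t. (norm (g t))\<^sup>2)}"

definition L2T_H :: "real \<Rightarrow> (real \<Rightarrow> torus_L2) set" where
  "L2T_H T = {g \<in> L2T T. AE t in lebesgue_on {0..T}. g t \<in> H0}"

text \<open>\<open>\<Lambda>\<^sup>r\<close> is an isometry of \<open>H\<^sup>r\<close> onto \<open>H\<close>, so measurability of \<open>\<Lambda>\<^sup>r \<circ> f\<close> is strong
  measurability of \<open>f\<close> as an \<open>H\<^sup>r\<close>-valued function.\<close>

definition L2T_Hs :: "real \<Rightarrow> real \<Rightarrow> (real \<Rightarrow> torus_L2) set" where
  "L2T_Hs T r = {f. (AE t in lebesgue_on {0..T}. f t \<in> Hs r) \<and>
     (\<lambda>t. Lam r (f t)) \<in> borel_measurable (lebesgue_on {0..T}) \<and>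
     integrable (lebesgue_on {0..T}) (\<lambda>t. (norm_Hs r (f t))\<^sup>2)}"

definition LinfT_H :: "real \<Rightarrow> (real \<Rightarrow> torus_L2) set" where
  "LinfT_H T = {f \<in> borel_measurable (lebesgue_on {0..T}).
     \<exists>C. AE t in lebesgue_on {0..T}. f t \<in> H0 \<and> norm (f t) \<le> C}"

text \<open>Weakly continuous paths. They are functions on \<open>[0,T]\<close> (\<open>extensional\<close>), so that
  equality in HOL is equality on \<open>[0,T]\<close>.\<close>

definition Cw_H :: "real \<Rightarrow> (real \<Rightarrow> torus_L2) set" where
  "Cw_H T = {f \<in> {0..T} \<rightarrow>\<^sub>E H0. \<forall>h\<in>H0. continuous_on {0..T} (\<lambda>t. inner (f t) h)}"

definition X_space :: "real \<Rightarrow> real \<Rightarrow> (real \<Rightarrow> torus_L2) set" where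
  "X_space T \<alpha> = L2T_H T \<inter> L2T_Hs T \<alpha> \<inter> Cw_H T"

text \<open>The intersection topology, generated by the balls of the seminorms defining, in this order,
  the norm topology of \<open>L\<^sup>2([0,T];H)\<close>, the weak topology of \<open>L\<^sup>2([0,T];H\<^sup>\<alpha>)\<close> and the topology of
  uniform convergence of \<open>C([0,T];H\<^sub>w)\<close>.\<close>

definition X_top :: "real \<Rightarrow> real \<Rightarrow> (real \<Rightarrow> torus_L2) topology" where
  "X_top T \<alpha> = topology_generated_by
    ({{\<theta> \<in> X_space T \<alpha>. sqrt (\<integral>t. (norm (\<theta> t - \<eta> t))\<^sup>2 \<partial>lebesgue_on {0..T}) < \<epsilon>}
        |\<eta> \<epsilon>. \<eta> \<in> X_space T \<alpha> \<and> 0 < \<epsilon>}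
     \<union> {{\<theta> \<in> X_space T \<alpha>.
          \<bar>\<integral>t. inner (Lam \<alpha> (\<theta> t - \<eta> t)) (Lam \<alpha> (\<psi> t)) \<partial>lebesgue_on {0..T}\<bar> < \<epsilon>}
        |\<eta> \<psi> \<epsilon>. \<eta> \<in> X_space T \<alpha> \<and> \<psi> \<in> L2T_Hs T \<alpha> \<and> 0 < \<epsilon>}
     \<union> {{\<theta> \<in> X_space T \<alpha>. (SUP t\<in>{0..T}. \<bar>inner (\<theta> t - \<eta> t) h\<bar>) < \<epsilon>}
        |\<eta> h \<epsilon>. \<eta> \<in> X_space T \<alpha> \<and> h \<in> H0 \<and> 0 < \<epsilon>})"

definition time_reversal :: "real \<Rightarrow> (real \<Rightarrow> torus_L2) \<Rightarrow> real \<Rightarrow> torus_L2" where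
  "time_reversal T \<theta> = (\<lambda>t\<in>{0..T}. - \<theta> (T - t))"

definition time_reversible :: "real \<Rightarrow> (real \<Rightarrow> torus_L2) set \<Rightarrow> bool" where
  "time_reversible T R \<longleftrightarrow> R = time_reversal T ` R"

section \<open>Weak solutions of the skeleton equation\<close>

text \<open>\<open>C\<^sup>\<infinity>([0,T];H\<^sup>\<infinity>)\<close>: \<open>\<Phi> n\<close> is the \<open>n\<close>-th time derivative, one-sided at the end points, with
  difference quotients converging in every \<open>H\<^sup>r\<close>, i.e. in the Frechet space \<open>H\<^sup>\<infinity>\<close>.\<close>

definition test_functions :: "real \<Rightarrow> (real \<Rightarrow> torus_L2) set" where
  "test_functions T = {\<phi>. \<exists>\<Phi> :: nat \<Rightarrow> real \<Rightarrow> torus_L2.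
     (\<forall>t\<in>{0..T}. \<Phi> 0 t = \<phi> t) \<and>
     (\<forall>n. \<forall>t\<in>{0..T}. \<Phi> n t \<in> Hinf \<and>
       (\<forall>r>0. ((\<lambda>s. norm_Hs r ((\<Phi> n s - \<Phi> n t) /\<^sub>R (s - t) - \<Phi> (Suc n) t)) \<longlongrightarrow> 0)
          (at t within {0..T})))}"

definition weak_solution ::
    "real \<Rightarrow> real \<Rightarrow> (real \<Rightarrow> torus_L2) \<Rightarrow> torus_L2 \<Rightarrow> (real \<Rightarrow> torus_L2) \<Rightarrow> bool" where
  "weak_solution T \<alpha> g \<theta>0 \<theta> \<longleftrightarrow>
     \<theta>0 \<in> H0 \<and> \<theta> \<in> LinfT_H T \<inter> L2T_Hs T \<alpha> \<inter> Cw_H T \<and>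
     (\<forall>\<phi>\<in>test_functions T. \<forall>t\<in>{0..T}.
        inner (\<theta> t) (\<phi> t) = inner \<theta>0 (\<phi> 0) +
          (\<integral>s. (inner (\<theta> s) (vector_derivative \<phi> (at s within {0..T}))
                - inner (\<theta> s) (Lam (2 * \<alpha>) (\<phi> s))
                - nonlin (\<theta> s) (\<phi> s)
                + inner (Lam \<alpha> (\<phi> s)) (g s)) \<partial>lebesgue_on {0..t}))"

section \<open>Rate function, uniqueness classes and closure\<close>

text \<open>Variational form of
  \<open>1/2 \<parallel>\<partial>\<^sub>t\<theta> + \<Lambda>\<^sup>2\<^sup>\<alpha>\<theta> + R\<^sup>\<bottom>\<theta>\<cdot>\<nabla>\<theta>\<parallel>\<^sup>2\<close> in \<open>L\<^sup>2([0,T];H\<^sup>-\<^sup>\<alpha>)\<close>; the infimum over the empty set is \<open>\<infinity>\<close>.\<close>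

definition I_dyna :: "real \<Rightarrow> real \<Rightarrow> (real \<Rightarrow> torus_L2) \<Rightarrow> ennreal" where
  "I_dyna T \<alpha> \<theta> = (INF g\<in>{g \<in> L2T_H T. weak_solution T \<alpha> g (\<theta> 0) \<theta>}.
     ennreal (1/2 * (\<integral>t. (norm (g t))\<^sup>2 \<partial>lebesgue_on {0..T})))"

definition rate :: "real \<Rightarrow> real \<Rightarrow> (real \<Rightarrow> torus_L2) \<Rightarrow> ennreal" where
  "rate T \<alpha> \<theta> = ennreal ((norm (\<theta> 0))\<^sup>2) + I_dyna T \<alpha> \<theta>"

definition energy_inequality ::
    "real \<Rightarrow> real \<Rightarrow> (real \<Rightarrow> torus_L2) \<Rightarrow> (real \<Rightarrow> torus_L2) \<Rightarrow> bool" where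
  "energy_inequality T \<alpha> g \<theta> \<longleftrightarrow> (\<forall>t\<in>{0..T}.
     1/2 * (norm (\<theta> t))\<^sup>2 + (\<integral>s. (norm_Hs \<alpha> (\<theta> s))\<^sup>2 \<partial>lebesgue_on {0..t})
     \<le> 1/2 * (norm (\<theta> 0))\<^sup>2 + (\<integral>s. inner (Lam \<alpha> (\<theta> s)) (g s) \<partial>lebesgue_on {0..t}))"

definition weak_strong_uniqueness_class ::
    "real \<Rightarrow> real \<Rightarrow> (real \<Rightarrow> torus_L2) set \<Rightarrow> bool" where
  "weak_strong_uniqueness_class T \<alpha> C0 \<longleftrightarrow> C0 \<subseteq> X_space T \<alpha> \<and>
     (\<forall>g\<in>L2T T. \<forall>\<theta>1 \<theta>2.
        weak_solution T \<alpha> g (\<theta>1 0) \<theta>1 \<longrightarrow> weak_solution T \<alpha> g (\<theta>2 0) \<theta>2 \<longrightarrow>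
        \<theta>1 0 = \<theta>2 0 \<longrightarrow> \<theta>1 \<in> C0 \<longrightarrow> energy_inequality T \<alpha> g \<theta>2 \<longrightarrow> \<theta>1 = \<theta>2)"

definition rate_closure ::
    "real \<Rightarrow> real \<Rightarrow> (real \<Rightarrow> torus_L2) set \<Rightarrow> (real \<Rightarrow> torus_L2) set" where
  "rate_closure T \<alpha> C0 = {\<theta> \<in> X_space T \<alpha>. \<exists>\<theta>n :: nat \<Rightarrow> real \<Rightarrow> torus_L2.
     (\<forall>n. \<theta>n n \<in> C0) \<and> limitin (X_top T \<alpha>) \<theta>n \<theta> sequentially \<and>
     (\<lambda>n. rate T \<alpha> (\<theta>n n)) \<longlonglongrightarrow> rate T \<alpha> \<theta>}"

end

theory Submission imports Defs "HOL-Complex_Analysis.Great_Picard" begin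

text \<open>A path \<open>\<theta>\<close> in a weak-strong uniqueness class coincides with the Leray solution for its own control,
  constructed by Galerkin approximation, and hence satisfies the energy inequality. Completing the square,
  this inequality at time \<open>T\<close> reads
  \<open>\<parallel>\<theta>(T)\<parallel>\<^sup>2 + 1/2 \<integral> \<parallel>g - 2\<Lambda>\<^sup>\<alpha>\<theta>\<parallel>\<^sup>2 \<le> \<parallel>\<theta>(0)\<parallel>\<^sup>2 + 1/2 \<integral> \<parallel>g\<parallel>\<^sup>2\<close>, whose right-hand side is the cost of \<open>\<theta>\<close>
  and whose left-hand side is the cost of the time-reversed path, driven by the reversal of
  \<open>g - 2\<Lambda>\<^sup>\<alpha>\<theta>\<close>. The left-hand side is weakly lower semicontinuous and the rate converges along the sequences
  defining the \<open>\<I>\<close>-closure, so the inequality extends to the closure. Applied to both \<open>\<theta>\<close> and its time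
  reversal it becomes an equality, which is the energy identity.\<close>

section \<open>The space \<open>L\<^sup>2\<close> of the torus\<close>

text \<open>The type \<open>torus_L2\<close> starts as a bare inner product space, and
  \<open>Lam\<close>, \<open>pd\<close> and \<open>fourier_mult\<close> are descriptions, meaningful
  only where the multiplied coefficients are square summable. Completeness, separability and an
  explicit real orthonormal basis therefore precede the analysis, and the equation is moved to
  coefficients in that basis: a weak solution becomes a countable family of scalar integral
  equations, which are stable under limits. The commutator form bounds the nonlinearity by two L2
  norms of \<theta> and the H^4 norm of the test function, so strong convergence in
  \<open>L2([0,T];H)\<close> is enough to pass to the limit, both for the Galerkin sequence and
  along the closure. The initial term of the rate carries no factor 1/2. With this weight twice the
  energy inequality is exactly a comparison of costs, and since reversal is an involution on pairs
  of path and control, applying the inequality to the reversed path interchanges its two sides. The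
  rate minimises over mean-zero controls, while the given g may have a mean; it is projected away at
  the start of the final argument.\<close>

lemma sq_integrable_rep: "sq_integrable (rep_torus_L2 f)"
  using Quotient3_rep_reflp[OF Quotient3_torus_L2, of f] by (auto simp: L2_rel_def)

lemma L2_rel_refl: "sq_integrable f \<Longrightarrow> L2_rel f f"
  by (auto simp: L2_rel_def)

lemma abs_rep_torus_L2: "abs_torus_L2 (rep_torus_L2 f) = f"
  using Quotient3_abs_rep[OF Quotient3_torus_L2] .

lemma inner_abs_torus_L2:
  "sq_integrable f \<Longrightarrow> sq_integrable g \<Longrightarrow>
    inner (abs_torus_L2 f) (abs_torus_L2 g) = (\<integral>x. f x * g x \<partial>torus)"
  by (simp add: inner_torus_L2.abs_eq L2_rel_refl)

lemma inner_rep_torus_L2: "inner f g = (\<integral>x. rep_torus_L2 f x * rep_torus_L2 g x \<partial>torus)"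
  using inner_abs_torus_L2[OF sq_integrable_rep sq_integrable_rep, of f g]
  by (simp add: abs_rep_torus_L2)

lemma diff_abs_torus_L2:
  assumes "sq_integrable f" "sq_integrable g"
  shows "abs_torus_L2 f - abs_torus_L2 g = abs_torus_L2 (\<lambda>x. f x - g x)"
  unfolding minus_torus_L2_def scaleR_torus_L2.abs_eq[OF L2_rel_refl[OF assms(2)]]
    plus_torus_L2.abs_eq[OF L2_rel_refl[OF assms(1)] L2_rel_refl[OF sq_integrable_scale[OF assms(2)]]]
  by simp

lemma sq_integrable_diff:
  assumes "sq_integrable f" "sq_integrable g"
  shows "sq_integrable (\<lambda>x. f x - g x)"
  using sq_integrable_add[OF assms(1) sq_integrable_scale[OF assms(2), of "-1"]] by simp

lemma norm_diff_rep:
  "(norm (f - g))\<^sup>2 = (\<integral>x. (rep_torus_L2 f x - rep_torus_L2 g x)\<^sup>2 \<partial>torus)"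
proof -
  have "f - g = abs_torus_L2 (\<lambda>x. rep_torus_L2 f x - rep_torus_L2 g x)"
    using diff_abs_torus_L2[OF sq_integrable_rep sq_integrable_rep, of f g]
    by (simp add: abs_rep_torus_L2)
  then show ?thesis
    by (simp add: power2_norm_eq_inner inner_abs_torus_L2 sq_integrable_diff sq_integrable_rep)
      (simp add: power2_eq_square)
qed

section \<open>The torus as a probability space\<close>

lemma space_torus [simp]: "space torus = {0..<1} \<times> {0..<1}"
  by (simp add: torus_def space_restrict_space)

lemma unit_square_sets: "{0..<1::real} \<times> {0..<1::real} \<in> sets borel"
  by (simp add: borel_prod[symmetric])

lemma emeasure_torus: "emeasure torus (space torus) = 1"
proof -
  have "emeasure torus (space torus) = emeasure lborel ({0..<1::real} \<times> {0..<1::real})"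
    unfolding space_torus unfolding torus_def
    by (subst emeasure_restrict_space) (auto simp: unit_square_sets)
  also have "\<dots> = 1"
    by (simp add: lborel_prod[symmetric] lborel.emeasure_pair_measure_Times)
  finally show ?thesis .
qed

interpretation torus: finite_measure torus
  by standard (simp only: emeasure_torus, simp)

lemma measure_torus: "measure torus (space torus) = 1"
  by (simp only: measure_def emeasure_torus) simp

lemma continuous_measurable_torus:
  fixes f :: "real \<times> real \<Rightarrow> 'b::topological_space"
  assumes "continuous_on UNIV f"
  shows "f \<in> borel_measurable torus"
  unfolding torus_def
  by (rule measurable_restrict_space1) (use assms in \<open>simp add: borel_measurable_continuous_onI\<close>)

lemma bounded_integrable_torus:
  fixes f :: "real \<times> real \<Rightarrow> 'b::{banach, second_countable_topology}"
  assumes "f \<in> borel_measurable torus" "\<And>x. norm (f x) \<le> C"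
  shows "integrable torus f"
  using assms by (intro torus.integrable_const_bound[of _ C]) auto

lemma sq_integrable_bounded:
  assumes "f \<in> borel_measurable torus" "\<And>x. \<bar>f x\<bar> \<le> C"
  shows "sq_integrable f"
proof -
  have "\<bar>f x\<bar>\<^sup>2 \<le> C\<^sup>2" for x using assms(2)[of x] by (intro power_mono) auto
  then show ?thesis unfolding sq_integrable_def using assms
    by (auto intro!: bounded_integrable_torus[where C="C\<^sup>2"])
qed

lemma sq_integrable_imp_integrable:
  assumes "sq_integrable f" shows "integrable torus f"
  using sq_integrable_mult[OF assms sq_integrable_bounded[of "\<lambda>_. 1" 1]] by simp

section \<open>Completeness of L2\<close>

lemma rapid_subsequence:
  fixes X :: "nat \<Rightarrow> 'a::metric_space"
  assumes "Cauchy X"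
  obtains r where "strict_mono (r :: nat \<Rightarrow> nat)" "\<And>n m. n \<le> m \<Longrightarrow> dist (X (r n)) (X (r m)) \<le> (1/2)^n"
proof -
  have ex: "\<exists>N. \<forall>m\<ge>N. \<forall>n\<ge>N. dist (X m) (X n) < (1/2)^k" for k :: nat
    using assms unfolding Cauchy_def by (meson half_gt_zero_iff zero_less_one zero_less_power)
  have "\<exists>r. \<forall>n. (\<forall>m\<ge>r n. \<forall>l\<ge>r n. dist (X m) (X l) < (1/2)^n) \<and> r n < r (Suc n)"
  proof (rule dependent_nat_choice)
    show "\<exists>x. \<forall>m\<ge>x. \<forall>l\<ge>x. dist (X m) (X l) < (1/2)^0" using ex[of 0] by blast
  next
    fix x n assume "\<forall>m\<ge>x. \<forall>l\<ge>x. dist (X m) (X l) < (1 / 2) ^ n"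
    obtain N where N: "\<forall>m\<ge>N. \<forall>l\<ge>N. dist (X m) (X l) < (1/2)^(Suc n)" using ex[of "Suc n"] by blast
    show "\<exists>y. (\<forall>m\<ge>y. \<forall>l\<ge>y. dist (X m) (X l) < (1 / 2) ^ Suc n) \<and> x < y"
      by (rule exI[of _ "max N (Suc x)"]) (use N in auto)
  qed
  then obtain r where r: "\<And>n m l. m \<ge> r n \<Longrightarrow> l \<ge> r n \<Longrightarrow> dist (X m) (X l) < (1/2)^n" "\<And>n. r n < r (Suc n)"
    by blast
  have sm: "strict_mono r" using r(2) by (simp add: strict_mono_Suc_iff)
  show ?thesis
  proof (rule that[OF sm])
    fix n m :: nat assume "n \<le> m"
    then have "r n \<le> r m" using sm by (simp add: strict_mono_less_eq)
    then show "dist (X (r n)) (X (r m)) \<le> (1/2)^n" using r(1)[of n "r n" "r m"] by simp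
  qed
qed

text \<open>Riesz-Fischer argument: along the rapid subsequence the increments have summable L1
  norms, so the representatives converge almost everywhere; Fatou's lemma upgrades this to L2 with a
  rate, and a Cauchy sequence with a convergent subsequence converges.\<close>

instance torus_L2 :: complete_space
proof
  fix X :: "nat \<Rightarrow> torus_L2" assume X: "Cauchy X"
  obtain r where r: "strict_mono (r :: nat \<Rightarrow> nat)"
    and d: "\<And>n m. n \<le> m \<Longrightarrow> dist (X (r n)) (X (r m)) \<le> (1/2)^n"
    using rapid_subsequence[OF X] by blast
  define f where "f n = rep_torus_L2 (X (r n))" for n
  have sq: "sq_integrable (f n)" for n unfolding f_def by (rule sq_integrable_rep)
  have [measurable]: "f n \<in> borel_measurable torus" for n using sq[of n] by (simp add: sq_integrable_def)
  have sqd: "sq_integrable (\<lambda>x. f m x - f n x)" for m n by (intro sq_integrable_diff sq)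
  have int2: "integrable torus (\<lambda>x. (f m x - f n x)\<^sup>2)" for m n
    using sqd[of m n] by (simp add: sq_integrable_def)
  have n2: "(\<integral>x. (f m x - f n x)\<^sup>2 \<partial>torus) \<le> ((1/2)^n)\<^sup>2" if "n \<le> m" for m n
  proof -
    have "(norm (X (r m) - X (r n)))\<^sup>2 \<le> ((1/2)^n)\<^sup>2"
      using d[OF that] by (intro power_mono) (auto simp: dist_norm norm_minus_commute)
    then show ?thesis by (simp add: norm_diff_rep f_def)
  qed
  have n1: "(\<integral>\<^sup>+x. ennreal \<bar>f (Suc n) x - f n x\<bar> \<partial>torus) \<le> ennreal ((1/2)^n)" for n
  proof -
    define c :: real where "c = (1/2)^n"
    have c: "c > 0" by (simp add: c_def)
    have i: "integrable torus (\<lambda>x. \<bar>f (Suc n) x - f n x\<bar>)"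
      using sq_integrable_imp_integrable[OF sqd] by (rule integrable_abs)
    \<comment> \<open>The weight in Young's inequality is the L2 bound c itself, so that both terms
      contribute c/2 after integration over the torus, which has total mass one.\<close>
    have p: "\<bar>a\<bar> \<le> c / 2 + a\<^sup>2 * (1 / (2 * c))" for a :: real
    proof -
      have "0 \<le> (\<bar>a\<bar> - c)\<^sup>2 / (2 * c)" using c by simp
      also have "\<dots> = c / 2 + a\<^sup>2 * (1 / (2 * c)) - \<bar>a\<bar>" using c by (simp add: power2_eq_square field_simps)
      finally show ?thesis by simp
    qed
    have "(\<integral>x. \<bar>f (Suc n) x - f n x\<bar> \<partial>torus) \<le> (\<integral>x. c / 2 + (f (Suc n) x - f n x)\<^sup>2 * (1 / (2 * c)) \<partial>torus)"
      using i int2[of "Suc n" n] p by (intro integral_mono) auto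
    also have "\<dots> = c / 2 + (\<integral>x. (f (Suc n) x - f n x)\<^sup>2 \<partial>torus) * (1 / (2 * c))"
      using int2[of "Suc n" n] by (simp add: measure_torus[simplified])
    also have "\<dots> \<le> c / 2 + c\<^sup>2 * (1 / (2 * c))"
      using n2[of n "Suc n"] c by (intro add_left_mono mult_right_mono) (auto simp: c_def)
    also have "\<dots> = c" using c by (simp add: power2_eq_square field_simps)
    finally show ?thesis using i by (subst nn_integral_eq_integral) (auto simp: c_def intro: ennreal_leI)
  qed
  have "(\<integral>\<^sup>+x. (\<Sum>n. ennreal \<bar>f (Suc n) x - f n x\<bar>) \<partial>torus) = (\<Sum>n. \<integral>\<^sup>+x. ennreal \<bar>f (Suc n) x - f n x\<bar> \<partial>torus)"
    by (rule nn_integral_suminf) auto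
  also have "\<dots> \<le> (\<Sum>n. ennreal ((1/2)^n))" by (intro suminf_le n1) auto
  also have "\<dots> < \<infinity>" by (subst suminf_ennreal2) (auto intro: summable_geometric)
  finally have "AE x in torus. (\<Sum>n. ennreal \<bar>f (Suc n) x - f n x\<bar>) \<noteq> \<infinity>"
    by (intro nn_integral_PInf_AE) auto
  then have conv: "AE x in torus. (\<lambda>n. f n x) \<longlonglongrightarrow> lim (\<lambda>n. f n x)"
  proof eventually_elim
    case (elim x)
    then have "summable (\<lambda>n. \<bar>f (Suc n) x - f n x\<bar>)"
      by (intro summable_suminf_not_top) auto
    then have "summable (\<lambda>n. f (Suc n) x - f n x)" by (rule summable_rabs_cancel)
    then have "convergent (\<lambda>n. \<Sum>k<n. (f (Suc k) x - f k x))" by (simp only: summable_iff_convergent)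
    then have "convergent (\<lambda>n. f n x - f 0 x)"
      using sum_lessThan_telescope[of "\<lambda>k. f k x"] by simp
    then obtain L where "(\<lambda>n. f n x - f 0 x) \<longlonglongrightarrow> L" by (auto simp: convergent_def)
    from tendsto_add[OF this tendsto_const[of "f 0 x"]] have "(\<lambda>n. f n x) \<longlonglongrightarrow> L + f 0 x" by simp
    then show ?case by (simp add: limI)
  qed
  define g where "g x = lim (\<lambda>n. f n x)" for x
  have gm[measurable]: "g \<in> borel_measurable torus" unfolding g_def by measurable
  \<comment> \<open>Fatou in m with n fixed: the bound of the rapid subsequence holds for all m
    \<ge> n and passes to the limit unchanged.\<close>
  have fat: "(\<integral>\<^sup>+x. ennreal ((g x - f n x)\<^sup>2) \<partial>torus) \<le> ennreal (((1/2)^n)\<^sup>2)" for n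
  proof -
    have "(\<integral>\<^sup>+x. ennreal ((g x - f n x)\<^sup>2) \<partial>torus) = (\<integral>\<^sup>+x. liminf (\<lambda>m. ennreal ((f m x - f n x)\<^sup>2)) \<partial>torus)"
    proof (rule nn_integral_cong_AE, use conv in eventually_elim)
      case (elim x)
      then have "(\<lambda>m. ennreal ((f m x - f n x)\<^sup>2)) \<longlonglongrightarrow> ennreal ((g x - f n x)\<^sup>2)"
        unfolding g_def by (intro tendsto_intros tendsto_ennrealI) auto
      from lim_imp_Liminf[OF _ this] show ?case by simp
    qed
    also have "\<dots> \<le> liminf (\<lambda>m. \<integral>\<^sup>+x. ennreal ((f m x - f n x)\<^sup>2) \<partial>torus)"
      by (rule nn_integral_liminf) auto
    also have "\<dots> \<le> ennreal (((1/2)^n)\<^sup>2)"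
    proof (rule Liminf_le)
      show "eventually (\<lambda>m. (\<integral>\<^sup>+x. ennreal ((f m x - f n x)\<^sup>2) \<partial>torus) \<le> ennreal (((1/2)^n)\<^sup>2)) sequentially"
        using eventually_ge_at_top[of n]
      proof eventually_elim
        case (elim m) then show ?case using n2[of n m] int2
          by (subst nn_integral_eq_integral) (auto intro: ennreal_leI)
      qed
    qed simp
    finally show ?thesis .
  qed
  have sgd: "sq_integrable (\<lambda>x. g x - f n x)" for n
    unfolding sq_integrable_def
    using fat[of n] by (auto intro!: integrableI_bounded simp: order.strict_trans1[OF _ ennreal_less_top])
  then have sg: "sq_integrable g" using sq_integrable_add[OF sgd[of 0] sq[of 0]] by simp
  have nb: "norm (abs_torus_L2 g - X (r n)) \<le> (1/2)^n" for n
  proof -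
    have "(norm (abs_torus_L2 g - X (r n)))\<^sup>2 = (\<integral>x. (g x - f n x)\<^sup>2 \<partial>torus)"
      using diff_abs_torus_L2[OF sg sq[of n]] sgd[of n]
      by (simp add: f_def abs_rep_torus_L2 power2_norm_eq_inner inner_abs_torus_L2) (simp add: power2_eq_square)
    also have "\<dots> \<le> ((1/2)^n)\<^sup>2"
    proof -
      have "ennreal (\<integral>x. (g x - f n x)\<^sup>2 \<partial>torus) \<le> ennreal (((1/2)^n)\<^sup>2)"
        using fat[of n] sgd[of n] by (subst nn_integral_eq_integral[symmetric]) (auto simp: sq_integrable_def)
      then show ?thesis by (simp add: ennreal_le_iff)
    qed
    finally show ?thesis by (rule power2_le_imp_le) simp
  qed
  have "(\<lambda>n. X (r n)) \<longlonglongrightarrow> abs_torus_L2 g"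
  proof (rule LIMSEQ_I)
    fix e :: real assume "e > 0"
    obtain N where N: "(1/2::real)^N < e" using real_arch_pow_inv[OF \<open>e > 0\<close>, of "1/2"] by auto
    show "\<exists>no. \<forall>n\<ge>no. norm (X (r n) - abs_torus_L2 g) < e"
    proof (rule exI[of _ N], intro allI impI)
      fix n assume "n \<ge> N"
      then have "(1/2::real)^n \<le> (1/2)^N" by (intro power_decreasing) auto
      then show "norm (X (r n) - abs_torus_L2 g) < e" using nb[of n] N norm_minus_commute[of "X (r n)" "abs_torus_L2 g"] by linarith
    qed
  qed
  then show "convergent X"
    using Cauchy_converges_subseq[OF X r] by (auto simp: convergent_def o_def)
qed

section \<open>A real trigonometric basis\<close>

lemma integral_cis_unit_interval:
  "(\<integral>x. indicator {0..<1} x *\<^sub>R cis (2 * pi * real_of_int a * x) \<partial>lborel) = (if a = 0 then 1 else 0)"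
proof -
  have "(\<integral>x. indicator {0..<1} x *\<^sub>R cis (2 * pi * real_of_int a * x) \<partial>lborel) =
     (\<integral>x. indicator {0..1} x *\<^sub>R cis (2 * pi * real_of_int a * x) \<partial>lborel)"
  proof (rule integral_cong_AE)
    show "AE x in lborel. indicator {0..<1} x *\<^sub>R cis (2 * pi * real_of_int a * x) =
        indicator {0..1} x *\<^sub>R cis (2 * pi * real_of_int a * x)"
      using AE_lborel_singleton[of "1::real"] by eventually_elim (auto simp: indicator_def)
  qed (auto intro!: borel_measurable_scaleR borel_measurable_indicator borel_measurable_continuous_onI[of "\<lambda>x. cis (_ x)"] continuous_intros)
  also have "\<dots> = (if a = 0 then 1 else 0)"
  proof (cases "a = 0")
    case True
    then show ?thesis by simp
  next
    case False
    define c where "c = \<i> * (2 * pi * real_of_int a)"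
    have c: "c \<noteq> 0" using False by (simp add: c_def)
    have e: "cis (2 * pi * real_of_int a * x) = exp (c * of_real x)" for x
      by (simp add: c_def cis_conv_exp mult_ac)
    have "(\<integral>x. indicator {0..1} x *\<^sub>R exp (c * of_real x) \<partial>lborel) = exp (c * of_real 1) / c - exp (c * of_real 0) / c"
    proof (rule integral_FTC_Icc)
      fix x :: real
      show "((\<lambda>x. exp (c * of_real x) / c) has_vector_derivative exp (c * of_real x)) (at x within {0..1})"
        using c by (auto intro!: derivative_eq_intros has_vector_derivative_real_field)
    qed (auto intro!: continuous_intros)
    also have "exp (c * of_real 1) = 1"
      using e[of 1] cis_multiple_2pi[of "real_of_int a"] by (simp)
    finally show ?thesis using False by (simp add: e)
  qed
  finally show ?thesis .
qed

lemma integral_cis_torus: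
  "(\<integral>x. cis (2 * pi * (real_of_int a * fst x + real_of_int b * snd x)) \<partial>torus) = (if a = 0 \<and> b = 0 then 1 else 0)"
proof -
  define e where "e a x = indicator {0..<1} x *\<^sub>R cis (2 * pi * real_of_int a * x)" for a and x :: real
  have me[measurable]: "e a \<in> borel_measurable lborel" for a unfolding e_def
    by (auto intro!: borel_measurable_scaleR borel_measurable_indicator borel_measurable_continuous_onI[of "\<lambda>x. cis (_ x)"] continuous_intros)
  have ie: "integrable lborel (e a)" for a
  proof -
    have "integrable lborel (\<lambda>x. indicator {0..<1::real} x *\<^sub>R (1::real))"
      by (simp)
    then show ?thesis
      by (rule Bochner_Integration.integrable_bound) (auto simp: e_def indicator_def)
  qed
  have "(\<integral>x. cis (2 * pi * (real_of_int a * fst x + real_of_int b * snd x)) \<partial>torus) =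
    (\<integral>x. indicator ({0..<1} \<times> {0..<1}) x *\<^sub>R cis (2 * pi * (real_of_int a * fst x + real_of_int b * snd x)) \<partial>lborel)"
    unfolding torus_def by (subst integral_restrict_space) (auto simp: unit_square_sets)
  also have "\<dots> = (\<integral>x. e a (fst x) * e b (snd x) \<partial>(lborel \<Otimes>\<^sub>M lborel))"
    unfolding lborel_prod
    by (intro Bochner_Integration.integral_cong) (auto simp: e_def indicator_def cis_mult ring_distribs mult_ac)
  also have "\<dots> = (\<integral>x. \<integral>y. e a x * e b y \<partial>lborel \<partial>lborel)"
  proof -
    have "integrable (lborel \<Otimes>\<^sub>M lborel) (\<lambda>x. e a (fst x) * e b (snd x))"
    proof (rule Bochner_Integration.integrable_bound)
      show "integrable (lborel \<Otimes>\<^sub>M lborel) (indicator ({0..<1} \<times> {0..<1}) :: real \<times> real \<Rightarrow> real)"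
        by (simp add: lborel.emeasure_pair_measure_Times)
      show "(\<lambda>x. e a (fst x) * e b (snd x)) \<in> borel_measurable (lborel \<Otimes>\<^sub>M lborel)"
        by measurable
      show "AE x in lborel \<Otimes>\<^sub>M lborel. norm (e a (fst x) * e b (snd x)) \<le>
          norm (indicator ({0..<1} \<times> {0..<1}) x :: real)"
        by (intro AE_I2) (auto simp: e_def indicator_def norm_mult)
    qed
    from lborel_pair.integral_fst'[OF this, symmetric] show ?thesis unfolding fst_conv snd_conv .
  qed
  also have "\<dots> = (\<integral>x. e a x \<partial>lborel) * (\<integral>x. e b x \<partial>lborel)"
    by simp
  also have "\<dots> = (if a = 0 \<and> b = 0 then 1 else 0)"
    unfolding e_def integral_cis_unit_interval by simp
  finally show ?thesis .
qed

definition phase :: "int \<times> int \<Rightarrow> real \<times> real \<Rightarrow> real" where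
  "phase k x = 2 * pi * (real_of_int (fst k) * fst x + real_of_int (snd k) * snd x)"

lemma phase_add: "phase (k + l) x = phase k x + phase l x"
  and phase_diff: "phase (k - l) x = phase k x - phase l x"
  and phase_minus: "phase (- k) x = - phase k x"
  and phase_0 [simp]: "phase 0 x = 0"
  by (auto simp: phase_def algebra_simps)

lemma continuous_phase [continuous_intros]: "continuous_on A (phase k)"
  unfolding phase_def by (intro continuous_intros)

lemma phase_measurable [measurable]: "phase k \<in> borel_measurable torus"
  by (intro continuous_measurable_torus continuous_intros)

lemma integral_cis_phase: "(\<integral>x. cis (phase k x) \<partial>torus) = (if k = 0 then 1 else 0)"
  using integral_cis_torus[of "fst k" "snd k"] by (auto simp: phase_def prod_eq_iff)

lemma integrable_cis_phase: "integrable torus (\<lambda>x. cis (phase k x))"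
  by (rule bounded_integrable_torus[of _ 1]) (auto intro!: continuous_measurable_torus continuous_intros)

lemma integral_cos_phase: "(\<integral>x. cos (phase k x) \<partial>torus) = (if k = 0 then 1 else 0)"
  using integral_Re[OF integrable_cis_phase[of k]] unfolding integral_cis_phase by (auto split: if_splits)

lemma integral_sin_phase: "(\<integral>x. sin (phase k x) \<partial>torus) = 0"
  using integral_Im[OF integrable_cis_phase[of k]] unfolding integral_cis_phase by (auto split: if_splits)

text \<open>Hartley's functions \<open>cos + sin\<close>: one real orthonormal family indexed by all frequencies, with no
  distinguished half plane.\<close>

definition cas :: "int \<times> int \<Rightarrow> real \<times> real \<Rightarrow> real" where
  "cas k x = cos (phase k x) + sin (phase k x)"

lemma cas_measurable [measurable]: "cas k \<in> borel_measurable torus"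
  unfolding cas_def by measurable

lemma abs_cas_le: "\<bar>cas k x\<bar> \<le> 2"
  unfolding cas_def
  using abs_cos_le_one[of "phase k x"] abs_sin_le_one[of "phase k x"] by linarith

lemma sq_integrable_cas: "sq_integrable (cas k)"
  by (rule sq_integrable_bounded[OF cas_measurable abs_cas_le])

lemma cas_mult_cas: "cas k x * cas l x = cos (phase (k - l) x) + sin (phase (k + l) x)"
  unfolding cas_def phase_add phase_diff cos_diff sin_add by (simp add: algebra_simps)

definition hbas :: "int \<times> int \<Rightarrow> torus_L2" where
  "hbas k = abs_torus_L2 (cas k)"

lemma integrable_cos_phase: "integrable torus (\<lambda>x. cos (phase k x))"
  and integrable_sin_phase: "integrable torus (\<lambda>x. sin (phase k x))"
  by (rule bounded_integrable_torus[of _ 1]; simp)+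

text \<open>In the product formula the sine has mean zero even at k + l = 0, and the cosine has mean
  one exactly at k = l. Hence the family is normalised without a constant and k = 0 needs no
  separate treatment.\<close>

lemma inner_hbas: "inner (hbas k) (hbas l) = (if k = l then 1 else 0)"
proof -
  have "inner (hbas k) (hbas l) = (\<integral>x. cos (phase (k - l) x) + sin (phase (k + l) x) \<partial>torus)"
    unfolding hbas_def by (simp add: inner_abs_torus_L2 sq_integrable_cas cas_mult_cas)
  also have "\<dots> = (if k = l then 1 else 0)"
    by (simp add: integrable_cos_phase integrable_sin_phase integral_cos_phase integral_sin_phase)
  finally show ?thesis .
qed

text \<open>The torus as a product of two circles: compact, so that Stone-Weierstrass applies.\<close>

definition circle_map :: "real \<times> real \<Rightarrow> complex \<times> complex" where
  "circle_map x = (cis (2 * pi * fst x), cis (2 * pi * snd x))"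

lemma circle_map_phase: "circle_map x = (cis (phase (1, 0) x), cis (phase (0, 1) x))"
  by (simp add: circle_map_def phase_def)

lemma continuous_circle_map: "continuous_on A circle_map"
  unfolding circle_map_def by (intro continuous_intros)

lemma circle_map_sphere: "circle_map x \<in> sphere 0 1 \<times> sphere 0 1"
  by (simp add: circle_map_def)

lemma cis_2pi_inj:
  assumes "cis (2 * pi * s) = cis (2 * pi * t)" "0 \<le> s" "s < 1" "0 \<le> t" "t < 1"
  shows "s = t"
proof -
  have "sin (2 * pi * s) = sin (2 * pi * t) \<and> cos (2 * pi * s) = cos (2 * pi * t)"
    using assms(1) by (simp add: complex_eq_iff)
  then obtain n where "2 * pi * s = 2 * pi * t + 2 * pi * real_of_int n"
    unfolding sin_cos_eq_iff by blast
  then have st: "s = t + real_of_int n"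
    by (simp add: distrib_left[symmetric] del: distrib_left)
  then have "\<bar>real_of_int n\<bar> < 1" using assms by auto
  then have "n = 0" by linarith
  then show ?thesis using st by simp
qed

text \<open>This is why the fundamental domain is half open: a point of the square can be recovered
  from its image, so the indicator of a compact subset of the square is the pull-back of the
  indicator of a compact subset of the product of circles.\<close>

lemma circle_map_inj: "inj_on circle_map ({0..<1} \<times> {0..<1})"
  unfolding inj_on_def circle_map_def using cis_2pi_inj by auto

text \<open>Bounded multipliers \<open>t\<close> for which \<open>f t\<close> is orthogonal to all trigonometric functions; they form a
  space that is enlarged step by step to polynomials, continuous functions and indicators.\<close>

definition orth :: "(real \<times> real \<Rightarrow> real) \<Rightarrow> (real \<times> real \<Rightarrow> real) set" where
  "orth f = {t. t \<in> borel_measurable torus \<and> bounded (range t) \<and>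
    (\<forall>k. (\<integral>x. f x * (t x * cos (phase k x)) \<partial>torus) = 0 \<and> (\<integral>x. f x * (t x * sin (phase k x)) \<partial>torus) = 0)}"

lemma integrable_mult_bounded:
  fixes t :: "real \<times> real \<Rightarrow> real"
  assumes "integrable torus f" "t \<in> borel_measurable torus" "\<And>x. \<bar>t x\<bar> \<le> C"
  shows "integrable torus (\<lambda>x. f x * t x :: real)"
proof (rule Bochner_Integration.integrable_bound[of _ "\<lambda>x. C * f x"])
  show "AE x in torus. norm (f x * t x) \<le> norm (C * f x)"
  proof (rule AE_I2)
    fix x
    have "\<bar>f x\<bar> * \<bar>t x\<bar> \<le> \<bar>f x\<bar> * \<bar>C\<bar>" using assms(3)[of x] by (intro mult_left_mono) auto
    then show "norm (f x * t x) \<le> norm (C * f x)" by (simp add: abs_mult mult.commute)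
  qed
qed (use assms in auto)

lemma orth_integrable:
  assumes f: "integrable torus f" and t: "t \<in> orth f"
  shows "integrable torus (\<lambda>x. f x * (t x * cos (phase k x)))" "integrable torus (\<lambda>x. f x * (t x * sin (phase k x)))"
proof -
  obtain B where B: "\<And>x. \<bar>t x\<bar> \<le> B" using t by (auto simp: orth_def bounded_iff)
  have B': "\<bar>t x * cos y\<bar> \<le> B" "\<bar>t x * sin y\<bar> \<le> B" for x y
    using B[of x] abs_cos_le_one[of y] abs_sin_le_one[of y] mult_mono[of "\<bar>t x\<bar>" B "\<bar>cos y\<bar>" 1] mult_mono[of "\<bar>t x\<bar>" B "\<bar>sin y\<bar>" 1]
    by (auto simp: abs_mult)
  have [measurable]: "t \<in> borel_measurable torus" using t by (simp add: orth_def)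
  show "integrable torus (\<lambda>x. f x * (t x * cos (phase k x)))" "integrable torus (\<lambda>x. f x * (t x * sin (phase k x)))"
    by (rule integrable_mult_bounded[OF f _ B'(1)] integrable_mult_bounded[OF f _ B'(2)]; measurable)+
qed

lemma orth_add:
  assumes f: "integrable torus f" and t: "s \<in> orth f" "t \<in> orth f"
  shows "(\<lambda>x. s x + t x) \<in> orth f"
proof -
  have "bounded (range (\<lambda>x. s x + t x))"
    using bounded_plus_comp[of s UNIV t] t by (simp add: orth_def)
  then show ?thesis
    using orth_integrable[OF f t(1)] orth_integrable[OF f t(2)] t
    by (auto simp: orth_def ring_distribs)
qed

lemma orth_scale:
  assumes t: "t \<in> orth f" shows "(\<lambda>x. c * t x) \<in> orth f"
proof -
  have "bounded (range (\<lambda>x. c * t x))"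
    using bounded_scaling[of "range t" c] t by (simp add: orth_def image_image)
  moreover have "(\<integral>x. f x * (c * t x * cos (phase k x)) \<partial>torus) = c * (\<integral>x. f x * (t x * cos (phase k x)) \<partial>torus)"
    "(\<integral>x. f x * (c * t x * sin (phase k x)) \<partial>torus) = c * (\<integral>x. f x * (t x * sin (phase k x)) \<partial>torus)" for k
    by (simp_all flip: integral_mult_right_zero add: mult_ac)
  ultimately show ?thesis using t by (auto simp: orth_def)
qed

text \<open>Product-to-sum formulas: a product of two trigonometric functions is a combination of
  those at k - l and k + l, against which f t is already orthogonal.\<close>

lemma orth_trig:
  assumes f: "integrable torus f" and t: "t \<in> orth f"
  shows "(\<lambda>x. cos (phase l x) * t x) \<in> orth f" "(\<lambda>x. sin (phase l x) * t x) \<in> orth f"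
proof -
  obtain B where B: "\<And>x. \<bar>t x\<bar> \<le> B" using t by (auto simp: orth_def bounded_iff)
  have "\<bar>cos y * t x\<bar> \<le> B" "\<bar>sin y * t x\<bar> \<le> B" for x y
    using B[of x] abs_cos_le_one[of y] abs_sin_le_one[of y] mult_mono[of "\<bar>t x\<bar>" B "\<bar>cos y\<bar>" 1] mult_mono[of "\<bar>t x\<bar>" B "\<bar>sin y\<bar>" 1]
    by (auto simp: abs_mult mult.commute)
  then have b: "bounded (range (\<lambda>x. cos (phase l x) * t x))" "bounded (range (\<lambda>x. sin (phase l x) * t x))"
    unfolding bounded_iff by (auto simp del: split_paired_All split_paired_Ex intro!: exI[of _ B])
  have [measurable]: "t \<in> borel_measurable torus" using t by (simp add: orth_def)
  note i = orth_integrable[OF f t]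
  have z: "(\<integral>x. f x * (t x * cos (phase k x)) \<partial>torus) = 0" "(\<integral>x. f x * (t x * sin (phase k x)) \<partial>torus) = 0" for k
    using t unfolding orth_def by blast+
  have cc: "f x * (cos (phase l x) * t x * cos (phase k x)) =
      (f x * (t x * cos (phase (k - l) x)) + f x * (t x * cos (phase (k + l) x))) / 2" for x k
    unfolding phase_add phase_diff cos_add cos_diff by (simp add: algebra_simps)
  have cs: "f x * (cos (phase l x) * t x * sin (phase k x)) =
      (f x * (t x * sin (phase (k - l) x)) + f x * (t x * sin (phase (k + l) x))) / 2" for x k
    unfolding phase_add phase_diff sin_add sin_diff by (simp add: algebra_simps)
  have sc: "f x * (sin (phase l x) * t x * cos (phase k x)) =
      (f x * (t x * sin (phase (k + l) x)) - f x * (t x * sin (phase (k - l) x))) / 2" for x k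
    unfolding phase_add phase_diff sin_add sin_diff by (simp add: algebra_simps)
  have ss: "f x * (sin (phase l x) * t x * sin (phase k x)) =
      (f x * (t x * cos (phase (k - l) x)) - f x * (t x * cos (phase (k + l) x))) / 2" for x k
    unfolding phase_add phase_diff cos_add cos_diff by (simp add: algebra_simps)
  show "(\<lambda>x. cos (phase l x) * t x) \<in> orth f" "(\<lambda>x. sin (phase l x) * t x) \<in> orth f"
    unfolding orth_def mem_Collect_eq cc cs sc ss using b z i by simp_all
qed

text \<open>Quantifying over t makes the product case immediate: g is applied to the multiplier
  already enlarged by h. In the linear case a real-linear functional on the pair of circles is a
  combination of its four real coordinates, the cosines and sines of the two basic phases.\<close>

lemma orth_polynomial:
  assumes f: "integrable torus f" and p: "real_polynomial_function p" and t: "t \<in> orth f"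
  shows "(\<lambda>x. p (circle_map x) * t x) \<in> orth f"
  using p t
proof (induction arbitrary: t rule: real_polynomial_function.induct)
  case (linear h t)
  interpret bounded_linear h by fact
  have "h (circle_map x) * t x = h (1, 0) * (cos (phase (1, 0) x) * t x) + h (\<i>, 0) * (sin (phase (1, 0) x) * t x)
     + (h (0, 1) * (cos (phase (0, 1) x) * t x) + h (0, \<i>) * (sin (phase (0, 1) x) * t x))" for x
  proof -
    have "circle_map x = cos (phase (1, 0) x) *\<^sub>R (1, 0) + sin (phase (1, 0) x) *\<^sub>R (\<i>, 0)
       + cos (phase (0, 1) x) *\<^sub>R (0, 1) + sin (phase (0, 1) x) *\<^sub>R (0, \<i>)"
      by (simp add: circle_map_phase complex_eq_iff)
    then show ?thesis by (simp only: add scaleR) (simp add: algebra_simps)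
  qed
  then show ?case using linear.prems
    by (simp only:) (intro orth_add[OF f] orth_scale orth_trig[OF f])
next
  case (const c)
  then show ?case by (rule orth_scale)
next
  case (add g h)
  then show ?case by (simp only: distrib_right) (intro orth_add[OF f])
next
  case (mult g h)
  then show ?case by (simp only: mult.assoc)
qed

text \<open>The Hartley functions at k and -k add up to twice the cosine and subtract to twice the
  sine, so vanishing Hartley coefficients give vanishing cosine and sine coefficients.\<close>

lemma orth_one:
  assumes f: "sq_integrable f" and z: "\<And>k. (\<integral>x. f x * cas k x \<partial>torus) = 0"
  shows "(\<lambda>x. 1) \<in> orth f"
proof -
  note fi = sq_integrable_imp_integrable[OF f]
  have i: "integrable torus (\<lambda>x. f x * cas k x)" for k
    by (rule integrable_mult_bounded[OF fi cas_measurable abs_cas_le])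
  have "f x * cos (phase k x) = (f x * cas k x + f x * cas (- k) x) / 2"
    "f x * sin (phase k x) = (f x * cas k x - f x * cas (- k) x) / 2" for x k
    by (simp_all add: cas_def phase_minus algebra_simps)
  then have "(\<integral>x. f x * cos (phase k x) \<partial>torus) = 0" "(\<integral>x. f x * sin (phase k x) \<partial>torus) = 0" for k
    using z i by (simp_all only:) simp_all
  then show ?thesis by (simp add: orth_def)
qed

lemma orth_continuous:
  assumes f: "sq_integrable f" and z: "\<And>k. (\<integral>x. f x * cas k x \<partial>torus) = 0"
    and h: "continuous_on UNIV h"
  shows "(\<integral>x. f x * h (circle_map x) \<partial>torus) = 0"
proof (rule ccontr)
  let ?I = "\<integral>x. f x * h (circle_map x) \<partial>torus"
  let ?F = "\<integral>x. \<bar>f x\<bar> \<partial>torus"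
  assume "?I \<noteq> 0"
  \<comment> \<open>With this error the approximation changes the integral by less than half its
    modulus; the summand 1 keeps the denominator positive when f vanishes.\<close>
  define e where "e = \<bar>?I\<bar> / (2 * (?F + 1))"
  have F: "?F \<ge> 0" by simp
  have e: "e > 0" unfolding e_def using \<open>?I \<noteq> 0\<close> F
    by (intro divide_pos_pos mult_pos_pos add_nonneg_pos) auto
  have "compact (sphere (0::complex) 1 \<times> sphere (0::complex) 1)" by (intro compact_Times) auto
  from Stone_Weierstrass_real_polynomial_function[OF this continuous_on_subset[OF h] e]
  obtain p where p: "real_polynomial_function p"
    and hp: "\<And>y. y \<in> sphere 0 1 \<times> sphere 0 1 \<Longrightarrow> \<bar>h y - p y\<bar> < e" by auto
  note fi = sq_integrable_imp_integrable[OF f]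
  have o: "(\<lambda>x. p (circle_map x) * 1) \<in> orth f" by (rule orth_polynomial[OF fi p orth_one[OF f z]])
  have ip: "integrable torus (\<lambda>x. f x * p (circle_map x))" and zp: "(\<integral>x. f x * p (circle_map x) \<partial>torus) = 0"
    using orth_integrable(1)[OF fi o, of 0] o by (simp_all add: orth_def del: split_paired_All) (auto dest!: spec[of _ 0] simp del: split_paired_All)
  have hm: "(\<lambda>x. h (circle_map x)) \<in> borel_measurable torus"
    by (intro continuous_measurable_torus continuous_on_compose2[OF h continuous_circle_map]) auto
  have pm: "(\<lambda>x. p (circle_map x)) \<in> borel_measurable torus" using o by (simp add: orth_def)
  have d: "integrable torus (\<lambda>x. f x * (h (circle_map x) - p (circle_map x)))"
    using hm pm hp[OF circle_map_sphere] by (intro integrable_mult_bounded[OF fi, where C=e] less_imp_le borel_measurable_diff)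
  have "integrable torus (\<lambda>x. f x * (h (circle_map x) - p (circle_map x)) + f x * p (circle_map x))"
    by (intro Bochner_Integration.integrable_add d ip)
  then have ih: "integrable torus (\<lambda>x. f x * h (circle_map x))" by (simp add: algebra_simps)
  have "?I = (\<integral>x. f x * (h (circle_map x) - p (circle_map x)) \<partial>torus)"
    using ih ip zp by (simp add: right_diff_distrib)
  also have "\<bar>\<dots>\<bar> \<le> (\<integral>x. \<bar>f x * (h (circle_map x) - p (circle_map x))\<bar> \<partial>torus)"
    by (rule integral_abs_bound)
  also have "\<dots> \<le> (\<integral>x. \<bar>f x\<bar> * e \<partial>torus)"
    using integrable_abs[OF d] fi
  proof (intro integral_mono)
    show "\<bar>f x * (h (circle_map x) - p (circle_map x))\<bar> \<le> \<bar>f x\<bar> * e" for x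
      using hp[OF circle_map_sphere, of x] by (simp add: abs_mult mult_left_mono)
  qed auto
  also have "\<dots> = ?F * e" by simp
  also have "\<dots> < (?F + 1) * e" using e by simp
  also have "\<dots> = \<bar>?I\<bar> / 2"
  proof -
    have "?F + 1 \<noteq> 0" using F by linarith
    then show ?thesis unfolding e_def by (simp add: divide_simps del: integral_nonneg_AE)
  qed
  finally show False using \<open>?I \<noteq> 0\<close> by linarith
qed

text \<open>The indicator of K is the pointwise limit of cut-offs of the distance to the image of K
  in the product of circles. They are continuous there, whereas a cut-off built on the square itself
  need not be periodic.\<close>

lemma orth_compact:
  assumes f: "sq_integrable f" and z: "\<And>k. (\<integral>x. f x * cas k x \<partial>torus) = 0"
    and K: "compact K" "K \<subseteq> {0..<1} \<times> {0..<1}"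
  shows "(\<integral>x. f x * indicator K x \<partial>torus) = 0"
proof (cases "K = {}")
  case False
  define C where "C = circle_map ` K"
  have C: "closed C" unfolding C_def
    by (intro compact_imp_closed compact_continuous_image continuous_circle_map K)
  have Cne: "C \<noteq> {}" using False by (simp add: C_def)
  define h where "h n y = max 0 (1 - real n * infdist y C)" for n y
  have hc: "continuous_on UNIV (h n)" for n unfolding h_def by (intro continuous_intros)
  have h1: "\<bar>h n y\<bar> \<le> 1" for n y unfolding h_def using infdist_nonneg[of y C] by (auto simp: max_def)
  note fi = sq_integrable_imp_integrable[OF f]
  have fm[measurable]: "f \<in> borel_measurable torus" using f by (simp add: sq_integrable_def)
  have hm[measurable]: "(\<lambda>x. h n (circle_map x)) \<in> borel_measurable torus" for n
    by (intro continuous_measurable_torus continuous_on_compose2[OF hc continuous_circle_map]) auto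
  have Km: "K \<in> sets borel" using K(1) by (simp add: borel_compact)
  have [measurable]: "(indicator K :: _ \<Rightarrow> real) \<in> borel_measurable torus" unfolding torus_def
    by (rule measurable_restrict_space1) (use Km in simp)
  have lim: "(\<lambda>n. h n (circle_map x)) \<longlonglongrightarrow> indicator K x" if x: "x \<in> space torus" for x
  proof (cases "circle_map x \<in> C")
    case True
    then obtain y where "y \<in> K" "circle_map x = circle_map y" by (auto simp: C_def)
    then have "x \<in> K" using circle_map_inj K(2) x by (auto dest: inj_onD)
    moreover have "h n (circle_map x) = 1" for n using True by (simp add: h_def)
    ultimately show ?thesis by simp
  next
    case False
    then have i: "infdist (circle_map x) C > 0"
      using C Cne in_closed_iff_infdist_zero infdist_nonneg[of "circle_map x" C] by (metis less_eq_real_def)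
    obtain N where N: "1 < real N * infdist (circle_map x) C" using reals_Archimedean3[OF i] by blast
    have "eventually (\<lambda>n. h n (circle_map x) = 0) sequentially"
      using eventually_ge_at_top[of N]
    proof eventually_elim
      case (elim n)
      then have "real N * infdist (circle_map x) C \<le> real n * infdist (circle_map x) C"
        using i by (intro mult_right_mono) auto
      then show ?case using N by (simp add: h_def)
    qed
    moreover have "x \<notin> K" using False by (auto simp: C_def)
    ultimately show ?thesis by (simp add: tendsto_eventually)
  qed
  have "(\<lambda>n. \<integral>x. f x * h n (circle_map x) \<partial>torus) \<longlonglongrightarrow> (\<integral>x. f x * indicator K x \<partial>torus)"
  proof (rule integral_dominated_convergence[where w="\<lambda>x. \<bar>f x\<bar>"])
    show "AE x in torus. (\<lambda>n. f x * h n (circle_map x)) \<longlonglongrightarrow> f x * indicator K x"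
      by (intro AE_I2 tendsto_mult tendsto_const lim)
    show "AE x in torus. norm (f x * h n (circle_map x)) \<le> \<bar>f x\<bar>" for n
      by (auto simp: abs_mult intro!: AE_I2 mult_left_le h1)
  qed (use fi in auto)
  moreover have "(\<integral>x. f x * h n (circle_map x) \<partial>torus) = 0" for n
    by (rule orth_continuous[OF f z hc])
  ultimately show ?thesis by (simp add: LIMSEQ_const_iff)
qed simp

text \<open>Inner regularity of Lebesgue measure extends the vanishing from compact sets to all Borel sets.\<close>

lemma cas_complete:
  assumes f: "sq_integrable f" and z: "\<And>k. (\<integral>x. f x * cas k x \<partial>torus) = 0"
  shows "AE x in torus. f x = 0"
proof -
  note fi = sq_integrable_imp_integrable[OF f]
  define Q where "Q = {0..<1::real} \<times> {0..<1::real}"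
  have Qm: "Q \<in> sets lborel" by (simp add: Q_def unit_square_sets)
  define F where "F x = indicator Q x * f x" for x
  have Fi: "integrable lborel F"
    using fi Qm unfolding torus_def F_def Q_def
    by (subst (asm) integrable_restrict_space) (auto simp: mult.commute)
  have Fm[measurable]: "F \<in> borel_measurable borel" using Fi by auto
  have restr: "(\<integral>x. f x * indicator A x \<partial>torus) = (\<integral>x. F x * indicator A x \<partial>lborel)" for A
    unfolding torus_def F_def Q_def
    by (subst integral_restrict_space) (auto simp: mult_ac unit_square_sets)
  have pos: "emeasure lborel {x \<in> Q. s * F x > 0} = 0" if s: "s = 1 \<or> s = -1" for s
  proof (rule ccontr)
    \<comment> \<open>\<open>ennreal\<close> cuts negative values off, so M has the positive part of
      s F as density. It is a finite Borel measure, hence inner regular, and a compact K inside B of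
      positive M-measure would contradict the vanishing integral over K.\<close>
    define M where "M = density lborel (\<lambda>x. ennreal (s * F x))"
    define B where "B = {x \<in> Q. s * F x > 0}"
    assume ne: "emeasure lborel {x \<in> Q. s * F x > 0} \<noteq> 0"
    have Bm: "B \<in> sets borel" using Qm unfolding B_def by measurable
    have sM: "sets M = sets borel" by (simp add: M_def)
    have fin: "emeasure M (space M) \<noteq> \<infinity>"
    proof -
      have "emeasure M (space M) = (\<integral>\<^sup>+x. ennreal (s * F x) \<partial>lborel)"
        unfolding M_def by (simp add: emeasure_density)
      also have "\<dots> < \<infinity>"
      proof -
        have "integrable lborel (\<lambda>x. s * F x)" using Fi by (rule integrable_mult_right)
        then have "(\<integral>\<^sup>+x. ennreal (norm (s * F x)) \<partial>lborel) < \<infinity>"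
          unfolding integrable_iff_bounded by blast
        moreover have "(\<integral>\<^sup>+x. ennreal (s * F x) \<partial>lborel) \<le> (\<integral>\<^sup>+x. ennreal (norm (s * F x)) \<partial>lborel)"
          by (intro nn_integral_mono ennreal_leI) simp
        ultimately show ?thesis by (rule order.strict_trans1[rotated])
      qed
      finally show ?thesis by simp
    qed
    have MB: "emeasure M B > 0"
    proof -
      have "emeasure M B = (\<integral>\<^sup>+x. ennreal (s * F x) * indicator B x \<partial>lborel)"
        unfolding M_def using Bm by (intro emeasure_density) auto
      moreover have "\<dots> \<noteq> 0"
      proof
        assume "(\<integral>\<^sup>+x. ennreal (s * F x) * indicator B x \<partial>lborel) = 0"
        then have "AE x in lborel. ennreal (s * F x) * indicator B x = 0"
          using Bm by (subst (asm) nn_integral_0_iff_AE) auto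
        then have "AE x in lborel. x \<notin> B"
          by eventually_elim (auto simp: B_def indicator_def ennreal_eq_0_iff split: if_splits)
        then have "emeasure lborel B = 0" using Bm by (subst (asm) AE_iff_measurable[of B]) (auto simp: B_def)
        then show False using ne by (simp add: B_def)
      qed
      ultimately show ?thesis by (simp add: zero_less_iff_neq_zero)
    qed
    have "emeasure M B = (SUP K\<in>{K. K \<subseteq> B \<and> compact K}. emeasure M K)"
      by (rule inner_regular[OF sM fin Bm])
    then obtain K where K: "K \<subseteq> B" "compact K" and MK: "emeasure M K > 0"
      using MB by (auto simp: less_SUP_iff)
    have Km: "K \<in> sets borel" using K(2) by (simp add: borel_compact)
    have KQ: "K \<subseteq> {0..<1} \<times> {0..<1}" using K(1) by (auto simp: B_def Q_def)
    have "(\<integral>x. s * F x * indicator K x \<partial>lborel) = s * (\<integral>x. f x * indicator K x \<partial>torus)"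
      unfolding restr by (simp add: mult.assoc)
    also have "\<dots> = 0" using orth_compact[OF f z K(2) KQ] by simp
    finally have z0: "(\<integral>x. s * F x * indicator K x \<partial>lborel) = 0" .
    have iK: "integrable lborel (\<lambda>x. s * F x * indicator K x)"
      using integrable_mult_indicator[OF _ Fi, of K] Km by (simp add: mult_ac)
    have nK: "0 \<le> s * F x * indicator K x" for x using K(1) by (auto simp: B_def indicator_def)
    have "emeasure M K = (\<integral>\<^sup>+x. ennreal (s * F x) * indicator K x \<partial>lborel)"
      unfolding M_def using Km by (intro emeasure_density) auto
    also have "\<dots> = (\<integral>\<^sup>+x. ennreal (s * F x * indicator K x) \<partial>lborel)"
      by (intro nn_integral_cong) (auto simp: indicator_def)
    also have "\<dots> = ennreal (\<integral>x. s * F x * indicator K x \<partial>lborel)"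
      by (rule nn_integral_eq_integral[OF iK]) (use nK in auto)
    finally show False using z0 MK by simp
  qed
  have "AE x in lborel. \<not> (x \<in> Q \<and> s * F x > 0)" if s: "s = 1 \<or> s = -1" for s
    by (rule AE_I'[of "{x \<in> Q. s * F x > 0}"]) (use pos[OF s] Qm in \<open>auto simp: null_sets_def\<close>)
  from this[of 1] this[of "-1"] have "AE x in lborel. x \<in> Q \<longrightarrow> f x = 0"
    by (simp, elim eventually_elim2) (auto simp: F_def)
  then show ?thesis unfolding torus_def Q_def
    by (subst AE_restrict_space_iff) (auto simp: unit_square_sets)
qed

section \<open>Orthonormal sequences and expansions\<close>

definition orthonormal_seq :: "(nat \<Rightarrow> 'a::real_inner) \<Rightarrow> bool" where
  "orthonormal_seq u \<longleftrightarrow> (\<forall>i j. inner (u i) (u j) = (if i = j then 1 else 0))"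

lemma inner_sum_orthonormal:
  assumes "orthonormal_seq u" "finite A"
  shows "inner (\<Sum>i\<in>A. c i *\<^sub>R u i) (u j) = (if j \<in> A then c j else 0)"
  using assms by (simp add: inner_sum_left orthonormal_seq_def if_distrib[of "\<lambda>x. _ * x"] cong: if_cong)

lemma norm_sum_orthonormal:
  assumes "orthonormal_seq u" "finite A"
  shows "(norm (\<Sum>i\<in>A. c i *\<^sub>R u i))\<^sup>2 = (\<Sum>i\<in>A. (c i)\<^sup>2)"
proof -
  have "(norm (\<Sum>i\<in>A. c i *\<^sub>R u i))\<^sup>2 = (\<Sum>j\<in>A. c j * inner (\<Sum>i\<in>A. c i *\<^sub>R u i) (u j))"
    by (simp only: power2_norm_eq_inner inner_sum_right inner_scaleR_right)
  also have "\<dots> = (\<Sum>i\<in>A. (c i)\<^sup>2)"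
    by (intro sum.cong) (auto simp: inner_sum_orthonormal[OF assms] power2_eq_square)
  finally show ?thesis .
qed

lemma bessel_finite:
  assumes u: "orthonormal_seq u" and A: "finite A"
  shows "(\<Sum>i\<in>A. (inner f (u i))\<^sup>2) \<le> (norm f)\<^sup>2"
proof -
  let ?p = "\<Sum>i\<in>A. inner f (u i) *\<^sub>R u i"
  have "inner f ?p = (\<Sum>i\<in>A. (inner f (u i))\<^sup>2)"
    by (simp add: inner_sum_right power2_eq_square)
  moreover have "(norm (f - ?p))\<^sup>2 = (norm f)\<^sup>2 - 2 * inner f ?p + (norm ?p)\<^sup>2"
    by (simp add: power2_norm_eq_inner inner_diff_left inner_diff_right inner_commute)
  ultimately have "(norm (f - ?p))\<^sup>2 = (norm f)\<^sup>2 - (\<Sum>i\<in>A. (inner f (u i))\<^sup>2)"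
    using norm_sum_orthonormal[OF u A, of "\<lambda>i. inner f (u i)"] by simp
  then show ?thesis using zero_le_power2[of "norm (f - ?p)"] by linarith
qed

lemma bessel_summable:
  assumes u: "orthonormal_seq u"
  shows "summable (\<lambda>i. (inner f (u i))\<^sup>2)"
  by (rule bounded_imp_summable[of _ "(norm f)\<^sup>2"]) (auto intro: bessel_finite[OF u])

lemma riesz_fischer:
  fixes u :: "nat \<Rightarrow> 'a::{real_inner, complete_space}"
  assumes u: "orthonormal_seq u" and c: "summable (\<lambda>i. (c i)\<^sup>2)"
  obtains f where "(\<lambda>n. \<Sum>i<n. c i *\<^sub>R u i) \<longlonglongrightarrow> f" "\<And>i. inner f (u i) = c i"
proof -
  have "Cauchy (\<lambda>n. \<Sum>i<n. c i *\<^sub>R u i)"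
  proof (rule metric_CauchyI)
    fix e :: real assume e: "e > 0"
    then obtain N where N: "\<And>m n. m \<ge> N \<Longrightarrow> norm (\<Sum>i=m..<n. (c i)\<^sup>2) < e\<^sup>2"
      using c unfolding summable_Cauchy by (metis zero_less_power)
    have *: "dist (\<Sum>i<m. c i *\<^sub>R u i) (\<Sum>i<n. c i *\<^sub>R u i) < e" if "N \<le> m" "m \<le> n" for m n
    proof -
      have "(\<Sum>i<n. c i *\<^sub>R u i) - (\<Sum>i<m. c i *\<^sub>R u i) = (\<Sum>i=m..<n. c i *\<^sub>R u i)"
        using sum_diff_nat_ivl[of 0 m n "\<lambda>i. c i *\<^sub>R u i"] \<open>m \<le> n\<close> by (simp add: lessThan_atLeast0)
      then have "(dist (\<Sum>i<m. c i *\<^sub>R u i) (\<Sum>i<n. c i *\<^sub>R u i))\<^sup>2 = (\<Sum>i=m..<n. (c i)\<^sup>2)"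
        using norm_sum_orthonormal[OF u, of "{m..<n}" c] by (subst dist_commute) (simp add: dist_norm)
      also have "\<dots> < e\<^sup>2" using N[OF \<open>N \<le> m\<close>, of n] by simp
      finally show ?thesis using e by (simp add: power_less_imp_less_base)
    qed
    show "\<exists>M. \<forall>m\<ge>M. \<forall>n\<ge>M. dist (\<Sum>i<m. c i *\<^sub>R u i) (\<Sum>i<n. c i *\<^sub>R u i) < e"
    proof (intro exI[of _ N] allI impI)
      fix m n assume mn: "N \<le> m" "N \<le> n"
      show "dist (\<Sum>i<m. c i *\<^sub>R u i) (\<Sum>i<n. c i *\<^sub>R u i) < e"
        using *[of m n] *[of n m] mn by (cases "m \<le> n") (auto simp: dist_commute)
    qed
  qed
  then obtain f where f: "(\<lambda>n. \<Sum>i<n. c i *\<^sub>R u i) \<longlonglongrightarrow> f"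
    by (auto simp: Cauchy_convergent_iff convergent_def)
  have "inner f (u j) = c j" for j
  proof (rule LIMSEQ_unique)
    show "(\<lambda>n. inner (\<Sum>i<n. c i *\<^sub>R u i) (u j)) \<longlonglongrightarrow> inner f (u j)"
      by (intro tendsto_inner f tendsto_const)
    show "(\<lambda>n. inner (\<Sum>i<n. c i *\<^sub>R u i) (u j)) \<longlonglongrightarrow> c j"
      using eventually_gt_at_top[of j]
      by (intro tendsto_eventually, elim eventually_mono) (simp add: inner_sum_orthonormal[OF u])
  qed
  then show ?thesis using that f by blast
qed

lemma inner_hbas_integral: "inner f (hbas k) = (\<integral>x. rep_torus_L2 f x * cas k x \<partial>torus)"
  using inner_abs_torus_L2[OF sq_integrable_rep sq_integrable_cas, of f k]
  by (simp add: abs_rep_torus_L2 hbas_def)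

lemma hbas_complete:
  assumes "\<And>k. inner f (hbas k) = 0" shows "f = 0"
proof -
  have "AE x in torus. rep_torus_L2 f x = 0"
    by (rule cas_complete[OF sq_integrable_rep]) (use assms in \<open>simp add: inner_hbas_integral\<close>)
  then have "inner f f = 0"
    unfolding inner_rep_torus_L2 by (intro integral_eq_zero_AE) auto
  then show ?thesis by simp
qed

lemma hbas_eqI: "(\<And>k. inner f (hbas k) = inner g (hbas k)) \<Longrightarrow> f = g"
  using hbas_complete[of "f - g"] by (simp add: inner_diff_left)

lemma orthonormal_hbas:
  assumes "inj m" shows "orthonormal_seq (\<lambda>n. hbas (m n))"
  using assms by (auto simp: orthonormal_seq_def inner_hbas dest: injD)

text \<open>Riesz-Fischer yields some limit; testing it at every frequency, including those outside
  the range of m, identifies it with f. Allowing m to miss frequencies where f vanishes covers both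
  the full basis and the basis of mean-zero functions.\<close>

lemma hbas_expansion:
  assumes m: "inj m" and f: "\<And>k. k \<notin> range m \<Longrightarrow> inner f (hbas k) = 0"
  shows "(\<lambda>n. \<Sum>i<n. inner f (hbas (m i)) *\<^sub>R hbas (m i)) \<longlonglongrightarrow> f"
proof -
  note u = orthonormal_hbas[OF m]
  obtain h where h: "(\<lambda>n. \<Sum>i<n. inner f (hbas (m i)) *\<^sub>R hbas (m i)) \<longlonglongrightarrow> h"
    and c: "\<And>i. inner h (hbas (m i)) = inner f (hbas (m i))"
    using riesz_fischer[OF u bessel_summable[OF u, of f]] by blast
  have "h = f"
  proof (rule hbas_eqI)
    fix k
    show "inner h (hbas k) = inner f (hbas k)"
    proof (cases "k \<in> range m")
      case False
      have "(\<lambda>n. inner (\<Sum>i<n. inner f (hbas (m i)) *\<^sub>R hbas (m i)) (hbas k)) \<longlonglongrightarrow> inner h (hbas k)"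
        by (intro tendsto_inner h tendsto_const)
      moreover have "inner (\<Sum>i<n. inner f (hbas (m i)) *\<^sub>R hbas (m i)) (hbas k) = 0" for n
        using False by (auto simp: inner_sum_left inner_hbas intro!: sum.neutral)
      ultimately show ?thesis using f[OF False] by (simp add: LIMSEQ_const_iff)
    qed (use c in auto)
  qed
  then show ?thesis using h by simp
qed

lemma parseval_seq:
  assumes m: "inj m" and f: "\<And>k. k \<notin> range m \<Longrightarrow> inner f (hbas k) = 0"
  shows "(\<lambda>i. inner f (hbas (m i)) * inner g (hbas (m i))) sums inner f g"
proof -
  have "(\<lambda>n. inner (\<Sum>i<n. inner f (hbas (m i)) *\<^sub>R hbas (m i)) g) \<longlonglongrightarrow> inner f g"
    by (intro tendsto_inner tendsto_const hbas_expansion[OF m f])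
  then show ?thesis
    by (simp add: sums_def inner_sum_left inner_commute[of g])
qed

text \<open>Bessel's inequality for f and g makes the products absolutely summable, so the series
  along an enumeration becomes an unordered sum, in which k may be exchanged with -k.\<close>

lemma parseval_has_sum: "((\<lambda>k. inner f (hbas k) * inner g (hbas k)) has_sum inner f g) UNIV"
proof -
  have inf: "infinite (UNIV :: (int \<times> int) set)"
    by (simp add: finite_prod infinite_UNIV_int)
  define m :: "nat \<Rightarrow> int \<times> int" where "m = from_nat_into UNIV"
  have bij: "bij_betw m UNIV UNIV" unfolding m_def
    by (rule bij_betw_from_nat_into) (use inf in auto)
  then have m: "inj m" "range m = UNIV" by (auto simp: bij_betw_def)
  note u = orthonormal_hbas[OF m(1)]
  have s: "(\<lambda>i. inner f (hbas (m i)) * inner g (hbas (m i))) sums inner f g"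
    by (rule parseval_seq[OF m(1)]) (simp add: m(2))
  have "summable (\<lambda>i. norm (inner f (hbas (m i)) * inner g (hbas (m i))))"
  proof (rule summable_comparison_test)
    show "summable (\<lambda>i. (inner f (hbas (m i)))\<^sup>2 + (inner g (hbas (m i)))\<^sup>2)"
      by (intro summable_add bessel_summable[OF u])
    have "\<bar>a * b\<bar> \<le> a\<^sup>2 + b\<^sup>2" for a b :: real
      using sum_squares_bound[of "\<bar>a\<bar>" "\<bar>b\<bar>"] mult_nonneg_nonneg[of "\<bar>a\<bar>" "\<bar>b\<bar>"]
      by (simp add: abs_mult del: mult_nonneg_nonneg)
    then show "\<exists>N. \<forall>i\<ge>N. norm (norm (inner f (hbas (m i)) * inner g (hbas (m i)))) \<le>
        (inner f (hbas (m i)))\<^sup>2 + (inner g (hbas (m i)))\<^sup>2" by auto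
  qed
  from norm_summable_imp_has_sum[OF this s]
  show ?thesis using has_sum_reindex_bij_betw[OF bij, of "\<lambda>k. inner f (hbas k) * inner g (hbas k)"] by simp
qed

lemma norm_has_sum: "((\<lambda>k. (inner f (hbas k))\<^sup>2) has_sum (norm f)\<^sup>2) UNIV"
  using parseval_has_sum[of f f] by (simp add: power2_eq_square[symmetric] power2_norm_eq_inner)

lemma hbas_realize:
  assumes "(\<lambda>k. (c k)\<^sup>2) summable_on UNIV"
  obtains f where "\<And>k. inner f (hbas k) = c k"
proof -
  have inf: "infinite (UNIV :: (int \<times> int) set)"
    by (simp add: finite_prod infinite_UNIV_int)
  define m :: "nat \<Rightarrow> int \<times> int" where "m = from_nat_into UNIV"
  have bij: "bij_betw m UNIV UNIV" unfolding m_def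
    by (rule bij_betw_from_nat_into) (use inf in auto)
  then have m: "inj m" "range m = UNIV" by (auto simp: bij_betw_def)
  have "(\<lambda>i. (c (m i))\<^sup>2) summable_on UNIV"
    using assms summable_on_reindex_bij_betw[OF bij, of "\<lambda>k. (c k)\<^sup>2"] by simp
  then have "summable (\<lambda>i. (c (m i))\<^sup>2)" by (rule summable_on_imp_summable)
  from riesz_fischer[OF orthonormal_hbas[OF m(1)] this]
  obtain f where f: "\<And>i. inner f (hbas (m i)) = c (m i)" by blast
  have "inner f (hbas k) = c k" for k using f m(2) by (metis surjD)
  then show ?thesis using that by blast
qed

section \<open>Separability\<close>

lemma countable_dense_second_countable:
  fixes D :: "'a::metric_space set"
  assumes "countable D" and dense: "\<And>x e. e > 0 \<Longrightarrow> \<exists>d\<in>D. dist x d < e"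
  shows "\<exists>B::'a set set. countable B \<and> open = generate_topology B"
proof (intro exI conjI)
  let ?B = "(\<lambda>(d, n). ball d (inverse (real (Suc n)))) ` (D \<times> (UNIV :: nat set))"
  show "countable ?B" using assms(1) by blast
  have "topological_basis ?B"
  proof (rule topological_basisI)
    fix U :: "'a set" and x assume U: "open U" "x \<in> U"
    then obtain e where e: "e > 0" "ball x e \<subseteq> U" using openE by blast
    obtain n where n: "inverse (real (Suc n)) < e / 2" using reals_Archimedean[of "e/2"] e by auto
    obtain d where d: "d \<in> D" "dist x d < inverse (real (Suc n))"
      using dense[of "inverse (real (Suc n))" x] by auto
    have "ball d (inverse (real (Suc n))) \<subseteq> ball x e"
    proof
      fix y assume "y \<in> ball d (inverse (real (Suc n)))"
      then show "y \<in> ball x e" using d(2) n dist_triangle[of x y d] by simp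
    qed
    then show "\<exists>B'\<in>?B. x \<in> B' \<and> B' \<subseteq> U"
      using d e(2) by (intro bexI[of _ "ball d (inverse (real (Suc n)))"]) (auto simp: dist_commute)
  qed auto
  then show "open = generate_topology ?B" by (rule topological_basis_imp_subbasis)
qed

text \<open>Finite rational combinations of the basis are dense. Second countability is what makes
  sums, differences and inner products of Borel measurable \<open>torus_L2\<close>-valued functions
  measurable.\<close>

instance torus_L2 :: second_countable_topology
proof
  define S where "S xs = (\<Sum>p\<leftarrow>xs. real_of_rat (snd p) *\<^sub>R hbas (fst p))" for xs :: "((int \<times> int) \<times> rat) list"
  have inf: "infinite (UNIV :: (int \<times> int) set)"
    by (simp add: finite_prod infinite_UNIV_int)
  define m :: "nat \<Rightarrow> int \<times> int" where "m = from_nat_into UNIV"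
  have bij: "bij_betw m UNIV UNIV" unfolding m_def
    by (rule bij_betw_from_nat_into) (use inf in auto)
  then have m: "inj m" "range m = UNIV" by (auto simp: bij_betw_def)
  have "\<exists>d\<in>range S. dist f d < e" if e: "e > 0" for f e
  proof -
    have "(\<lambda>n. \<Sum>i<n. inner f (hbas (m i)) *\<^sub>R hbas (m i)) \<longlonglongrightarrow> f"
      by (rule hbas_expansion[OF m(1)]) (simp add: m(2))
    from metric_LIMSEQ_D[OF this half_gt_zero[OF e]]
    obtain n where n: "dist (\<Sum>i<n. inner f (hbas (m i)) *\<^sub>R hbas (m i)) f < e / 2"
      by blast
    \<comment> \<open>The remaining tolerance e/2 is divided among the n coefficients; n + 1 avoids
      a division by zero.\<close>
    have "\<exists>q. \<bar>inner f (hbas (m i)) - real_of_rat q\<bar> < e / (2 * (real n + 1))" for i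
    proof -
      have "inner f (hbas (m i)) - e / (2 * (real n + 1)) < inner f (hbas (m i)) + e / (2 * (real n + 1))"
      proof -
        have "e / (2 * (real n + 1)) > 0" using e by simp
        then show ?thesis by linarith
      qed
      from Rats_dense_in_real[OF this] obtain r where r: "r \<in> \<rat>" "inner f (hbas (m i)) - e / (2 * (real n + 1)) < r"
          "r < inner f (hbas (m i)) + e / (2 * (real n + 1))" by blast
      from r(1) obtain p where "r = real_of_rat p" by (auto elim: Rats_cases)
      with r have "\<bar>inner f (hbas (m i)) - real_of_rat p\<bar> < e / (2 * (real n + 1))"
        unfolding abs_less_iff by linarith
      then show ?thesis by blast
    qed
    then obtain q where q: "\<And>i. \<bar>inner f (hbas (m i)) - real_of_rat (q i)\<bar> < e / (2 * (real n + 1))" by metis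
    have S: "S (map (\<lambda>i. (m i, q i)) [0..<n]) = (\<Sum>i<n. real_of_rat (q i) *\<^sub>R hbas (m i))"
      by (simp add: S_def o_def interv_sum_list_conv_sum_set_nat atLeast0LessThan)
    have "dist (\<Sum>i<n. inner f (hbas (m i)) *\<^sub>R hbas (m i)) (\<Sum>i<n. real_of_rat (q i) *\<^sub>R hbas (m i))
       = norm (\<Sum>i<n. (inner f (hbas (m i)) - real_of_rat (q i)) *\<^sub>R hbas (m i))"
      by (simp add: dist_norm sum_subtractf[symmetric] scaleR_left_diff_distrib)
    also have "\<dots> \<le> (\<Sum>i<n. e / (2 * (real n + 1)))"
    proof (rule sum_norm_le)
      have n1: "norm (hbas k) = 1" for k by (simp add: norm_eq_sqrt_inner inner_hbas)
      show "norm ((inner f (hbas (m i)) - real_of_rat (q i)) *\<^sub>R hbas (m i)) \<le> e / (2 * (real n + 1))" for i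
        using q[of i] by (simp add: n1)
    qed
    also have "\<dots> = (real n / (real n + 1)) * (e / 2)" by simp
    also have "\<dots> \<le> 1 * (e / 2)" using e by (intro mult_right_mono) auto
    finally have "dist f (S (map (\<lambda>i. (m i, q i)) [0..<n])) < e"
      unfolding S using n dist_triangle3[of f "\<Sum>i<n. real_of_rat (q i) *\<^sub>R hbas (m i)"
          "\<Sum>i<n. inner f (hbas (m i)) *\<^sub>R hbas (m i)"] by linarith
    then show ?thesis by blast
  qed
  then show "\<exists>B::torus_L2 set set. countable B \<and> open = generate_topology B"
    by (intro countable_dense_second_countable[of "range S"]) auto
qed

section \<open>Fourier coefficients and Sobolev norms\<close>

lemma fourier_integral:
  "fourier f k = (\<integral>x. complex_of_real (rep_torus_L2 f x) * cis (- phase k x) \<partial>torus)"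
proof -
  have "fourier f k = fourier (abs_torus_L2 (rep_torus_L2 f)) k" by (simp only: abs_rep_torus_L2)
  also have "\<dots> = (\<integral>x. complex_of_real (rep_torus_L2 f x) * cis (- phase k x) \<partial>torus)"
    unfolding fourier.abs_eq[OF L2_rel_refl[OF sq_integrable_rep]] phase_def by simp
  finally show ?thesis .
qed

text \<open>Cosine and sine are the even and odd parts of a Hartley function, so the two families of
  coefficients determine each other linearly. This is the dictionary between the definitions, stated
  with \<open>fourier\<close>, and the real basis.\<close>

lemma
  shows Re_fourier: "Re (fourier f k) = (inner f (hbas k) + inner f (hbas (- k))) / 2"
    and Im_fourier: "Im (fourier f k) = (inner f (hbas (- k)) - inner f (hbas k)) / 2"
proof -
  define F where "F = rep_torus_L2 f"
  have Fi: "integrable torus F" unfolding F_def by (rule sq_integrable_imp_integrable[OF sq_integrable_rep])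
  have Fm[measurable]: "F \<in> borel_measurable torus" using Fi by auto
  have i: "integrable torus (\<lambda>x. complex_of_real (F x) * cis (- phase k x))"
  proof (rule Bochner_Integration.integrable_bound[OF Fi])
    have "(\<lambda>x. cis (- phase k x)) \<in> borel_measurable torus"
      by (intro continuous_measurable_torus continuous_intros)
    then show "(\<lambda>x. complex_of_real (F x) * cis (- phase k x)) \<in> borel_measurable torus"
      by measurable
  qed (simp add: norm_mult)
  have ic: "integrable torus (\<lambda>x. F x * cas l x)" for l
    by (rule integrable_mult_bounded[OF Fi cas_measurable abs_cas_le])
  have "Re (fourier f k) = (\<integral>x. Re (complex_of_real (F x) * cis (- phase k x)) \<partial>torus)"
    unfolding fourier_integral F_def[symmetric] by (rule integral_Re[OF i, symmetric])
  also have "\<dots> = (\<integral>x. (F x * cas k x + F x * cas (- k) x) / 2 \<partial>torus)"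
    by (intro Bochner_Integration.integral_cong) (auto simp: cas_def phase_minus algebra_simps)
  also have "\<dots> = (inner f (hbas k) + inner f (hbas (- k))) / 2"
    using ic by (simp add: inner_hbas_integral F_def)
  finally show "Re (fourier f k) = (inner f (hbas k) + inner f (hbas (- k))) / 2" .
  have "Im (fourier f k) = (\<integral>x. Im (complex_of_real (F x) * cis (- phase k x)) \<partial>torus)"
    unfolding fourier_integral F_def[symmetric] by (rule integral_Im[OF i, symmetric])
  also have "\<dots> = (\<integral>x. (F x * cas (- k) x - F x * cas k x) / 2 \<partial>torus)"
    by (intro Bochner_Integration.integral_cong) (auto simp: cas_def phase_minus algebra_simps)
  also have "\<dots> = (inner f (hbas (- k)) - inner f (hbas k)) / 2"
    using ic by (simp add: inner_hbas_integral F_def)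
  finally show "Im (fourier f k) = (inner f (hbas (- k)) - inner f (hbas k)) / 2" .
qed

lemma hbas_fourier: "inner f (hbas k) = Re (fourier f k) - Im (fourier f k)"
  by (simp add: Re_fourier Im_fourier field_simps)

lemma fourier_minus: "fourier f (- k) = cnj (fourier f k)"
  by (simp add: complex_eq_iff Re_fourier Im_fourier field_simps)

lemma fourier_eqI: "(\<And>k. fourier f k = fourier g k) \<Longrightarrow> f = g"
  by (rule hbas_eqI) (simp add: hbas_fourier)

lemma fourier_add: "fourier (f + g) k = fourier f k + fourier g k"
  and fourier_diff: "fourier (f - g) k = fourier f k - fourier g k"
  and fourier_scaleR: "fourier (c *\<^sub>R f) k = c *\<^sub>R fourier f k"
  and fourier_zero [simp]: "fourier 0 k = 0"
  by (simp_all add: complex_eq_iff Re_fourier Im_fourier inner_add_left inner_diff_left field_simps)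

lemma cmod_fourier: "(cmod (fourier f k))\<^sup>2 = ((inner f (hbas k))\<^sup>2 + (inner f (hbas (- k)))\<^sup>2) / 2"
  unfolding cmod_power2 Re_fourier Im_fourier by (simp add: power2_eq_square field_simps)

lemma has_sum_reflect:
  fixes g :: "int \<times> int \<Rightarrow> 'b::{comm_monoid_add, topological_space}"
  assumes "uminus ` A = A"
  shows "((\<lambda>k. g (- k)) has_sum S) A \<longleftrightarrow> (g has_sum S) A"
proof -
  have "bij_betw uminus A A" using assms by (simp add: bij_betw_def inj_on_def)
  then show ?thesis by (rule has_sum_reindex_bij_betw)
qed

lemma reflect_UNIV: "uminus ` (UNIV :: (int \<times> int) set) = UNIV"
  by (rule surjI[of _ uminus]) simp

lemma reflect_nonzero: "uminus ` (- {0 :: int \<times> int}) = - {0}"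
  by (auto simp: zero_prod_def intro!: image_eqI[of _ uminus "- _"])

text \<open>The squared modulus of a Fourier coefficient is the mean of the Hartley squares at k and
  -k. Over a symmetric index set and with an even weight the averaging disappears in the sum, so
  Sobolev norms can be computed in the real basis.\<close>

lemma has_sum_fourier_weighted:
  assumes A: "uminus ` A = A" and w: "\<And>k. w (- k) = w k"
    and S: "((\<lambda>k. w k * (inner f (hbas k))\<^sup>2) has_sum S) A"
  shows "((\<lambda>k. w k * (cmod (fourier f k))\<^sup>2) has_sum S) A"
proof -
  have "((\<lambda>k. w k * (inner f (hbas (- k)))\<^sup>2) has_sum S) A"
    using S has_sum_reflect[OF A, of "\<lambda>k. w k * (inner f (hbas k))\<^sup>2"] by (simp add: w)
  from has_sum_cmult_right[OF has_sum_add[OF S this], of "1/2"]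
  have "((\<lambda>k. 1/2 * (w k * (inner f (hbas k))\<^sup>2 + w k * (inner f (hbas (- k)))\<^sup>2)) has_sum S) A"
    by (simp only: mult_2[symmetric]) simp
  moreover have "w k * (cmod (fourier f k))\<^sup>2 =
      1/2 * (w k * (inner f (hbas k))\<^sup>2 + w k * (inner f (hbas (- k)))\<^sup>2)" for k
    by (simp add: cmod_fourier field_simps)
  ultimately show ?thesis by (simp only:)
qed

lemma summable_fourier_weighted:
  fixes w :: "int \<times> int \<Rightarrow> real"
  assumes A: "uminus ` A = A" and w: "\<And>k. w (- k) = w k" "\<And>k. 0 \<le> w k"
  shows "(\<lambda>k. w k * (cmod (fourier f k))\<^sup>2) summable_on A \<longleftrightarrow> (\<lambda>k. w k * (inner f (hbas k))\<^sup>2) summable_on A"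
proof
  assume "(\<lambda>k. w k * (inner f (hbas k))\<^sup>2) summable_on A"
  then show "(\<lambda>k. w k * (cmod (fourier f k))\<^sup>2) summable_on A"
    using has_sum_fourier_weighted[where w=w, OF A w(1)] by (auto simp: summable_on_def)
next
  assume s: "(\<lambda>k. w k * (cmod (fourier f k))\<^sup>2) summable_on A"
  have "(\<lambda>k. 2 * (w k * (cmod (fourier f k))\<^sup>2)) summable_on A"
    by (rule summable_on_cmult_right[OF s])
  then show "(\<lambda>k. w k * (inner f (hbas k))\<^sup>2) summable_on A"
  proof (rule summable_on_comparison_test)
    fix k
    have "w k * (inner f (hbas k))\<^sup>2 \<le> w k * (2 * (cmod (fourier f k))\<^sup>2)"
      using w(2)[of k] by (intro mult_left_mono) (simp_all add: cmod_fourier)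
    then show "w k * (inner f (hbas k))\<^sup>2 \<le> 2 * (w k * (cmod (fourier f k))\<^sup>2)" by simp
  qed (use w(2) in auto)
qed

lemma fourier_norm_has_sum: "((\<lambda>k. (cmod (fourier f k))\<^sup>2) has_sum (norm f)\<^sup>2) UNIV"
  using has_sum_fourier_weighted[OF reflect_UNIV, of "\<lambda>_. 1" f] norm_has_sum[of f] by simp

lemma fourier_parseval: "((\<lambda>k. Re (fourier f k * cnj (fourier g k))) has_sum inner f g) UNIV"
proof -
  have "((\<lambda>k. inner f (hbas (- k)) * inner g (hbas (- k))) has_sum inner f g) UNIV"
    using parseval_has_sum[of f g] has_sum_reflect[OF reflect_UNIV, of "\<lambda>k. inner f (hbas k) * inner g (hbas k)"]
    by simp
  from has_sum_cmult_right[OF has_sum_add[OF parseval_has_sum[of f g] this], of "1/2"]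
  have "((\<lambda>k. 1/2 * (inner f (hbas k) * inner g (hbas k) + inner f (hbas (- k)) * inner g (hbas (- k))))
      has_sum inner f g) UNIV" by (simp only: mult_2[symmetric]) simp
  moreover have "Re (fourier f k * cnj (fourier g k)) =
      1/2 * (inner f (hbas k) * inner g (hbas k) + inner f (hbas (- k)) * inner g (hbas (- k)))" for k
    by (simp add: Re_fourier Im_fourier field_simps)
  ultimately show ?thesis by (simp only:)
qed

text \<open>Hermitian symmetry is the condition for the coefficients to come from a real function;
  the Hartley coefficient to prescribe is \<open>Re (c k) - Im (c k)\<close>.\<close>

lemma fourier_realize:
  assumes sym: "\<And>k. c (- k) = cnj (c k)" and s: "(\<lambda>k. (cmod (c k))\<^sup>2) summable_on UNIV"
  shows "\<exists>f. \<forall>k. fourier f k = c k"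
proof -
  have "(\<lambda>k. 2 * (cmod (c k))\<^sup>2) summable_on UNIV" by (rule summable_on_cmult_right[OF s])
  then have "(\<lambda>k. (Re (c k) - Im (c k))\<^sup>2) summable_on UNIV"
  proof (rule summable_on_comparison_test)
    have "(a - b)\<^sup>2 \<le> 2 * (a\<^sup>2 + b\<^sup>2)" for a b :: real
      using zero_le_power2[of "a + b"] by (simp add: power2_sum power2_diff)
    then show "(Re (c k) - Im (c k))\<^sup>2 \<le> 2 * (cmod (c k))\<^sup>2" for k by (simp add: cmod_power2)
  qed auto
  from hbas_realize[OF this] obtain f where f: "\<And>k. inner f (hbas k) = Re (c k) - Im (c k)" by blast
  then show ?thesis
    by (intro exI[of _ f] allI) (simp add: complex_eq_iff Re_fourier Im_fourier sym)
qed

text \<open>Under these assumptions the description in \<open>fourier_mult\<close> is proper: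
  symmetry and square summability give existence, injectivity of the Fourier transform gives
  uniqueness.\<close>

lemma fourier_fourier_mult:
  assumes sym: "\<And>k. m (- k) = cnj (m k)" and s: "(\<lambda>k. (cmod (m k * fourier f k))\<^sup>2) summable_on UNIV"
  shows "fourier (fourier_mult m f) k = m k * fourier f k"
proof -
  have "\<exists>h. \<forall>k. fourier h k = m k * fourier f k"
    by (rule fourier_realize[OF _ s]) (simp add: sym fourier_minus)
  then have "\<exists>!h. \<forall>k. fourier h k = m k * fourier f k"
    by (auto intro: fourier_eqI)
  from theI'[OF this] show ?thesis unfolding fourier_mult_def by blast
qed

section \<open>Frequencies\<close>

lemma freq_norm: "freq k = 2 * pi * norm (real_of_int (fst k), real_of_int (snd k))"
  by (simp add: freq_def norm_prod_def)

lemma freq_minus [simp]: "freq (- k) = freq k"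
  by (simp add: freq_def)

lemma freq_nonneg [simp]: "0 \<le> freq k"
  by (simp add: freq_norm)

lemma freq_zero [simp]: "freq 0 = 0"
  by (simp add: freq_def)

lemma freq_triangle: "freq (k + l) \<le> freq k + freq l"
proof -
  have "norm (real_of_int (fst (k + l)), real_of_int (snd (k + l))) \<le>
    norm (real_of_int (fst k), real_of_int (snd k)) + norm (real_of_int (fst l), real_of_int (snd l))"
    using norm_triangle_ineq[of "(real_of_int (fst k), real_of_int (snd k))" "(real_of_int (fst l), real_of_int (snd l))"]
    by simp
  then show ?thesis by (simp add: freq_norm distrib_left[symmetric] del: distrib_left)
qed

text \<open>This reverse triangle inequality is the gain of the commutator: the difference of the
  two symbols of \<open>Lam 1\<close> is controlled by the frequency of the test function
  alone.\<close>

lemma freq_diff_le: "\<bar>freq m - freq (m - j)\<bar> \<le> freq j"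
  using freq_triangle[of j "m - j"] freq_triangle[of m "- j"] by simp

lemma abs_fst_le_freq: "2 * pi * \<bar>real_of_int (fst k)\<bar> \<le> freq k"
  and abs_snd_le_freq: "2 * pi * \<bar>real_of_int (snd k)\<bar> \<le> freq k"
  using norm_fst_le[of "real_of_int (fst k)" "real_of_int (snd k)"] norm_snd_le[of "real_of_int (snd k)" "real_of_int (fst k)"]
  by (simp_all add: freq_norm)

lemma freq_ge:
  assumes "k \<noteq> 0" shows "2 * pi \<le> freq k"
proof -
  have "1 \<le> \<bar>fst k\<bar> \<or> 1 \<le> \<bar>snd k\<bar>" using assms by (auto simp: prod_eq_iff)
  then have "1 \<le> \<bar>real_of_int (fst k)\<bar> \<or> 1 \<le> \<bar>real_of_int (snd k)\<bar>" by linarith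
  moreover have "2 * pi \<le> 2 * pi * x" if "1 \<le> x" for x :: real
    using mult_left_mono[OF that, of "2 * pi"] by simp
  ultimately show ?thesis using abs_fst_le_freq[of k] abs_snd_le_freq[of k] by (metis order.trans)
qed

lemma freq_ge_1: "k \<noteq> 0 \<Longrightarrow> 1 \<le> freq k"
  using freq_ge[of k] pi_ge_two by linarith

lemma freq_pos: "k \<noteq> 0 \<Longrightarrow> 0 < freq k"
  using freq_ge_1[of k] by linarith

lemma finite_freq_le: "finite {k. freq k \<le> M}"
proof (rule finite_subset)
  show "finite ({- \<lceil>\<bar>M\<bar>\<rceil>..\<lceil>\<bar>M\<bar>\<rceil>} \<times> {- \<lceil>\<bar>M\<bar>\<rceil>..\<lceil>\<bar>M\<bar>\<rceil>})" by simp
  show "{k. freq k \<le> M} \<subseteq> {- \<lceil>\<bar>M\<bar>\<rceil>..\<lceil>\<bar>M\<bar>\<rceil>} \<times> {- \<lceil>\<bar>M\<bar>\<rceil>..\<lceil>\<bar>M\<bar>\<rceil>}"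
  proof clarify
    fix a b assume le: "freq (a, b) \<le> M"
    have "1 * \<bar>real_of_int a\<bar> \<le> 2 * pi * \<bar>real_of_int a\<bar>" "1 * \<bar>real_of_int b\<bar> \<le> 2 * pi * \<bar>real_of_int b\<bar>"
      using pi_ge_two by (intro mult_right_mono; simp)+
    then have "\<bar>real_of_int a\<bar> \<le> \<bar>M\<bar>" "\<bar>real_of_int b\<bar> \<le> \<bar>M\<bar>"
      using abs_fst_le_freq[of "(a, b)"] abs_snd_le_freq[of "(a, b)"] le by auto
    then have "\<bar>a\<bar> \<le> \<lceil>\<bar>M\<bar>\<rceil>" "\<bar>b\<bar> \<le> \<lceil>\<bar>M\<bar>\<rceil>" by linarith+
    then show "a \<in> {- \<lceil>\<bar>M\<bar>\<rceil>..\<lceil>\<bar>M\<bar>\<rceil>} \<and> b \<in> {- \<lceil>\<bar>M\<bar>\<rceil>..\<lceil>\<bar>M\<bar>\<rceil>}" by auto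
  qed
qed

section \<open>The basis of mean-zero functions and the Sobolev scale\<close>

lemma H0_iff: "f \<in> H0 \<longleftrightarrow> inner f (hbas 0) = 0"
  by (simp add: H0_def complex_eq_iff Re_fourier Im_fourier zero_prod_def[symmetric])

lemma H0_fourier: "f \<in> H0 \<longleftrightarrow> fourier f 0 = 0"
  by (simp add: H0_def zero_prod_def)

lemma H0_add: "f \<in> H0 \<Longrightarrow> g \<in> H0 \<Longrightarrow> f + g \<in> H0"
  and H0_diff: "f \<in> H0 \<Longrightarrow> g \<in> H0 \<Longrightarrow> f - g \<in> H0"
  and H0_scaleR: "f \<in> H0 \<Longrightarrow> c *\<^sub>R f \<in> H0"
  and H0_uminus: "f \<in> H0 \<Longrightarrow> - f \<in> H0"
  and H0_zero [simp]: "0 \<in> H0"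
  by (simp_all add: H0_iff inner_add_left inner_diff_left)

lemma H0_sum: "(\<And>i. i \<in> A \<Longrightarrow> f i \<in> H0) \<Longrightarrow> sum f A \<in> H0"
  by (induction A rule: infinite_finite_induct) (auto intro: H0_add)

text \<open>The enumeration of the nonzero frequencies is arbitrary and not sorted by size; growth
  along it is expressed through \<open>finite_lam_le\<close>.\<close>

definition mode :: "nat \<Rightarrow> int \<times> int" where
  "mode = from_nat_into (- {0})"

definition bas :: "nat \<Rightarrow> torus_L2" where
  "bas n = hbas (mode n)"

definition lam :: "nat \<Rightarrow> real" where
  "lam n = freq (mode n)"

lemma bij_mode: "bij_betw mode UNIV (- {0})"
  unfolding mode_def
  by (rule bij_betw_from_nat_into)
    (use finite_Diff2[of "{0::int\<times>int}" UNIV] in \<open>auto simp: Compl_eq_Diff_UNIV finite_prod infinite_UNIV_int\<close>)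

lemma inj_mode: "inj mode" and range_mode: "range mode = - {0}"
  using bij_mode by (auto simp: bij_betw_def)

lemma mode_nonzero: "mode n \<noteq> 0"
  using range_mode by auto

lemma lam_ge_1: "1 \<le> lam n" and lam_pos: "0 < lam n"
  unfolding lam_def using freq_ge_1[OF mode_nonzero] freq_pos[OF mode_nonzero] by auto

lemma finite_lam_le: "finite {n. lam n \<le> M}"
proof -
  have "mode ` {n. lam n \<le> M} \<subseteq> {k. freq k \<le> M}" by (auto simp: lam_def)
  then have "finite (mode ` {n. lam n \<le> M})" using finite_freq_le finite_subset by blast
  then show ?thesis by (rule finite_imageD) (use inj_mode in \<open>auto intro: inj_on_subset\<close>)
qed

lemma orthonormal_bas: "orthonormal_seq bas"
  unfolding bas_def by (rule orthonormal_hbas[OF inj_mode])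

lemma inner_bas: "inner (bas i) (bas j) = (if i = j then 1 else 0)"
  using orthonormal_bas by (simp add: orthonormal_seq_def)

lemma bas_H0 [simp]: "bas n \<in> H0"
  using mode_nonzero[of n] by (simp add: H0_iff bas_def inner_hbas)

lemma H0_vanish: "f \<in> H0 \<Longrightarrow> k \<notin> range mode \<Longrightarrow> inner f (hbas k) = 0"
  by (auto simp: H0_iff range_mode)

lemma H0_expansion: "f \<in> H0 \<Longrightarrow> (\<lambda>n. \<Sum>i<n. inner f (bas i) *\<^sub>R bas i) \<longlonglongrightarrow> f"
  unfolding bas_def by (rule hbas_expansion[OF inj_mode H0_vanish])

lemma H0_parseval: "f \<in> H0 \<Longrightarrow> (\<lambda>i. inner f (bas i) * inner g (bas i)) sums inner f g"
  unfolding bas_def by (rule parseval_seq[OF inj_mode H0_vanish])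

lemma H0_norm_sums: "f \<in> H0 \<Longrightarrow> (\<lambda>i. (inner f (bas i))\<^sup>2) sums (norm f)\<^sup>2"
  using H0_parseval[of f f] by (simp add: power2_eq_square[symmetric] power2_norm_eq_inner)

lemma H0_eqI:
  assumes "f \<in> H0" "g \<in> H0" "\<And>i. inner f (bas i) = inner g (bas i)" shows "f = g"
proof -
  have "(\<lambda>i. 0) sums (norm (f - g))\<^sup>2"
    using H0_norm_sums[OF H0_diff[OF assms(1,2)]] by (simp add: inner_diff_left assms(3))
  then show ?thesis using sums_unique2[OF sums_zero] by force
qed

lemma H0_realize:
  assumes "summable (\<lambda>i. (c i)\<^sup>2)"
  obtains f where "f \<in> H0" "\<And>i. inner f (bas i) = c i"
proof -
  obtain f where f: "(\<lambda>n. \<Sum>i<n. c i *\<^sub>R bas i) \<longlonglongrightarrow> f" "\<And>i. inner f (bas i) = c i"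
    using riesz_fischer[OF orthonormal_bas assms] by blast
  have "(\<lambda>n. inner (\<Sum>i<n. c i *\<^sub>R bas i) (hbas 0)) \<longlonglongrightarrow> inner f (hbas 0)"
    by (intro tendsto_inner f tendsto_const)
  moreover have "inner (\<Sum>i<n. c i *\<^sub>R bas i) (hbas 0) = 0" for n
    using H0_sum[of "{..<n}" "\<lambda>i. c i *\<^sub>R bas i"] by (simp add: H0_scaleR H0_iff[symmetric])
  ultimately have "f \<in> H0" by (simp add: H0_iff LIMSEQ_const_iff)
  then show ?thesis using that f(2) by blast
qed

lemma summable_on_modes:
  fixes g :: "int \<times> int \<Rightarrow> real"
  assumes "\<And>k. 0 \<le> g k"
  shows "g summable_on (- {0}) \<longleftrightarrow> summable (\<lambda>n. g (mode n))"
  using summable_on_reindex_bij_betw[OF bij_mode, of g] assms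
  by (simp add: summable_on_UNIV_nonneg_real_iff)

lemma freq_powr_double: "freq k powr (2 * r) = (freq k powr r)\<^sup>2"
  by (simp only: mult_2 powr_add power2_eq_square)

text \<open>In the real basis membership in a Sobolev space is summability of a real sequence
  indexed by the naturals, and \<open>Lam r\<close> becomes multiplication by
  \<open>lam n powr r\<close>.\<close>

lemma Hs_iff: "f \<in> Hs r \<longleftrightarrow> f \<in> H0 \<and> summable (\<lambda>n. (lam n powr r * inner f (bas n))\<^sup>2)"
proof -
  have "(\<lambda>k. freq k powr (2 * r) * (cmod (fourier f k))\<^sup>2) summable_on (- {0}) \<longleftrightarrow>
    (\<lambda>k. freq k powr (2 * r) * (inner f (hbas k))\<^sup>2) summable_on (- {0})"
    by (rule summable_fourier_weighted[OF reflect_nonzero]) auto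
  also have "\<dots> \<longleftrightarrow> summable (\<lambda>n. freq (mode n) powr (2 * r) * (inner f (hbas (mode n)))\<^sup>2)"
    by (rule summable_on_modes) auto
  also have "\<dots> \<longleftrightarrow> summable (\<lambda>n. (lam n powr r * inner f (bas n))\<^sup>2)"
    by (simp add: lam_def bas_def power_mult_distrib freq_powr_double)
  finally show ?thesis by (simp add: Hs_def zero_prod_def)
qed

lemma norm_Hs_sums:
  assumes "f \<in> Hs r"
  shows "(\<lambda>n. (lam n powr r * inner f (bas n))\<^sup>2) sums (norm_Hs r f)\<^sup>2"
proof -
  have e: "(lam n powr r * inner f (bas n))\<^sup>2 = freq (mode n) powr (2 * r) * (inner f (hbas (mode n)))\<^sup>2" for n
    by (simp add: lam_def bas_def power_mult_distrib freq_powr_double)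
  let ?g = "\<lambda>k. freq k powr (2 * r) * (inner f (hbas k))\<^sup>2"
  have "summable (\<lambda>n. ?g (mode n))" using assms by (simp add: Hs_iff e)
  then have "?g summable_on (- {0})" by (subst summable_on_modes) auto
  then have h: "(?g has_sum infsum ?g (- {0})) (- {0})" by simp
  have "((\<lambda>k. freq k powr (2 * r) * (cmod (fourier f k))\<^sup>2) has_sum infsum ?g (- {0})) (- {0})"
    by (rule has_sum_fourier_weighted[OF reflect_nonzero _ h]) auto
  then have "infsum (\<lambda>k. freq k powr (2 * r) * (cmod (fourier f k))\<^sup>2) (- {0}) = infsum ?g (- {0})"
    by (rule infsumI)
  then have n: "(norm_Hs r f)\<^sup>2 = infsum ?g (- {0})"
    unfolding norm_Hs_def by (simp add: zero_prod_def infsum_nonneg)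
  have "((\<lambda>n. ?g (mode n)) has_sum infsum ?g (- {0})) UNIV"
    using h has_sum_reindex_bij_betw[OF bij_mode, of ?g] by simp
  then show ?thesis unfolding n e by (rule has_sum_imp_sums)
qed

lemma norm_Hs_nonneg [simp]: "0 \<le> norm_Hs r f"
  unfolding norm_Hs_def by (auto intro!: infsum_nonneg)

lemma fourier_Lam:
  assumes "(\<lambda>k. (cmod (complex_of_real (freq k powr r) * fourier f k))\<^sup>2) summable_on (- {0})"
  shows "fourier (Lam r f) k = (if k = 0 then 0 else complex_of_real (freq k powr r) * fourier f k)"
proof -
  let ?m = "\<lambda>k. if k = (0, 0) then 0 else complex_of_real (freq k powr r)"
  have "(\<lambda>k. (cmod (?m k * fourier f k))\<^sup>2) summable_on (- {0})"
    using assms by (rule summable_on_cong[THEN iffD1, rotated]) (auto simp: zero_prod_def)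
  then have "(\<lambda>k. (cmod (?m k * fourier f k))\<^sup>2) summable_on UNIV"
    by (rule summable_on_cong_neutral[THEN iffD1, rotated 3]) (auto simp: zero_prod_def)
  then have "fourier (Lam r f) k = ?m k * fourier f k"
    unfolding Lam_def by (intro fourier_fourier_mult) (auto simp: zero_prod_def[symmetric])
  then show ?thesis by (simp add: zero_prod_def)
qed

lemma Hs_fourier_Lam:
  assumes "f \<in> Hs r"
  shows "fourier (Lam r f) k = complex_of_real (freq k powr r) * fourier f k"
proof -
  have "(\<lambda>k. freq k powr (2 * r) * (cmod (fourier f k))\<^sup>2) summable_on (- {0})"
    using assms by (simp add: Hs_def zero_prod_def)
  then have "(\<lambda>k. (cmod (complex_of_real (freq k powr r) * fourier f k))\<^sup>2) summable_on (- {0})"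
    by (rule summable_on_cong[THEN iffD1, rotated])
      (simp add: norm_mult power_mult_distrib freq_powr_double)
  from fourier_Lam[OF this] show ?thesis
    using assms by (auto simp: Hs_def H0_fourier)
qed

lemma Lam_H0: "f \<in> Hs r \<Longrightarrow> Lam r f \<in> H0"
  by (simp add: H0_fourier Hs_fourier_Lam)

lemma Lam_bas: "f \<in> Hs r \<Longrightarrow> inner (Lam r f) (bas n) = lam n powr r * inner f (bas n)"
  unfolding bas_def hbas_fourier lam_def by (simp add: Hs_fourier_Lam algebra_simps)

lemma norm_Lam:
  assumes f: "f \<in> Hs r" shows "norm (Lam r f) = norm_Hs r f"
proof -
  have "(norm (Lam r f))\<^sup>2 = (norm_Hs r f)\<^sup>2"
    using sums_unique2[OF H0_norm_sums[OF Lam_H0[OF f], unfolded Lam_bas[OF f]] norm_Hs_sums[OF f]] .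
  then show ?thesis by simp
qed

lemma Hs_H0: "f \<in> Hs r \<Longrightarrow> f \<in> H0"
  by (simp add: Hs_iff)

text \<open>Nonzero frequencies satisfy \<open>1 \<le> lam n\<close>, so the weights increase with
  the exponent, for negative exponents as well.\<close>

lemma Hs_mono:
  assumes "s \<le> r" "f \<in> Hs r" shows "f \<in> Hs s" "norm_Hs s f \<le> norm_Hs r f"
proof -
  have le: "(lam n powr s * inner f (bas n))\<^sup>2 \<le> (lam n powr r * inner f (bas n))\<^sup>2" for n
    unfolding power_mult_distrib
    using lam_ge_1[of n] assms(1) by (intro mult_right_mono power_mono powr_mono) auto
  have "summable (\<lambda>n. (lam n powr s * inner f (bas n))\<^sup>2)"
    by (rule summable_comparison_test[of _ "\<lambda>n. (lam n powr r * inner f (bas n))\<^sup>2"])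
      (use le assms(2) in \<open>auto simp: Hs_iff\<close>)
  then show s: "f \<in> Hs s" using assms(2) by (simp add: Hs_iff)
  have "(norm_Hs s f)\<^sup>2 \<le> (norm_Hs r f)\<^sup>2"
    by (rule sums_le[OF le norm_Hs_sums[OF s] norm_Hs_sums[OF assms(2)]])
  then show "norm_Hs s f \<le> norm_Hs r f" by (rule power2_le_imp_le) simp
qed

lemma Hs_0 [simp]: "f \<in> Hs 0 \<longleftrightarrow> f \<in> H0"
  using bessel_summable[OF orthonormal_bas, of f] lam_pos
  by (auto simp: Hs_iff less_imp_neq[THEN not_sym])

lemma norm_Hs_0: "f \<in> H0 \<Longrightarrow> norm_Hs 0 f = norm f"
proof -
  assume f: "f \<in> H0"
  have "lam n powr 0 = 1" for n using lam_pos[of n] by simp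
  then have "(\<lambda>n. (inner f (bas n))\<^sup>2) sums (norm_Hs 0 f)\<^sup>2"
    using norm_Hs_sums[of f 0] f by simp
  from sums_unique2[OF H0_norm_sums[OF f] this] have "(norm_Hs 0 f)\<^sup>2 = (norm f)\<^sup>2" by simp
  then show ?thesis by simp
qed

lemma norm_le_norm_Hs: "f \<in> Hs r \<Longrightarrow> 0 \<le> r \<Longrightarrow> norm f \<le> norm_Hs r f"
  using Hs_mono(2)[of 0 r f] norm_Hs_0[of f] by (simp add: Hs_H0)

lemma Hs_nonpos: "r \<le> 0 \<Longrightarrow> f \<in> H0 \<Longrightarrow> f \<in> Hs r"
  using Hs_mono(1)[of r 0 f] by simp

lemma Hs_add: assumes "f \<in> Hs r" "g \<in> Hs r" shows "f + g \<in> Hs r"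
proof -
  have ab: "(a + b)\<^sup>2 \<le> 2 * a\<^sup>2 + 2 * b\<^sup>2" for a b :: real
    using zero_le_power2[of "a - b"] by (simp add: power2_sum power2_diff)
  have "summable (\<lambda>n. 2 * (lam n powr r * inner f (bas n))\<^sup>2 + 2 * (lam n powr r * inner g (bas n))\<^sup>2)"
    using assms by (intro summable_add summable_mult) (simp_all add: Hs_iff)
  then have "summable (\<lambda>n. (lam n powr r * inner f (bas n) + lam n powr r * inner g (bas n))\<^sup>2)"
    by (rule summable_comparison_test[rotated]) (use ab in simp)
  then show ?thesis using assms by (simp add: Hs_iff H0_add inner_add_left distrib_left)
qed

lemma Hs_scaleR: "f \<in> Hs r \<Longrightarrow> c *\<^sub>R f \<in> Hs r"
proof -
  assume "f \<in> Hs r"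
  then have "summable (\<lambda>n. c\<^sup>2 * (lam n powr r * inner f (bas n))\<^sup>2)" "f \<in> H0"
    by (auto simp: Hs_iff intro: summable_mult)
  then show ?thesis by (simp add: Hs_iff H0_scaleR power_mult_distrib mult_ac)
qed

lemma Hs_zero [simp]: "0 \<in> Hs r"
  by (simp add: Hs_iff)

lemma Hs_uminus: "f \<in> Hs r \<Longrightarrow> - f \<in> Hs r"
  using Hs_scaleR[of f r "-1"] by simp

lemma Hs_diff: "f \<in> Hs r \<Longrightarrow> g \<in> Hs r \<Longrightarrow> f - g \<in> Hs r"
  using Hs_add[of f r "- g"] Hs_uminus[of g r] by simp

lemma Hs_sum: "(\<And>i. i \<in> A \<Longrightarrow> f i \<in> Hs r) \<Longrightarrow> sum f A \<in> Hs r"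
  by (induction A rule: infinite_finite_induct) (auto intro: Hs_add)

lemma Lam_add: "f \<in> Hs r \<Longrightarrow> g \<in> Hs r \<Longrightarrow> Lam r (f + g) = Lam r f + Lam r g"
  and Lam_scaleR: "f \<in> Hs r \<Longrightarrow> Lam r (c *\<^sub>R f) = c *\<^sub>R Lam r f"
  by (rule H0_eqI; simp add: Lam_H0 H0_add H0_diff H0_scaleR Hs_add Hs_diff Hs_scaleR Lam_bas
      inner_add_left inner_diff_left algebra_simps)+

lemma Lam_uminus: "f \<in> Hs r \<Longrightarrow> Lam r (- f) = - Lam r f"
  using Lam_scaleR[of f r "-1"] by simp

lemma norm_Hs_scaleR: "f \<in> Hs r \<Longrightarrow> norm_Hs r (c *\<^sub>R f) = \<bar>c\<bar> * norm_Hs r f"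
  by (simp add: norm_Lam[symmetric] Hs_scaleR Lam_scaleR)

lemma norm_Hs_triangle: "f \<in> Hs r \<Longrightarrow> g \<in> Hs r \<Longrightarrow> norm_Hs r (f + g) \<le> norm_Hs r f + norm_Hs r g"
  by (simp add: norm_Lam[symmetric] Hs_add Lam_add norm_triangle_ineq)

lemma norm_Hs_zero [simp]: "norm_Hs r 0 = 0"
  using norm_Hs_scaleR[of 0 r 0] by simp

lemma bas_Hs [simp]: "bas n \<in> Hs r"
proof -
  have "summable (\<lambda>i. (lam i powr r * inner (bas n) (bas i))\<^sup>2)"
    by (rule summable_finite[of "{n}"]) (auto simp: inner_bas)
  then show ?thesis by (simp add: Hs_iff)
qed

lemma Lam_bas_eq: "Lam r (bas n) = (lam n powr r) *\<^sub>R bas n"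
  by (rule H0_eqI) (simp_all add: Lam_H0 H0_scaleR Lam_bas inner_bas)

lemma Hinf_Hs: "f \<in> Hinf \<Longrightarrow> f \<in> Hs r"
  unfolding Hinf_def using Hs_mono(1)[of r "max r 1" f] by auto

lemma bas_Hinf [simp]: "bas n \<in> Hinf"
  by (simp add: Hinf_def)

lemma Hinf_H0: "f \<in> Hinf \<Longrightarrow> f \<in> H0"
  using Hinf_Hs[of f 0] by simp

lemma Hinf_add: "f \<in> Hinf \<Longrightarrow> g \<in> Hinf \<Longrightarrow> f + g \<in> Hinf"
  and Hinf_diff: "f \<in> Hinf \<Longrightarrow> g \<in> Hinf \<Longrightarrow> f - g \<in> Hinf"
  and Hinf_scaleR: "f \<in> Hinf \<Longrightarrow> c *\<^sub>R f \<in> Hinf"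
  and Hinf_zero [simp]: "0 \<in> Hinf"
  and Hinf_sum: "(\<And>i. i \<in> A \<Longrightarrow> h i \<in> Hinf) \<Longrightarrow> sum h A \<in> Hinf"
  by (auto simp: Hinf_def intro: Hs_add Hs_diff Hs_scaleR Hs_sum)

section \<open>The commutator and the nonlinearity\<close>

lemma fourier_abs_torus_L2:
  assumes "sq_integrable f"
  shows "fourier (abs_torus_L2 f) k = (\<integral>x. complex_of_real (f x) * cis (- phase k x) \<partial>torus)"
  unfolding fourier.abs_eq[OF L2_rel_refl[OF assms]] phase_def by simp

lemma summable_modes_enum:
  obtains m :: "nat \<Rightarrow> int \<times> int" where "bij_betw m UNIV UNIV"
proof -
  have "infinite (UNIV :: (int \<times> int) set)"
    by (simp add: finite_prod infinite_UNIV_int)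
  then have "bij_betw (from_nat_into UNIV :: nat \<Rightarrow> int \<times> int) UNIV UNIV"
    by (intro bij_betw_from_nat_into) auto
  then show ?thesis using that by blast
qed

lemma integrable_mult_bounded_complex:
  fixes K e :: "real \<times> real \<Rightarrow> complex"
  assumes "integrable torus K" "e \<in> borel_measurable torus" "\<And>x. cmod (e x) \<le> C"
  shows "integrable torus (\<lambda>x. e x * K x)"
proof (rule Bochner_Integration.integrable_bound[of _ "\<lambda>x. C *\<^sub>R K x"])
  show "AE x in torus. norm (e x * K x) \<le> norm (C *\<^sub>R K x)"
  proof (rule AE_I2)
    fix x
    have "0 \<le> C" using assms(3)[of x] norm_ge_zero[of "e x"] by linarith
    then show "norm (e x * K x) \<le> norm (C *\<^sub>R K x)"
      using assms(3)[of x] by (simp add: norm_mult mult_right_mono)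
  qed
qed (use assms in auto)

text \<open>Dominated convergence along an enumeration, with the total absolute sum times |K| as
  majorant. The free kernel K is used twice in the product formula: as a pure character it
  identifies coefficients, as a character times an L2 function it produces the convolution.\<close>

lemma absolutely_convergent_series:
  fixes c :: "int \<times> int \<Rightarrow> complex"
  assumes c: "(\<lambda>j. cmod (c j)) summable_on UNIV"
  obtains G where "G \<in> borel_measurable torus" "\<And>x. cmod (G x) \<le> (\<Sum>\<^sub>\<infinity>j. cmod (c j))"
    "\<And>x. ((\<lambda>j. c j * cis (phase j x)) has_sum G x) UNIV"
    "\<And>K. integrable torus K \<Longrightarrow>
      ((\<lambda>j. c j * (\<integral>x. cis (phase j x) * K x \<partial>torus)) has_sum (\<integral>x. G x * K x \<partial>torus)) UNIV"
proof -
  obtain m :: "nat \<Rightarrow> int \<times> int" where bij: "bij_betw m UNIV UNIV" by (rule summable_modes_enum)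
  define A where "A = (\<Sum>\<^sub>\<infinity>j. cmod (c j))"
  define G where "G x = (\<Sum>\<^sub>\<infinity>j. c j * cis (phase j x))" for x
  have hs: "((\<lambda>j. c j * cis (phase j x)) has_sum G x) UNIV" for x
    unfolding G_def by (rule has_sum_infsum, rule abs_summable_summable) (use c in \<open>simp add: norm_mult\<close>)
  have GA: "cmod (G x) \<le> A" for x
    unfolding G_def A_def using norm_infsum_bound[of "\<lambda>j. c j * cis (phase j x)" UNIV] c
    by (simp add: norm_mult)
  have sm: "(\<lambda>i. cmod (c (m i))) summable_on UNIV"
    using c summable_on_reindex_bij_betw[OF bij, of "\<lambda>j. cmod (c j)"] by simp
  have sms: "summable (\<lambda>i. cmod (c (m i)))" by (rule summable_on_imp_summable[OF sm])
  have part: "(\<Sum>i<n. cmod (c (m i))) \<le> A" for n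
  proof -
    have "(\<Sum>i<n. cmod (c (m i))) \<le> (\<Sum>\<^sub>\<infinity>i. cmod (c (m i)))"
      by (rule finite_sum_le_infsum[OF sm]) auto
    also have "\<dots> = A" unfolding A_def by (rule infsum_reindex_bij_betw[OF bij])
    finally show ?thesis .
  qed
  have ss: "(\<lambda>i. c (m i) * cis (phase (m i) x)) sums G x" for x
    using hs[of x] has_sum_reindex_bij_betw[OF bij, of "\<lambda>j. c j * cis (phase j x)"]
    by (intro has_sum_imp_sums) simp
  have [measurable]: "(\<lambda>x. cis (phase j x)) \<in> borel_measurable torus" for j
    by (intro continuous_measurable_torus continuous_intros)
  have Gm: "G \<in> borel_measurable torus"
    by (rule borel_measurable_LIMSEQ_metric[of "\<lambda>n x. \<Sum>i<n. c (m i) * cis (phase (m i) x)"])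
      (use ss in \<open>auto simp: sums_def\<close>)
  have swap: "((\<lambda>j. c j * (\<integral>x. cis (phase j x) * K x \<partial>torus)) has_sum (\<integral>x. G x * K x \<partial>torus)) UNIV"
    if K: "integrable torus K" for K
  proof -
    have Km[measurable]: "K \<in> borel_measurable torus" using K by auto
    have ei: "integrable torus (\<lambda>x. cis (phase j x) * K x)" for j
      by (rule integrable_mult_bounded_complex[OF K, of _ 1]) auto
    have "(\<lambda>n. \<integral>x. (\<Sum>i<n. c (m i) * cis (phase (m i) x)) * K x \<partial>torus) \<longlonglongrightarrow> (\<integral>x. G x * K x \<partial>torus)"
    proof (rule integral_dominated_convergence[where w="\<lambda>x. A * norm (K x)"])
      show "AE x in torus. (\<lambda>n. (\<Sum>i<n. c (m i) * cis (phase (m i) x)) * K x) \<longlonglongrightarrow> G x * K x"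
        using ss by (intro AE_I2 tendsto_mult tendsto_const) (simp add: sums_def)
      show "AE x in torus. norm ((\<Sum>i<n. c (m i) * cis (phase (m i) x)) * K x) \<le> A * norm (K x)" for n
      proof (rule AE_I2)
        fix x
        have "norm (\<Sum>i<n. c (m i) * cis (phase (m i) x)) \<le> (\<Sum>i<n. cmod (c (m i)))"
          by (rule sum_norm_le) (simp add: norm_mult)
        then show "norm ((\<Sum>i<n. c (m i) * cis (phase (m i) x)) * K x) \<le> A * norm (K x)"
          using part[of n] by (auto simp: norm_mult intro!: mult_right_mono)
      qed
    qed (use K Gm in auto)
    moreover have "(\<integral>x. (\<Sum>i<n. c (m i) * cis (phase (m i) x)) * K x \<partial>torus) =
        (\<Sum>i<n. c (m i) * (\<integral>x. cis (phase (m i) x) * K x \<partial>torus))" for n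
    proof -
      have "(\<integral>x. (\<Sum>i<n. c (m i) * cis (phase (m i) x)) * K x \<partial>torus) =
          (\<integral>x. (\<Sum>i<n. c (m i) * (cis (phase (m i) x) * K x)) \<partial>torus)"
        by (simp add: sum_distrib_right mult.assoc)
      also have "\<dots> = (\<Sum>i<n. \<integral>x. c (m i) * (cis (phase (m i) x) * K x) \<partial>torus)"
        by (rule Bochner_Integration.integral_sum) (intro integrable_mult_right ei)
      finally show ?thesis by simp
    qed
    ultimately have s: "(\<lambda>i. c (m i) * (\<integral>x. cis (phase (m i) x) * K x \<partial>torus)) sums (\<integral>x. G x * K x \<partial>torus)"
      by (simp add: sums_def)
    have eb: "cmod (\<integral>x. cis (phase j x) * K x \<partial>torus) \<le> (\<integral>x. norm (K x) \<partial>torus)" for j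
      using integral_norm_bound[of torus "\<lambda>x. cis (phase j x) * K x"] by (simp add: norm_mult)
    have "summable (\<lambda>i. norm (c (m i) * (\<integral>x. cis (phase (m i) x) * K x \<partial>torus)))"
    proof (rule summable_comparison_test[OF _ summable_mult2[OF sms, of "\<integral>x. norm (K x) \<partial>torus"]])
      show "\<exists>N. \<forall>i\<ge>N. norm (norm (c (m i) * (\<integral>x. cis (phase (m i) x) * K x \<partial>torus))) \<le>
          cmod (c (m i)) * (\<integral>x. norm (K x) \<partial>torus)"
        by (auto simp: norm_mult intro!: mult_left_mono eb)
    qed
    from norm_summable_imp_has_sum[OF this s]
    show ?thesis
      using has_sum_reindex_bij_betw[OF bij, of "\<lambda>j. c j * (\<integral>x. cis (phase j x) * K x \<partial>torus)"] by simp
  qed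
  show ?thesis by (rule that[OF Gm GA[unfolded A_def] hs swap])
qed

text \<open>An absolutely convergent Fourier series represents its function as a bounded one, which
  turns the product into the convolution of the coefficients.\<close>

lemma fourier_L2_mult:
  assumes f: "(\<lambda>j. cmod (fourier f j)) summable_on UNIV"
  shows "((\<lambda>j. fourier f j * fourier h (m - j)) has_sum fourier (L2_mult f h) m) UNIV"
proof -
  obtain G where Gm[measurable]: "G \<in> borel_measurable torus"
    and GA: "\<And>x. cmod (G x) \<le> (\<Sum>\<^sub>\<infinity>j. cmod (fourier f j))"
    and hs: "\<And>x. ((\<lambda>j. fourier f j * cis (phase j x)) has_sum G x) UNIV"
    and swap: "\<And>K. integrable torus K \<Longrightarrow>
      ((\<lambda>j. fourier f j * (\<integral>x. cis (phase j x) * K x \<partial>torus)) has_sum (\<integral>x. G x * K x \<partial>torus)) UNIV"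
    using absolutely_convergent_series[OF f] by blast
  \<comment> \<open>Since f is real, conjugating the series amounts to reflecting its index; hence
    its sum is real and Re G can represent f.\<close>
  have Gr: "complex_of_real (Re (G x)) = G x" for x
  proof -
    have "((\<lambda>j. cnj (fourier f j * cis (phase j x))) has_sum cnj (G x)) UNIV"
      using hs[of x] by (simp only: has_sum_cnj_iff)
    moreover have "cnj (fourier f j * cis (phase j x)) = fourier f (- j) * cis (phase (- j) x)" for j
      by (simp add: fourier_minus phase_minus cis_cnj)
    ultimately have "((\<lambda>j. fourier f (- j) * cis (phase (- j) x)) has_sum cnj (G x)) UNIV" by simp
    then have "((\<lambda>j. fourier f j * cis (phase j x)) has_sum cnj (G x)) UNIV"
      by (simp only: has_sum_reflect[OF reflect_UNIV, of "\<lambda>j. fourier f j * cis (phase j x)"])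
    then have "cnj (G x) = G x" using hs has_sum_unique by blast
    then show ?thesis by (simp add: complex_eq_iff)
  qed
  have ReG: "\<bar>Re (G x)\<bar> \<le> (\<Sum>\<^sub>\<infinity>j. cmod (fourier f j))" for x
    using GA[of x] abs_Re_le_cmod[of "G x"] by linarith
  have sG: "sq_integrable (\<lambda>x. Re (G x))"
    by (rule sq_integrable_bounded[OF _ ReG]) measurable
  have f_eq: "f = abs_torus_L2 (\<lambda>x. Re (G x))"
  proof (rule fourier_eqI)
    fix k
    have K: "integrable torus (\<lambda>x. cis (- phase k x))"
      using integrable_cis_phase[of "- k"] by (simp add: phase_minus)
    have "(\<integral>x. cis (phase j x) * cis (- phase k x) \<partial>torus) = (if j = k then 1 else 0)" for j
      using integral_cis_phase[of "j - k"] by (simp add: cis_mult phase_diff)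
    then have "((\<lambda>j. fourier f j * (if j = k then 1 else 0)) has_sum (\<integral>x. G x * cis (- phase k x) \<partial>torus)) UNIV"
      using swap[OF K] by simp
    moreover have "((\<lambda>j. fourier f j * (if j = k then 1 else 0)) has_sum fourier f k) UNIV"
      by (rule has_sum_finite_neutralI[of "{k}"]) auto
    ultimately have "fourier f k = (\<integral>x. G x * cis (- phase k x) \<partial>torus)"
      using has_sum_unique by blast
    then show "fourier f k = fourier (abs_torus_L2 (\<lambda>x. Re (G x))) k"
      by (simp add: fourier_abs_torus_L2[OF sG] Gr)
  qed
  define H where "H = rep_torus_L2 h"
  have sH: "sq_integrable H" unfolding H_def by (rule sq_integrable_rep)
  then have Hm[measurable]: "H \<in> borel_measurable torus" by (simp add: sq_integrable_def)
  have sGH: "sq_integrable (\<lambda>x. Re (G x) * H x)"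
  proof -
    have "integrable torus (\<lambda>x. (H x)\<^sup>2 * (Re (G x))\<^sup>2)"
    proof (rule integrable_mult_bounded[where C="(\<Sum>\<^sub>\<infinity>j. cmod (fourier f j))\<^sup>2"])
      show "integrable torus (\<lambda>x. (H x)\<^sup>2)" using sH by (simp add: sq_integrable_def)
      show "\<bar>(Re (G x))\<^sup>2\<bar> \<le> (\<Sum>\<^sub>\<infinity>j. cmod (fourier f j))\<^sup>2" for x
        using power_mono[OF ReG[of x], of 2] by simp
    qed measurable
    then show ?thesis unfolding sq_integrable_def by (simp add: power_mult_distrib mult.commute)
  qed
  have "L2_mult f h = abs_torus_L2 (\<lambda>x. Re (G x) * H x)"
  proof -
    have "L2_mult f h = L2_mult (abs_torus_L2 (\<lambda>x. Re (G x))) (abs_torus_L2 H)"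
      by (simp add: f_eq[symmetric] H_def abs_rep_torus_L2)
    then show ?thesis
      using L2_mult.abs_eq[OF L2_rel_refl[OF sG] L2_rel_refl[OF sH]] sGH by simp
  qed
  then have P: "fourier (L2_mult f h) m = (\<integral>x. G x * (complex_of_real (H x) * cis (- phase m x)) \<partial>torus)"
    by (simp add: fourier_abs_torus_L2[OF sGH] Gr mult.assoc)
  have K: "integrable torus (\<lambda>x. complex_of_real (H x) * cis (- phase m x))"
  proof -
    have "integrable torus (\<lambda>x. complex_of_real (H x))"
      using sq_integrable_imp_integrable[OF sH] by simp
    moreover have "(\<lambda>x. cis (- phase m x)) \<in> borel_measurable torus"
      by (intro continuous_measurable_torus continuous_intros)
    ultimately have "integrable torus (\<lambda>x. cis (- phase m x) * complex_of_real (H x))"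
      by (rule integrable_mult_bounded_complex[of _ _ 1]) simp
    then show ?thesis by (simp add: mult.commute)
  qed
  have "(\<integral>x. cis (phase j x) * (complex_of_real (H x) * cis (- phase m x)) \<partial>torus) = fourier h (m - j)" for j
  proof -
    have "cis (phase j x) * (complex_of_real (H x) * cis (- phase m x)) = complex_of_real (H x) * cis (- phase (m - j) x)" for x
    proof -
      have "cis (- phase (m - j) x) = cis (phase j x) * cis (- phase m x)"
        unfolding cis_mult by (simp add: phase_diff)
      then show ?thesis by (simp only: mult_ac)
    qed
    then show ?thesis by (simp only: fourier_integral H_def)
  qed
  then show ?thesis using swap[OF K] by (simp add: P)
qed

section \<open>Young's inequality and summable weights\<close>

lemma infsum_Cauchy_Schwarz:
  fixes w v :: "'i \<Rightarrow> real"
  assumes w: "\<And>j. 0 \<le> w j" "w summable_on UNIV"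
    and v: "(\<lambda>j. w j * v j) summable_on UNIV" "(\<lambda>j. w j * (v j)\<^sup>2) summable_on UNIV"
  shows "(\<Sum>\<^sub>\<infinity>j. w j * v j)\<^sup>2 \<le> infsum w UNIV * (\<Sum>\<^sub>\<infinity>j. w j * (v j)\<^sup>2)"
proof (cases "infsum w UNIV = 0")
  case True
  have "w j = 0" for j
    using nonneg_infsum_le_0D[of w UNIV j] True w by simp
  then show ?thesis by simp
next
  case False
  define W S Q where "W = infsum w UNIV" and "S = (\<Sum>\<^sub>\<infinity>j. w j * v j)" and "Q = (\<Sum>\<^sub>\<infinity>j. w j * (v j)\<^sup>2)"
  have "W \<ge> 0" unfolding W_def by (rule infsum_nonneg) (use w in auto)
  then have W: "W > 0" using False by (simp add: W_def)
  \<comment> \<open>The weighted mean of v: it minimises the sum of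
    \<open>w j * (v j - t)^2\<close>, and nonnegativity of the minimum is the claim.\<close>
  define t where "t = S / W"
  have "((\<lambda>j. w j * (v j)\<^sup>2 + (- 2 * t) * (w j * v j) + t\<^sup>2 * w j) has_sum (Q + (- 2 * t) * S + t\<^sup>2 * W)) UNIV"
    unfolding Q_def S_def W_def by (intro has_sum_add has_sum_cmult_right has_sum_infsum assms)
  then have "0 \<le> Q + (- 2 * t) * S + t\<^sup>2 * W"
  proof (rule has_sum_nonneg)
    fix j
    have "0 \<le> w j * (v j - t)\<^sup>2" using w by simp
    then show "0 \<le> w j * (v j)\<^sup>2 + (- 2 * t) * (w j * v j) + t\<^sup>2 * w j"
      by (simp add: power2_diff algebra_simps)
  qed
  also have "\<dots> = Q - S\<^sup>2 / W" using W by (simp add: t_def power2_eq_square field_simps)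
  finally show ?thesis using W by (simp add: Q_def S_def W_def field_simps)
qed

text \<open>Cauchy-Schwarz with w as weight bounds each squared convolution by the sum of w times
  the convolution of w with v^2, and summing over m factorises by Tonelli. Hence the square of the
  l1 norm of w.\<close>

lemma young_l1_l2:
  fixes w v :: "int \<times> int \<Rightarrow> real"
  assumes w: "\<And>j. 0 \<le> w j" "w summable_on UNIV"
    and v: "\<And>j. 0 \<le> v j" "(\<lambda>j. (v j)\<^sup>2) summable_on UNIV"
  shows "(\<lambda>j. w j * v (m - j)) summable_on UNIV"
    and "(\<lambda>m. (\<Sum>\<^sub>\<infinity>j. w j * v (m - j))\<^sup>2) summable_on UNIV"
    and "(\<Sum>\<^sub>\<infinity>m. (\<Sum>\<^sub>\<infinity>j. w j * v (m - j))\<^sup>2) \<le> (infsum w UNIV)\<^sup>2 * (\<Sum>\<^sub>\<infinity>j. (v j)\<^sup>2)"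
proof -
  define W V where "W = infsum w UNIV" and "V = (\<Sum>\<^sub>\<infinity>j. (v j)\<^sup>2)"
  have W0: "0 \<le> W" unfolding W_def by (rule infsum_nonneg) (use w in auto)
  have v2: "(v j)\<^sup>2 \<le> V" for j
    unfolding V_def using finite_sum_le_infsum[OF v(2), of "{j}"] by simp
  have V0: "0 \<le> V" using v2[of 0] zero_le_power2[of "v 0"] by linarith
  have vV: "v j \<le> 1 + V" for j
  proof -
    have "0 \<le> (v j - 1)\<^sup>2" by simp
    then have "2 * v j \<le> 1 + (v j)\<^sup>2" by (simp add: power2_diff)
    then show ?thesis using v2[of j] V0 by simp
  qed
  have s1: "(\<lambda>j. w j * v (m - j)) summable_on UNIV" for m
    by (rule summable_on_comparison_test[OF summable_on_cmult_left[OF w(2), of "1 + V"]])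
      (auto intro!: mult_left_mono mult_nonneg_nonneg w(1) v(1) vV)
  have s2: "(\<lambda>j. w j * (v (m - j))\<^sup>2) summable_on UNIV" for m
    by (rule summable_on_comparison_test[OF summable_on_cmult_left[OF w(2), of V]])
      (auto intro!: mult_left_mono mult_nonneg_nonneg w(1) v2)
  define Q where "Q m = (\<Sum>\<^sub>\<infinity>j. w j * (v (m - j))\<^sup>2)" for m
  have vs: "((\<lambda>j. (v j)\<^sup>2) has_sum V) UNIV" unfolding V_def using v(2) by simp
  have row: "((\<lambda>l. (\<lambda>(j, l). w j * (v l)\<^sup>2) (j, l)) has_sum w j * V) UNIV" for j
    using has_sum_cmult_right[OF vs, of "w j"] by simp
  have tot: "((\<lambda>j. w j * V) has_sum W * V) UNIV"
    unfolding W_def by (intro has_sum_cmult_left has_sum_infsum w)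
  have "(\<lambda>(j, l). w j * (v l)\<^sup>2) summable_on (UNIV \<times> UNIV)"
    by (rule summable_on_SigmaI[OF row]) (use tot in \<open>auto simp: summable_on_def intro!: mult_nonneg_nonneg w(1)\<close>)
  from has_sum_SigmaI[OF row tot this]
  have "((\<lambda>(j, l). w j * (v l)\<^sup>2) has_sum W * V) (UNIV \<times> UNIV)" .
  \<comment> \<open>The shear taking (m, j) to (j, m - j) is a bijection, so the double sum of the
    convolution is the double sum of the product.\<close>
  then have pairs: "((\<lambda>(m, j). w j * (v (m - j))\<^sup>2) has_sum W * V) (UNIV \<times> UNIV)"
    by (subst has_sum_reindex_bij_witness[where S="UNIV \<times> UNIV" and T="UNIV \<times> UNIV"
          and i="\<lambda>(j, l). (l + j, j)" and j="\<lambda>(m, j). (j, m - j)" and h="\<lambda>(j, l). w j * (v l)\<^sup>2" and s'="W * V"]) auto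
  have Qs: "(Q has_sum W * V) UNIV"
  proof (rule has_sum_SigmaD[OF pairs])
    show "((\<lambda>j. (\<lambda>(m, j). w j * (v (m - j))\<^sup>2) (m, j)) has_sum Q m) UNIV" for m
      unfolding Q_def prod.case using s2[of m] by simp
  qed
  have le: "(\<Sum>\<^sub>\<infinity>j. w j * v (m - j))\<^sup>2 \<le> W * Q m" for m
    unfolding W_def Q_def by (rule infsum_Cauchy_Schwarz[OF w s1 s2])
  have WQ: "((\<lambda>m. W * Q m) has_sum W * (W * V)) UNIV" by (rule has_sum_cmult_right[OF Qs])
  show "(\<lambda>j. w j * v (m - j)) summable_on UNIV" by (rule s1)
  show sq: "(\<lambda>m. (\<Sum>\<^sub>\<infinity>j. w j * v (m - j))\<^sup>2) summable_on UNIV"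
    by (rule summable_on_comparison_test[of "\<lambda>m. W * Q m"]) (use WQ in \<open>auto simp: summable_on_def intro!: le\<close>)
  have "(\<Sum>\<^sub>\<infinity>m. (\<Sum>\<^sub>\<infinity>j. w j * v (m - j))\<^sup>2) \<le> W * (W * V)"
    using has_sum_mono[OF has_sum_infsum[OF sq] WQ le] by simp
  then show "(\<Sum>\<^sub>\<infinity>m. (\<Sum>\<^sub>\<infinity>j. w j * v (m - j))\<^sup>2) \<le> (infsum w UNIV)\<^sup>2 * (\<Sum>\<^sub>\<infinity>j. (v j)\<^sup>2)"
    by (simp add: W_def V_def power2_eq_square mult.assoc)
qed

lemma summable_inverse_square_int: "(\<lambda>n::int. inverse (1 + (real_of_int n)\<^sup>2)) summable_on UNIV"
proof -
  have nat: "(\<lambda>n. inverse (1 + (real n)\<^sup>2)) summable_on UNIV"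
  proof -
    have "summable (\<lambda>n. inverse (1 + (real n)\<^sup>2))"
    proof (rule summable_comparison_test'[OF inverse_power_summable[of 2, where 'a=real], of 1])
      show "norm (inverse (1 + (real n)\<^sup>2)) \<le> inverse (real n ^ 2)" if "1 \<le> n" for n
        using that by (simp add: le_imp_inverse_le)
    qed simp
    then show ?thesis by (subst summable_on_UNIV_nonneg_real_iff) auto
  qed
  have "(\<lambda>n::int. inverse (1 + (real_of_int n)\<^sup>2)) summable_on (range int)"
    using nat by (subst summable_on_reindex) (auto simp: o_def)
  moreover have "(\<lambda>n::int. inverse (1 + (real_of_int n)\<^sup>2)) summable_on (range (\<lambda>n. - int n))"
    using nat by (subst summable_on_reindex) (auto simp: o_def inj_on_def)
  ultimately have "(\<lambda>n::int. inverse (1 + (real_of_int n)\<^sup>2)) summable_on (range int \<union> range (\<lambda>n. - int n))"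
    by (rule summable_on_union)
  moreover have "range int \<union> range (\<lambda>n. - int n) = UNIV"
  proof -
    have "x \<in> range int \<union> range (\<lambda>n. - int n)" for x
      by (cases x rule: int_cases2) auto
    then show ?thesis by blast
  qed
  ultimately show ?thesis by simp
qed

text \<open>In dimension two the inverse fourth power is the first even one that converges. The
  square of \<open>freq k\<close> dominates 1 + a^2 + b^2, whose square dominates (1 + a^2)(1 +
  b^2), so two one-dimensional series suffice; at the zero frequency the term is
  \<open>inverse 0 = 0\<close>.\<close>

lemma summable_freq_minus_4: "(\<lambda>k. inverse (freq k ^ 4)) summable_on UNIV"
proof (rule summable_on_comparison_test)
  define p where "p n = inverse (1 + (real_of_int n)\<^sup>2)" for n :: int
  have s: "(p has_sum infsum p UNIV) UNIV" unfolding p_def using summable_inverse_square_int by simp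
  show "(\<lambda>(a, b). p a * p b) summable_on UNIV"
    unfolding UNIV_Times_UNIV[symmetric]
  proof (rule summable_on_SigmaI)
    show "((\<lambda>y. case (x, y) of (a, b) \<Rightarrow> p a * p b) has_sum p x * infsum p UNIV) UNIV" for x
      using has_sum_cmult_right[OF s, of "p x"] by simp
    show "(\<lambda>x. p x * infsum p UNIV) summable_on UNIV"
      using has_sum_cmult_left[OF s] by (auto simp: summable_on_def)
  qed (auto simp: p_def)
  fix k :: "int \<times> int"
  show "inverse (freq k ^ 4) \<le> (case k of (a, b) \<Rightarrow> p a * p b)"
  proof (cases "k = 0")
    case False
    obtain a b where k: "k = (a, b)" by (cases k)
    define x y where "x = (real_of_int a)\<^sup>2" and "y = (real_of_int b)\<^sup>2"
    have xy: "0 \<le> x" "0 \<le> y" by (auto simp: x_def y_def)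
    have f: "freq k ^ 2 = (4 * pi\<^sup>2) * (x + y)"
      by (simp add: freq_def k x_def y_def power_mult_distrib)
    have f1: "1 \<le> x + y"
    proof -
      have "a\<^sup>2 + b\<^sup>2 \<noteq> 0" using False by (auto simp: k zero_prod_def)
      then have "1 \<le> a\<^sup>2 + b\<^sup>2" using zero_le_power2[of a] zero_le_power2[of b] by linarith
      then have "real_of_int 1 \<le> real_of_int (a\<^sup>2 + b\<^sup>2)" by (simp only: of_int_le_iff)
      then show ?thesis by (simp add: x_def y_def)
    qed
    have "2 * (x + y) \<le> (4 * pi\<^sup>2) * (x + y)"
    proof (rule mult_right_mono)
      have "2 * 2 \<le> pi * pi" using pi_ge_two by (intro mult_mono) auto
      then show "2 \<le> 4 * pi\<^sup>2" by (simp add: power2_eq_square)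
    qed (use xy in auto)
    moreover have "1 + x + y \<le> 2 * (x + y)" using f1 by simp
    ultimately have "1 + x + y \<le> freq k ^ 2" unfolding f by (rule order_trans[rotated])
    then have "(1 + x + y) ^ 2 \<le> (freq k ^ 2) ^ 2" using xy by (intro power_mono) auto
    moreover have "(1 + x) * (1 + y) \<le> (1 + x + y) ^ 2"
      using xy by (simp add: power2_eq_square algebra_simps)
    ultimately have "(1 + x) * (1 + y) \<le> freq k ^ 4"
      by (simp flip: power_mult)
    moreover have "0 < (1 + x) * (1 + y)" using xy by (intro mult_pos_pos) auto
    ultimately show ?thesis
      unfolding k p_def x_def y_def prod.case inverse_mult_distrib[symmetric]
      by (intro le_imp_inverse_le) auto
  qed (simp add: p_def split: prod.split)
qed simp

text \<open>The Wiener-algebra norm of the Laplacian of \<phi>. One of the two powers of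
  \<open>freq\<close> pays for the gradient of \<phi>, the other for the commutator with
  \<open>Lam 1\<close>.\<close>

definition wt :: "torus_L2 \<Rightarrow> real" where
  "wt \<phi> = (\<Sum>\<^sub>\<infinity>j. (freq j)\<^sup>2 * cmod (fourier \<phi> j))"

text \<open>The value produced by the inequality of arithmetic and geometric means in
  \<open>wt_summable_bound\<close>, where Cauchy-Schwarz would give the square root of the
  sum.\<close>

definition wt_const :: real where
  "wt_const = (1 + (\<Sum>\<^sub>\<infinity>k. inverse (freq k ^ 4))) / 2"

lemma wt_const_pos: "0 < wt_const"
  unfolding wt_const_def using infsum_nonneg[of UNIV "\<lambda>k. inverse (freq k ^ 4)"] by simp

lemma wt_summable_bound:
  assumes \<phi>: "\<phi> \<in> Hs 4"
  shows "(\<lambda>j. (freq j)\<^sup>2 * cmod (fourier \<phi> j)) summable_on UNIV" (is ?s)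
    and "wt \<phi> \<le> wt_const * norm_Hs 4 \<phi>"
proof -
  define Z where "Z = (\<Sum>\<^sub>\<infinity>k. inverse (freq k ^ 4))"
  define N where "N = norm_Hs 4 \<phi>"
  have hZ: "((\<lambda>k. inverse (freq k ^ 4)) has_sum Z) UNIV"
    unfolding Z_def using summable_freq_minus_4 by simp
  have hN: "((\<lambda>k. (freq k ^ 4 * cmod (fourier \<phi> k))\<^sup>2) has_sum N\<^sup>2) UNIV"
  proof -
    have "(\<lambda>k. freq k powr (2 * 4) * (cmod (fourier \<phi> k))\<^sup>2) summable_on (- {0})"
      using \<phi> by (simp add: Hs_def zero_prod_def)
    then have "((\<lambda>k. freq k powr (2 * 4) * (cmod (fourier \<phi> k))\<^sup>2) has_sum N\<^sup>2) (- {0})"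
      unfolding N_def norm_Hs_def by (simp add: zero_prod_def infsum_nonneg)
    then show ?thesis
    proof (rule has_sum_cong_neutral[THEN iffD1, rotated 3])
      fix k :: "int \<times> int"
      show "freq k powr (2 * 4) * (cmod (fourier \<phi> k))\<^sup>2 = (freq k ^ 4 * cmod (fourier \<phi> k))\<^sup>2"
        unfolding freq_powr_double using freq_nonneg[of k]
        by (cases "freq k = 0") (simp_all add: power_mult_distrib powr_numeral)
    qed auto
  qed
  \<comment> \<open>Splits freq^2 into freq^4 times freq^(-2) and applies 2ab \<le> t a^2 + b^2 / t.
    The free t is later set to the reciprocal of the norm, so that the bound becomes linear in
    \<phi>.\<close>
  have key: "(freq k)\<^sup>2 * cmod (fourier \<phi> k) \<le> (t * (freq k ^ 4 * cmod (fourier \<phi> k))\<^sup>2 + inverse t * inverse (freq k ^ 4)) / 2"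
    if t: "0 < t" for k t
  proof (cases "k = 0")
    case False
    define x y where "x = freq k" and "y = cmod (fourier \<phi> k)"
    have x: "x > 0" using freq_pos[OF False] by (simp add: x_def)
    have "0 \<le> inverse t * (t * (x ^ 4 * y) - inverse (x\<^sup>2))\<^sup>2" using t by simp
    also have "\<dots> = t * (x ^ 4 * y)\<^sup>2 + inverse t * inverse (x ^ 4) - 2 * (x\<^sup>2 * y)"
      using x t by (simp add: power2_eq_square power4_eq_xxxx field_simps)
    finally show ?thesis by (simp add: x_def y_def)
  qed (use t in simp)
  have bnd: "((\<lambda>k. (t * (freq k ^ 4 * cmod (fourier \<phi> k))\<^sup>2 + inverse t * inverse (freq k ^ 4)) / 2) has_sum
     (t * N\<^sup>2 + inverse t * Z) / 2) UNIV" for t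
    using has_sum_cmult_right[OF has_sum_add[OF has_sum_cmult_right[OF hN, of t] has_sum_cmult_right[OF hZ, of "inverse t"]], of "1/2"]
    by (simp only: times_divide_eq_left mult_1)
  show s: ?s
    by (rule summable_on_comparison_test[OF has_sum_imp_summable[OF bnd[of 1]]])
      (use key[of 1] in \<open>simp_all only: zero_less_one zero_le_mult_iff norm_ge_zero zero_le_power2 simp_thms\<close>)
  have le: "wt \<phi> \<le> (t * N\<^sup>2 + inverse t * Z) / 2" if "0 < t" for t
    unfolding wt_def using has_sum_mono[OF has_sum_infsum[OF s] bnd[of t] key[OF that]] .
  show "wt \<phi> \<le> wt_const * norm_Hs 4 \<phi>"
  proof (cases "N = 0")
    case True
    have "\<phi> = 0"
      using norm_le_norm_Hs[OF \<phi>] True by (simp add: N_def)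
    then show ?thesis by (simp add: wt_def)
  next
    case False
    then have N: "N > 0" using norm_Hs_nonneg[of 4 \<phi>] by (simp add: N_def del: norm_Hs_nonneg)
    have "wt \<phi> \<le> (inverse N * N\<^sup>2 + inverse (inverse N) * Z) / 2" by (rule le) (use N in simp)
    also have "\<dots> = wt_const * N" using N by (simp add: wt_const_def Z_def power2_eq_square field_simps)
    finally show ?thesis by (simp add: N_def)
  qed
qed

lemma wt_nonneg: "0 \<le> wt \<phi>"
  unfolding wt_def by (rule infsum_nonneg) simp

section \<open>Derivatives, Riesz transforms and the commutator\<close>

lemma abs_kcomp_le_freq: "2 * pi * \<bar>real_of_int (kcomp i k)\<bar> \<le> freq k"
  using abs_fst_le_freq[of k] abs_snd_le_freq[of k] by (simp add: kcomp_def)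

lemma kcomp_minus: "kcomp i (- k) = - kcomp i k"
  by (simp add: kcomp_def)

lemma fourier_pd:
  assumes \<phi>: "\<phi> \<in> Hs 1"
  shows "fourier (pd i \<phi>) k = \<i> * complex_of_real (2 * pi * real_of_int (kcomp i k)) * fourier \<phi> k"
  unfolding pd_def
proof (rule fourier_fourier_mult)
  have "(\<lambda>k. freq k powr (2 * 1) * (cmod (fourier \<phi> k))\<^sup>2) summable_on (- {0})"
    using \<phi> by (simp add: Hs_def zero_prod_def)
  then have "(\<lambda>k. freq k powr (2 * 1) * (cmod (fourier \<phi> k))\<^sup>2) summable_on UNIV"
    by (rule summable_on_cong_neutral[THEN iffD1, rotated 3]) auto
  then show "(\<lambda>k. (cmod (\<i> * complex_of_real (2 * pi * real_of_int (kcomp i k)) * fourier \<phi> k))\<^sup>2) summable_on UNIV"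
  proof (rule summable_on_comparison_test)
    fix k
    have "(2 * pi * \<bar>real_of_int (kcomp i k)\<bar>)\<^sup>2 \<le> (freq k)\<^sup>2"
      by (intro power_mono abs_kcomp_le_freq) auto
    then have "(2 * pi * \<bar>real_of_int (kcomp i k)\<bar>)\<^sup>2 * (cmod (fourier \<phi> k))\<^sup>2 \<le> (freq k)\<^sup>2 * (cmod (fourier \<phi> k))\<^sup>2"
      by (rule mult_right_mono) simp
    then show "(cmod (\<i> * complex_of_real (2 * pi * real_of_int (kcomp i k)) * fourier \<phi> k))\<^sup>2 \<le>
        freq k powr (2 * 1) * (cmod (fourier \<phi> k))\<^sup>2"
      unfolding freq_powr_double by (simp add: norm_mult power_mult_distrib abs_mult)
  qed simp
qed (simp add: kcomp_minus)

lemma fourier_Lam_minus_one: "\<theta> \<in> H0 \<Longrightarrow> fourier (Lam (- 1) \<theta>) k = complex_of_real (inverse (freq k)) * fourier \<theta> k"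
  by (simp add: Hs_fourier_Lam Hs_nonpos divide_inverse powr_minus mult.commute)

lemma Lam_minus_one_Hs1:
  assumes "\<theta> \<in> H0" shows "Lam (- 1) \<theta> \<in> Hs 1"
proof -
  have "lam n powr 1 * inner (Lam (- 1) \<theta>) (bas n) = inner \<theta> (bas n)" for n
    using assms lam_pos[of n] by (simp add: Lam_bas Hs_nonpos powr_minus)
  moreover have "Lam (- 1) \<theta> \<in> H0" using assms by (simp add: Lam_H0 Hs_nonpos)
  ultimately show ?thesis
    using bessel_summable[OF orthonormal_bas, of \<theta>] unfolding Hs_iff by (simp only:)
qed

lemma Lam_one_Lam_minus_one:
  assumes "\<theta> \<in> H0" shows "Lam 1 (Lam (- 1) \<theta>) = \<theta>"
proof (rule H0_eqI)
  fix n
  show "inner (Lam 1 (Lam (- 1) \<theta>)) (bas n) = inner \<theta> (bas n)"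
    using assms lam_pos[of n] by (simp add: Lam_bas Hs_nonpos Lam_minus_one_Hs1 powr_minus)
qed (use assms Lam_minus_one_Hs1 in \<open>auto intro: Lam_H0\<close>)

lemma fourier_riesz:
  assumes "\<theta> \<in> H0"
  shows "fourier (riesz i \<theta>) k = \<i> * complex_of_real (2 * pi * real_of_int (kcomp i k)) * complex_of_real (inverse (freq k)) * fourier \<theta> k"
  unfolding riesz_def by (simp add: fourier_pd Lam_minus_one_Hs1 fourier_Lam_minus_one assms)

lemma norm_riesz:
  assumes \<theta>: "\<theta> \<in> H0" shows "norm (riesz i \<theta>) \<le> norm \<theta>"
proof -
  have "cmod (fourier (riesz i \<theta>) k) \<le> cmod (fourier \<theta> k)" for k
  proof -
    have "2 * pi * \<bar>real_of_int (kcomp i k)\<bar> * inverse (freq k) \<le> 1"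
      using abs_kcomp_le_freq[of i k] freq_pos[of k]
      by (cases "k = 0") (auto simp: divide_le_eq simp flip: divide_inverse)
    then have "2 * pi * \<bar>real_of_int (kcomp i k)\<bar> * inverse (freq k) * cmod (fourier \<theta> k) \<le> 1 * cmod (fourier \<theta> k)"
      by (rule mult_right_mono) simp
    then show ?thesis by (simp add: fourier_riesz[OF \<theta>] norm_mult norm_inverse abs_mult)
  qed
  then have "(norm (riesz i \<theta>))\<^sup>2 \<le> (norm \<theta>)\<^sup>2"
    by (intro has_sum_mono[OF fourier_norm_has_sum fourier_norm_has_sum] power_mono) auto
  then show ?thesis by (rule power2_le_imp_le) simp
qed

lemma riesz_add: "\<theta> \<in> H0 \<Longrightarrow> \<eta> \<in> H0 \<Longrightarrow> riesz i (\<theta> + \<eta>) = riesz i \<theta> + riesz i \<eta>"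
  and riesz_scaleR: "\<theta> \<in> H0 \<Longrightarrow> riesz i (c *\<^sub>R \<theta>) = c *\<^sub>R riesz i \<theta>"
  by (rule fourier_eqI; simp add: fourier_riesz H0_add H0_scaleR fourier_add fourier_scaleR algebra_simps scaleR_conv_of_real)+

text \<open>The contribution to the Fourier coefficient at m of the commutator applied to
  \<open>Lam (- 1) \<eta>\<close>, resolved by the frequency j taken from \<phi>. At m = j the
  inverse is 0 by convention, which agrees with \<eta> having mean zero.\<close>

definition comm_kernel :: "nat \<Rightarrow> torus_L2 \<Rightarrow> torus_L2 \<Rightarrow> int \<times> int \<Rightarrow> int \<times> int \<Rightarrow> complex" where
  "comm_kernel i \<phi> \<eta> m j = \<i> * complex_of_real (2 * pi * real_of_int (kcomp i j)) * fourier \<phi> j *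
     complex_of_real ((freq m - freq (m - j)) * inverse (freq (m - j))) * fourier \<eta> (m - j)"

text \<open>The difference of symbols costs one frequency of \<phi> and the derivative another,
  while the inverse frequency attached to \<eta> is at most one. No derivative falls on \<eta>, so
  \<open>nonlin\<close> can be estimated on all of H.\<close>

lemma cmod_comm_kernel:
  "cmod (comm_kernel i \<phi> \<eta> m j) \<le> ((freq j)\<^sup>2 * cmod (fourier \<phi> j)) * cmod (fourier \<eta> (m - j))"
proof -
  have i: "inverse (freq (m - j)) \<le> 1"
    using freq_ge_1[of "m - j"] by (cases "m - j = 0") (auto simp: inverse_le_1_iff)
  have "(2 * pi * \<bar>real_of_int (kcomp i j)\<bar>) * (\<bar>freq m - freq (m - j)\<bar> * inverse (freq (m - j))) \<le> freq j * (freq j * 1)"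
    using abs_kcomp_le_freq[of i j] freq_diff_le[of m j] i by (intro mult_mono) auto
  then have "((2 * pi * \<bar>real_of_int (kcomp i j)\<bar>) * (\<bar>freq m - freq (m - j)\<bar> * inverse (freq (m - j)))) * (cmod (fourier \<phi> j) * cmod (fourier \<eta> (m - j)))
      \<le> (freq j * (freq j * 1)) * (cmod (fourier \<phi> j) * cmod (fourier \<eta> (m - j)))"
    by (rule mult_right_mono) simp
  then show ?thesis
    by (simp add: comm_kernel_def norm_mult norm_inverse abs_mult power2_eq_square mult_ac flip: of_real_diff)
qed

text \<open>Both products are convolutions of coefficients. Their combination is the kernel, whose
  sums are square summable by Young's inequality with the l1 weight behind \<open>wt \<phi>\<close>;
  this also gives the norm bound.\<close>

lemma commutator_fourier:
  assumes \<phi>: "\<phi> \<in> Hinf" and \<eta>: "\<eta> \<in> H0"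
  shows "(comm_kernel i \<phi> \<eta> m has_sum fourier (commutator i \<phi> (Lam (- 1) \<eta>)) m) UNIV"
    and "norm (commutator i \<phi> (Lam (- 1) \<eta>)) \<le> wt \<phi> * norm \<eta>"
proof -
  define f u P Q where "f = pd i \<phi>" and "u = Lam (- 1) \<eta>" and "P = L2_mult f u" and "Q = L2_mult f \<eta>"
  have ws: "(\<lambda>j. (freq j)\<^sup>2 * cmod (fourier \<phi> j)) summable_on UNIV"
    by (rule wt_summable_bound[OF Hinf_Hs[OF \<phi>]])
  have fj: "fourier f j = \<i> * complex_of_real (2 * pi * real_of_int (kcomp i j)) * fourier \<phi> j" for j
    unfolding f_def by (rule fourier_pd[OF Hinf_Hs[OF \<phi>]])
  have fl: "cmod (fourier f j) \<le> (freq j)\<^sup>2 * cmod (fourier \<phi> j)" for j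
  proof -
    have "2 * pi * \<bar>real_of_int (kcomp i j)\<bar> \<le> (freq j)\<^sup>2"
    proof (cases "j = 0")
      case False
      have "freq j * 1 \<le> freq j * freq j" using freq_ge_1[OF False] by (intro mult_left_mono) auto
      then show ?thesis using abs_kcomp_le_freq[of i j] by (simp add: power2_eq_square)
    qed (simp add: kcomp_def)
    then show ?thesis by (simp add: fj norm_mult abs_mult mult_right_mono)
  qed
  have fs: "(\<lambda>j. cmod (fourier f j)) summable_on UNIV"
    by (rule summable_on_comparison_test[OF ws fl]) simp
  have uj: "fourier u l = complex_of_real (inverse (freq l)) * fourier \<eta> l" for l
    unfolding u_def by (rule fourier_Lam_minus_one[OF \<eta>])
  have Ps: "((\<lambda>j. fourier f j * fourier u (m - j)) has_sum fourier P m) UNIV" for m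
    unfolding P_def by (rule fourier_L2_mult[OF fs])
  have Qs: "((\<lambda>j. fourier f j * fourier \<eta> (m - j)) has_sum fourier Q m) UNIV" for m
    unfolding Q_def by (rule fourier_L2_mult[OF fs])
  have hs: "(comm_kernel i \<phi> \<eta> m has_sum (complex_of_real (freq m) * fourier P m - fourier Q m)) UNIV" for m
  proof -
    have "((\<lambda>j. complex_of_real (freq m) * (fourier f j * fourier u (m - j)) - fourier f j * fourier \<eta> (m - j)) has_sum
        (complex_of_real (freq m) * fourier P m - fourier Q m)) UNIV"
      using has_sum_add[OF has_sum_cmult_right[OF Ps[of m], of "complex_of_real (freq m)"] has_sum_uminusI[OF Qs[of m]]]
      by simp
    moreover have "complex_of_real (freq m) * (fourier f j * fourier u (m - j)) - fourier f j * fourier \<eta> (m - j) = comm_kernel i \<phi> \<eta> m j" for j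
    proof (cases "m - j = 0")
      case True
      then have "fourier \<eta> (m - j) = 0" using \<eta> by (simp add: H0_fourier)
      then show ?thesis by (simp add: comm_kernel_def uj)
    next
      case False
      then have "freq (m - j) \<noteq> 0" using freq_pos by fastforce
      then show ?thesis by (simp add: comm_kernel_def uj fj field_simps)
    qed
    ultimately show ?thesis by (simp only:)
  qed
  define S where "S m = (\<Sum>\<^sub>\<infinity>j. ((freq j)\<^sup>2 * cmod (fourier \<phi> j)) * cmod (fourier \<eta> (m - j)))" for m
  have \<eta>s: "(\<lambda>j. (cmod (fourier \<eta> j))\<^sup>2) summable_on UNIV" "(\<Sum>\<^sub>\<infinity>j. (cmod (fourier \<eta> j))\<^sup>2) = (norm \<eta>)\<^sup>2"
    using fourier_norm_has_sum[of \<eta>] by (auto simp: summable_on_def infsumI)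
  note Y = young_l1_l2[of "\<lambda>j. (freq j)\<^sup>2 * cmod (fourier \<phi> j)" "\<lambda>l. cmod (fourier \<eta> l)", OF _ ws _ \<eta>s(1)]
  have KS: "cmod (complex_of_real (freq m) * fourier P m - fourier Q m) \<le> S m" for m
  proof -
    have s: "(\<lambda>j. norm (comm_kernel i \<phi> \<eta> m j)) summable_on UNIV"
      by (rule summable_on_comparison_test[OF Y(1) cmod_comm_kernel]) auto
    have "cmod (complex_of_real (freq m) * fourier P m - fourier Q m) \<le> (\<Sum>\<^sub>\<infinity>j. norm (comm_kernel i \<phi> \<eta> m j))"
      using norm_infsum_bound[OF s] infsumI[OF hs[of m]] by simp
    also have "\<dots> \<le> S m" unfolding S_def
      by (rule infsum_mono[OF s Y(1) cmod_comm_kernel]) auto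
    finally show ?thesis .
  qed
  have S2: "(\<lambda>m. (S m)\<^sup>2) summable_on UNIV" "(\<Sum>\<^sub>\<infinity>m. (S m)\<^sup>2) \<le> (wt \<phi>)\<^sup>2 * (norm \<eta>)\<^sup>2"
    unfolding S_def wt_def \<eta>s(2)[symmetric] by (rule Y; simp)+
  have K2: "(\<lambda>m. (cmod (complex_of_real (freq m) * fourier P m - fourier Q m))\<^sup>2) summable_on UNIV"
    by (rule summable_on_comparison_test[OF S2(1)]) (auto intro!: power_mono KS)
  \<comment> \<open>\<open>Lam 1 P\<close> is a description, so square summability of freq m times
    the coefficient of P comes first. That sequence is the commutator sequence plus the coefficients
    of Q, both square summable.\<close>
  have Lp: "fourier (Lam 1 P) m = complex_of_real (freq m) * fourier P m" for m
  proof -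
    have "(\<lambda>m. 2 * (cmod (complex_of_real (freq m) * fourier P m - fourier Q m))\<^sup>2 + 2 * (cmod (fourier Q m))\<^sup>2) summable_on UNIV"
      using has_sum_imp_summable[OF fourier_norm_has_sum[of Q]]
      by (intro summable_on_add summable_on_cmult_right K2)
    then have "(\<lambda>m. (cmod (complex_of_real (freq m) * fourier P m))\<^sup>2) summable_on UNIV"
    proof (rule summable_on_comparison_test)
      fix m
      define x y where "x = complex_of_real (freq m) * fourier P m" and "y = fourier Q m"
      have "cmod x \<le> cmod (x - y) + cmod y" using norm_triangle_ineq[of "x - y" y] by simp
      then have "(cmod x)\<^sup>2 \<le> (cmod (x - y) + cmod y)\<^sup>2" by (intro power_mono) auto
      also have "\<dots> \<le> 2 * (cmod (x - y))\<^sup>2 + 2 * (cmod y)\<^sup>2"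
        using zero_le_power2[of "cmod (x - y) - cmod y"] by (simp add: power2_sum power2_diff)
      finally show "(cmod (complex_of_real (freq m) * fourier P m))\<^sup>2 \<le>
        2 * (cmod (complex_of_real (freq m) * fourier P m - fourier Q m))\<^sup>2 + 2 * (cmod (fourier Q m))\<^sup>2"
        by (simp add: x_def y_def)
    qed simp
    then have "(\<lambda>m. (cmod (complex_of_real (freq m powr 1) * fourier P m))\<^sup>2) summable_on (- {0})"
      by (simp add: summable_on_subset_banach[of _ UNIV])
    from fourier_Lam[OF this] show ?thesis by simp
  qed
  have C: "fourier (commutator i \<phi> (Lam (- 1) \<eta>)) m = complex_of_real (freq m) * fourier P m - fourier Q m" for m
    unfolding commutator_def Lam_one_Lam_minus_one[OF \<eta>] fourier_diff
    using Lp[of m] by (simp add: P_def Q_def f_def u_def)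
  show "(comm_kernel i \<phi> \<eta> m has_sum fourier (commutator i \<phi> (Lam (- 1) \<eta>)) m) UNIV"
    unfolding C by (rule hs)
  have "((\<lambda>m. (cmod (fourier (commutator i \<phi> (Lam (- 1) \<eta>)) m))\<^sup>2) has_sum (norm (commutator i \<phi> (Lam (- 1) \<eta>)))\<^sup>2) UNIV"
    by (rule fourier_norm_has_sum)
  from has_sum_mono[OF this has_sum_infsum[OF S2(1)]]
  have "(norm (commutator i \<phi> (Lam (- 1) \<eta>)))\<^sup>2 \<le> (\<Sum>\<^sub>\<infinity>m. (S m)\<^sup>2)"
    unfolding C using KS by (simp add: power_mono)
  also have "\<dots> \<le> (wt \<phi> * norm \<eta>)\<^sup>2" using S2(2) by (simp add: power_mult_distrib)
  finally show "norm (commutator i \<phi> (Lam (- 1) \<eta>)) \<le> wt \<phi> * norm \<eta>"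
    by (rule power2_le_imp_le) (simp add: wt_nonneg)
qed

text \<open>Linearity is read off the kernel, since neither \<open>L2_mult\<close> nor the
  description behind \<open>Lam\<close> need be linear outside its proper domain.\<close>

lemma commutator_add_right:
  assumes "\<phi> \<in> Hinf" "\<eta> \<in> H0" "\<zeta> \<in> H0"
  shows "commutator i \<phi> (Lam (- 1) (\<eta> + \<zeta>)) = commutator i \<phi> (Lam (- 1) \<eta>) + commutator i \<phi> (Lam (- 1) \<zeta>)"
proof (rule fourier_eqI)
  fix m
  have "comm_kernel i \<phi> (\<eta> + \<zeta>) m = (\<lambda>j. comm_kernel i \<phi> \<eta> m j + comm_kernel i \<phi> \<zeta> m j)"
    by (rule ext) (simp add: comm_kernel_def fourier_add distrib_left)
  then show "fourier (commutator i \<phi> (Lam (- 1) (\<eta> + \<zeta>))) m = fourier (commutator i \<phi> (Lam (- 1) \<eta>) + commutator i \<phi> (Lam (- 1) \<zeta>)) m"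
    using has_sum_unique[OF commutator_fourier(1)[OF assms(1) H0_add[OF assms(2,3)], of i m]]
      has_sum_add[OF commutator_fourier(1)[OF assms(1,2), of i m] commutator_fourier(1)[OF assms(1,3), of i m]]
    by (simp add: fourier_add)
qed

lemma commutator_scaleR_right:
  assumes "\<phi> \<in> Hinf" "\<eta> \<in> H0"
  shows "commutator i \<phi> (Lam (- 1) (c *\<^sub>R \<eta>)) = c *\<^sub>R commutator i \<phi> (Lam (- 1) \<eta>)"
proof (rule fourier_eqI)
  fix m
  have "comm_kernel i \<phi> (c *\<^sub>R \<eta>) m = (\<lambda>j. complex_of_real c * comm_kernel i \<phi> \<eta> m j)"
    by (rule ext) (simp add: comm_kernel_def fourier_scaleR scaleR_conv_of_real mult_ac)
  then show "fourier (commutator i \<phi> (Lam (- 1) (c *\<^sub>R \<eta>))) m = fourier (c *\<^sub>R commutator i \<phi> (Lam (- 1) \<eta>)) m"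
    using has_sum_unique[OF commutator_fourier(1)[OF assms(1) H0_scaleR[OF assms(2), of c], of i m]]
      has_sum_cmult_right[OF commutator_fourier(1)[OF assms(1,2), of i m], of "complex_of_real c"]
    by (simp add: fourier_scaleR scaleR_conv_of_real)
qed

lemma commutator_add_left:
  assumes "\<phi> \<in> Hinf" "\<psi> \<in> Hinf" "\<eta> \<in> H0"
  shows "commutator i (\<phi> + \<psi>) (Lam (- 1) \<eta>) = commutator i \<phi> (Lam (- 1) \<eta>) + commutator i \<psi> (Lam (- 1) \<eta>)"
proof (rule fourier_eqI)
  fix m
  have "comm_kernel i (\<phi> + \<psi>) \<eta> m = (\<lambda>j. comm_kernel i \<phi> \<eta> m j + comm_kernel i \<psi> \<eta> m j)"
    by (rule ext) (simp add: comm_kernel_def fourier_add algebra_simps)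
  then show "fourier (commutator i (\<phi> + \<psi>) (Lam (- 1) \<eta>)) m = fourier (commutator i \<phi> (Lam (- 1) \<eta>) + commutator i \<psi> (Lam (- 1) \<eta>)) m"
    using has_sum_unique[OF commutator_fourier(1)[OF Hinf_add[OF assms(1,2)] assms(3), of i m]]
      has_sum_add[OF commutator_fourier(1)[OF assms(1,3), of i m] commutator_fourier(1)[OF assms(2,3), of i m]]
    by (simp add: fourier_add)
qed

lemma commutator_scaleR_left:
  assumes "\<phi> \<in> Hinf" "\<eta> \<in> H0"
  shows "commutator i (c *\<^sub>R \<phi>) (Lam (- 1) \<eta>) = c *\<^sub>R commutator i \<phi> (Lam (- 1) \<eta>)"
proof (rule fourier_eqI)
  fix m
  have "comm_kernel i (c *\<^sub>R \<phi>) \<eta> m = (\<lambda>j. complex_of_real c * comm_kernel i \<phi> \<eta> m j)"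
    by (rule ext) (simp add: comm_kernel_def fourier_scaleR scaleR_conv_of_real mult_ac)
  then show "fourier (commutator i (c *\<^sub>R \<phi>) (Lam (- 1) \<eta>)) m = fourier (c *\<^sub>R commutator i \<phi> (Lam (- 1) \<eta>)) m"
    using has_sum_unique[OF commutator_fourier(1)[OF Hinf_scaleR[OF assms(1), of c] assms(2), of i m]]
      has_sum_cmult_right[OF commutator_fourier(1)[OF assms(1,2), of i m], of "complex_of_real c"]
    by (simp add: fourier_scaleR scaleR_conv_of_real)
qed

text \<open>The polarised form of \<open>nonlin\<close>: a difference of quadratic terms becomes two
  trilinear ones, and linearity in the test function permits its truncation.\<close>

definition trilin :: "torus_L2 \<Rightarrow> torus_L2 \<Rightarrow> torus_L2 \<Rightarrow> real" where
  "trilin \<theta> \<eta> \<phi> = - (1/2) * inner (riesz 2 \<theta>) (commutator 1 \<phi> (Lam (- 1) \<eta>))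
     + (1/2) * inner (riesz 1 \<theta>) (commutator 2 \<phi> (Lam (- 1) \<eta>))"

lemma nonlin_trilin: "nonlin \<theta> \<phi> = trilin \<theta> \<theta> \<phi>"
  by (simp add: nonlin_def trilin_def)

lemma trilin_add1: "\<theta> \<in> H0 \<Longrightarrow> \<theta>' \<in> H0 \<Longrightarrow> trilin (\<theta> + \<theta>') \<eta> \<phi> = trilin \<theta> \<eta> \<phi> + trilin \<theta>' \<eta> \<phi>"
  and trilin_scaleR1: "\<theta> \<in> H0 \<Longrightarrow> trilin (c *\<^sub>R \<theta>) \<eta> \<phi> = c * trilin \<theta> \<eta> \<phi>"
  and trilin_add2: "\<eta> \<in> H0 \<Longrightarrow> \<eta>' \<in> H0 \<Longrightarrow> \<phi> \<in> Hinf \<Longrightarrow> trilin \<theta> (\<eta> + \<eta>') \<phi> = trilin \<theta> \<eta> \<phi> + trilin \<theta> \<eta>' \<phi>"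
  and trilin_scaleR2: "\<eta> \<in> H0 \<Longrightarrow> \<phi> \<in> Hinf \<Longrightarrow> trilin \<theta> (c *\<^sub>R \<eta>) \<phi> = c * trilin \<theta> \<eta> \<phi>"
  and trilin_add3: "\<eta> \<in> H0 \<Longrightarrow> \<phi> \<in> Hinf \<Longrightarrow> \<psi> \<in> Hinf \<Longrightarrow> trilin \<theta> \<eta> (\<phi> + \<psi>) = trilin \<theta> \<eta> \<phi> + trilin \<theta> \<eta> \<psi>"
  and trilin_scaleR3: "\<eta> \<in> H0 \<Longrightarrow> \<phi> \<in> Hinf \<Longrightarrow> trilin \<theta> \<eta> (c *\<^sub>R \<phi>) = c * trilin \<theta> \<eta> \<phi>"
  by (simp_all add: trilin_def riesz_add riesz_scaleR commutator_add_right commutator_scaleR_right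
      commutator_add_left commutator_scaleR_left inner_add_left inner_add_right algebra_simps)

text \<open>The Riesz transform contracts H and the commutator is bounded by
  \<open>wt \<phi>\<close>, so \<theta> and \<eta> enter through their L2 norms only. Continuity of
  the nonlinearity under strong convergence in \<open>L2([0,T];H)\<close> rests on this.\<close>

lemma trilin_bound:
  assumes "\<theta> \<in> H0" "\<eta> \<in> H0" "\<phi> \<in> Hinf"
  shows "\<bar>trilin \<theta> \<eta> \<phi>\<bar> \<le> wt_const * norm_Hs 4 \<phi> * norm \<theta> * norm \<eta>"
proof -
  have "\<bar>inner (riesz i \<theta>) (commutator j \<phi> (Lam (- 1) \<eta>))\<bar> \<le> norm \<theta> * (wt \<phi> * norm \<eta>)" for i j
  proof -
    have "\<bar>inner (riesz i \<theta>) (commutator j \<phi> (Lam (- 1) \<eta>))\<bar> \<le> norm (riesz i \<theta>) * norm (commutator j \<phi> (Lam (- 1) \<eta>))"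
      by (rule Cauchy_Schwarz_ineq2)
    also have "\<dots> \<le> norm \<theta> * (wt \<phi> * norm \<eta>)"
      using commutator_fourier(2)[OF assms(3,2)] norm_riesz[OF assms(1)] by (intro mult_mono) auto
    finally show ?thesis .
  qed
  from this[of 2 1] this[of 1 2] have "\<bar>trilin \<theta> \<eta> \<phi>\<bar> \<le> norm \<theta> * (wt \<phi> * norm \<eta>)"
    unfolding trilin_def by linarith
  also have "\<dots> = wt \<phi> * (norm \<theta> * norm \<eta>)" by simp
  also have "\<dots> \<le> (wt_const * norm_Hs 4 \<phi>) * (norm \<theta> * norm \<eta>)"
    using wt_summable_bound(2)[OF Hinf_Hs[OF assms(3)]] by (intro mult_right_mono) auto
  finally show ?thesis by (simp add: mult.assoc)
qed

section \<open>Cancellation of the nonlinearity\<close>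

lemma fourier_bas: "k \<noteq> mode n \<Longrightarrow> k \<noteq> - mode n \<Longrightarrow> fourier (bas n) k = 0"
  by (auto simp: complex_eq_iff Re_fourier Im_fourier bas_def inner_hbas)

text \<open>The trilinear form is a sum over triads \<open>p + q + r = 0\<close> of
  \<open>(1 / |r| - 1 / |p|) (p \<times> q) z\<^sub>p z\<^sub>q z\<^sub>r\<close>; each of the two parts is odd under exchanging
  two members of the triad.\<close>

lemma nonlin_cancel:
  assumes z: "z \<in> H0" "z \<in> Hinf" and S: "finite S" "uminus ` S = S" "\<And>k. k \<notin> S \<Longrightarrow> fourier z k = 0"
  shows "nonlin z z = 0"
proof -
  define Z where "Z = fourier z"
  define cr :: "int \<times> int \<Rightarrow> int \<times> int \<Rightarrow> complex"
    where "cr p q = of_int (fst p * snd q - snd p * fst q)" for p q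
  have Z0: "Z 0 = 0" using z(1) by (simp add: Z_def H0_fourier)
  have ZS: "k \<in> S" if "Z k \<noteq> 0" for k using S(3)[of k] that unfolding Z_def by blast
  have S0: "- k \<in> S \<longleftrightarrow> k \<in> S" for k using S(2) by (metis image_eqI minus_minus)
  have kern: "fourier (commutator i z (Lam (- 1) z)) m = (\<Sum>j\<in>S. comm_kernel i z z m j)" for i m
  proof (rule has_sum_unique[OF commutator_fourier(1)[OF z(2,1)]])
    show "(comm_kernel i z z m has_sum (\<Sum>j\<in>S. comm_kernel i z z m j)) UNIV"
      by (rule has_sum_finite_neutralI[OF S(1)]) (auto simp: comm_kernel_def S(3))
  qed
  have ip: "inner (riesz l z) (commutator i z (Lam (- 1) z)) =
      Re (\<Sum>m\<in>S. fourier (riesz l z) m * cnj (\<Sum>j\<in>S. comm_kernel i z z m j))" for l i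
    unfolding kern[symmetric] Re_sum
  proof (rule has_sum_unique[OF fourier_parseval])
    show "((\<lambda>k. Re (fourier (riesz l z) k * cnj (fourier (commutator i z (Lam (- 1) z)) k))) has_sum
      (\<Sum>m\<in>S. Re (fourier (riesz l z) m * cnj (fourier (commutator i z (Lam (- 1) z)) m)))) UNIV"
      by (rule has_sum_finite_neutralI[OF S(1)]) (auto simp: fourier_riesz[OF z(1)] S(3))
  qed
  define T where "T m q = (inverse (of_real (freq (- m - q))) - inverse (of_real (freq m))) * cr m q * Z m * Z q * Z (- m - q)" for m q
  \<comment> \<open>Conjugating the kernel turns the frequency j of the test function into -j, and
    \<open>cr\<close> changes sign with it; the constant is (2 pi)^2 times 1/2. If Z m or Z (m - j)
    vanishes both sides are zero, and otherwise the frequencies to be inverted are nonzero.\<close>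
  have term_eq: "- (1/2) * (fourier (riesz 2 z) m * cnj (comm_kernel 1 z z m j)) + (1/2) * (fourier (riesz 1 z) m * cnj (comm_kernel 2 z z m j))
     = - 2 * of_real pi ^ 2 * T m (- j)" for m j
  proof (cases "Z m = 0 \<or> Z (m - j) = 0")
    case True
    have "Z (j - m) = cnj (Z (m - j))" using fourier_minus[of z "m - j"] by (simp add: Z_def)
    then show ?thesis using True by (auto simp: T_def fourier_riesz[OF z(1)] comm_kernel_def Z_def[symmetric])
  next
    case False
    have "m \<noteq> 0" "m - j \<noteq> 0" using False Z0 by auto
    then have f: "freq m \<noteq> 0" "freq (m - j) \<noteq> 0" using freq_pos by (metis less_irrefl)+
    have c: "cnj (Z j) = Z (- j)" "cnj (Z (m - j)) = Z (j - m)"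
      using fourier_minus[of z j] fourier_minus[of z "m - j"] by (simp_all add: Z_def)
    have g: "freq (j - m) = freq (m - j)" using freq_minus[of "m - j"] by simp
    have k1: "fourier (riesz 2 z) m * cnj (comm_kernel 1 z z m j) = 4 * of_real pi ^ 2 * (of_int (snd m) * of_int (fst j))
        * (inverse (of_real (freq (m - j))) - inverse (of_real (freq m))) * Z m * Z (- j) * Z (j - m)"
      unfolding fourier_riesz[OF z(1)] comm_kernel_def Z_def[symmetric]
      using f by (simp add: c kcomp_def field_simps power2_eq_square)
    have k2: "fourier (riesz 1 z) m * cnj (comm_kernel 2 z z m j) = 4 * of_real pi ^ 2 * (of_int (fst m) * of_int (snd j))
        * (inverse (of_real (freq (m - j))) - inverse (of_real (freq m))) * Z m * Z (- j) * Z (j - m)"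
      unfolding fourier_riesz[OF z(1)] comm_kernel_def Z_def[symmetric]
      using f by (simp add: c kcomp_def field_simps power2_eq_square)
    have "- m - - j = j - m" by simp
    then show ?thesis unfolding k1 k2 T_def cr_def by (simp add: g) (simp add: algebra_simps)
  qed
  have "nonlin z z = Re (- (1/2) * (\<Sum>m\<in>S. fourier (riesz 2 z) m * cnj (\<Sum>j\<in>S. comm_kernel 1 z z m j))
      + (1/2) * (\<Sum>m\<in>S. fourier (riesz 1 z) m * cnj (\<Sum>j\<in>S. comm_kernel 2 z z m j)))"
    unfolding nonlin_def ip by simp
  also have "- (1/2) * (\<Sum>m\<in>S. fourier (riesz 2 z) m * cnj (\<Sum>j\<in>S. comm_kernel 1 z z m j))
      + (1/2) * (\<Sum>m\<in>S. fourier (riesz 1 z) m * cnj (\<Sum>j\<in>S. comm_kernel 2 z z m j))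
      = (\<Sum>m\<in>S. \<Sum>j\<in>S. - 2 * of_real pi ^ 2 * T m (- j))"
    unfolding term_eq[symmetric] by (simp only: cnj_sum sum_distrib_left sum.distrib)
  also have "\<dots> = - 2 * of_real pi ^ 2 * (\<Sum>m\<in>S. \<Sum>j\<in>S. T m (- j))"
    by (simp only: sum_distrib_left)
  also have "(\<Sum>m\<in>S. \<Sum>j\<in>S. T m (- j)) = (\<Sum>m\<in>S. \<Sum>q\<in>S. T m q)"
    by (intro sum.cong refl sum.reindex_bij_witness[of _ uminus uminus]) (auto simp: S0)
  also have "\<dots> = 0"
  proof -
    \<comment> \<open>T1 is odd under exchanging m and q. T2 is odd under exchanging q with the
      third member -m - q, because the cross product of m with -m - q is minus that of m with
      q.\<close>
    define T1 where "T1 m q = inverse (of_real (freq (- m - q))) * cr m q * Z m * Z q * Z (- m - q)" for m q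
    define T2 where "T2 m q = inverse (of_real (freq m)) * cr m q * Z m * Z q * Z (- m - q)" for m q
    have anti: "T1 m q = - T1 q m" for m q
    proof -
      have "- m - q = - q - m" by simp
      then show ?thesis unfolding T1_def cr_def by (simp only:) (simp add: algebra_simps)
    qed
    have "(\<Sum>m\<in>S. \<Sum>q\<in>S. T1 m q) = (\<Sum>m\<in>S. \<Sum>q\<in>S. - T1 q m)"
      by (intro sum.cong refl anti)
    also have "\<dots> = - (\<Sum>m\<in>S. \<Sum>q\<in>S. T1 q m)" by (simp only: sum_negf)
    also have "(\<Sum>m\<in>S. \<Sum>q\<in>S. T1 q m) = (\<Sum>m\<in>S. \<Sum>q\<in>S. T1 m q)" by (rule sum.swap)
    finally have s1: "(\<Sum>m\<in>S. \<Sum>q\<in>S. T1 m q) = 0" by simp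
    have s2: "(\<Sum>q\<in>S. T2 m q) = 0" for m
    proof -
      have e: "T2 m (- m - q) = - T2 m q" for q
      proof -
        have "- m - (- m - q) = q" by simp
        then show ?thesis unfolding T2_def cr_def by (simp only:) (simp add: algebra_simps)
      qed
      \<comment> \<open>S need not be invariant under q \<mapsto> -m - q. Restricting the sum to the
        part that stays in S costs nothing, since Z vanishes off S.\<close>
      have tz: "T2 m q = 0" if "q \<in> S - {q \<in> S. - m - q \<in> S}" for q
        using ZS[of "- m - q"] that by (auto simp: T2_def)
      have "(\<Sum>q\<in>S. T2 m q) = (\<Sum>q\<in>{q \<in> S. - m - q \<in> S}. T2 m q)"
        by (intro sum.mono_neutral_right S(1) ballI tz) auto
      also have "\<dots> = (\<Sum>q\<in>{q \<in> S. - m - q \<in> S}. T2 m (- m - q))"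
        by (intro sum.reindex_bij_witness[of _ "\<lambda>q. - m - q" "\<lambda>q. - m - q"]) auto
      also have "\<dots> = - (\<Sum>q\<in>{q \<in> S. - m - q \<in> S}. T2 m q)"
        by (simp only: e sum_negf)
      also have "(\<Sum>q\<in>{q \<in> S. - m - q \<in> S}. T2 m q) = (\<Sum>q\<in>S. T2 m q)"
        by (intro sum.mono_neutral_left S(1) ballI tz) auto
      finally show ?thesis by simp
    qed
    have "(\<Sum>m\<in>S. \<Sum>q\<in>S. T m q) = (\<Sum>m\<in>S. \<Sum>q\<in>S. T1 m q) - (\<Sum>m\<in>S. \<Sum>q\<in>S. T2 m q)"
      unfolding sum_subtractf[symmetric] T_def T1_def T2_def by (simp only: left_diff_distrib)
    then show ?thesis using s1 s2 by simp
  qed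
  finally show ?thesis by simp
qed

text \<open>A Hartley function has Fourier coefficients at both k and -k, so the frequency set is
  symmetrised before the triad argument applies.\<close>

lemma nonlin_cancel_span: "nonlin (\<Sum>n<N. c n *\<^sub>R bas n) (\<Sum>n<N. c n *\<^sub>R bas n) = 0"
proof (rule nonlin_cancel)
  define S where "S = mode ` {..<N} \<union> uminus ` mode ` {..<N}"
  show "finite S" by (simp add: S_def)
  show "uminus ` S = S" by (auto simp: S_def image_Un image_image)
  have sum: "fourier (\<Sum>n\<in>A. c n *\<^sub>R bas n) k = (\<Sum>n\<in>A. c n *\<^sub>R fourier (bas n) k)" for A k
    by (induction A rule: infinite_finite_induct) (simp_all add: fourier_add fourier_scaleR)
  show "fourier (\<Sum>n<N. c n *\<^sub>R bas n) k = 0" if "k \<notin> S" for k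
    unfolding sum
  proof (intro sum.neutral ballI)
    fix n assume "n \<in> {..<N}"
    then have "mode n \<in> S" "- mode n \<in> S" by (auto simp: S_def)
    then have "k \<noteq> mode n" "k \<noteq> - mode n" using that by auto
    then show "c n *\<^sub>R fourier (bas n) k = 0" by (simp add: fourier_bas)
  qed
qed (auto intro!: H0_sum H0_scaleR Hinf_sum Hinf_scaleR)

section \<open>Paths and their primitives\<close>

text \<open>Often only the coefficients of a path are known to be continuous or measurable;
  convergence of the partial sums recovers measurability of the path itself.\<close>

lemma borel_measurable_torus_L2_iff_modes:
  assumes f: "\<And>t. t \<in> space M \<Longrightarrow> f t \<in> H0" and c: "\<And>n. (\<lambda>t. inner (f t) (bas n)) \<in> borel_measurable M"
  shows "f \<in> borel_measurable M"
proof (rule borel_measurable_LIMSEQ_metric)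
  show "(\<lambda>t. \<Sum>i<n. inner (f t) (bas i) *\<^sub>R bas i) \<in> borel_measurable M" for n
    by (intro borel_measurable_sum borel_measurable_scaleR c) auto
  show "(\<lambda>n. \<Sum>i<n. inner (f t) (bas i) *\<^sub>R bas i) \<longlonglongrightarrow> f t" if "t \<in> space M" for t
    by (rule H0_expansion[OF f[OF that]])
qed

lemma integrable_upto:
  fixes f :: "real \<Rightarrow> real"
  assumes "integrable (lebesgue_on {0..T}) f" "t \<le> T"
  shows "integrable (lebesgue_on {0..t}) f"
  by (rule integrable_subinterval[OF assms(1)]) (use assms(2) in auto)

lemma AE_upto:
  fixes T t :: real
  assumes "AE s in lebesgue_on {0..T}. P s" "t \<le> T"
  shows "AE s in lebesgue_on {0..t}. P s"
proof -
  have "AE s in lebesgue. s \<in> {0..T} \<longrightarrow> P s"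
    using assms(1) by (subst (asm) AE_restrict_space_iff) auto
  then have "AE s in lebesgue. s \<in> {0..t} \<longrightarrow> P s"
    by eventually_elim (use assms(2) in auto)
  then show ?thesis by (subst AE_restrict_space_iff) auto
qed

lemma measurable_upto:
  fixes T t :: real
  assumes "f \<in> borel_measurable (lebesgue_on {0..T})" "t \<le> T"
  shows "f \<in> borel_measurable (lebesgue_on {0..t})"
  by (rule measurable_restrict_mono[OF assms(1)]) (use assms(2) in auto)

lemma integral_upto:
  fixes f :: "real \<Rightarrow> real"
  assumes "t \<le> T"
  shows "(\<integral>s. f s \<partial>lebesgue_on {0..t}) = (\<integral>s. (if s \<le> t then f s else 0) \<partial>lebesgue_on {0..T})"
proof -
  have "(\<integral>s. (if s \<in> {..t} then f s else 0) \<partial>lebesgue_on {0..T}) = (\<integral>s. f s \<partial>lebesgue_on ({..t} \<inter> {0..T}))"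
    by (rule Lebesgue_Measure.integral_restrict_Int) auto
  moreover have "{..t} \<inter> {0..T} = {0..t}" using assms by auto
  ultimately show ?thesis by (simp only: atMost_iff)
qed

lemma integral_upto_strict:
  fixes f :: "real \<Rightarrow> real"
  assumes t: "t \<le> T" and f: "integrable (lebesgue_on {0..T}) f"
  shows "(\<integral>s. f s \<partial>lebesgue_on {0..t}) = (\<integral>s. (if s < t then f s else 0) \<partial>lebesgue_on {0..T})"
  unfolding integral_upto[OF t]
proof (rule integral_cong_AE)
  have [measurable]: "(\<lambda>s. s) \<in> borel_measurable (lebesgue_on {0..T})" "f \<in> borel_measurable (lebesgue_on {0..T})"
    using f id_borel_measurable_lebesgue_on by (auto simp: id_def)
  show "(\<lambda>s. if s \<le> t then f s else 0) \<in> borel_measurable (lebesgue_on {0..T})"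
    "(\<lambda>s. if s < t then f s else 0) \<in> borel_measurable (lebesgue_on {0..T})"
    by measurable
  have "AE s in lebesgue. s \<noteq> t"
    using AE_lborel_singleton[of t] by (rule AE_completion)
  then have "AE s in lebesgue. s \<in> {0..T} \<longrightarrow> s \<noteq> t" by eventually_elim auto
  then have "AE s in lebesgue_on {0..T}. s \<noteq> t" by (subst AE_restrict_space_iff) auto
  then show "AE s in lebesgue_on {0..T}. (if s \<le> t then f s else 0) = (if s < t then f s else 0)"
    by eventually_elim auto
qed

lemma continuous_integral_upto:
  fixes f :: "real \<Rightarrow> real"
  assumes f: "integrable (lebesgue_on {0..T}) f"
  shows "continuous_on {0..T} (\<lambda>t. \<integral>s. f s \<partial>lebesgue_on {0..t})"
proof -
  have "continuous_on {0..T} (\<lambda>t. integral {0..t} f)"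
    by (rule indefinite_integral_continuous_1) (use integrable_on_lebesgue_on[OF f] in auto)
  moreover have "integral {0..t} f = (\<integral>s. f s \<partial>lebesgue_on {0..t})" if "t \<in> {0..T}" for t
    using that by (intro lebesgue_integral_eq_integral[symmetric] integrable_upto[OF f]) auto
  ultimately show ?thesis by (rule continuous_on_eq)
qed

lemma abs_integral_upto_le:
  fixes f :: "real \<Rightarrow> real"
  assumes f: "integrable (lebesgue_on {0..T}) f" and t: "t \<le> T"
  shows "\<bar>\<integral>s. f s \<partial>lebesgue_on {0..t}\<bar> \<le> (\<integral>s. \<bar>f s\<bar> \<partial>lebesgue_on {0..T})"
proof -
  have [measurable]: "(\<lambda>s. s) \<in> borel_measurable (lebesgue_on {0..T})" "f \<in> borel_measurable (lebesgue_on {0..T})"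
    using f id_borel_measurable_lebesgue_on by (auto simp: id_def)
  have "\<bar>\<integral>s. f s \<partial>lebesgue_on {0..t}\<bar> \<le> (\<integral>s. \<bar>if s \<le> t then f s else 0\<bar> \<partial>lebesgue_on {0..T})"
    unfolding integral_upto[OF t] by (rule integral_abs_bound)
  also have "\<dots> \<le> (\<integral>s. \<bar>f s\<bar> \<partial>lebesgue_on {0..T})"
  proof (rule integral_mono)
    show "integrable (lebesgue_on {0..T}) (\<lambda>s. \<bar>if s \<le> t then f s else 0\<bar>)"
      by (rule Bochner_Integration.integrable_bound[OF f]) auto
  qed (use f in auto)
  finally show ?thesis .
qed

text \<open>Fubini on a square split along its diagonal.\<close>

lemma integral_product_primitives:
  fixes w v :: "real \<Rightarrow> real"
  assumes w: "integrable (lebesgue_on {0..t}) w" and v: "integrable (lebesgue_on {0..t}) v"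
  shows "integrable (lebesgue_on {0..t}) (\<lambda>s. w s * (\<integral>r. v r \<partial>lebesgue_on {0..s}))"
    and "integrable (lebesgue_on {0..t}) (\<lambda>s. v s * (\<integral>r. w r \<partial>lebesgue_on {0..s}))"
    and "(\<integral>s. w s \<partial>lebesgue_on {0..t}) * (\<integral>s. v s \<partial>lebesgue_on {0..t}) =
      (\<integral>s. w s * (\<integral>r. v r \<partial>lebesgue_on {0..s}) + v s * (\<integral>r. w r \<partial>lebesgue_on {0..s}) \<partial>lebesgue_on {0..t})"
proof -
  define M where "M = lebesgue_on {0..t}"
  have wM: "integrable M w" and vM: "integrable M v" using w v by (auto simp: M_def)
  have [measurable]: "(\<lambda>s. s) \<in> borel_measurable M" "w \<in> borel_measurable M" "v \<in> borel_measurable M"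
    using wM vM id_borel_measurable_lebesgue_on by (auto simp: id_def M_def)
  interpret finite_measure M unfolding M_def by (rule finite_measure_lebesgue_on) simp
  interpret pair_sigma_finite M M ..
  have prim: "integrable M (\<lambda>s. a s * (\<integral>r. b r \<partial>lebesgue_on {0..s}))"
    if a: "integrable M a" and b: "integrable M b" for a b :: "real \<Rightarrow> real"
  proof (rule Bochner_Integration.integrable_bound[of _ "\<lambda>s. (\<integral>r. \<bar>b r\<bar> \<partial>M) * a s"])
    have "(\<lambda>s. \<integral>r. b r \<partial>lebesgue_on {0..s}) \<in> borel_measurable M"
      unfolding M_def by (intro continuous_imp_measurable_on_sets_lebesgue continuous_integral_upto)
        (use b in \<open>auto simp: M_def\<close>)
    then show "(\<lambda>s. a s * (\<integral>r. b r \<partial>lebesgue_on {0..s})) \<in> borel_measurable M"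
      using a by auto
    show "AE s in M. norm (a s * (\<integral>r. b r \<partial>lebesgue_on {0..s})) \<le> norm ((\<integral>r. \<bar>b r\<bar> \<partial>M) * a s)"
    proof (rule AE_I2)
      fix s assume "s \<in> space M"
      then have "\<bar>\<integral>r. b r \<partial>lebesgue_on {0..s}\<bar> \<le> (\<integral>r. \<bar>b r\<bar> \<partial>M)"
        unfolding M_def by (intro abs_integral_upto_le) (use b in \<open>auto simp: M_def\<close>)
      then show "norm (a s * (\<integral>r. b r \<partial>lebesgue_on {0..s})) \<le> norm ((\<integral>r. \<bar>b r\<bar> \<partial>M) * a s)"
        by (simp add: abs_mult mult.commute[of "\<bar>a s\<bar>"] mult_right_mono)
    qed
  qed (use a in auto)
  show i1: "integrable (lebesgue_on {0..t}) (\<lambda>s. w s * (\<integral>r. v r \<partial>lebesgue_on {0..s}))"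
    and i2: "integrable (lebesgue_on {0..t}) (\<lambda>s. v s * (\<integral>r. w r \<partial>lebesgue_on {0..s}))"
    using prim[OF wM vM] prim[OF vM wM] by (auto simp: M_def)
  have full: "integrable (M \<Otimes>\<^sub>M M) (\<lambda>p. w (fst p) * v (snd p))"
  proof (rule Fubini_integrable)
    show "integrable M (\<lambda>x. \<integral>y. norm (w (fst (x, y)) * v (snd (x, y))) \<partial>M)"
      using wM by (simp add: abs_mult)
    show "AE x in M. integrable M (\<lambda>y. w (fst (x, y)) * v (snd (x, y)))"
      using vM by simp
  qed measurable
  have g1: "integrable (M \<Otimes>\<^sub>M M) (\<lambda>(s, r). if s \<le> r then w s * v r else 0)"
    by (rule Bochner_Integration.integrable_bound[OF full]) (auto simp: case_prod_beta')
  have g2: "integrable (M \<Otimes>\<^sub>M M) (\<lambda>(s, r). if r < s then w s * v r else 0)"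
    by (rule Bochner_Integration.integrable_bound[OF full]) (auto simp: case_prod_beta')
  have "(\<integral>s. w s \<partial>M) * (\<integral>s. v s \<partial>M) = (\<integral>s. (\<integral>r. w s * v r \<partial>M) \<partial>M)" by simp
  also have "\<dots> = (\<integral>p. w (fst p) * v (snd p) \<partial>(M \<Otimes>\<^sub>M M))"
    using integral_fst'[OF full] by simp
  also have "\<dots> = (\<integral>p. (case p of (s, r) \<Rightarrow> if s \<le> r then w s * v r else 0) + (case p of (s, r) \<Rightarrow> if r < s then w s * v r else 0) \<partial>(M \<Otimes>\<^sub>M M))"
    by (intro Bochner_Integration.integral_cong) auto
  also have "\<dots> = (\<integral>r. (\<integral>s. (if s \<le> r then w s * v r else 0) \<partial>M) \<partial>M) + (\<integral>s. (\<integral>r. (if r < s then w s * v r else 0) \<partial>M) \<partial>M)"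
    unfolding Bochner_Integration.integral_add[OF g1 g2] integral_snd[OF g1] integral_fst[OF g2] ..
  also have "(\<integral>r. (\<integral>s. (if s \<le> r then w s * v r else 0) \<partial>M) \<partial>M) = (\<integral>r. v r * (\<integral>s. w s \<partial>lebesgue_on {0..r}) \<partial>M)"
  proof (rule Bochner_Integration.integral_cong[OF refl])
    fix r assume "r \<in> space M"
    then have "r \<le> t" by (simp add: M_def)
    have "(\<integral>s. (if s \<le> r then w s * v r else 0) \<partial>M) = (\<integral>s. v r * (if s \<le> r then w s else 0) \<partial>M)"
      by (intro Bochner_Integration.integral_cong) auto
    then show "(\<integral>s. (if s \<le> r then w s * v r else 0) \<partial>M) = v r * (\<integral>s. w s \<partial>lebesgue_on {0..r})"
      using integral_upto[OF \<open>r \<le> t\<close>, of w] by (simp add: M_def)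
  qed
  also have "(\<integral>s. (\<integral>r. (if r < s then w s * v r else 0) \<partial>M) \<partial>M) = (\<integral>s. w s * (\<integral>r. v r \<partial>lebesgue_on {0..s}) \<partial>M)"
  proof (rule Bochner_Integration.integral_cong[OF refl])
    fix s assume "s \<in> space M"
    then have "s \<le> t" by (simp add: M_def)
    have "(\<integral>r. (if r < s then w s * v r else 0) \<partial>M) = (\<integral>r. w s * (if r < s then v r else 0) \<partial>M)"
      by (intro Bochner_Integration.integral_cong) auto
    then show "(\<integral>r. (if r < s then w s * v r else 0) \<partial>M) = w s * (\<integral>r. v r \<partial>lebesgue_on {0..s})"
      using integral_upto_strict[OF \<open>s \<le> t\<close> v] by (simp add: M_def)
  qed
  finally show "(\<integral>s. w s \<partial>lebesgue_on {0..t}) * (\<integral>s. v s \<partial>lebesgue_on {0..t}) =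
      (\<integral>s. w s * (\<integral>r. v r \<partial>lebesgue_on {0..s}) + v s * (\<integral>r. w r \<partial>lebesgue_on {0..s}) \<partial>lebesgue_on {0..t})"
    using i1 i2 by (simp add: M_def)
qed

text \<open>The product rule for absolutely continuous functions given as primitives of merely
  integrable densities. It is used with coefficients of a test function and, with u = p, for the
  squares in the energy balance.\<close>

lemma product_rule_primitives:
  fixes u p :: "real \<Rightarrow> real"
  assumes w: "integrable (lebesgue_on {0..T}) w" and v: "integrable (lebesgue_on {0..T}) v"
    and u: "\<And>s. s \<in> {0..T} \<Longrightarrow> u s = u0 + (\<integral>r. w r \<partial>lebesgue_on {0..s})"
    and p: "\<And>s. s \<in> {0..T} \<Longrightarrow> p s = p0 + (\<integral>r. v r \<partial>lebesgue_on {0..s})"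
    and t: "t \<in> {0..T}"
  shows "integrable (lebesgue_on {0..t}) (\<lambda>s. w s * p s + v s * u s)"
    and "u t * p t = u0 * p0 + (\<integral>s. w s * p s + v s * u s \<partial>lebesgue_on {0..t})"
proof -
  have wt: "integrable (lebesgue_on {0..t}) w" and vt: "integrable (lebesgue_on {0..t}) v"
    using integrable_upto[OF w] integrable_upto[OF v] t by auto
  note I = integral_product_primitives[OF wt vt]
  have e: "w s * p s + v s * u s = (p0 * w s + u0 * v s) + (w s * (\<integral>r. v r \<partial>lebesgue_on {0..s}) + v s * (\<integral>r. w r \<partial>lebesgue_on {0..s}))"
    if "s \<in> {0..t}" for s
    using that t by (simp add: u p algebra_simps)
  have i: "integrable (lebesgue_on {0..t}) (\<lambda>s. (p0 * w s + u0 * v s) + (w s * (\<integral>r. v r \<partial>lebesgue_on {0..s}) + v s * (\<integral>r. w r \<partial>lebesgue_on {0..s})))"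
    using wt vt I by auto
  show "integrable (lebesgue_on {0..t}) (\<lambda>s. w s * p s + v s * u s)"
    using i by (rule Bochner_Integration.integrable_cong[THEN iffD1, OF refl, rotated]) (simp add: e)
  have "(\<integral>s. w s * p s + v s * u s \<partial>lebesgue_on {0..t}) = (\<integral>s. (p0 * w s + u0 * v s) + (w s * (\<integral>r. v r \<partial>lebesgue_on {0..s}) + v s * (\<integral>r. w r \<partial>lebesgue_on {0..s})) \<partial>lebesgue_on {0..t})"
    by (intro Bochner_Integration.integral_cong) (auto simp: e)
  also have "\<dots> = (p0 * (\<integral>s. w s \<partial>lebesgue_on {0..t}) + u0 * (\<integral>s. v s \<partial>lebesgue_on {0..t})) +
     (\<integral>s. w s \<partial>lebesgue_on {0..t}) * (\<integral>s. v s \<partial>lebesgue_on {0..t})"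
    using wt vt I by simp
  finally show "u t * p t = u0 * p0 + (\<integral>s. w s * p s + v s * u s \<partial>lebesgue_on {0..t})"
    using t by (simp add: u p algebra_simps)
qed

section \<open>Truncation and continuity of the nonlinearity\<close>

definition trunc :: "nat \<Rightarrow> torus_L2 \<Rightarrow> torus_L2" where
  "trunc N f = (\<Sum>n<N. inner f (bas n) *\<^sub>R bas n)"

lemma inner_trunc_bas: "inner (trunc N f) (bas n) = (if n < N then inner f (bas n) else 0)"
  unfolding trunc_def by (simp add: inner_sum_orthonormal[OF orthonormal_bas])

lemma trunc_Hinf [simp]: "trunc N f \<in> Hinf" and trunc_H0 [simp]: "trunc N f \<in> H0"
  unfolding trunc_def by (auto intro!: Hinf_sum Hinf_scaleR H0_sum H0_scaleR)

lemma inner_trunc: "inner f (trunc N h) = (\<Sum>n<N. inner f (bas n) * inner h (bas n))"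
  unfolding trunc_def by (simp add: inner_sum_right mult.commute)

lemma norm_Hs_trunc_diff:
  assumes "f \<in> Hs r"
  shows "(norm_Hs r (f - trunc N f))\<^sup>2 = (norm_Hs r f)\<^sup>2 - (\<Sum>n<N. (lam n powr r * inner f (bas n))\<^sup>2)"
proof -
  have d: "f - trunc N f \<in> Hs r" by (intro Hs_diff assms Hinf_Hs) simp
  have "(\<lambda>n. (lam n powr r * inner f (bas n))\<^sup>2 - (if n \<in> {..<N} then (lam n powr r * inner f (bas n))\<^sup>2 else 0)) sums
      ((norm_Hs r f)\<^sup>2 - (\<Sum>n<N. (lam n powr r * inner f (bas n))\<^sup>2))"
    by (intro sums_diff norm_Hs_sums assms sums_If_finite_set) simp
  moreover have "(lam n powr r * inner f (bas n))\<^sup>2 - (if n \<in> {..<N} then (lam n powr r * inner f (bas n))\<^sup>2 else 0)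
      = (lam n powr r * inner (f - trunc N f) (bas n))\<^sup>2" for n
    by (simp add: inner_diff_left inner_trunc_bas)
  ultimately show ?thesis using sums_unique2[OF norm_Hs_sums[OF d]] by simp
qed

lemma norm_Hs_trunc_le:
  assumes "f \<in> Hs r" shows "norm_Hs r (trunc N f) \<le> norm_Hs r f"
proof -
  have t: "trunc N f \<in> Hs r" by (intro Hinf_Hs) simp
  have "(norm_Hs r (trunc N f))\<^sup>2 \<le> (norm_Hs r f)\<^sup>2"
    by (rule sums_le[OF _ norm_Hs_sums[OF t] norm_Hs_sums[OF assms]]) (simp add: inner_trunc_bas)
  then show ?thesis by (rule power2_le_imp_le) simp
qed

lemma norm_trunc_le: "f \<in> H0 \<Longrightarrow> norm (trunc N f) \<le> norm f"
  using norm_Hs_trunc_le[of f 0 N] by (simp add: norm_Hs_0)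

lemma norm_Hs_trunc_tendsto:
  assumes "f \<in> Hs r" shows "(\<lambda>N. norm_Hs r (f - trunc N f)) \<longlonglongrightarrow> 0"
proof -
  have "(\<lambda>N. (norm_Hs r f)\<^sup>2 - (\<Sum>n<N. (lam n powr r * inner f (bas n))\<^sup>2)) \<longlonglongrightarrow> (norm_Hs r f)\<^sup>2 - (norm_Hs r f)\<^sup>2"
    using norm_Hs_sums[OF assms] by (intro tendsto_intros) (simp add: sums_def)
  then have "(\<lambda>N. (norm_Hs r (f - trunc N f))\<^sup>2) \<longlonglongrightarrow> 0"
    by (simp add: norm_Hs_trunc_diff[OF assms])
  from tendsto_real_sqrt[OF this] show ?thesis by simp
qed

lemma abs_sum_coeff_le:
  assumes "f \<in> H0" "h \<in> H0"
  shows "\<bar>\<Sum>n<N. inner f (bas n) * inner h (bas n)\<bar> \<le> norm f * norm h"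
proof -
  have "\<bar>inner f (trunc N h)\<bar> \<le> norm f * norm (trunc N h)" by (rule Cauchy_Schwarz_ineq2)
  also have "\<dots> \<le> norm f * norm h" using norm_trunc_le[OF assms(2)] by (intro mult_left_mono) auto
  finally show ?thesis by (simp add: inner_trunc)
qed

lemma trilin_zero3: "\<eta> \<in> H0 \<Longrightarrow> trilin \<theta> \<eta> 0 = 0"
  using trilin_scaleR3[of \<eta> 0 \<theta> 0] by simp

lemma trilin_diff3: "\<eta> \<in> H0 \<Longrightarrow> \<phi> \<in> Hinf \<Longrightarrow> \<psi> \<in> Hinf \<Longrightarrow> trilin \<theta> \<eta> (\<phi> - \<psi>) = trilin \<theta> \<eta> \<phi> - trilin \<theta> \<eta> \<psi>"
  using trilin_add3[of \<eta> \<phi> "(-1) *\<^sub>R \<psi>" \<theta>] trilin_scaleR3[of \<eta> \<psi> \<theta> "-1"] Hinf_scaleR[of \<psi> "-1"] by simp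

lemma trilin_diff2: "\<eta> \<in> H0 \<Longrightarrow> \<zeta> \<in> H0 \<Longrightarrow> \<phi> \<in> Hinf \<Longrightarrow> trilin \<theta> (\<eta> - \<zeta>) \<phi> = trilin \<theta> \<eta> \<phi> - trilin \<theta> \<zeta> \<phi>"
  using trilin_add2[of \<eta> "(-1) *\<^sub>R \<zeta>" \<phi> \<theta>] trilin_scaleR2[of \<zeta> \<phi> \<theta> "-1"] H0_uminus[of \<zeta>] by simp

lemma trilin_diff1: "\<theta> \<in> H0 \<Longrightarrow> \<zeta> \<in> H0 \<Longrightarrow> trilin (\<theta> - \<zeta>) \<eta> \<phi> = trilin \<theta> \<eta> \<phi> - trilin \<zeta> \<eta> \<phi>"
  using trilin_add1[of \<theta> "(-1) *\<^sub>R \<zeta>" \<eta> \<phi>] trilin_scaleR1[of \<zeta> "-1" \<eta> \<phi>] H0_uminus[of \<zeta>] by simp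

lemma nonlin_bound: "\<theta> \<in> H0 \<Longrightarrow> \<phi> \<in> Hinf \<Longrightarrow> \<bar>nonlin \<theta> \<phi>\<bar> \<le> wt_const * norm_Hs 4 \<phi> * (norm \<theta>)\<^sup>2"
  using trilin_bound[of \<theta> \<theta> \<phi>] by (simp add: nonlin_trilin power2_eq_square mult.assoc)

lemma nonlin_diff_bound:
  assumes "\<theta> \<in> H0" "\<eta> \<in> H0" "\<phi> \<in> Hinf"
  shows "\<bar>nonlin \<theta> \<phi> - nonlin \<eta> \<phi>\<bar> \<le> wt_const * norm_Hs 4 \<phi> * norm (\<theta> - \<eta>) * (norm \<theta> + norm \<eta>)"
proof -
  have "nonlin \<theta> \<phi> - nonlin \<eta> \<phi> = trilin (\<theta> - \<eta>) \<theta> \<phi> + trilin \<eta> (\<theta> - \<eta>) \<phi>"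
    using assms by (simp add: nonlin_trilin trilin_diff1 trilin_diff2)
  then have "\<bar>nonlin \<theta> \<phi> - nonlin \<eta> \<phi>\<bar> \<le> \<bar>trilin (\<theta> - \<eta>) \<theta> \<phi>\<bar> + \<bar>trilin \<eta> (\<theta> - \<eta>) \<phi>\<bar>" by simp
  also have "\<dots> \<le> wt_const * norm_Hs 4 \<phi> * norm (\<theta> - \<eta>) * norm \<theta> + wt_const * norm_Hs 4 \<phi> * norm \<eta> * norm (\<theta> - \<eta>)"
    using assms by (intro add_mono trilin_bound H0_diff)
  also have "\<dots> = wt_const * norm_Hs 4 \<phi> * norm (\<theta> - \<eta>) * (norm \<theta> + norm \<eta>)" by (simp add: algebra_simps)
  finally show ?thesis .
qed

lemma nonlin_trunc_sum:
  assumes "\<theta> \<in> H0"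
  shows "nonlin \<theta> (trunc N \<phi>) = (\<Sum>n<N. inner \<phi> (bas n) * nonlin \<theta> (bas n))"
proof -
  have "trilin \<theta> \<theta> (\<Sum>n\<in>A. inner \<phi> (bas n) *\<^sub>R bas n) = (\<Sum>n\<in>A. inner \<phi> (bas n) * trilin \<theta> \<theta> (bas n))" for A
    by (induction A rule: infinite_finite_induct)
      (simp_all add: trilin_zero3 assms trilin_add3 trilin_scaleR3 Hinf_scaleR Hinf_sum)
  then show ?thesis by (simp add: nonlin_trilin trunc_def)
qed

text \<open>Truncations of an element of \<open>Hinf\<close> converge in every Sobolev norm, in
  particular in H^4, which controls \<open>nonlin\<close> linearly in the test function.\<close>

lemma nonlin_trunc_tendsto:
  assumes "\<theta> \<in> H0" "\<phi> \<in> Hinf"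
  shows "(\<lambda>N. nonlin \<theta> (trunc N \<phi>)) \<longlonglongrightarrow> nonlin \<theta> \<phi>"
proof -
  have "(\<lambda>N. wt_const * norm_Hs 4 (\<phi> - trunc N \<phi>) * (norm \<theta>)\<^sup>2) \<longlonglongrightarrow> wt_const * 0 * (norm \<theta>)\<^sup>2"
    by (intro tendsto_intros norm_Hs_trunc_tendsto Hinf_Hs assms)
  then have lim: "(\<lambda>N. wt_const * norm_Hs 4 (\<phi> - trunc N \<phi>) * (norm \<theta>)\<^sup>2) \<longlonglongrightarrow> 0" by simp
  have le: "norm (nonlin \<theta> (trunc N \<phi>) - nonlin \<theta> \<phi>) \<le> wt_const * norm_Hs 4 (\<phi> - trunc N \<phi>) * (norm \<theta>)\<^sup>2" for N
  proof -
    have "\<bar>nonlin \<theta> \<phi> - nonlin \<theta> (trunc N \<phi>)\<bar> = \<bar>nonlin \<theta> (\<phi> - trunc N \<phi>)\<bar>"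
      using assms by (simp add: nonlin_trilin trilin_diff3)
    also have "\<dots> \<le> wt_const * norm_Hs 4 (\<phi> - trunc N \<phi>) * (norm \<theta>)\<^sup>2"
      using assms by (intro nonlin_bound Hinf_diff) auto
    finally show ?thesis by (simp add: abs_minus_commute)
  qed
  have "(\<lambda>N. nonlin \<theta> (trunc N \<phi>) - nonlin \<theta> \<phi>) \<longlonglongrightarrow> 0"
    by (rule Lim_null_comparison[OF always_eventually[OF allI[OF le]] lim])
  then show ?thesis by (rule LIM_zero_cancel)
qed

text \<open>\<open>\<theta> \<mapsto> nonlin \<theta> \<phi>\<close> is controlled on \<open>H\<close> only, so it is precomposed with the projection onto
  \<open>H\<close> to obtain a function that is continuous everywhere.\<close>

definition mean_free :: "torus_L2 \<Rightarrow> torus_L2" where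
  "mean_free f = f - inner f (hbas 0) *\<^sub>R hbas 0"

lemma mean_free_H0 [simp]: "mean_free f \<in> H0"
  by (simp add: H0_iff mean_free_def inner_diff_left inner_hbas)

lemma mean_free_id: "f \<in> H0 \<Longrightarrow> mean_free f = f"
  by (simp add: H0_iff mean_free_def)

lemma continuous_mean_free [continuous_intros]: "continuous_on A mean_free"
  unfolding mean_free_def by (intro continuous_intros)

lemma inner_mean_free: "h \<in> H0 \<Longrightarrow> inner h (mean_free f) = inner h f"
  by (simp add: H0_iff mean_free_def inner_diff_right)

lemma norm_mean_free_le: "norm (mean_free f) \<le> norm f"
proof -
  have "(norm (mean_free f))\<^sup>2 = inner (mean_free f) f"
    unfolding power2_norm_eq_inner by (rule inner_mean_free) simp
  also have "\<dots> \<le> norm (mean_free f) * norm f" by (rule norm_cauchy_schwarz)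
  finally show ?thesis
    by (cases "norm (mean_free f) = 0") (auto simp: power2_eq_square)
qed

lemma continuous_nonlin:
  assumes \<phi>: "\<phi> \<in> Hinf" shows "continuous_on UNIV (\<lambda>\<theta>. nonlin (mean_free \<theta>) \<phi>)"
proof (rule continuous_at_imp_continuous_on, intro ballI)
  fix \<theta> :: torus_L2
  let ?b = "\<lambda>\<eta>. wt_const * norm_Hs 4 \<phi> * norm (mean_free \<eta> - mean_free \<theta>) * (norm (mean_free \<eta>) + norm (mean_free \<theta>))"
  have mf: "(mean_free \<longlongrightarrow> mean_free \<theta>) (at \<theta>)"
    using continuous_mean_free[of UNIV] by (simp add: continuous_on_def)
  have "(?b \<longlongrightarrow> wt_const * norm_Hs 4 \<phi> * norm (mean_free \<theta> - mean_free \<theta>) * (norm (mean_free \<theta>) + norm (mean_free \<theta>))) (at \<theta>)"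
    by (intro tendsto_intros mf)
  then have "(?b \<longlongrightarrow> 0) (at \<theta>)" by simp
  then have "((\<lambda>\<eta>. nonlin (mean_free \<eta>) \<phi> - nonlin (mean_free \<theta>) \<phi>) \<longlongrightarrow> 0) (at \<theta>)"
    by (rule Lim_null_comparison[OF always_eventually[OF allI], rotated])
      (simp only: real_norm_def nonlin_diff_bound[OF mean_free_H0 mean_free_H0 \<phi>])
  then have "((\<lambda>\<eta>. nonlin (mean_free \<eta>) \<phi>) \<longlongrightarrow> nonlin (mean_free \<theta>) \<phi>) (at \<theta>)"
    by (rule LIM_zero_cancel)
  then show "isCont (\<lambda>\<theta>. nonlin (mean_free \<theta>) \<phi>) \<theta>" by (simp add: isCont_def)
qed

lemma measurable_nonlin:
  assumes "\<phi> \<in> Hinf" "f \<in> borel_measurable M" "\<And>t. t \<in> space M \<Longrightarrow> f t \<in> H0"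
  shows "(\<lambda>t. nonlin (f t) \<phi>) \<in> borel_measurable M"
proof -
  have "(\<lambda>t. nonlin (mean_free (f t)) \<phi>) \<in> borel_measurable M"
    using measurable_compose[OF assms(2) borel_measurable_continuous_onI[OF continuous_nonlin[OF assms(1)]]] .
  then show ?thesis
    by (rule measurable_cong[THEN iffD1, rotated]) (simp add: assms(3) mean_free_id)
qed

section \<open>Weak solutions mode by mode\<close>

lemma norm_Hs_minus_commute: "f \<in> Hs r \<Longrightarrow> g \<in> Hs r \<Longrightarrow> norm_Hs r (f - g) = norm_Hs r (g - f)"
  using norm_Hs_scaleR[OF Hs_diff[of f r g], of "-1"] by simp

lemma norm_Hs_triangle_sub: "f \<in> Hs r \<Longrightarrow> g \<in> Hs r \<Longrightarrow> norm_Hs r f \<le> norm_Hs r g + norm_Hs r (f - g)"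
  using norm_Hs_triangle[of g r "f - g"] by (simp add: Hs_diff)

text \<open>Differentiability implies continuity, carried out directly for \<open>norm_Hs r\<close>,
  because the difference quotients of a test function converge in this family of norms and not in
  the norm of a type.\<close>

lemma difference_quotient_continuous:
  fixes \<Phi> \<Psi> :: "real \<Rightarrow> torus_L2"
  assumes H: "\<And>t. t \<in> A \<Longrightarrow> \<Phi> t \<in> Hs r" "\<And>t. t \<in> A \<Longrightarrow> \<Psi> t \<in> Hs r"
    and d: "\<And>t. t \<in> A \<Longrightarrow> ((\<lambda>s. norm_Hs r ((\<Phi> s - \<Phi> t) /\<^sub>R (s - t) - \<Psi> t)) \<longlongrightarrow> 0) (at t within A)"
  shows "continuous_on A (\<lambda>t. norm_Hs r (\<Phi> t))"
    and "t \<in> A \<Longrightarrow> ((\<lambda>s. norm_Hs r (\<Phi> s - \<Phi> t)) \<longlongrightarrow> 0) (at t within A)"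
proof -
  have lim: "((\<lambda>s. norm_Hs r (\<Phi> s - \<Phi> t)) \<longlongrightarrow> 0) (at t within A)" if t: "t \<in> A" for t
  proof (rule Lim_null_comparison)
    let ?q = "\<lambda>s. norm_Hs r ((\<Phi> s - \<Phi> t) /\<^sub>R (s - t) - \<Psi> t)"
    have "((\<lambda>s. \<bar>s - t\<bar> * (?q s + norm_Hs r (\<Psi> t))) \<longlongrightarrow> \<bar>t - t\<bar> * (0 + norm_Hs r (\<Psi> t))) (at t within A)"
      by (intro tendsto_intros d[OF t])
    then show "((\<lambda>s. \<bar>s - t\<bar> * (?q s + norm_Hs r (\<Psi> t))) \<longlongrightarrow> 0) (at t within A)" by simp
    have "\<forall>\<^sub>F s in at t within A. s \<in> A \<and> s \<noteq> t" by (simp add: eventually_at_filter)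
    then show "\<forall>\<^sub>F s in at t within A. norm (norm_Hs r (\<Phi> s - \<Phi> t)) \<le> \<bar>s - t\<bar> * (?q s + norm_Hs r (\<Psi> t))"
    proof eventually_elim
      case (elim s)
      have Q: "(\<Phi> s - \<Phi> t) /\<^sub>R (s - t) \<in> Hs r" using elim t by (intro Hs_scaleR Hs_diff H) auto
      have "\<Phi> s - \<Phi> t = (s - t) *\<^sub>R ((\<Phi> s - \<Phi> t) /\<^sub>R (s - t))" using elim by simp
      then have "norm_Hs r (\<Phi> s - \<Phi> t) = \<bar>s - t\<bar> * norm_Hs r ((\<Phi> s - \<Phi> t) /\<^sub>R (s - t))"
        using norm_Hs_scaleR[OF Q, of "s - t"] by simp
      also have "\<dots> \<le> \<bar>s - t\<bar> * (?q s + norm_Hs r (\<Psi> t))"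
        using norm_Hs_triangle_sub[OF Q H(2)[OF t]] by (intro mult_left_mono) auto
      finally show ?case by simp
    qed
  qed
  then show "t \<in> A \<Longrightarrow> ((\<lambda>s. norm_Hs r (\<Phi> s - \<Phi> t)) \<longlongrightarrow> 0) (at t within A)" .
  show "continuous_on A (\<lambda>t. norm_Hs r (\<Phi> t))"
    unfolding continuous_on_def
  proof
    fix t assume t: "t \<in> A"
    have "((\<lambda>s. norm_Hs r (\<Phi> s) - norm_Hs r (\<Phi> t)) \<longlongrightarrow> 0) (at t within A)"
    proof (rule Lim_null_comparison[OF _ lim[OF t]])
      have "\<forall>\<^sub>F s in at t within A. s \<in> A" by (simp add: eventually_at_filter)
      then show "\<forall>\<^sub>F s in at t within A. norm (norm_Hs r (\<Phi> s) - norm_Hs r (\<Phi> t)) \<le> norm_Hs r (\<Phi> s - \<Phi> t)"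
      proof eventually_elim
        case (elim s)
        show ?case
          using norm_Hs_triangle_sub[OF H(1)[OF elim] H(1)[OF t]] norm_Hs_triangle_sub[OF H(1)[OF t] H(1)[OF elim]]
            norm_Hs_minus_commute[OF H(1)[OF elim] H(1)[OF t]] by (simp add: abs_le_iff)
      qed
    qed
    then show "((\<lambda>t. norm_Hs r (\<Phi> t)) \<longlongrightarrow> norm_Hs r (\<Phi> t)) (at t within A)"
      by (rule LIM_zero_cancel)
  qed
qed

text \<open>Collects what the passage to the limit consumes: uniform Sobolev bounds on [0,T] for the
  majorants, coefficients as primitives for the product rule, and the identification of
  \<open>vector_derivative\<close>, which is unique because T > 0 makes every point of the interval
  a limit point.\<close>

lemma test_function_derivative:
  assumes T: "0 < T" and \<phi>: "\<phi> \<in> test_functions T"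
  obtains \<psi> where "\<And>t. t \<in> {0..T} \<Longrightarrow> \<phi> t \<in> Hinf" "\<And>t. t \<in> {0..T} \<Longrightarrow> \<psi> t \<in> Hinf"
    "\<And>r. 0 < r \<Longrightarrow> \<exists>C. \<forall>t\<in>{0..T}. norm_Hs r (\<phi> t) \<le> C"
    "\<exists>C. \<forall>t\<in>{0..T}. norm (\<psi> t) \<le> C"
    "\<And>n. continuous_on {0..T} (\<lambda>t. inner (\<psi> t) (bas n))"
    "\<And>n t. t \<in> {0..T} \<Longrightarrow> inner (\<phi> t) (bas n) = inner (\<phi> 0) (bas n) + (\<integral>s. inner (\<psi> s) (bas n) \<partial>lebesgue_on {0..t})"
    "\<And>t. t \<in> {0..T} \<Longrightarrow> vector_derivative \<phi> (at t within {0..T}) = \<psi> t"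
proof -
  obtain \<Phi> :: "nat \<Rightarrow> real \<Rightarrow> torus_L2" where \<Phi>0: "\<And>t. t \<in> {0..T} \<Longrightarrow> \<Phi> 0 t = \<phi> t"
    and \<Phi>i: "\<And>n t. t \<in> {0..T} \<Longrightarrow> \<Phi> n t \<in> Hinf"
    and \<Phi>d: "\<And>n t r. t \<in> {0..T} \<Longrightarrow> 0 < r \<Longrightarrow>
      ((\<lambda>s. norm_Hs r ((\<Phi> n s - \<Phi> n t) /\<^sub>R (s - t) - \<Phi> (Suc n) t)) \<longlongrightarrow> 0) (at t within {0..T})"
    using \<phi> unfolding test_functions_def by blast
  have cont: "continuous_on {0..T} (\<lambda>t. norm_Hs r (\<Phi> n t))"
    and lim: "t \<in> {0..T} \<Longrightarrow> ((\<lambda>s. norm_Hs r (\<Phi> n s - \<Phi> n t)) \<longlongrightarrow> 0) (at t within {0..T})" if "0 < r" for r n t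
    by (rule difference_quotient_continuous[of "{0..T}" "\<Phi> n" r "\<Phi> (Suc n)"]; use \<Phi>i \<Phi>d[OF _ that] Hinf_Hs in auto)+
  have bdd: "\<exists>C. \<forall>t\<in>{0..T}. norm_Hs r (\<Phi> n t) \<le> C" if r: "0 < r" for r n
  proof -
    have "compact ((\<lambda>t. norm_Hs r (\<Phi> n t)) ` {0..T})"
      by (rule compact_continuous_image[OF cont[OF r]]) simp
    then have "bounded ((\<lambda>t. norm_Hs r (\<Phi> n t)) ` {0..T})" by (rule compact_imp_bounded)
    then show ?thesis by (auto simp: bounded_iff)
  qed
  have n1: "norm f \<le> norm_Hs 1 f" if "f \<in> Hinf" for f
    by (rule norm_le_norm_Hs[OF Hinf_Hs[OF that]]) simp
  have hvd: "(\<Phi> n has_vector_derivative \<Phi> (Suc n) t) (at t within {0..T})" if t: "t \<in> {0..T}" for n t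
    unfolding has_vector_derivative_def has_derivative_iff_norm
  proof (intro conjI bounded_linear_scaleR_left)
    show "((\<lambda>s. norm (\<Phi> n s - \<Phi> n t - (s - t) *\<^sub>R \<Phi> (Suc n) t) / norm (s - t)) \<longlongrightarrow> 0) (at t within {0..T})"
    \<comment> \<open>Exponent 1 is one choice of a positive exponent: convergence in such a Sobolev
      norm implies convergence in L2.\<close>
    proof (rule Lim_null_comparison[OF _ \<Phi>d[OF t zero_less_one]])
      have "\<forall>\<^sub>F s in at t within {0..T}. s \<in> {0..T} \<and> s \<noteq> t" by (simp add: eventually_at_filter)
      then show "\<forall>\<^sub>F s in at t within {0..T}. norm (norm (\<Phi> n s - \<Phi> n t - (s - t) *\<^sub>R \<Phi> (Suc n) t) / norm (s - t))
          \<le> norm_Hs 1 ((\<Phi> n s - \<Phi> n t) /\<^sub>R (s - t) - \<Phi> (Suc n) t)"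
      proof eventually_elim
        case (elim s)
        let ?q = "(\<Phi> n s - \<Phi> n t) /\<^sub>R (s - t) - \<Phi> (Suc n) t"
        have "\<Phi> n s - \<Phi> n t - (s - t) *\<^sub>R \<Phi> (Suc n) t = (s - t) *\<^sub>R ?q"
          using elim by (simp add: scaleR_right_diff_distrib)
        then have "norm (\<Phi> n s - \<Phi> n t - (s - t) *\<^sub>R \<Phi> (Suc n) t) / norm (s - t) = norm ?q"
          using elim by simp
        also have "\<dots> \<le> norm_Hs 1 ?q"
          using elim t by (intro n1 Hinf_diff Hinf_scaleR \<Phi>i) auto
        finally show ?case by simp
      qed
    qed
  qed
  have hvd_inner: "((\<lambda>t. inner (\<Phi> n t) (bas m)) has_vector_derivative inner (\<Phi> (Suc n) t) (bas m)) (at t within {0..T})"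
    if t: "t \<in> {0..T}" for n t m
    by (rule bounded_linear.has_vector_derivative[OF bounded_linear_inner_left hvd[OF t]])
  have ic: "continuous_on {0..T} (\<lambda>t. inner (\<Phi> n t) (bas m))" for n m
    using hvd_inner by (rule continuous_on_vector_derivative)
  show ?thesis
  proof (rule that[of "\<Phi> 1"])
    show "\<phi> t \<in> Hinf" "\<Phi> 1 t \<in> Hinf" if "t \<in> {0..T}" for t using \<Phi>i[OF that] \<Phi>0[OF that] by metis+
    show "\<exists>C. \<forall>t\<in>{0..T}. norm_Hs r (\<phi> t) \<le> C" if "0 < r" for r using bdd[OF that, of 0] \<Phi>0 by simp
    show "\<exists>C. \<forall>t\<in>{0..T}. norm (\<Phi> 1 t) \<le> C"
      using bdd[of 1 1] n1 \<Phi>i by (meson order_trans zero_less_one)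
    show "continuous_on {0..T} (\<lambda>t. inner (\<Phi> 1 t) (bas n))" for n by (rule ic)
    show "inner (\<phi> t) (bas n) = inner (\<phi> 0) (bas n) + (\<integral>s. inner (\<Phi> 1 s) (bas n) \<partial>lebesgue_on {0..t})"
      if t: "t \<in> {0..T}" for n t
    proof -
      have "((\<lambda>s. inner (\<Phi> 1 s) (bas n)) has_integral (inner (\<Phi> 0 t) (bas n) - inner (\<Phi> 0 0) (bas n))) {0..t}"
      proof (rule fundamental_theorem_of_calculus)
        fix s assume s: "s \<in> {0..t}"
        then have "((\<lambda>t. inner (\<Phi> 0 t) (bas n)) has_vector_derivative inner (\<Phi> 1 s) (bas n)) (at s within {0..T})"
          using hvd_inner[of s 0 n] t by auto
        then show "((\<lambda>t. inner (\<Phi> 0 t) (bas n)) has_vector_derivative inner (\<Phi> 1 s) (bas n)) (at s within {0..t})"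
          by (rule has_vector_derivative_within_subset) (use t in auto)
      qed (use t in auto)
      moreover have "(\<integral>s. inner (\<Phi> 1 s) (bas n) \<partial>lebesgue_on {0..t}) = integral {0..t} (\<lambda>s. inner (\<Phi> 1 s) (bas n))"
        by (intro lebesgue_integral_eq_integral continuous_imp_integrable_real continuous_on_subset[OF ic]) (use t in auto)
      ultimately show ?thesis using \<Phi>0[of t] \<Phi>0[of 0] t T by (simp add: integral_unique)
    qed
    show "vector_derivative \<phi> (at t within {0..T}) = \<Phi> 1 t" if t: "t \<in> {0..T}" for t
    proof (rule vector_derivative_within)
      show "at t within {0..T} \<noteq> bot" using t T by (simp add: trivial_limit_within islimpt_Icc)
      show "(\<phi> has_vector_derivative \<Phi> 1 t) (at t within {0..T})"
        using has_vector_derivative_transform[OF t \<Phi>0[symmetric] hvd[OF t, of 0]] by simp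
    qed
  qed
qed

lemma const_test_function:
  assumes "h \<in> Hinf" shows "(\<lambda>_. h) \<in> test_functions T"
  unfolding test_functions_def
proof (rule CollectI, rule exI[of _ "\<lambda>n t. if n = 0 then h else 0"])
  show "(\<forall>t\<in>{0..T}. (if 0 = (0::nat) then h else 0) = h) \<and>
    (\<forall>n. \<forall>t\<in>{0..T}. (if n = 0 then h else 0) \<in> Hinf \<and>
      (\<forall>r>0. ((\<lambda>s. norm_Hs r (((if n = 0 then h else 0) - (if n = 0 then h else 0)) /\<^sub>R (s - t) - (if Suc n = 0 then h else 0))) \<longlongrightarrow> 0) (at t within {0..T})))"
    using assms by auto
qed

section \<open>The scalar mode equations\<close>

definition mode_rhs :: "real \<Rightarrow> (real \<Rightarrow> torus_L2) \<Rightarrow> (real \<Rightarrow> torus_L2) \<Rightarrow> nat \<Rightarrow> real \<Rightarrow> real" where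
  "mode_rhs \<alpha> g \<theta> n s = - (lam n powr (2 * \<alpha>) * inner (\<theta> s) (bas n)) - nonlin (\<theta> s) (bas n)
     + lam n powr \<alpha> * inner (g s) (bas n)"

text \<open>The weak formulation tested with time-independent basis functions only. For paths of the
  right regularity it is equivalent to \<open>weak_solution\<close>, and since each equation governs
  one real coefficient, compactness and limits can be treated scalar by scalar.\<close>

definition mode_equations :: "real \<Rightarrow> real \<Rightarrow> (real \<Rightarrow> torus_L2) \<Rightarrow> torus_L2 \<Rightarrow> (real \<Rightarrow> torus_L2) \<Rightarrow> bool" where
  "mode_equations T \<alpha> g \<theta>0 \<theta> \<longleftrightarrow> (\<forall>n. \<forall>t\<in>{0..T}.
     inner (\<theta> t) (bas n) = inner \<theta>0 (bas n) + (\<integral>s. mode_rhs \<alpha> g \<theta> n s \<partial>lebesgue_on {0..t}))"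

lemma Cw_H_D:
  assumes "\<theta> \<in> Cw_H T"
  shows "t \<in> {0..T} \<Longrightarrow> \<theta> t \<in> H0" "continuous_on {0..T} (\<lambda>t. inner (\<theta> t) (bas n))"
    "\<theta> \<in> borel_measurable (lebesgue_on {0..T})"
proof -
  show 1: "t \<in> {0..T} \<Longrightarrow> \<theta> t \<in> H0" for t using assms by (auto simp: Cw_H_def)
  show 2: "continuous_on {0..T} (\<lambda>t. inner (\<theta> t) (bas n))" for n using assms by (auto simp: Cw_H_def)
  show "\<theta> \<in> borel_measurable (lebesgue_on {0..T})"
    by (rule borel_measurable_torus_L2_iff_modes) (auto intro: 1 continuous_imp_measurable_on_sets_lebesgue[OF 2])
qed

lemma L2T_integrable_norm:
  assumes "g \<in> L2T T" shows "integrable (lebesgue_on {0..T}) (\<lambda>s. norm (g s))"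
proof (rule Bochner_Integration.integrable_bound[of _ "\<lambda>s. 1 + (norm (g s))\<^sup>2"])
  interpret finite_measure "lebesgue_on {0..T}" by (rule finite_measure_lebesgue_on) simp
  show "integrable (lebesgue_on {0..T}) (\<lambda>s. 1 + (norm (g s))\<^sup>2)"
    using assms by (simp add: L2T_def)
  have "x \<le> 1 + x\<^sup>2" for x :: real
  proof -
    have "2 * x \<le> x\<^sup>2 + 1" using zero_le_power2[of "x - 1"] by (simp add: power2_diff)
    then show ?thesis using zero_le_power2[of x] by linarith
  qed
  then show "AE s in lebesgue_on {0..T}. norm (norm (g s)) \<le> norm (1 + (norm (g s))\<^sup>2)"
    by (intro AE_I2) simp
  show "(\<lambda>s. norm (g s)) \<in> borel_measurable (lebesgue_on {0..T})"
    using assms by (auto simp: L2T_def)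
qed

lemma norm_bas [simp]: "norm (bas n) = 1"
  by (simp add: norm_eq_sqrt_inner inner_bas)

lemma abs_inner_bas_le: "\<bar>inner f (bas n)\<bar> \<le> norm f"
  using Cauchy_Schwarz_ineq2[of f "bas n"] by simp

lemma integrable_mode_rhs:
  assumes \<theta>: "\<theta> \<in> Cw_H T" and C: "AE s in lebesgue_on {0..T}. norm (\<theta> s) \<le> C" and g: "g \<in> L2T T"
  shows "integrable (lebesgue_on {0..T}) (\<lambda>s. nonlin (\<theta> s) (bas n))"
    "integrable (lebesgue_on {0..T}) (\<lambda>s. inner (\<theta> s) (bas n))"
    "integrable (lebesgue_on {0..T}) (\<lambda>s. inner (g s) (bas n))"
    "integrable (lebesgue_on {0..T}) (mode_rhs \<alpha> g \<theta> n)"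
proof -
  interpret finite_measure "lebesgue_on {0..T}" by (rule finite_measure_lebesgue_on) simp
  have [measurable]: "\<theta> \<in> borel_measurable (lebesgue_on {0..T})" by (rule Cw_H_D(3)[OF \<theta>])
  have [measurable]: "g \<in> borel_measurable (lebesgue_on {0..T})" using g by (simp add: L2T_def)
  show 1: "integrable (lebesgue_on {0..T}) (\<lambda>s. nonlin (\<theta> s) (bas n))"
  proof (rule integrable_const_bound[of _ "wt_const * norm_Hs 4 (bas n) * C\<^sup>2"])
    show "(\<lambda>s. nonlin (\<theta> s) (bas n)) \<in> borel_measurable (lebesgue_on {0..T})"
      by (rule measurable_nonlin) (use Cw_H_D(1)[OF \<theta>] in auto)
    have "AE s in lebesgue_on {0..T}. s \<in> {0..T}" by (rule AE_I2) simp
    with C show "AE s in lebesgue_on {0..T}. norm (nonlin (\<theta> s) (bas n)) \<le> wt_const * norm_Hs 4 (bas n) * C\<^sup>2"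
    proof eventually_elim
      case (elim s)
      have "\<bar>nonlin (\<theta> s) (bas n)\<bar> \<le> wt_const * norm_Hs 4 (bas n) * (norm (\<theta> s))\<^sup>2"
        using Cw_H_D(1)[OF \<theta> elim(2)] by (intro nonlin_bound) auto
      also have "\<dots> \<le> wt_const * norm_Hs 4 (bas n) * C\<^sup>2"
        using elim(1) wt_const_pos by (intro mult_left_mono power_mono) auto
      finally show ?case by simp
    qed
  qed
  show 2: "integrable (lebesgue_on {0..T}) (\<lambda>s. inner (\<theta> s) (bas n))"
    by (rule continuous_imp_integrable_real[OF Cw_H_D(2)[OF \<theta>]])
  show 3: "integrable (lebesgue_on {0..T}) (\<lambda>s. inner (g s) (bas n))"
    by (rule Bochner_Integration.integrable_bound[OF L2T_integrable_norm[OF g]]) (auto simp: abs_inner_bas_le)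
  show "integrable (lebesgue_on {0..T}) (mode_rhs \<alpha> g \<theta> n)"
    unfolding mode_rhs_def using 1 2 3 by auto
qed

lemma LinfT_H_bound:
  assumes "\<theta> \<in> LinfT_H T"
  obtains C where "0 \<le> C" "AE s in lebesgue_on {0..T}. norm (\<theta> s) \<le> C"
proof -
  obtain C where "AE s in lebesgue_on {0..T}. \<theta> s \<in> H0 \<and> norm (\<theta> s) \<le> C"
    using assms by (auto simp: LinfT_H_def)
  then have "AE s in lebesgue_on {0..T}. norm (\<theta> s) \<le> max C 0" by eventually_elim auto
  then show ?thesis by (rule that[rotated]) simp
qed

lemma weak_solution_imp_mode_equations:
  assumes T: "0 < T" and sol: "weak_solution T \<alpha> g \<theta>0 \<theta>"
  shows "mode_equations T \<alpha> g \<theta>0 \<theta>"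
  unfolding mode_equations_def
proof (intro allI ballI)
  fix n t assume t: "t \<in> {0..T}"
  have "inner (\<theta> t) (bas n) = inner \<theta>0 (bas n) +
     (\<integral>s. (inner (\<theta> s) (vector_derivative (\<lambda>_. bas n) (at s within {0..T}))
                - inner (\<theta> s) (Lam (2 * \<alpha>) (bas n))
                - nonlin (\<theta> s) (bas n)
                + inner (Lam \<alpha> (bas n)) (g s)) \<partial>lebesgue_on {0..t})"
    using sol[unfolded weak_solution_def, THEN conjunct2, THEN conjunct2, rule_format,
        OF const_test_function[OF bas_Hinf[of n]] t] .
  also have "(\<integral>s. (inner (\<theta> s) (vector_derivative (\<lambda>_. bas n) (at s within {0..T}))
                - inner (\<theta> s) (Lam (2 * \<alpha>) (bas n))
                - nonlin (\<theta> s) (bas n)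
                + inner (Lam \<alpha> (bas n)) (g s)) \<partial>lebesgue_on {0..t}) = (\<integral>s. mode_rhs \<alpha> g \<theta> n s \<partial>lebesgue_on {0..t})"
  proof (intro Bochner_Integration.integral_cong refl)
    fix s assume "s \<in> space (lebesgue_on {0..t})"
    then have "at s within {0..T} \<noteq> bot" using t T by (simp add: trivial_limit_within islimpt_Icc)
    then have "vector_derivative (\<lambda>_. bas n) (at s within {0..T}) = 0"
      by (rule vector_derivative_within) (rule has_vector_derivative_const)
    then show "inner (\<theta> s) (vector_derivative (\<lambda>_. bas n) (at s within {0..T}))
                - inner (\<theta> s) (Lam (2 * \<alpha>) (bas n))
                - nonlin (\<theta> s) (bas n)
                + inner (Lam \<alpha> (bas n)) (g s) = mode_rhs \<alpha> g \<theta> n s"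
      by (simp add: mode_rhs_def Lam_bas_eq inner_commute[of "bas n"])
  qed
  finally show "inner (\<theta> t) (bas n) = inner \<theta>0 (bas n) + (\<integral>s. mode_rhs \<alpha> g \<theta> n s \<partial>lebesgue_on {0..t})" .
qed

text \<open>The product rule gives the tested equation in each mode, the first N modes are added,
  and N tends to infinity under the integral. The majorant comes from uniform Sobolev bounds of the
  test function; exponent 4 serves the nonlinearity.\<close>

lemma mode_equations_imp_weak_solution:
  assumes T: "0 < T" and \<alpha>: "0 < \<alpha>" and \<theta>0: "\<theta>0 \<in> H0"
    and reg: "\<theta> \<in> LinfT_H T" "\<theta> \<in> L2T_Hs T \<alpha>" "\<theta> \<in> Cw_H T"
    and g: "g \<in> L2T T" and me: "mode_equations T \<alpha> g \<theta>0 \<theta>"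
  shows "weak_solution T \<alpha> g \<theta>0 \<theta>"
proof -
  obtain C where C0: "0 \<le> C" and C: "AE s in lebesgue_on {0..T}. norm (\<theta> s) \<le> C"
    by (rule LinfT_H_bound[OF reg(1)])
  have H: "\<theta> t \<in> H0" if "t \<in> {0..T}" for t by (rule Cw_H_D(1)[OF reg(3) that])
  have "inner (\<theta> t) (\<phi> t) = inner \<theta>0 (\<phi> 0) +
          (\<integral>s. (inner (\<theta> s) (vector_derivative \<phi> (at s within {0..T}))
                - inner (\<theta> s) (Lam (2 * \<alpha>) (\<phi> s))
                - nonlin (\<theta> s) (\<phi> s)
                + inner (Lam \<alpha> (\<phi> s)) (g s)) \<partial>lebesgue_on {0..t})"
    if \<phi>: "\<phi> \<in> test_functions T" and t: "t \<in> {0..T}" for \<phi> t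
  proof -
    obtain \<psi> where \<phi>i: "\<And>t. t \<in> {0..T} \<Longrightarrow> \<phi> t \<in> Hinf" and \<psi>i: "\<And>t. t \<in> {0..T} \<Longrightarrow> \<psi> t \<in> Hinf"
      and \<phi>b: "\<And>r. 0 < r \<Longrightarrow> \<exists>C. \<forall>t\<in>{0..T}. norm_Hs r (\<phi> t) \<le> C"
      and \<psi>b: "\<exists>C. \<forall>t\<in>{0..T}. norm (\<psi> t) \<le> C"
      and \<psi>c: "\<And>n. continuous_on {0..T} (\<lambda>t. inner (\<psi> t) (bas n))"
      and ftc: "\<And>n t. t \<in> {0..T} \<Longrightarrow> inner (\<phi> t) (bas n) = inner (\<phi> 0) (bas n) + (\<integral>s. inner (\<psi> s) (bas n) \<partial>lebesgue_on {0..t})"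
      and vd: "\<And>t. t \<in> {0..T} \<Longrightarrow> vector_derivative \<phi> (at t within {0..T}) = \<psi> t"
      using test_function_derivative[OF T \<phi>] by blast
    define F where "F N s = (\<Sum>n<N. mode_rhs \<alpha> g \<theta> n s * inner (\<phi> s) (bas n) + inner (\<psi> s) (bas n) * inner (\<theta> s) (bas n))" for N s
    define G where "G s = inner (\<theta> s) (\<psi> s) - inner (\<theta> s) (Lam (2 * \<alpha>) (\<phi> s)) - nonlin (\<theta> s) (\<phi> s) + inner (Lam \<alpha> (\<phi> s)) (g s)" for s
    note pr = product_rule_primitives[OF integrable_mode_rhs(4)[OF reg(3) C g, of \<alpha>] continuous_imp_integrable_real[OF \<psi>c] _ ftc t,
        where u="\<lambda>s. inner (\<theta> s) (bas _)"]
    have Fi: "integrable (lebesgue_on {0..t}) (F N)" for N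
      unfolding F_def using me by (intro Bochner_Integration.integrable_sum pr(1)) (auto simp: mode_equations_def)
    have eqN: "(\<Sum>n<N. inner (\<theta> t) (bas n) * inner (\<phi> t) (bas n)) =
      (\<Sum>n<N. inner \<theta>0 (bas n) * inner (\<phi> 0) (bas n)) + (\<integral>s. F N s \<partial>lebesgue_on {0..t})" for N
    proof -
      have "(\<integral>s. F N s \<partial>lebesgue_on {0..t}) = (\<Sum>n<N. \<integral>s. mode_rhs \<alpha> g \<theta> n s * inner (\<phi> s) (bas n) + inner (\<psi> s) (bas n) * inner (\<theta> s) (bas n) \<partial>lebesgue_on {0..t})"
        unfolding F_def using me by (intro Bochner_Integration.integral_sum pr(1)) (auto simp: mode_equations_def)
      moreover have "inner (\<theta> t) (bas n) * inner (\<phi> t) (bas n) = inner \<theta>0 (bas n) * inner (\<phi> 0) (bas n) +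
         (\<integral>s. mode_rhs \<alpha> g \<theta> n s * inner (\<phi> s) (bas n) + inner (\<psi> s) (bas n) * inner (\<theta> s) (bas n) \<partial>lebesgue_on {0..t})" for n
        using me by (intro pr(2)) (auto simp: mode_equations_def)
      ultimately show ?thesis by (simp only: sum.distrib)
    qed
    have Fs: "F N s = (\<Sum>n<N. inner (\<theta> s) (bas n) * inner (\<psi> s) (bas n)) - (\<Sum>n<N. inner (\<theta> s) (bas n) * inner (Lam (2 * \<alpha>) (\<phi> s)) (bas n))
        - nonlin (\<theta> s) (trunc N (\<phi> s)) + (\<Sum>n<N. inner (Lam \<alpha> (\<phi> s)) (bas n) * inner (g s) (bas n))" if s: "s \<in> {0..T}" for N s
    proof -
      have Lam_coef: "inner (Lam r (\<phi> s)) (bas n) = lam n powr r * inner (\<phi> s) (bas n)" for r n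
        by (rule Lam_bas[OF Hinf_Hs[OF \<phi>i[OF s]]])
      show ?thesis
        unfolding F_def nonlin_trunc_sum[OF H[OF s]] Lam_coef sum.distrib[symmetric] sum_subtractf[symmetric]
        by (intro sum.cong refl) (simp add: mode_rhs_def algebra_simps)
    qed
    have lim: "(\<lambda>N. F N s) \<longlonglongrightarrow> G s" if s: "s \<in> {0..T}" for s
      unfolding Fs[OF s] G_def
      using H0_parseval[OF H[OF s]] H0_parseval[OF Lam_H0[OF Hinf_Hs[OF \<phi>i[OF s]]]]
      by (intro tendsto_intros nonlin_trunc_tendsto H \<phi>i s) (simp_all add: sums_def)
    obtain C1 where C1: "\<And>s. s \<in> {0..T} \<Longrightarrow> norm (\<psi> s) \<le> C1" using \<psi>b by blast
    obtain C2 where C2: "\<And>s. s \<in> {0..T} \<Longrightarrow> norm_Hs (2 * \<alpha>) (\<phi> s) \<le> C2" using \<phi>b[of "2 * \<alpha>"] \<alpha> by (auto simp del: atLeastAtMost_iff)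
    obtain C3 where C3: "\<And>s. s \<in> {0..T} \<Longrightarrow> norm_Hs 4 (\<phi> s) \<le> C3" using \<phi>b[of 4] by (auto simp del: atLeastAtMost_iff)
    obtain C4 where C4: "\<And>s. s \<in> {0..T} \<Longrightarrow> norm_Hs \<alpha> (\<phi> s) \<le> C4" using \<phi>b[of \<alpha>] \<alpha> by (auto simp del: atLeastAtMost_iff)
    have gn: "integrable (lebesgue_on {0..t}) (\<lambda>s. norm (g s))"
      using integrable_upto[OF L2T_integrable_norm[OF g]] t by auto
    have bound: "AE s in lebesgue_on {0..t}. norm (F N s) \<le> C * C1 + C * C2 + wt_const * C3 * C\<^sup>2 + C4 * norm (g s)" for N
    proof -
      have "AE s in lebesgue_on {0..t}. s \<in> {0..t}" by (rule AE_I2) simp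
      moreover have "AE s in lebesgue_on {0..t}. norm (\<theta> s) \<le> C" by (rule AE_upto[OF C]) (use t in auto)
      ultimately show ?thesis
      proof eventually_elim
        case (elim s)
        then have s: "s \<in> {0..T}" using t by auto
        have L: "Lam r (\<phi> s) \<in> H0" "norm (Lam r (\<phi> s)) = norm_Hs r (\<phi> s)" for r
          using Hinf_Hs[OF \<phi>i[OF s]] by (auto intro: Lam_H0 norm_Lam)
        have "\<bar>\<Sum>n<N. inner (\<theta> s) (bas n) * inner (\<psi> s) (bas n)\<bar> \<le> norm (\<theta> s) * norm (\<psi> s)"
          by (rule abs_sum_coeff_le[OF H[OF s] Hinf_H0[OF \<psi>i[OF s]]])
        also have "\<dots> \<le> C * C1" using elim C1[OF s] C0 by (intro mult_mono) auto
        finally have 1: "\<bar>\<Sum>n<N. inner (\<theta> s) (bas n) * inner (\<psi> s) (bas n)\<bar> \<le> C * C1" .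
        have "\<bar>\<Sum>n<N. inner (\<theta> s) (bas n) * inner (Lam (2 * \<alpha>) (\<phi> s)) (bas n)\<bar> \<le> norm (\<theta> s) * norm (Lam (2 * \<alpha>) (\<phi> s))"
          by (rule abs_sum_coeff_le[OF H[OF s] L(1)])
        also have "\<dots> \<le> C * C2" using elim C2[OF s] C0 by (intro mult_mono) (auto simp: L(2))
        finally have 2: "\<bar>\<Sum>n<N. inner (\<theta> s) (bas n) * inner (Lam (2 * \<alpha>) (\<phi> s)) (bas n)\<bar> \<le> C * C2" .
        have "\<bar>nonlin (\<theta> s) (trunc N (\<phi> s))\<bar> \<le> wt_const * norm_Hs 4 (trunc N (\<phi> s)) * (norm (\<theta> s))\<^sup>2"
          by (rule nonlin_bound[OF H[OF s]]) simp
        also have "\<dots> \<le> wt_const * C3 * C\<^sup>2"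
          using elim C3[OF s] norm_Hs_trunc_le[OF Hinf_Hs[OF \<phi>i[OF s]], of 4 N] wt_const_pos
            order_trans[OF norm_Hs_nonneg C3[OF s]]
          by (intro mult_mono power_mono) auto
        finally have 3: "\<bar>nonlin (\<theta> s) (trunc N (\<phi> s))\<bar> \<le> wt_const * C3 * C\<^sup>2" .
        \<comment> \<open>The control may have a mean. The basis functions do not see it, so it is
          projected away before the coefficient estimate for mean-zero functions is applied.\<close>
        have "\<bar>\<Sum>n<N. inner (Lam \<alpha> (\<phi> s)) (bas n) * inner (g s) (bas n)\<bar> = \<bar>\<Sum>n<N. inner (Lam \<alpha> (\<phi> s)) (bas n) * inner (mean_free (g s)) (bas n)\<bar>"
          using inner_mean_free[OF bas_H0] by (simp add: inner_commute[of _ "bas _"])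
        also have "\<dots> \<le> norm (Lam \<alpha> (\<phi> s)) * norm (mean_free (g s))"
          by (rule abs_sum_coeff_le[OF L(1) mean_free_H0])
        also have "\<dots> \<le> C4 * norm (g s)"
          using C4[OF s] norm_mean_free_le order_trans[OF norm_Hs_nonneg C4[OF s]] by (intro mult_mono) (auto simp: L(2))
        finally have 4: "\<bar>\<Sum>n<N. inner (Lam \<alpha> (\<phi> s)) (bas n) * inner (g s) (bas n)\<bar> \<le> C4 * norm (g s)" .
        show ?case unfolding Fs[OF s] real_norm_def using 1 2 3 4 by linarith
      qed
    qed
    have Gm: "G \<in> borel_measurable (lebesgue_on {0..t})"
      by (rule borel_measurable_LIMSEQ_real[of _ F]) (use lim t Fi in auto)
    interpret finite_measure "lebesgue_on {0..t}" by (rule finite_measure_lebesgue_on) simp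
    have "(\<lambda>N. \<integral>s. F N s \<partial>lebesgue_on {0..t}) \<longlonglongrightarrow> (\<integral>s. G s \<partial>lebesgue_on {0..t})"
    proof (rule integral_dominated_convergence[OF Gm _ _ _ bound])
      show "integrable (lebesgue_on {0..t}) (\<lambda>s. C * C1 + C * C2 + wt_const * C3 * C\<^sup>2 + C4 * norm (g s))"
        using gn by auto
      show "AE s in lebesgue_on {0..t}. (\<lambda>N. F N s) \<longlonglongrightarrow> G s"
        by (rule AE_I2) (use lim t in auto)
    qed (use Fi in auto)
    moreover have "(\<lambda>N. \<Sum>n<N. inner \<theta>0 (bas n) * inner (\<phi> 0) (bas n)) \<longlonglongrightarrow> inner \<theta>0 (\<phi> 0)"
      using H0_parseval[OF \<theta>0, of "\<phi> 0"] by (simp add: sums_def)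
    ultimately have rhs: "(\<lambda>N. \<Sum>n<N. inner (\<theta> t) (bas n) * inner (\<phi> t) (bas n)) \<longlonglongrightarrow> inner \<theta>0 (\<phi> 0) + (\<integral>s. G s \<partial>lebesgue_on {0..t})"
      unfolding eqN by (rule tendsto_add[rotated])
    have "(\<lambda>N. \<Sum>n<N. inner (\<theta> t) (bas n) * inner (\<phi> t) (bas n)) \<longlonglongrightarrow> inner (\<theta> t) (\<phi> t)"
      using H0_parseval[OF H[OF t], of "\<phi> t"] by (simp add: sums_def)
    from LIMSEQ_unique[OF this rhs]
    have "inner (\<theta> t) (\<phi> t) = inner \<theta>0 (\<phi> 0) + (\<integral>s. G s \<partial>lebesgue_on {0..t})" .
    also have "(\<integral>s. G s \<partial>lebesgue_on {0..t}) = (\<integral>s. (inner (\<theta> s) (vector_derivative \<phi> (at s within {0..T}))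
                - inner (\<theta> s) (Lam (2 * \<alpha>) (\<phi> s)) - nonlin (\<theta> s) (\<phi> s) + inner (Lam \<alpha> (\<phi> s)) (g s)) \<partial>lebesgue_on {0..t})"
      by (intro Bochner_Integration.integral_cong refl) (use t vd in \<open>auto simp: G_def\<close>)
    finally show ?thesis .
  qed
  then show ?thesis unfolding weak_solution_def using \<theta>0 reg by blast
qed

section \<open>Galerkin approximations\<close>

instance torus_L2 :: banach ..

text \<open>In the weighted norm
  \<open>sup e\<^sup>-\<^sup>K\<^sup>t |z t|\<close> with \<open>K > L\<close> the integral operator is a contraction on the whole interval.\<close>

lemma picard_integral_equation:
  fixes f :: "'a::banach \<Rightarrow> 'a" and T :: real
  assumes T: "0 \<le> T" and L: "0 \<le> L" "\<And>x y. norm (f x - f y) \<le> L * norm (x - y)"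
    and c: "continuous_on {0..T} c"
  shows "\<exists>z. continuous_on {0..T} z \<and> (\<forall>t\<in>{0..T}. z t = c t + integral {0..t} (\<lambda>s. f (z s)))"
proof -
  define K where "K = L + 1"
  have K: "0 < K" "L < K" using L by (auto simp: K_def)
  \<comment> \<open>Clamping time to [0,T] extends continuous paths to bounded continuous functions
    on the line, the complete space in which the fixed point is sought. The unknown w is the
    solution multiplied by exp (- K t).\<close>
  define \<tau> where "\<tau> t = max 0 (min T t)" for t :: real
  have \<tau>: "\<tau> t \<in> {0..T}" for t using T by (auto simp: \<tau>_def)
  have \<tau>id: "\<tau> t = t" if "t \<in> {0..T}" for t using that by (auto simp: \<tau>_def)
  have \<tau>c: "continuous_on UNIV \<tau>" unfolding \<tau>_def by (intro continuous_intros)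
  have "L-lipschitz_on UNIV f" using L by (auto simp: lipschitz_on_def dist_norm)
  then have fc: "continuous_on UNIV f" by (rule lipschitz_on_continuous_on)
  define P where "P w t = exp (- K * t) *\<^sub>R (c t + integral {0..t} (\<lambda>s. f (exp (K * s) *\<^sub>R apply_bcontfun w s)))"
    for w :: "real \<Rightarrow>\<^sub>C 'a" and t
  have ic: "continuous_on A (\<lambda>s. f (exp (K * s) *\<^sub>R apply_bcontfun w s))" for w :: "real \<Rightarrow>\<^sub>C 'a" and A
    by (rule continuous_on_compose2[OF fc]) (auto intro!: continuous_intros)
  have Pc: "continuous_on {0..T} (P w)" for w
    unfolding P_def
    by (intro continuous_intros c indefinite_integral_continuous_1 integrable_continuous_real ic)
  have Pb: "(\<lambda>t. P w (\<tau> t)) \<in> bcontfun" for w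
    unfolding bcontfun_def
  proof (rule CollectI, rule conjI)
    show "continuous_on UNIV (\<lambda>t. P w (\<tau> t))"
      by (rule continuous_on_compose2[OF Pc \<tau>c]) (use \<tau> in auto)
    have "bounded (P w ` {0..T})"
      by (intro compact_imp_bounded compact_continuous_image Pc) auto
    then show "bounded (range (\<lambda>t. P w (\<tau> t)))" by (rule bounded_subset) (use \<tau> in auto)
  qed
  define \<Psi> where "\<Psi> w = Bcontfun (\<lambda>t. P w (\<tau> t))" for w
  have \<Psi>: "apply_bcontfun (\<Psi> w) t = P w (\<tau> t)" for w t
    unfolding \<Psi>_def using Bcontfun_inverse[OF Pb] by simp
  have contr: "dist (\<Psi> w) (\<Psi> v) \<le> (L / K) * dist w v" for w v
  proof (rule dist_bound)
    fix t
    define s where "s = \<tau> t"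
    define d where "d = dist w v"
    have s: "0 \<le> s" using \<tau>[of t] by (auto simp: s_def)
    let ?h = "\<lambda>w r. f (exp (K * r) *\<^sub>R apply_bcontfun w r)"
    have hi: "((\<lambda>r. L * (exp (K * r) * d)) has_integral (L * (exp (K * s) * d) / K - L * (exp (K * 0) * d) / K)) {0..s}"
      by (rule fundamental_theorem_of_calculus[OF s])
        (use K in \<open>auto intro!: derivative_eq_intros simp: has_real_derivative_iff_has_vector_derivative[symmetric]\<close>)
    have "norm (integral {0..s} (?h w) - integral {0..s} (?h v)) = norm (integral {0..s} (\<lambda>r. ?h w r - ?h v r))"
      by (subst Henstock_Kurzweil_Integration.integral_diff) (auto intro!: integrable_continuous_real ic)
    also have "\<dots> \<le> integral {0..s} (\<lambda>r. L * (exp (K * r) * d))"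
    proof (rule integral_norm_bound_integral)
      show "(\<lambda>r. ?h w r - ?h v r) integrable_on {0..s}"
        by (intro integrable_continuous_real continuous_on_diff ic)
      show "(\<lambda>r. L * (exp (K * r) * d)) integrable_on {0..s}" using hi by blast
      fix r
      have "norm (?h w r - ?h v r) \<le> L * norm (exp (K * r) *\<^sub>R (apply_bcontfun w r - apply_bcontfun v r))"
        using L(2)[of "exp (K * r) *\<^sub>R apply_bcontfun w r" "exp (K * r) *\<^sub>R apply_bcontfun v r"]
        by (simp only: scaleR_right_diff_distrib)
      also have "\<dots> \<le> L * (exp (K * r) * d)"
        using L dist_bounded[of w r v] by (intro mult_left_mono) (auto simp: d_def dist_norm)
      finally show "norm (?h w r - ?h v r) \<le> L * (exp (K * r) * d)" .
    qed
    also have "\<dots> = L * d / K * (exp (K * s) - 1)"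
      using integral_unique[OF hi] by (simp add: algebra_simps diff_divide_distrib)
    also have "\<dots> \<le> L * d / K * exp (K * s)"
      using L K by (intro mult_left_mono) (auto simp: d_def)
    finally have n: "norm (integral {0..s} (?h w) - integral {0..s} (?h v)) \<le> L * d / K * exp (K * s)" .
    have "dist (P w s) (P v s) = exp (- K * s) * norm (integral {0..s} (?h w) - integral {0..s} (?h v))"
      by (simp add: P_def dist_norm scaleR_right_diff_distrib[symmetric])
    also have "\<dots> \<le> exp (- K * s) * (L * d / K * exp (K * s))"
      by (intro mult_left_mono n) simp
    also have "\<dots> = L / K * d" by (simp add: exp_minus)
    finally show "dist (apply_bcontfun (\<Psi> w) t) (apply_bcontfun (\<Psi> v) t) \<le> L / K * dist w v"
      by (simp add: \<Psi> s_def d_def)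
  qed
  have "\<exists>!w. \<Psi> w = w"
    by (rule banach_fix_type[of "L / K"]) (use K L contr in auto)
  then obtain w where w: "\<Psi> w = w" by blast
  define z where "z t = exp (K * t) *\<^sub>R apply_bcontfun w t" for t
  have "z t = c t + integral {0..t} (\<lambda>s. f (z s))" if t: "t \<in> {0..T}" for t
  proof -
    have "apply_bcontfun w t = P w t" using \<Psi>[of w t] w \<tau>id[OF t] by simp
    then show ?thesis by (simp add: z_def P_def exp_minus)
  qed
  moreover have "continuous_on {0..T} z" unfolding z_def by (auto intro!: continuous_intros)
  ultimately show ?thesis by blast
qed

section \<open>Radial cut-off and the finite-dimensional system\<close>

definition radial :: "real \<Rightarrow> 'a::real_normed_vector \<Rightarrow> 'a" where
  "radial M x = (M / max M (norm x)) *\<^sub>R x"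

lemma norm_radial_le: assumes "0 < M" shows "norm (radial M x) \<le> M"
  using assms by (simp add: radial_def divide_simps mult_left_mono)

lemma radial_id: "0 < M \<Longrightarrow> norm x \<le> M \<Longrightarrow> radial M x = x"
  by (simp add: radial_def)

text \<open>The difference is split into a multiple of x - y with factor at most one and the change
  of the scalar factor applied to y. The latter is controlled by x - y again because norm y \<le> b;
  adding both gives the constant 2 in any normed space.\<close>

lemma radial_lipschitz:
  assumes M: "0 < M" shows "norm (radial M x - radial M y) \<le> 2 * norm (x - y)"
proof -
  define a b where "a = max M (norm x)" and "b = max M (norm y)"
  have ab: "0 < a" "0 < b" "M \<le> a" "norm y \<le> b" using M by (auto simp: a_def b_def)
  have "radial M x - radial M y = (M / a) *\<^sub>R (x - y) + (M / a - M / b) *\<^sub>R y"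
    by (simp add: radial_def a_def b_def algebra_simps)
  then have "norm (radial M x - radial M y) \<le> \<bar>M / a\<bar> * norm (x - y) + \<bar>M / a - M / b\<bar> * norm y"
    by (metis norm_scaleR norm_triangle_ineq)
  also have "\<bar>M / a\<bar> * norm (x - y) \<le> 1 * norm (x - y)"
    using ab M by (intro mult_right_mono) auto
  also have "\<bar>M / a - M / b\<bar> * norm y = (M / a) * (norm y / b) * \<bar>b - a\<bar>"
  proof -
    have "M / a - M / b = (M / a) * ((b - a) / b)" using ab by (simp add: field_simps)
    then show ?thesis using ab M by (simp add: abs_mult)
  qed
  also have "\<dots> \<le> (1 * 1) * norm (x - y)"
  proof (intro mult_mono)
    have "\<bar>b - a\<bar> \<le> \<bar>norm y - norm x\<bar>" by (auto simp: a_def b_def)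
    also have "\<dots> \<le> norm (x - y)" by (metis norm_minus_commute norm_triangle_ineq3)
    finally show "\<bar>b - a\<bar> \<le> norm (x - y)" .
  qed (use ab M in auto)
  finally show ?thesis by simp
qed

lemma mean_free_diff: "mean_free x - mean_free y = mean_free (x - y)"
  by (simp add: mean_free_def inner_diff_left algebra_simps)

lemma nonlin_scaleR:
  assumes "\<theta> \<in> H0" "\<phi> \<in> Hinf" shows "nonlin (c *\<^sub>R \<theta>) \<phi> = c\<^sup>2 * nonlin \<theta> \<phi>"
  using assms by (simp add: nonlin_trilin trilin_scaleR1 trilin_scaleR2 H0_scaleR power2_eq_square)

lemma trunc_linear: "bounded_linear (trunc N)"
  unfolding trunc_def
  by (intro bounded_linear_sum bounded_linear_scaleR_const bounded_linear_inner_left)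

lemma trunc_span: "trunc N (\<Sum>n<N. c n *\<^sub>R bas n) = (\<Sum>n<N. c n *\<^sub>R bas n)"
  unfolding trunc_def by (intro sum.cong refl) (simp add: inner_sum_orthonormal[OF orthonormal_bas])

text \<open>The radial cut-off makes the finite-dimensional field globally Lipschitz; the energy identity
  removes it afterwards.\<close>

lemma galerkin_cutoff:
  assumes T: "0 \<le> T" and M: "0 < M" and z0: "z0 \<in> H0" and g: "g \<in> L2T T"
  shows "\<exists>z. continuous_on {0..T} z \<and> (\<forall>t\<in>{0..T}. trunc N (z t) = z t) \<and>
    (\<forall>m<N. \<forall>t\<in>{0..T}. inner (z t) (bas m) = inner z0 (bas m) +
      (\<integral>s. - (lam m powr (2 * \<alpha>) * inner (z s) (bas m)) - nonlin (radial M (z s)) (bas m)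
         + lam m powr \<alpha> * inner (g s) (bas m) \<partial>lebesgue_on {0..t}))"
proof -
  \<comment> \<open>Projection onto mean-zero functions and cut-off together make the quadratic term
    globally Lipschitz on the whole space.\<close>
  define nl where "nl m x = nonlin (radial M (mean_free x)) (bas m)" for m x
  define fm where "fm m x = - (lam m powr (2 * \<alpha>) * inner x (bas m)) - nl m x" for m x
  define f where "f x = (\<Sum>m<N. fm m x *\<^sub>R bas m)" for x
  \<comment> \<open>The factor 4 M is the Lipschitz constant 2 of the cut-off times the sum of two
    norms, each at most M.\<close>
  define L where "L = (\<Sum>m<N. lam m powr (2 * \<alpha>) + 4 * M * (wt_const * norm_Hs 4 (bas m)))"
  have gi: "integrable (lebesgue_on {0..T}) (\<lambda>s. inner (g s) (bas m))" for m
    by (rule Bochner_Integration.integrable_bound[OF L2T_integrable_norm[OF g]])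
      (use g in \<open>auto simp: abs_inner_bas_le L2T_def\<close>)
  \<comment> \<open>The control is only square integrable in time, so it is kept out of the vector
    field: its primitive enters as a continuous additive path and the field stays
    autonomous.\<close>
  define c where "c t = (\<Sum>m<N. (inner z0 (bas m) + lam m powr \<alpha> * (\<integral>s. inner (g s) (bas m) \<partial>lebesgue_on {0..t})) *\<^sub>R bas m)" for t
  have cc: "continuous_on {0..T} c" unfolding c_def
    by (intro continuous_intros continuous_integral_upto gi)
  have rH: "radial M (mean_free x) \<in> H0" for x unfolding radial_def by (intro H0_scaleR) simp
  have nlL: "\<bar>nl m x - nl m y\<bar> \<le> 4 * M * (wt_const * norm_Hs 4 (bas m)) * norm (x - y)" for m x y
  proof -
    let ?x = "radial M (mean_free x)" and ?y = "radial M (mean_free y)"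
    have "\<bar>nl m x - nl m y\<bar> \<le> (wt_const * norm_Hs 4 (bas m)) * norm (?x - ?y) * (norm ?x + norm ?y)"
      unfolding nl_def by (rule nonlin_diff_bound[OF rH rH bas_Hinf])
    also have "\<dots> \<le> (wt_const * norm_Hs 4 (bas m)) * (2 * norm (x - y)) * (M + M)"
    proof (intro mult_mono add_mono norm_radial_le[OF M])
      have "norm (?x - ?y) \<le> 2 * norm (mean_free x - mean_free y)" by (rule radial_lipschitz[OF M])
      also have "\<dots> \<le> 2 * norm (x - y)" unfolding mean_free_diff using norm_mean_free_le[of "x - y"] by simp
      finally show "norm (?x - ?y) \<le> 2 * norm (x - y)" .
    qed (use wt_const_pos in auto)
    finally show ?thesis by (simp add: algebra_simps)
  qed
  have fL: "norm (f x - f y) \<le> L * norm (x - y)" for x y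
  proof -
    have "norm (f x - f y) = norm (\<Sum>m<N. (fm m x - fm m y) *\<^sub>R bas m)"
      by (simp add: f_def sum_subtractf scaleR_left_diff_distrib)
    also have "\<dots> \<le> (\<Sum>m<N. (lam m powr (2 * \<alpha>) + 4 * M * (wt_const * norm_Hs 4 (bas m))) * norm (x - y))"
    proof (rule sum_norm_le)
      fix m
      have "\<bar>fm m x - fm m y\<bar> \<le> lam m powr (2 * \<alpha>) * \<bar>inner (x - y) (bas m)\<bar> + \<bar>nl m x - nl m y\<bar>"
      proof -
        have "fm m x - fm m y = - (lam m powr (2 * \<alpha>) * inner (x - y) (bas m)) - (nl m x - nl m y)"
          by (simp add: fm_def inner_diff_left algebra_simps)
        moreover have "\<bar>lam m powr (2 * \<alpha>) * inner (x - y) (bas m)\<bar> = lam m powr (2 * \<alpha>) * \<bar>inner (x - y) (bas m)\<bar>"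
          by (simp add: abs_mult)
        ultimately show ?thesis by linarith
      qed
      also have "\<dots> \<le> lam m powr (2 * \<alpha>) * norm (x - y) + 4 * M * (wt_const * norm_Hs 4 (bas m)) * norm (x - y)"
        by (intro add_mono mult_left_mono abs_inner_bas_le nlL) auto
      finally show "norm ((fm m x - fm m y) *\<^sub>R bas m) \<le> (lam m powr (2 * \<alpha>) + 4 * M * (wt_const * norm_Hs 4 (bas m))) * norm (x - y)"
        unfolding norm_scaleR norm_bas by (simp only: mult_1_right distrib_right real_norm_def)
    qed
    finally show ?thesis by (simp add: L_def sum_distrib_right)
  qed
  have L0: "0 \<le> L" unfolding L_def using M wt_const_pos by (intro sum_nonneg add_nonneg_nonneg mult_nonneg_nonneg) auto
  obtain z where zc: "continuous_on {0..T} z" and z: "\<And>t. t \<in> {0..T} \<Longrightarrow> z t = c t + integral {0..t} (\<lambda>s. f (z s))"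
    using picard_integral_equation[OF T L0 fL cc] by blast
  have "L-lipschitz_on UNIV f" using L0 fL by (auto simp: lipschitz_on_def dist_norm)
  then have fc: "continuous_on UNIV f" by (rule lipschitz_on_continuous_on)
  have fzc: "continuous_on {0..t} (\<lambda>s. f (z s))" if "t \<in> {0..T}" for t
    by (rule continuous_on_compose2[OF fc continuous_on_subset[OF zc]]) (use that in auto)
  have fzi: "(\<lambda>s. f (z s)) integrable_on {0..t}" if "t \<in> {0..T}" for t
    by (rule integrable_continuous_real[OF fzc[OF that]])
  have tr: "trunc N (z t) = z t" if t: "t \<in> {0..T}" for t
  proof -
    have "trunc N (integral {0..t} (\<lambda>s. f (z s))) = integral {0..t} (\<lambda>s. trunc N (f (z s)))"
      using integral_linear[OF fzi[OF t] trunc_linear[of N]] by (simp add: o_def)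
    then show ?thesis
      unfolding z[OF t] using trunc_span
      by (simp add: linear_add[OF bounded_linear.linear[OF trunc_linear]] c_def f_def)
  qed
  have coef: "inner (z t) (bas m) = inner z0 (bas m) +
      (\<integral>s. - (lam m powr (2 * \<alpha>) * inner (z s) (bas m)) - nonlin (radial M (z s)) (bas m)
         + lam m powr \<alpha> * inner (g s) (bas m) \<partial>lebesgue_on {0..t})" if m: "m < N" and t: "t \<in> {0..T}" for m t
  proof -
    have ifm: "inner (f x) (bas m) = fm m x" for x
      using m by (simp add: f_def inner_sum_orthonormal[OF orthonormal_bas])
    have cfm: "continuous_on {0..t} (\<lambda>s. fm m (z s))"
      unfolding ifm[symmetric] by (intro continuous_on_inner fzc[OF t] continuous_on_const)
    have "inner (integral {0..t} (\<lambda>s. f (z s))) (bas m) = integral {0..t} (\<lambda>s. fm m (z s))"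
      using integral_linear[OF fzi[OF t] bounded_linear_inner_left[of "bas m"]] by (simp add: o_def ifm)
    also have "\<dots> = (\<integral>s. fm m (z s) \<partial>lebesgue_on {0..t})"
      by (intro lebesgue_integral_eq_integral[symmetric] continuous_imp_integrable_real cfm) simp
    finally have "inner (z t) (bas m) = inner z0 (bas m) + (lam m powr \<alpha> * (\<integral>s. inner (g s) (bas m) \<partial>lebesgue_on {0..t})
       + (\<integral>s. fm m (z s) \<partial>lebesgue_on {0..t}))"
      using m by (simp add: z[OF t] inner_add_left c_def inner_sum_orthonormal[OF orthonormal_bas])
    also have "lam m powr \<alpha> * (\<integral>s. inner (g s) (bas m) \<partial>lebesgue_on {0..t}) + (\<integral>s. fm m (z s) \<partial>lebesgue_on {0..t})
      = (\<integral>s. lam m powr \<alpha> * inner (g s) (bas m) + fm m (z s) \<partial>lebesgue_on {0..t})"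
      using integrable_upto[OF gi, of t] continuous_imp_integrable_real[OF cfm] t by simp
    also have "\<dots> = (\<integral>s. - (lam m powr (2 * \<alpha>) * inner (z s) (bas m)) - nonlin (radial M (z s)) (bas m)
         + lam m powr \<alpha> * inner (g s) (bas m) \<partial>lebesgue_on {0..t})"
    proof (intro Bochner_Integration.integral_cong refl)
      fix s assume "s \<in> space (lebesgue_on {0..t})"
      then have "s \<in> {0..T}" using t by auto
      then have "z s \<in> H0" using tr[of s] trunc_H0 by metis
      then show "lam m powr \<alpha> * inner (g s) (bas m) + fm m (z s) = - (lam m powr (2 * \<alpha>) * inner (z s) (bas m)) - nonlin (radial M (z s)) (bas m)
         + lam m powr \<alpha> * inner (g s) (bas m)"
        by (simp add: fm_def nl_def mean_free_id)
    qed
    finally show ?thesis .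
  qed
  show ?thesis using zc tr coef by blast
qed

lemma inner_bas_square_le: "(inner f (bas n))\<^sup>2 \<le> (norm f)\<^sup>2"
  using bessel_finite[OF orthonormal_bas, of "{n}" f] by simp

text \<open>Completing the square, \<open>a\<^sup>2 - a \<gamma> = (a - \<gamma>/2)\<^sup>2 - \<gamma>\<^sup>2/4\<close>, leaves a sign-definite dissipation on the left, so
  that lower semicontinuity alone yields the energy inequality in the limit.\<close>

lemma galerkin:
  assumes T: "0 \<le> T" and z0: "z0 \<in> H0" and g: "g \<in> L2T T"
    and M: "0 < M" "(norm z0)\<^sup>2 + 1/2 * (\<integral>s. (norm (g s))\<^sup>2 \<partial>lebesgue_on {0..T}) \<le> M\<^sup>2"
  shows "\<exists>z. continuous_on {0..T} z \<and> (\<forall>t\<in>{0..T}. trunc N (z t) = z t \<and> norm (z t) \<le> M) \<and>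
    (\<forall>m<N. \<forall>t\<in>{0..T}. inner (z t) (bas m) = inner z0 (bas m) + (\<integral>s. mode_rhs \<alpha> g z m s \<partial>lebesgue_on {0..t})) \<and>
    (\<forall>t\<in>{0..T}. (\<Sum>m<N. (inner (z t) (bas m))\<^sup>2) +
        2 * (\<integral>s. (\<Sum>m<N. (lam m powr \<alpha> * inner (z s) (bas m) - inner (g s) (bas m) / 2)\<^sup>2) \<partial>lebesgue_on {0..t})
      = (\<Sum>m<N. (inner z0 (bas m))\<^sup>2) + 1/2 * (\<integral>s. (\<Sum>m<N. (inner (g s) (bas m))\<^sup>2) \<partial>lebesgue_on {0..t}))"
proof -
  obtain z where zc: "continuous_on {0..T} z" and tr: "\<And>t. t \<in> {0..T} \<Longrightarrow> trunc N (z t) = z t"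
    and coef: "\<And>m t. m < N \<Longrightarrow> t \<in> {0..T} \<Longrightarrow> inner (z t) (bas m) = inner z0 (bas m) +
      (\<integral>s. - (lam m powr (2 * \<alpha>) * inner (z s) (bas m)) - nonlin (radial M (z s)) (bas m)
         + lam m powr \<alpha> * inner (g s) (bas m) \<partial>lebesgue_on {0..t})"
    using galerkin_cutoff[OF T M(1) z0 g, of N \<alpha>] by blast
  define w where "w m s = - (lam m powr (2 * \<alpha>) * inner (z s) (bas m)) - nonlin (radial M (z s)) (bas m)
         + lam m powr \<alpha> * inner (g s) (bas m)" for m s
  have zH: "z t \<in> H0" if "t \<in> {0..T}" for t using tr[OF that] trunc_H0 by metis
  have rH: "radial M (z t) \<in> H0" if "t \<in> {0..T}" for t unfolding radial_def by (intro H0_scaleR zH that)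
  interpret finite_measure "lebesgue_on {0..T}" by (rule finite_measure_lebesgue_on) simp
  have zi: "continuous_on {0..T} (\<lambda>s. inner (z s) (bas m))" for m by (intro continuous_intros zc)
  have gm[measurable]: "g \<in> borel_measurable (lebesgue_on {0..T})" using g by (simp add: L2T_def)
  have gi: "integrable (lebesgue_on {0..T}) (\<lambda>s. inner (g s) (bas m))" for m
    by (rule Bochner_Integration.integrable_bound[OF L2T_integrable_norm[OF g]]) (auto simp: abs_inner_bas_le)
  have g2: "integrable (lebesgue_on {0..T}) (\<lambda>s. (norm (g s))\<^sup>2)" using g by (simp add: L2T_def)
  have gi2: "integrable (lebesgue_on {0..T}) (\<lambda>s. (inner (g s) (bas m))\<^sup>2)" for m
    by (rule Bochner_Integration.integrable_bound[OF g2])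
      (simp_all add: inner_bas_square_le)
  have rc: "continuous_on {0..T} (\<lambda>s. radial M (z s))"
    unfolding radial_def by (intro continuous_intros zc) (use M in auto)
  have ni: "integrable (lebesgue_on {0..T}) (\<lambda>s. nonlin (radial M (z s)) (bas m))" for m
  proof (rule continuous_imp_integrable_real)
    have "continuous_on {0..T} (\<lambda>s. nonlin (mean_free (radial M (z s))) (bas m))"
      by (rule continuous_on_compose2[OF continuous_nonlin[OF bas_Hinf] rc]) simp
    then show "continuous_on {0..T} (\<lambda>s. nonlin (radial M (z s)) (bas m))"
      by (rule continuous_on_eq) (simp add: mean_free_id rH)
  qed
  have wi: "integrable (lebesgue_on {0..T}) (w m)" for m
    unfolding w_def using continuous_imp_integrable_real[OF zi] ni gi by auto
  have en: "(inner (z t) (bas m))\<^sup>2 = (inner z0 (bas m))\<^sup>2 + (\<integral>s. w m s * inner (z s) (bas m) + w m s * inner (z s) (bas m) \<partial>lebesgue_on {0..t})"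
    and eni: "integrable (lebesgue_on {0..t}) (\<lambda>s. w m s * inner (z s) (bas m) + w m s * inner (z s) (bas m))"
    if m: "m < N" and t: "t \<in> {0..T}" for m t
    using product_rule_primitives[OF wi wi coef[OF m, folded w_def] coef[OF m, folded w_def] t]
    by (simp_all add: power2_eq_square)
  \<comment> \<open>The cut-off multiplies z by a scalar, so the quadratic term merely picks up the
    square of that scalar and remains orthogonal to z. The energy identity thus holds before the
    cut-off is removed.\<close>
  have cancel: "(\<Sum>m<N. nonlin (radial M (z s)) (bas m) * inner (z s) (bas m)) = 0" if s: "s \<in> {0..T}" for s
  proof -
    have "(\<Sum>m<N. inner (z s) (bas m) * nonlin (z s) (bas m)) = nonlin (z s) (trunc N (z s))"
      by (rule nonlin_trunc_sum[OF zH[OF s], symmetric])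
    also have "\<dots> = nonlin (trunc N (z s)) (trunc N (z s))" using tr[OF s] by simp
    also have "\<dots> = 0" unfolding trunc_def by (rule nonlin_cancel_span)
    finally have "(\<Sum>m<N. inner (z s) (bas m) * nonlin (z s) (bas m)) = 0" .
    moreover have "nonlin (radial M (z s)) (bas m) = (M / max M (norm (z s)))\<^sup>2 * nonlin (z s) (bas m)" for m
      unfolding radial_def by (rule nonlin_scaleR[OF zH[OF s] bas_Hinf])
    ultimately show ?thesis
      by (simp only: mult.assoc sum_distrib_left[symmetric] mult.commute[of "nonlin (z s) _"] mult_zero_right)
  qed
  define D where "D s = (\<Sum>m<N. (lam m powr \<alpha> * inner (z s) (bas m) - inner (g s) (bas m) / 2)\<^sup>2)" for s
  define G where "G s = (\<Sum>m<N. (inner (g s) (bas m))\<^sup>2)" for s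
  have pw: "(\<Sum>m<N. w m s * inner (z s) (bas m) + w m s * inner (z s) (bas m)) = 1/2 * G s - 2 * D s" if s: "s \<in> {0..T}" for s
  proof -
    have "w m s * inner (z s) (bas m) + w m s * inner (z s) (bas m) =
       1/2 * (inner (g s) (bas m))\<^sup>2 - 2 * (lam m powr \<alpha> * inner (z s) (bas m) - inner (g s) (bas m) / 2)\<^sup>2
        - 2 * (nonlin (radial M (z s)) (bas m) * inner (z s) (bas m))" for m
    proof -
      have "lam m powr (2 * \<alpha>) = (lam m powr \<alpha>)\<^sup>2" by (simp only: mult_2 powr_add power2_eq_square)
      then show ?thesis by (simp add: w_def power2_eq_square algebra_simps)
    qed
    then show ?thesis using cancel[OF s]
      by (simp only: sum_subtractf sum_distrib_left[symmetric] D_def G_def)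
  qed
  have Gi: "integrable (lebesgue_on {0..t}) G" if "t \<in> {0..T}" for t
    unfolding G_def by (intro Bochner_Integration.integrable_sum integrable_upto[OF gi2]) (use that in auto)
  have wsi: "integrable (lebesgue_on {0..t}) (\<lambda>s. 1/2 * G s - 2 * D s)" if t: "t \<in> {0..T}" for t
  proof -
    have "integrable (lebesgue_on {0..t}) (\<lambda>s. \<Sum>m<N. w m s * inner (z s) (bas m) + w m s * inner (z s) (bas m))"
      by (intro Bochner_Integration.integrable_sum eni t) simp
    then show ?thesis
      by (rule Bochner_Integration.integrable_cong[THEN iffD1, OF refl, rotated]) (use t pw in auto)
  qed
  have Di: "integrable (lebesgue_on {0..t}) D" if t: "t \<in> {0..T}" for t
  proof -
    have "integrable (lebesgue_on {0..t}) (\<lambda>s. 1/2 * (1/2 * G s - (1/2 * G s - 2 * D s)))"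
      by (intro integrable_mult_right Bochner_Integration.integrable_diff wsi Gi t)
    then show ?thesis by simp
  qed
  have energy: "(\<Sum>m<N. (inner (z t) (bas m))\<^sup>2) + 2 * (\<integral>s. D s \<partial>lebesgue_on {0..t})
      = (\<Sum>m<N. (inner z0 (bas m))\<^sup>2) + 1/2 * (\<integral>s. G s \<partial>lebesgue_on {0..t})" if t: "t \<in> {0..T}" for t
  proof -
    have "(\<Sum>m<N. (inner (z t) (bas m))\<^sup>2) = (\<Sum>m<N. (inner z0 (bas m))\<^sup>2 + (\<integral>s. w m s * inner (z s) (bas m) + w m s * inner (z s) (bas m) \<partial>lebesgue_on {0..t}))"
      by (intro sum.cong refl en t) simp
    also have "\<dots> = (\<Sum>m<N. (inner z0 (bas m))\<^sup>2) + (\<integral>s. (\<Sum>m<N. w m s * inner (z s) (bas m) + w m s * inner (z s) (bas m)) \<partial>lebesgue_on {0..t})"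
    proof -
      have "(\<integral>s. (\<Sum>m<N. w m s * inner (z s) (bas m) + w m s * inner (z s) (bas m)) \<partial>lebesgue_on {0..t}) =
          (\<Sum>m<N. \<integral>s. w m s * inner (z s) (bas m) + w m s * inner (z s) (bas m) \<partial>lebesgue_on {0..t})"
        by (intro Bochner_Integration.integral_sum eni t) simp
      then show ?thesis
        by (simp only: sum.distrib[of "\<lambda>m. (inner z0 (bas m))\<^sup>2"])
    qed
    also have "(\<integral>s. (\<Sum>m<N. w m s * inner (z s) (bas m) + w m s * inner (z s) (bas m)) \<partial>lebesgue_on {0..t}) = (\<integral>s. 1/2 * G s - 2 * D s \<partial>lebesgue_on {0..t})"
      by (intro Bochner_Integration.integral_cong refl pw) (use t in auto)
    also have "\<dots> = 1/2 * (\<integral>s. G s \<partial>lebesgue_on {0..t}) - 2 * (\<integral>s. D s \<partial>lebesgue_on {0..t})"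
      using Gi[OF t] Di[OF t] by simp
    finally show ?thesis by simp
  qed
  \<comment> \<open>M dominates the right-hand side of the energy identity, so the solution never
    leaves the ball on which \<open>radial M\<close> is the identity.\<close>
  have bnd: "norm (z t) \<le> M" if t: "t \<in> {0..T}" for t
  proof -
    have "(norm (z t))\<^sup>2 = (\<Sum>m<N. (inner (z t) (bas m))\<^sup>2)"
      using norm_sum_orthonormal[OF orthonormal_bas, of "{..<N}" "\<lambda>n. inner (z t) (bas n)"] tr[OF t]
      by (simp add: trunc_def)
    also have "\<dots> \<le> (\<Sum>m<N. (inner z0 (bas m))\<^sup>2) + 1/2 * (\<integral>s. G s \<partial>lebesgue_on {0..t})"
    proof -
      have "0 \<le> (\<integral>s. D s \<partial>lebesgue_on {0..t})"
        by (rule Bochner_Integration.integral_nonneg) (auto simp: D_def intro: sum_nonneg)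
      then show ?thesis using energy[OF t] by linarith
    qed
    also have "\<dots> \<le> (norm z0)\<^sup>2 + 1/2 * (\<integral>s. (norm (g s))\<^sup>2 \<partial>lebesgue_on {0..T})"
    proof (intro add_mono mult_left_mono bessel_finite[OF orthonormal_bas])
      have "(\<integral>s. G s \<partial>lebesgue_on {0..t}) \<le> (\<integral>s. \<bar>G s\<bar> \<partial>lebesgue_on {0..T})"
        using abs_integral_upto_le[OF Gi[of T], of t] t T by auto
      also have "\<dots> \<le> (\<integral>s. (norm (g s))\<^sup>2 \<partial>lebesgue_on {0..T})"
      proof (rule integral_mono)
        show "integrable (lebesgue_on {0..T}) (\<lambda>s. \<bar>G s\<bar>)" using Gi[of T] T by auto
        show "\<bar>G s\<bar> \<le> (norm (g s))\<^sup>2" for s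
          using bessel_finite[OF orthonormal_bas, of "{..<N}" "g s"] by (simp add: G_def sum_nonneg)
      qed (rule g2)
      finally show "(\<integral>s. G s \<partial>lebesgue_on {0..t}) \<le> (\<integral>s. (norm (g s))\<^sup>2 \<partial>lebesgue_on {0..T})" .
    qed auto
    also have "\<dots> \<le> M\<^sup>2" by (rule M(2))
    finally show ?thesis by (rule power2_le_imp_le) (use M(1) in simp)
  qed
  have wm: "w m s = mode_rhs \<alpha> g z m s" if "s \<in> {0..T}" for m s
    using bnd[OF that] M(1) by (simp add: w_def mode_rhs_def radial_id)
  have "inner (z t) (bas m) = inner z0 (bas m) + (\<integral>s. mode_rhs \<alpha> g z m s \<partial>lebesgue_on {0..t})"
    if m: "m < N" and t: "t \<in> {0..T}" for m t
  proof -
    have "(\<integral>s. w m s \<partial>lebesgue_on {0..t}) = (\<integral>s. mode_rhs \<alpha> g z m s \<partial>lebesgue_on {0..t})"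
      by (intro Bochner_Integration.integral_cong refl wm) (use t in auto)
    then show ?thesis using coef[OF m t] by (simp add: w_def)
  qed
  then show ?thesis using zc tr bnd energy unfolding D_def G_def by blast
qed

section \<open>Leray solutions\<close>

lemma integral_upto_mono:
  fixes h :: "real \<Rightarrow> real"
  assumes h: "integrable (lebesgue_on {0..T}) h" "\<And>r. r \<in> {0..T} \<Longrightarrow> 0 \<le> h r" and st: "s \<le> t" "t \<le> T"
  shows "(\<integral>r. h r \<partial>lebesgue_on {0..s}) \<le> (\<integral>r. h r \<partial>lebesgue_on {0..t})"
proof -
  have [measurable]: "(\<lambda>s. s) \<in> borel_measurable (lebesgue_on {0..T})" "h \<in> borel_measurable (lebesgue_on {0..T})"
    using h id_borel_measurable_lebesgue_on by (auto simp: id_def)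
  have i: "integrable (lebesgue_on {0..T}) (\<lambda>r. if r \<le> u then h r else 0)" for u
    by (rule Bochner_Integration.integrable_bound[OF h(1)]) auto
  have "(\<integral>r. (if r \<le> s then h r else 0) \<partial>lebesgue_on {0..T}) \<le> (\<integral>r. (if r \<le> t then h r else 0) \<partial>lebesgue_on {0..T})"
    by (rule integral_mono[OF i i]) (use h(2) st in auto)
  then show ?thesis
    using integral_upto[OF order_trans[OF st], of h] integral_upto[OF st(2), of h] by (simp only:)
qed

text \<open>Both F - f and F + f are nonnegative, so their primitives increase. With a common
  majorant F this gives the Galerkin coefficients a modulus of continuity that depends on the mode
  alone.\<close>

lemma integral_increment_bound:
  fixes f F :: "real \<Rightarrow> real"
  assumes f: "integrable (lebesgue_on {0..T}) f" and F: "integrable (lebesgue_on {0..T}) F"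
    and le: "\<And>r. r \<in> {0..T} \<Longrightarrow> \<bar>f r\<bar> \<le> F r" and st: "s \<in> {0..T}" "t \<in> {0..T}"
  shows "\<bar>(\<integral>r. f r \<partial>lebesgue_on {0..t}) - (\<integral>r. f r \<partial>lebesgue_on {0..s})\<bar> \<le>
     \<bar>(\<integral>r. F r \<partial>lebesgue_on {0..t}) - (\<integral>r. F r \<partial>lebesgue_on {0..s})\<bar>"
proof -
  have *: "\<bar>(\<integral>r. f r \<partial>lebesgue_on {0..t}) - (\<integral>r. f r \<partial>lebesgue_on {0..s})\<bar> \<le>
     (\<integral>r. F r \<partial>lebesgue_on {0..t}) - (\<integral>r. F r \<partial>lebesgue_on {0..s})" if "s \<le> t" "t \<le> T" for s t
  proof -
    have i: "integrable (lebesgue_on {0..u}) f" "integrable (lebesgue_on {0..u}) F" if "u \<le> T" for u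
      using integrable_upto[OF f that] integrable_upto[OF F that] by auto
    have "(\<integral>r. F r - f r \<partial>lebesgue_on {0..s}) \<le> (\<integral>r. F r - f r \<partial>lebesgue_on {0..t})"
    proof (rule integral_upto_mono[OF _ _ that])
      show "0 \<le> F r - f r" if "r \<in> {0..T}" for r using le[OF that] by linarith
    qed (use f F in auto)
    moreover have "(\<integral>r. F r + f r \<partial>lebesgue_on {0..s}) \<le> (\<integral>r. F r + f r \<partial>lebesgue_on {0..t})"
    proof (rule integral_upto_mono[OF _ _ that])
      show "0 \<le> F r + f r" if "r \<in> {0..T}" for r using le[OF that] by linarith
    qed (use f F in auto)
    ultimately show ?thesis using i[of s] i[of t] that by (simp add: abs_le_iff)
  qed
  show ?thesis
  proof (cases "s \<le> t")
    case True then show ?thesis using *[of s t] st by auto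
  next
    case False then show ?thesis using *[of t s] st by (auto simp: abs_minus_commute)
  qed
qed

text \<open>Diagonal extraction at rational times; the common modulus of continuity extends the
  convergence to all times.\<close>

lemma equicontinuous_subsequence:
  fixes a :: "nat \<Rightarrow> nat \<Rightarrow> real \<Rightarrow> real"
  assumes T: "0 < T" and M: "\<And>N n t. t \<in> {0..T} \<Longrightarrow> \<bar>a N n t\<bar> \<le> M"
    and E: "\<And>N n s t. s \<in> {0..T} \<Longrightarrow> t \<in> {0..T} \<Longrightarrow> \<bar>a N n t - a N n s\<bar> \<le> \<bar>E n t - E n s\<bar>"
    and Ec: "\<And>n. continuous_on {0..T} (E n)"
  shows "\<exists>k A. strict_mono (k :: nat \<Rightarrow> nat) \<and> (\<forall>n. \<forall>t\<in>{0..T}. (\<lambda>N. a (k N) n t) \<longlonglongrightarrow> A n t)"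
proof -
  define S where "S = (UNIV :: nat set) \<times> (\<rat> \<inter> {0..T})"
  have "countable S" unfolding S_def by (intro countable_SIGMA countable_Int1 countable_rat) auto
  moreover have "norm (case x of (n, t) \<Rightarrow> a N n t) \<le> M" if "x \<in> S" for N x
    using that M by (auto simp: S_def)
  ultimately obtain k where k: "strict_mono (k :: nat \<Rightarrow> nat)"
    and conv: "\<And>x. x \<in> S \<Longrightarrow> \<exists>l. (\<lambda>N. (case x of (n, t) \<Rightarrow> a (k N) n t)) \<longlonglongrightarrow> l"
    using function_convergent_subsequence[of S "\<lambda>N x. case x of (n, t) \<Rightarrow> a N n t" M] by blast
  have "Cauchy (\<lambda>N. a (k N) n t)" if t: "t \<in> {0..T}" for n t
  proof (rule metric_CauchyI)
    fix e :: real assume e: "0 < e"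
    then have "0 < e / 4" by simp
    then obtain d where d: "d > 0" "\<And>s. s \<in> {0..T} \<Longrightarrow> dist s t < d \<Longrightarrow> dist (E n s) (E n t) < e / 4"
      using Ec[of n] t unfolding continuous_on_iff by blast
    \<comment> \<open>The rational time has to lie near t and inside [0,T], also when t is an end
      point; T > 0 leaves room for it.\<close>
    have "max 0 (t - d) < min T (t + d)" using t T d(1) by auto
    then obtain q where q: "q \<in> \<rat>" "max 0 (t - d) < q" "q < min T (t + d)"
      using Rats_dense_in_real by blast
    then have qT: "q \<in> {0..T}" "dist q t < d" by (auto simp: dist_real_def)
    have "(n, q) \<in> S" using q qT by (auto simp: S_def)
    from conv[OF this] have "convergent (\<lambda>N. a (k N) n q)" by (simp add: convergent_def)
    then have "Cauchy (\<lambda>N. a (k N) n q)" by (simp add: Cauchy_convergent_iff)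
    then obtain N0 where N0: "\<And>i j. i \<ge> N0 \<Longrightarrow> j \<ge> N0 \<Longrightarrow> dist (a (k i) n q) (a (k j) n q) < e / 4"
      using metric_CauchyD[OF _ \<open>0 < e / 4\<close>] by blast
    have near: "\<bar>a (k i) n t - a (k i) n q\<bar> < e / 4" for i
      using E[OF qT(1) t, of "k i" n] d(2)[OF qT] by (simp add: dist_real_def abs_minus_commute)
    show "\<exists>M. \<forall>i\<ge>M. \<forall>j\<ge>M. dist (a (k i) n t) (a (k j) n t) < e"
    proof (intro exI[of _ N0] allI impI)
      fix i j assume "N0 \<le> i" "N0 \<le> j"
      then show "dist (a (k i) n t) (a (k j) n t) < e"
        using near[of i] near[of j] N0[of i j] unfolding dist_real_def by linarith
    qed
  qed
  then have "\<And>n t. t \<in> {0..T} \<Longrightarrow> (\<lambda>N. a (k N) n t) \<longlonglongrightarrow> lim (\<lambda>N. a (k N) n t)"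
    by (simp add: Cauchy_convergent_iff convergent_LIMSEQ_iff)
  then show ?thesis using k by (intro exI[of _ k] exI[of _ "\<lambda>n t. lim (\<lambda>N. a (k N) n t)"]) simp
qed

text \<open>Sublevel sets of \<open>lam\<close> are finite, so all modes from some index on exceed
  the threshold (1/\<epsilon>)^(1/(2\<alpha>)). This is where \<alpha> > 0 provides
  compactness.\<close>

lemma lam_powr_unbounded:
  assumes "0 < \<alpha>" "0 < \<epsilon>"
  obtains K where "\<And>m. K \<le> m \<Longrightarrow> 1 \<le> \<epsilon> * lam m powr (2 * \<alpha>)"
proof -
  define B where "B = (1 / \<epsilon>) powr (1 / (2 * \<alpha>))"
  obtain K where K: "\<And>m. lam m \<le> B \<Longrightarrow> m < K"
    using finite_lam_le[of B] by (auto simp: finite_nat_set_iff_bounded)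
  show ?thesis
  proof (rule that[of K])
    fix m assume "K \<le> m"
    then have "B \<le> lam m" using K[of m] by force
    then have "B powr (2 * \<alpha>) \<le> lam m powr (2 * \<alpha>)"
      using assms by (intro powr_mono2) (auto simp: B_def)
    moreover have "B powr (2 * \<alpha>) = 1 / \<epsilon>" using assms by (simp add: B_def powr_powr)
    ultimately have "1 / \<epsilon> \<le> lam m powr (2 * \<alpha>)" by simp
    then have "\<epsilon> * (1 / \<epsilon>) \<le> \<epsilon> * lam m powr (2 * \<alpha>)" using assms(2) by (intro mult_left_mono) auto
    then show "1 \<le> \<epsilon> * lam m powr (2 * \<alpha>)" using assms(2) by simp
  qed
qed

lemma lam_powr_double: "lam m powr (2 * \<alpha>) = (lam m powr \<alpha>)\<^sup>2"
  by (simp only: mult_2 powr_add power2_eq_square)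

text \<open>The compactness behind strong convergence in \<open>L\<^sup>2([0,T];H)\<close>: the high modes are controlled by the
  dissipation.\<close>

lemma norm_split_low_high:
  assumes f: "f \<in> Hs \<alpha>" and K: "\<And>m. K \<le> m \<Longrightarrow> 1 \<le> \<epsilon> * lam m powr (2 * \<alpha>)" and \<epsilon>: "0 \<le> \<epsilon>"
  shows "(norm f)\<^sup>2 \<le> (\<Sum>m<K. (inner f (bas m))\<^sup>2) + \<epsilon> * (norm_Hs \<alpha> f)\<^sup>2"
proof (rule sums_le[OF _ H0_norm_sums[OF Hs_H0[OF f]] sums_add[OF sums_If_finite_set sums_mult[OF norm_Hs_sums[OF f]]]])
  fix m
  show "(inner f (bas m))\<^sup>2 \<le> (if m \<in> {..<K} then (inner f (bas m))\<^sup>2 else 0) + \<epsilon> * (lam m powr \<alpha> * inner f (bas m))\<^sup>2"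
  proof (cases "m < K")
    case False
    then have "1 * (inner f (bas m))\<^sup>2 \<le> (\<epsilon> * lam m powr (2 * \<alpha>)) * (inner f (bas m))\<^sup>2"
      using K[of m] by (intro mult_right_mono) auto
    then show ?thesis using False by (simp add: lam_powr_double power_mult_distrib mult.assoc)
  qed (use \<epsilon> in simp)
qed simp

section \<open>Measurability of Sobolev-valued paths\<close>

lemma Lam_outside_Hs:
  assumes "f \<in> H0" "f \<notin> Hs r"
  shows "Lam r f = (THE h. False)"
proof -
  have "\<not> (\<forall>k. fourier h k = (if k = (0, 0) then 0 else complex_of_real (freq k powr r)) * fourier f k)" for h
  proof
    assume h: "\<forall>k. fourier h k = (if k = (0, 0) then 0 else complex_of_real (freq k powr r)) * fourier f k"
    have "(\<lambda>k. (cmod (fourier h k))\<^sup>2) summable_on (- {0})"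
      using has_sum_imp_summable[OF fourier_norm_has_sum[of h]] by (simp add: summable_on_subset_banach[of _ UNIV])
    then have "(\<lambda>k. freq k powr (2 * r) * (cmod (fourier f k))\<^sup>2) summable_on (- {0})"
      by (rule summable_on_cong[THEN iffD1, rotated])
        (simp add: h norm_mult power_mult_distrib freq_powr_double zero_prod_def[symmetric])
    then show False using assms by (simp add: Hs_def zero_prod_def)
  qed
  then have "(\<lambda>h. \<forall>k. fourier h k = (if k = (0, 0) then 0 else complex_of_real (freq k powr r)) * fourier f k) = (\<lambda>h. False)"
    by (intro ext) (simp only: simp_thms)
  then show ?thesis unfolding Lam_def fourier_mult_def by (rule arg_cong)
qed

text \<open>Where the partial sums are Cauchy the path lies in \<open>Hs r\<close> and
  \<open>Lam r\<close> has measurable coefficients. Elsewhere the description has no solution, so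
  \<open>Lam r\<close> takes the single value \<open>THE h. False\<close>. The two pieces are
  patched along a measurable set without knowing that value.\<close>

lemma measurable_Lam:
  assumes f: "\<And>t. t \<in> space M \<Longrightarrow> f t \<in> H0" "f \<in> borel_measurable M"
  shows "(\<lambda>t. Lam r (f t)) \<in> borel_measurable M"
proof -
  have [measurable]: "f \<in> borel_measurable M" by (rule f)
  define S where "S = {t \<in> space M. Cauchy (\<lambda>N. \<Sum>n<N. (lam n powr r * inner (f t) (bas n))\<^sup>2)}"
  have S[measurable]: "S \<in> sets M" unfolding S_def by measurable
  have SH: "t \<in> S \<longleftrightarrow> f t \<in> Hs r" if "t \<in> space M" for t
    using that f(1)[OF that] by (simp add: S_def Hs_iff summable_iff_convergent Cauchy_convergent_iff)
  have "(\<lambda>t. if t \<in> S then Lam r (f t) else 0) \<in> borel_measurable M"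
  proof (rule borel_measurable_torus_L2_iff_modes)
    show "(if t \<in> S then Lam r (f t) else 0) \<in> H0" if "t \<in> space M" for t
      using SH[OF that] by (auto intro: Lam_H0)
    show "(\<lambda>t. inner (if t \<in> S then Lam r (f t) else 0) (bas n)) \<in> borel_measurable M" for n
    proof -
      have "(\<lambda>t. if t \<in> S then lam n powr r * inner (f t) (bas n) else 0) \<in> borel_measurable M" by measurable
      then show ?thesis
        by (rule measurable_cong[THEN iffD1, rotated]) (auto simp: SH Lam_bas)
    qed
  qed
  then have "(\<lambda>t. if t \<in> S then (if t \<in> S then Lam r (f t) else 0) else (THE h. False)) \<in> borel_measurable M"
    by measurable
  then show ?thesis
    by (rule measurable_cong[THEN iffD1, rotated]) (use SH f(1) Lam_outside_Hs in auto)
qed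

lemma norm_Hs_outside: "f \<in> H0 \<Longrightarrow> f \<notin> Hs r \<Longrightarrow> norm_Hs r f = 0"
  by (simp add: Hs_def norm_Hs_def infsum_not_exists)

lemma measurable_norm_Hs:
  assumes f: "\<And>t. t \<in> space M \<Longrightarrow> f t \<in> H0" "f \<in> borel_measurable M"
  shows "(\<lambda>t. norm_Hs r (f t)) \<in> borel_measurable M"
proof -
  have [measurable]: "f \<in> borel_measurable M" "(\<lambda>t. Lam r (f t)) \<in> borel_measurable M"
    by (rule f measurable_Lam[OF f])+
  define S where "S = {t \<in> space M. Cauchy (\<lambda>N. \<Sum>n<N. (lam n powr r * inner (f t) (bas n))\<^sup>2)}"
  have S[measurable]: "S \<in> sets M" unfolding S_def by measurable
  have SH: "t \<in> S \<longleftrightarrow> f t \<in> Hs r" if "t \<in> space M" for t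
    using that f(1)[OF that] by (simp add: S_def Hs_iff summable_iff_convergent Cauchy_convergent_iff)
  have "(\<lambda>t. if t \<in> S then norm (Lam r (f t)) else 0) \<in> borel_measurable M" by measurable
  then show ?thesis
    by (rule measurable_cong[THEN iffD1, rotated]) (use SH f(1) norm_Hs_outside norm_Lam in auto)
qed

text \<open>Monotone convergence over the modes: bounds on finite sums, which limits preserve, give
  membership in \<open>Hs \<alpha>\<close> almost everywhere and the bound on the full
  dissipation.\<close>

lemma L2T_Hs_from_partial_sums:
  assumes \<theta>: "\<And>t. t \<in> {0..T} \<Longrightarrow> \<theta> t \<in> H0" "\<theta> \<in> borel_measurable (lebesgue_on {0..T})"
    and i: "\<And>m. integrable (lebesgue_on {0..T}) (\<lambda>s. (lam m powr \<alpha> * inner (\<theta> s) (bas m))\<^sup>2)"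
    and C: "\<And>K. (\<integral>s. (\<Sum>m<K. (lam m powr \<alpha> * inner (\<theta> s) (bas m))\<^sup>2) \<partial>lebesgue_on {0..T}) \<le> C"
  shows "\<theta> \<in> L2T_Hs T \<alpha>" "(\<integral>s. (norm_Hs \<alpha> (\<theta> s))\<^sup>2 \<partial>lebesgue_on {0..T}) \<le> C"
proof -
  let ?M = "lebesgue_on {0..T}"
  let ?c = "\<lambda>m s. (lam m powr \<alpha> * inner (\<theta> s) (bas m))\<^sup>2"
  have [measurable]: "\<theta> \<in> borel_measurable ?M" by (rule \<theta>)
  have C0: "0 \<le> C" using C[of 0] by simp
  have "(\<integral>\<^sup>+s. (\<Sum>m. ennreal (?c m s)) \<partial>?M) = (\<Sum>m. \<integral>\<^sup>+s. ennreal (?c m s) \<partial>?M)"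
    by (rule nn_integral_suminf) measurable
  also have "\<dots> = (\<Sum>m. ennreal (\<integral>s. ?c m s \<partial>?M))"
    by (intro suminf_cong nn_integral_eq_integral i) auto
  also have "\<dots> \<le> ennreal C"
  proof (rule suminf_le_const)
    show "(\<Sum>m<K. ennreal (\<integral>s. ?c m s \<partial>?M)) \<le> ennreal C" for K
    proof -
      have "(\<Sum>m<K. ennreal (\<integral>s. ?c m s \<partial>?M)) = ennreal (\<Sum>m<K. \<integral>s. ?c m s \<partial>?M)"
        by (intro sum_ennreal Bochner_Integration.integral_nonneg) auto
      also have "(\<Sum>m<K. \<integral>s. ?c m s \<partial>?M) = (\<integral>s. (\<Sum>m<K. ?c m s) \<partial>?M)"
        by (rule Bochner_Integration.integral_sum[symmetric]) (rule i)
      finally show ?thesis using C[of K] by (simp add: ennreal_leI)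
    qed
  qed simp
  finally have nn: "(\<integral>\<^sup>+s. (\<Sum>m. ennreal (?c m s)) \<partial>?M) \<le> ennreal C" .
  then have "(\<integral>\<^sup>+s. (\<Sum>m. ennreal (?c m s)) \<partial>?M) \<noteq> \<infinity>"
    by (auto simp: top_unique)
  then have "AE s in ?M. (\<Sum>m. ennreal (?c m s)) \<noteq> \<infinity>"
    by (intro nn_integral_PInf_AE) auto
  moreover have "AE s in ?M. s \<in> {0..T}" by (rule AE_I2) simp
  ultimately have ae: "AE s in ?M. \<theta> s \<in> Hs \<alpha>"
  proof eventually_elim
    case (elim s)
    then have "summable (\<lambda>m. ?c m s)" by (intro summable_suminf_not_top) auto
    then show ?case using \<theta>(1)[OF elim(2)] by (simp add: Hs_iff)
  qed
  have "(\<integral>\<^sup>+s. ennreal ((norm_Hs \<alpha> (\<theta> s))\<^sup>2) \<partial>?M) = (\<integral>\<^sup>+s. (\<Sum>m. ennreal (?c m s)) \<partial>?M)"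
  proof (rule nn_integral_cong_AE, use ae in eventually_elim)
    case (elim s)
    from norm_Hs_sums[OF this] have "summable (\<lambda>m. ?c m s)" "(\<Sum>m. ?c m s) = (norm_Hs \<alpha> (\<theta> s))\<^sup>2"
      by (simp_all add: sums_iff)
    then show ?case by (simp add: suminf_ennreal2)
  qed
  then have nn2: "(\<integral>\<^sup>+s. ennreal ((norm_Hs \<alpha> (\<theta> s))\<^sup>2) \<partial>?M) \<le> ennreal C" using nn by simp
  have mN: "(\<lambda>s. norm_Hs \<alpha> (\<theta> s)) \<in> borel_measurable ?M"
    by (rule measurable_norm_Hs) (use \<theta> in auto)
  have int: "integrable ?M (\<lambda>s. (norm_Hs \<alpha> (\<theta> s))\<^sup>2)"
    using nn2 mN by (intro integrableI_bounded) (auto intro: order.strict_trans1[OF _ ennreal_less_top])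
  then show "(\<integral>s. (norm_Hs \<alpha> (\<theta> s))\<^sup>2 \<partial>?M) \<le> C"
    using nn2 C0 by (subst (asm) nn_integral_eq_integral) (auto simp: ennreal_le_iff)
  have "(\<lambda>s. Lam \<alpha> (\<theta> s)) \<in> borel_measurable ?M"
    by (rule measurable_Lam) (use \<theta> in auto)
  then show "\<theta> \<in> L2T_Hs T \<alpha>" using ae int by (simp add: L2T_Hs_def)
qed

text \<open>The difference of the quadratic terms is bounded by the squared distance plus a cross
  term between the distance and the norm of the limit. Young's inequality splits the cross term with
  a parameter \<delta> that is fixed before N tends to infinity, so mean-square convergence
  suffices.\<close>

lemma nonlin_integral_tendsto:
  fixes z :: "nat \<Rightarrow> real \<Rightarrow> torus_L2" and T :: real
  assumes z: "\<And>N s. s \<in> {0..T} \<Longrightarrow> z N s \<in> H0" "\<And>N. z N \<in> borel_measurable (lebesgue_on {0..T})"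
    and \<theta>: "\<And>s. s \<in> {0..T} \<Longrightarrow> \<theta> s \<in> H0" "\<theta> \<in> borel_measurable (lebesgue_on {0..T})"
    and \<theta>2: "integrable (lebesgue_on {0..T}) (\<lambda>s. (norm (\<theta> s))\<^sup>2)"
    and d2: "\<And>N. integrable (lebesgue_on {0..T}) (\<lambda>s. (norm (z N s - \<theta> s))\<^sup>2)"
    and lim: "(\<lambda>N. \<integral>s. (norm (z N s - \<theta> s))\<^sup>2 \<partial>lebesgue_on {0..T}) \<longlonglongrightarrow> 0"
    and t: "t \<le> T" and \<phi>: "\<phi> \<in> Hinf"
  shows "(\<lambda>N. \<integral>s. nonlin (z N s) \<phi> \<partial>lebesgue_on {0..t}) \<longlonglongrightarrow> (\<integral>s. nonlin (\<theta> s) \<phi> \<partial>lebesgue_on {0..t})"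
proof -
  let ?M = "lebesgue_on {0..T}"
  define c where "c = wt_const * norm_Hs 4 \<phi>"
  have c: "0 \<le> c" unfolding c_def using wt_const_pos by simp
  have ni: "integrable ?M (\<lambda>s. nonlin (f s) \<phi>)"
    if f: "\<And>s. s \<in> {0..T} \<Longrightarrow> f s \<in> H0" "f \<in> borel_measurable ?M" "integrable ?M (\<lambda>s. (norm (f s))\<^sup>2)" for f
  proof (rule Bochner_Integration.integrable_bound[OF integrable_mult_right[OF f(3), of c]])
    show "(\<lambda>s. nonlin (f s) \<phi>) \<in> borel_measurable ?M"
      by (rule measurable_nonlin[OF \<phi> f(2)]) (use f(1) in auto)
    show "AE s in ?M. norm (nonlin (f s) \<phi>) \<le> norm (c * (norm (f s))\<^sup>2)"
      by (rule AE_I2) (use nonlin_bound[OF f(1) \<phi>] c in \<open>auto simp: c_def\<close>)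
  qed
  have z2: "integrable ?M (\<lambda>s. (norm (z N s))\<^sup>2)" for N
  proof (rule Bochner_Integration.integrable_bound)
    show "integrable ?M (\<lambda>s. 2 * (norm (z N s - \<theta> s))\<^sup>2 + 2 * (norm (\<theta> s))\<^sup>2)"
      using d2[of N] \<theta>2 by auto
    show "(\<lambda>s. (norm (z N s))\<^sup>2) \<in> borel_measurable ?M" using z(2)[of N] by measurable
    show "AE s in ?M. norm ((norm (z N s))\<^sup>2) \<le> norm (2 * (norm (z N s - \<theta> s))\<^sup>2 + 2 * (norm (\<theta> s))\<^sup>2)"
    proof (rule AE_I2)
      fix s
      have "norm (z N s) \<le> norm (z N s - \<theta> s) + norm (\<theta> s)" using norm_triangle_ineq[of "z N s - \<theta> s" "\<theta> s"] by simp
      then have "(norm (z N s))\<^sup>2 \<le> (norm (z N s - \<theta> s) + norm (\<theta> s))\<^sup>2" by (intro power_mono) auto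
      also have "\<dots> \<le> 2 * (norm (z N s - \<theta> s))\<^sup>2 + 2 * (norm (\<theta> s))\<^sup>2"
        using zero_le_power2[of "norm (z N s - \<theta> s) - norm (\<theta> s)"] by (simp add: power2_sum power2_diff)
      finally show "norm ((norm (z N s))\<^sup>2) \<le> norm (2 * (norm (z N s - \<theta> s))\<^sup>2 + 2 * (norm (\<theta> s))\<^sup>2)" by simp
    qed
  qed
  define D where "D N = (\<integral>s. (norm (z N s - \<theta> s))\<^sup>2 \<partial>?M)" for N
  define Q where "Q = (\<integral>s. (norm (\<theta> s))\<^sup>2 \<partial>?M)"
  have Q0: "0 \<le> Q" unfolding Q_def by simp
  have key: "\<bar>(\<integral>s. nonlin (z N s) \<phi> \<partial>lebesgue_on {0..t}) - (\<integral>s. nonlin (\<theta> s) \<phi> \<partial>lebesgue_on {0..t})\<bar>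
      \<le> c * (1 + inverse \<delta>) * D N + c * \<delta> * Q" if \<delta>: "0 < \<delta>" for N \<delta>
  proof -
    let ?d = "\<lambda>s. nonlin (z N s) \<phi> - nonlin (\<theta> s) \<phi>"
    have i1: "integrable ?M (\<lambda>s. nonlin (z N s) \<phi>)" by (rule ni) (use z z2 in auto)
    have i2: "integrable ?M (\<lambda>s. nonlin (\<theta> s) \<phi>)" by (rule ni) (use \<theta> \<theta>2 in auto)
    have "(\<integral>s. nonlin (z N s) \<phi> \<partial>lebesgue_on {0..t}) - (\<integral>s. nonlin (\<theta> s) \<phi> \<partial>lebesgue_on {0..t}) = (\<integral>s. ?d s \<partial>lebesgue_on {0..t})"
      using integrable_upto[OF i1 t] integrable_upto[OF i2 t] by simp
    also have "\<bar>\<dots>\<bar> \<le> (\<integral>s. \<bar>?d s\<bar> \<partial>?M)" using i1 i2 t by (intro abs_integral_upto_le) auto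
    also have "\<dots> \<le> (\<integral>s. c * (1 + inverse \<delta>) * (norm (z N s - \<theta> s))\<^sup>2 + c * \<delta> * (norm (\<theta> s))\<^sup>2 \<partial>?M)"
    proof (rule integral_mono)
      show "integrable ?M (\<lambda>s. \<bar>?d s\<bar>)" using i1 i2 by auto
      show "integrable ?M (\<lambda>s. c * (1 + inverse \<delta>) * (norm (z N s - \<theta> s))\<^sup>2 + c * \<delta> * (norm (\<theta> s))\<^sup>2)"
        using d2[of N] \<theta>2 by auto
      fix s assume "s \<in> space ?M"
      then have s: "s \<in> {0..T}" by simp
      define x y where "x = norm (z N s - \<theta> s)" and "y = norm (\<theta> s)"
      have xy: "0 \<le> x" "0 \<le> y" by (auto simp: x_def y_def)
      have zt: "norm (z N s) \<le> x + y" unfolding x_def y_def using norm_triangle_ineq[of "z N s - \<theta> s" "\<theta> s"] by simp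
      have "\<bar>?d s\<bar> \<le> c * x * (norm (z N s) + y)"
        unfolding c_def x_def y_def by (rule nonlin_diff_bound[OF z(1)[OF s] \<theta>(1)[OF s] \<phi>])
      also have "\<dots> \<le> c * x * ((x + y) + y)" using zt c xy by (intro mult_left_mono) auto
      also have "\<dots> = c * (x\<^sup>2 + 2 * x * y)" by (simp add: power2_eq_square algebra_simps)
      also have "\<dots> \<le> c * (x\<^sup>2 + (inverse \<delta> * x\<^sup>2 + \<delta> * y\<^sup>2))"
      proof (intro mult_left_mono add_left_mono c)
        have "0 \<le> inverse \<delta> * (x - \<delta> * y)\<^sup>2" using \<delta> by simp
        also have "\<dots> = inverse \<delta> * x\<^sup>2 + \<delta> * y\<^sup>2 - 2 * x * y" using \<delta> by (simp add: power2_eq_square field_simps)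
        finally show "2 * x * y \<le> inverse \<delta> * x\<^sup>2 + \<delta> * y\<^sup>2" by simp
      qed
      finally show "\<bar>?d s\<bar> \<le> c * (1 + inverse \<delta>) * (norm (z N s - \<theta> s))\<^sup>2 + c * \<delta> * (norm (\<theta> s))\<^sup>2"
        by (simp add: x_def y_def algebra_simps)
    qed
    also have "\<dots> = c * (1 + inverse \<delta>) * D N + c * \<delta> * Q"
      using d2[of N] \<theta>2 by (simp add: D_def Q_def)
    finally show ?thesis .
  qed
  show ?thesis
  proof (rule LIMSEQ_I)
    fix e :: real assume e: "0 < e"
    \<comment> \<open>This makes c \<delta> Q smaller than e/2; the summand 1 covers the case c Q =
      0.\<close>
    define \<delta> where "\<delta> = e / (2 * (c * Q + 1))"
    have cQ: "0 < 2 * (c * Q + 1)" using c Q0 by (simp add: add_nonneg_pos)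
    have \<delta>: "0 < \<delta>" using e cQ by (simp add: \<delta>_def)
    have small: "c * \<delta> * Q < e / 2"
    proof -
      have "c * \<delta> * Q = \<delta> * (c * Q)" by simp
      also have "\<dots> < \<delta> * (c * Q + 1)" using \<delta> by simp
      also have "\<dots> = e / 2"
      proof -
        have "c * Q + 1 \<noteq> 0" using cQ by auto
        then show ?thesis by (simp add: \<delta>_def divide_simps del: distrib_left_numeral)
      qed
      finally show ?thesis .
    qed
    have "(\<lambda>N. c * (1 + inverse \<delta>) * D N) \<longlonglongrightarrow> c * (1 + inverse \<delta>) * 0"
      unfolding D_def by (intro tendsto_intros lim)
    then have "(\<lambda>N. c * (1 + inverse \<delta>) * D N) \<longlonglongrightarrow> 0" by simp
    from LIMSEQ_D[OF this, of "e / 2"] e obtain N0 where N0: "\<And>N. N \<ge> N0 \<Longrightarrow> \<bar>c * (1 + inverse \<delta>) * D N\<bar> < e / 2" by auto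
    show "\<exists>no. \<forall>n\<ge>no. norm ((\<integral>s. nonlin (z n s) \<phi> \<partial>lebesgue_on {0..t}) - (\<integral>s. nonlin (\<theta> s) \<phi> \<partial>lebesgue_on {0..t})) < e"
    proof (intro exI[of _ N0] allI impI)
      fix n assume "N0 \<le> n"
      then show "norm ((\<integral>s. nonlin (z n s) \<phi> \<partial>lebesgue_on {0..t}) - (\<integral>s. nonlin (\<theta> s) \<phi> \<partial>lebesgue_on {0..t})) < e"
        using N0[of n] key[OF \<delta>, of n] small unfolding real_norm_def by linarith
    qed
  qed
qed

text \<open>Against a truncated h the pairing is a finite sum of continuous functions, and the
  uniform bound on the norms makes the truncation error uniform in time.\<close>

lemma Cw_H_from_modes:
  assumes ext: "\<theta> \<in> extensional {0..T}" and H: "\<And>t. t \<in> {0..T} \<Longrightarrow> \<theta> t \<in> H0"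
    and M: "\<And>t. t \<in> {0..T} \<Longrightarrow> norm (\<theta> t) \<le> M" and c: "\<And>n. continuous_on {0..T} (\<lambda>t. inner (\<theta> t) (bas n))"
  shows "\<theta> \<in> Cw_H T"
proof -
  have "continuous_on {0..T} (\<lambda>t. inner (\<theta> t) h)" if h: "h \<in> H0" for h
  proof (rule uniform_limit_theorem)
    show "\<forall>\<^sub>F N in sequentially. continuous_on {0..T} (\<lambda>t. inner (\<theta> t) (trunc N h))"
      unfolding inner_trunc by (intro always_eventually allI continuous_on_sum continuous_on_mult c continuous_on_const)
    show "uniform_limit {0..T} (\<lambda>N t. inner (\<theta> t) (trunc N h)) (\<lambda>t. inner (\<theta> t) h) sequentially"
    proof (rule uniform_limitI)
      fix e :: real assume e: "0 < e"
      have h0: "h \<in> Hs 0" using h by simp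
      have "(\<lambda>N. \<bar>M\<bar> * norm_Hs 0 (h - trunc N h)) \<longlonglongrightarrow> \<bar>M\<bar> * 0"
        by (intro tendsto_intros norm_Hs_trunc_tendsto h0)
      then have "(\<lambda>N. \<bar>M\<bar> * norm (h - trunc N h)) \<longlonglongrightarrow> 0"
        using h by (simp add: norm_Hs_0 H0_diff)
      from order_tendstoD(2)[OF this e]
      show "\<forall>\<^sub>F N in sequentially. \<forall>t\<in>{0..T}. dist (inner (\<theta> t) (trunc N h)) (inner (\<theta> t) h) < e"
      proof eventually_elim
        case (elim N)
        show ?case
        proof
          fix t assume t: "t \<in> {0..T}"
          have "dist (inner (\<theta> t) (trunc N h)) (inner (\<theta> t) h) = \<bar>inner (\<theta> t) (h - trunc N h)\<bar>"
            by (simp add: dist_real_def inner_diff_right abs_minus_commute)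
          also have "\<dots> \<le> norm (\<theta> t) * norm (h - trunc N h)" by (rule Cauchy_Schwarz_ineq2)
          also have "\<dots> \<le> \<bar>M\<bar> * norm (h - trunc N h)" using M[OF t] by (intro mult_right_mono) auto
          finally show "dist (inner (\<theta> t) (trunc N h)) (inner (\<theta> t) h) < e" using elim by linarith
        qed
      qed
    qed
  qed simp
  then show ?thesis using ext H by (auto simp: Cw_H_def PiE_def)
qed

lemma norm_Hs_diff_square_le:
  assumes "f \<in> Hs r" "h \<in> Hs r"
  shows "(norm_Hs r (f - h))\<^sup>2 \<le> 2 * (norm_Hs r f)\<^sup>2 + 2 * (norm_Hs r h)\<^sup>2"
proof -
  have "norm_Hs r (f - h) \<le> norm_Hs r f + norm_Hs r h"
    using norm_Hs_triangle[OF assms(1) Hs_uminus[OF assms(2)]] norm_Hs_scaleR[OF assms(2), of "-1"] by simp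
  then have "(norm_Hs r (f - h))\<^sup>2 \<le> (norm_Hs r f + norm_Hs r h)\<^sup>2" by (intro power_mono) auto
  also have "\<dots> \<le> 2 * (norm_Hs r f)\<^sup>2 + 2 * (norm_Hs r h)\<^sup>2"
    using zero_le_power2[of "norm_Hs r f - norm_Hs r h"] by (simp add: power2_sum power2_diff)
  finally show ?thesis .
qed

lemma integrable_mode_rhs_continuous:
  assumes zc: "continuous_on {0..T} z" and zH: "\<And>t. t \<in> {0..T} \<Longrightarrow> z t \<in> H0" and g: "g \<in> L2T T"
  shows "integrable (lebesgue_on {0..T}) (mode_rhs \<alpha> g z m)"
proof -
  have "integrable (lebesgue_on {0..T}) (\<lambda>s. inner (g s) (bas m))"
    by (rule Bochner_Integration.integrable_bound[OF L2T_integrable_norm[OF g]])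
      (use g in \<open>auto simp: abs_inner_bas_le L2T_def\<close>)
  moreover have "continuous_on {0..T} (\<lambda>s. nonlin (mean_free (z s)) (bas m))"
    by (rule continuous_on_compose2[OF continuous_nonlin[OF bas_Hinf] zc]) simp
  then have "continuous_on {0..T} (\<lambda>s. nonlin (z s) (bas m))"
    by (rule continuous_on_eq) (simp add: mean_free_id zH)
  then have "integrable (lebesgue_on {0..T}) (\<lambda>s. nonlin (z s) (bas m))" by (rule continuous_imp_integrable_real)
  moreover have "integrable (lebesgue_on {0..T}) (\<lambda>s. inner (z s) (bas m))"
    by (intro continuous_imp_integrable_real continuous_intros zc)
  ultimately show ?thesis unfolding mode_rhs_def by auto
qed

lemma abs_coeff_square_bound:
  fixes x y l M :: real
  assumes "\<bar>x\<bar> \<le> M"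
  shows "(l * x - y / 2)\<^sup>2 \<le> 2 * l\<^sup>2 * M\<^sup>2 + y\<^sup>2 / 2"
proof -
  have "(l * x - y / 2)\<^sup>2 \<le> 2 * (l * x)\<^sup>2 + 2 * (y / 2)\<^sup>2"
    using zero_le_power2[of "l * x + y / 2"] by (simp add: power2_sum power2_diff)
  moreover have "(l * x)\<^sup>2 \<le> l\<^sup>2 * M\<^sup>2"
    unfolding power_mult_distrib using assms by (intro mult_left_mono) (auto simp: abs_le_square_iff[symmetric])
  ultimately show ?thesis by (simp add: power_divide)
qed

text \<open>The Galerkin solutions share three bounds: on the L2 norm uniformly in time, on the
  dissipation, and on the modulus of continuity of each coefficient. The last yields convergence of
  all coefficients at every time, the second upgrades it to strong convergence in
  \<open>L2([0,T];H)\<close> as the quadratic term requires, and the energy balance survives as an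
  inequality.\<close>

theorem leray_solution_exists:
  assumes T: "0 < T" and \<alpha>: "0 < \<alpha>" and z0: "z0 \<in> H0" and g: "g \<in> L2T T"
  shows "\<exists>\<theta>. \<theta> 0 = z0 \<and> weak_solution T \<alpha> g z0 \<theta> \<and> energy_inequality T \<alpha> g \<theta>"
proof -
  let ?L = "lebesgue_on {0..T}"
  interpret finite_measure ?L by (rule finite_measure_lebesgue_on) simp
  have gm[measurable]: "g \<in> borel_measurable ?L" and g2: "integrable ?L (\<lambda>s. (norm (g s))\<^sup>2)"
    using g by (auto simp: L2T_def)
  define G2 where "G2 = (\<integral>s. (norm (g s))\<^sup>2 \<partial>?L)"
  have G20: "0 \<le> G2" by (simp add: G2_def)
  \<comment> \<open>The summand 1 keeps the cut-off radius positive when datum and control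
    vanish.\<close>
  define M where "M = sqrt ((norm z0)\<^sup>2 + 1/2 * G2) + 1"
  have M: "0 < M" "(norm z0)\<^sup>2 + 1/2 * G2 \<le> M\<^sup>2"
  proof -
    have r: "0 \<le> sqrt ((norm z0)\<^sup>2 + 1/2 * G2)" using G20 by simp
    then show "0 < M" unfolding M_def by linarith
    have "(sqrt ((norm z0)\<^sup>2 + 1/2 * G2))\<^sup>2 \<le> M\<^sup>2" using r by (intro power_mono) (auto simp: M_def)
    then show "(norm z0)\<^sup>2 + 1/2 * G2 \<le> M\<^sup>2" using G20 by simp
  qed
  define \<gamma> where "\<gamma> n s = inner (g s) (bas n)" for n s
  define l where "l n = lam n powr \<alpha>" for n
  have \<gamma>m[measurable]: "\<gamma> n \<in> borel_measurable ?L" for n unfolding \<gamma>_def by measurable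
  have \<gamma>2: "integrable ?L (\<lambda>s. (\<gamma> n s)\<^sup>2)" for n
    by (rule Bochner_Integration.integrable_bound[OF g2]) (simp_all add: \<gamma>_def inner_bas_square_le)
  define P where "P N z \<longleftrightarrow> continuous_on {0..T} z \<and> (\<forall>t\<in>{0..T}. trunc N (z t) = z t \<and> norm (z t) \<le> M) \<and>
    (\<forall>m<N. \<forall>t\<in>{0..T}. inner (z t) (bas m) = inner z0 (bas m) + (\<integral>s. mode_rhs \<alpha> g z m s \<partial>lebesgue_on {0..t})) \<and>
    (\<forall>t\<in>{0..T}. (\<Sum>m<N. (inner (z t) (bas m))\<^sup>2) + 2 * (\<integral>s. (\<Sum>m<N. (l m * inner (z s) (bas m) - \<gamma> m s / 2)\<^sup>2) \<partial>lebesgue_on {0..t})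
      = (\<Sum>m<N. (inner z0 (bas m))\<^sup>2) + 1/2 * (\<integral>s. (\<Sum>m<N. (\<gamma> m s)\<^sup>2) \<partial>lebesgue_on {0..t}))" for N z
  have "\<exists>z. P N z" for N
    unfolding P_def l_def \<gamma>_def by (rule galerkin[OF less_imp_le[OF T] z0 g M[unfolded G2_def]])
  then obtain z where "\<And>N. P N (z N)" by metis
  then have zc: "\<And>N. continuous_on {0..T} (z N)"
    and ztr: "\<And>N t. t \<in> {0..T} \<Longrightarrow> trunc N (z N t) = z N t" and zM: "\<And>N t. t \<in> {0..T} \<Longrightarrow> norm (z N t) \<le> M"
    and zeq: "\<And>N m t. m < N \<Longrightarrow> t \<in> {0..T} \<Longrightarrow>
      inner (z N t) (bas m) = inner z0 (bas m) + (\<integral>s. mode_rhs \<alpha> g (z N) m s \<partial>lebesgue_on {0..t})"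
    and zen: "\<And>N t. t \<in> {0..T} \<Longrightarrow> (\<Sum>m<N. (inner (z N t) (bas m))\<^sup>2) + 2 * (\<integral>s. (\<Sum>m<N. (l m * inner (z N s) (bas m) - \<gamma> m s / 2)\<^sup>2) \<partial>lebesgue_on {0..t})
      = (\<Sum>m<N. (inner z0 (bas m))\<^sup>2) + 1/2 * (\<integral>s. (\<Sum>m<N. (\<gamma> m s)\<^sup>2) \<partial>lebesgue_on {0..t})"
    unfolding P_def by blast+
  have zH: "z N t \<in> H0" if "t \<in> {0..T}" for N t using ztr[OF that, of N] trunc_H0 by metis
  have zi: "z N t \<in> Hinf" if "t \<in> {0..T}" for N t using ztr[OF that, of N] trunc_Hinf by metis
  have zm[measurable]: "z N \<in> borel_measurable ?L" for N
    by (rule continuous_imp_measurable_on_sets_lebesgue[OF zc]) simp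
  define a where "a N n t = inner (z N t) (bas n)" for N n t
  have aM: "\<bar>a N n t\<bar> \<le> M" if "t \<in> {0..T}" for N n t
    using abs_inner_bas_le[of "z N t" n] zM[OF that, of N] by (simp add: a_def)
  have a0: "a N n t = 0" if "t \<in> {0..T}" "N \<le> n" for N n t
    using inner_trunc_bas[of N "z N t" n] ztr[OF that(1)] that(2) by (simp add: a_def)
  have ac: "continuous_on {0..T} (a N n)" for N n unfolding a_def by (intro continuous_intros zc)
  have am[measurable]: "a N n \<in> borel_measurable ?L" for N n unfolding a_def by measurable
  \<comment> \<open>An integrable majorant of the right-hand side of mode n, independent of the
    Galerkin index; its primitive \<open>E n\<close> is the common modulus of continuity.\<close>
  define F where "F n s = l n ^ 2 * M + wt_const * norm_Hs 4 (bas n) * M\<^sup>2 + l n * norm (g s)" for n s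
  define E where "E n t = (\<integral>s. F n s \<partial>lebesgue_on {0..t})" for n t
  have Fi: "integrable ?L (F n)" for n unfolding F_def using L2T_integrable_norm[OF g] by auto
  have Ec: "continuous_on {0..T} (E n)" for n unfolding E_def by (rule continuous_integral_upto[OF Fi])
  have ri: "integrable ?L (mode_rhs \<alpha> g (z N) n)" for N n
    by (rule integrable_mode_rhs_continuous[OF zc zH g])
  have rF: "\<bar>mode_rhs \<alpha> g (z N) n s\<bar> \<le> F n s" if s: "s \<in> {0..T}" for N n s
  proof -
    have "\<bar>nonlin (z N s) (bas n)\<bar> \<le> wt_const * norm_Hs 4 (bas n) * (norm (z N s))\<^sup>2"
      by (rule nonlin_bound[OF zH[OF s]]) simp
    also have "\<dots> \<le> wt_const * norm_Hs 4 (bas n) * M\<^sup>2"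
      using zM[OF s, of N] wt_const_pos by (intro mult_left_mono power_mono) auto
    finally have 1: "\<bar>nonlin (z N s) (bas n)\<bar> \<le> wt_const * norm_Hs 4 (bas n) * M\<^sup>2" .
    have 2: "\<bar>l n ^ 2 * inner (z N s) (bas n)\<bar> \<le> l n ^ 2 * M"
      using aM[OF s, of N n] by (simp add: abs_mult a_def mult_left_mono)
    have 3: "\<bar>l n * inner (g s) (bas n)\<bar> \<le> l n * norm (g s)"
      using abs_inner_bas_le[of "g s" n] by (simp add: abs_mult l_def mult_left_mono)
    show ?thesis unfolding mode_rhs_def F_def lam_powr_double l_def[symmetric] using 1 2 3 by linarith
  qed
  have aE: "\<bar>a N n t - a N n s\<bar> \<le> \<bar>E n t - E n s\<bar>" if st: "s \<in> {0..T}" "t \<in> {0..T}" for N n s t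
  proof (cases "n < N")
    case True
    have "a N n t - a N n s = (\<integral>r. mode_rhs \<alpha> g (z N) n r \<partial>lebesgue_on {0..t}) - (\<integral>r. mode_rhs \<alpha> g (z N) n r \<partial>lebesgue_on {0..s})"
      unfolding a_def using zeq[OF True st(1)] zeq[OF True st(2)] by simp
    then show ?thesis unfolding E_def using integral_increment_bound[OF ri Fi rF st] by simp
  qed (use a0 st in auto)
  have "\<exists>k A. strict_mono (k :: nat \<Rightarrow> nat) \<and> (\<forall>n. \<forall>t\<in>{0..T}. (\<lambda>N. a (k N) n t) \<longlonglongrightarrow> A n t)"
    by (rule equicontinuous_subsequence[OF T aM aE Ec])
  then obtain k A where k: "strict_mono (k :: nat \<Rightarrow> nat)"
    and A': "\<forall>n. \<forall>t\<in>{0..T}. (\<lambda>N. a (k N) n t) \<longlonglongrightarrow> A n t"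
    by (elim exE conjE)
  have A: "(\<lambda>N. a (k N) n t) \<longlonglongrightarrow> A n t" if "t \<in> {0..T}" for n t
    using A' that by (elim allE ballE) auto
  have Asum: "(\<Sum>n<K. (A n t)\<^sup>2) \<le> M\<^sup>2" if t: "t \<in> {0..T}" for K t
  proof (rule LIMSEQ_le_const2)
    show "(\<lambda>N. \<Sum>n<K. (a (k N) n t)\<^sup>2) \<longlonglongrightarrow> (\<Sum>n<K. (A n t)\<^sup>2)" by (intro tendsto_intros A t)
    have "(\<Sum>n<K. (a (k N) n t)\<^sup>2) \<le> M\<^sup>2" for N
    proof -
      have "(\<Sum>n<K. (a (k N) n t)\<^sup>2) \<le> (norm (z (k N) t))\<^sup>2"
        unfolding a_def by (rule bessel_finite[OF orthonormal_bas]) simp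
      also have "\<dots> \<le> M\<^sup>2" using zM[OF t] by (intro power_mono) auto
      finally show ?thesis .
    qed
    then show "\<exists>N. \<forall>n\<ge>N. (\<Sum>na<K. (a (k n) na t)\<^sup>2) \<le> M\<^sup>2" by blast
  qed
  \<comment> \<open>The limiting coefficients at a fixed time are square summable by Bessel's
    inequality, so a mean-zero function with these coefficients exists. The restriction to [0,T]
    makes the path extensional, as \<open>Cw_H\<close> demands.\<close>
  define \<theta> where "\<theta> = (\<lambda>t\<in>{0..T}. SOME f. f \<in> H0 \<and> (\<forall>n. inner f (bas n) = A n t))"
  have \<theta>: "\<theta> t \<in> H0" "inner (\<theta> t) (bas n) = A n t" if t: "t \<in> {0..T}" for t n
  proof -
    have "summable (\<lambda>n. (A n t)\<^sup>2)" by (rule bounded_imp_summable[of _ "M\<^sup>2"]) (use Asum[OF t, of "Suc _"] lessThan_Suc_atMost in auto)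
    then obtain f where f: "f \<in> H0" "\<And>n. inner f (bas n) = A n t" by (rule H0_realize) simp
    have "\<theta> t \<in> H0 \<and> (\<forall>n. inner (\<theta> t) (bas n) = A n t)"
      unfolding \<theta>_def restrict_apply'[OF t] by (rule someI[of _ f]) (simp add: f)
    then show "\<theta> t \<in> H0" "inner (\<theta> t) (bas n) = A n t" by auto
  qed
  have \<theta>M: "norm (\<theta> t) \<le> M" if t: "t \<in> {0..T}" for t
  proof -
    have "(norm (\<theta> t))\<^sup>2 \<le> M\<^sup>2"
    proof (rule LIMSEQ_le_const2)
      show "(\<lambda>K. \<Sum>n<K. (A n t)\<^sup>2) \<longlonglongrightarrow> (norm (\<theta> t))\<^sup>2"
        using H0_norm_sums[OF \<theta>(1)[OF t]] by (simp add: sums_def \<theta>(2)[OF t])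
    qed (use Asum[OF t] in blast)
    then show ?thesis by (rule power2_le_imp_le) (use M in simp)
  qed
  have AE: "\<bar>A n t - A n s\<bar> \<le> \<bar>E n t - E n s\<bar>" if st: "s \<in> {0..T}" "t \<in> {0..T}" for n s t
    by (rule LIMSEQ_le_const2[OF tendsto_rabs[OF tendsto_diff[OF A[OF st(2)] A[OF st(1)]]]]) (use aE[OF st] in blast)
  have Ac: "continuous_on {0..T} (A n)" for n
    unfolding continuous_on_iff
  proof (intro ballI allI impI)
    fix t e assume t: "t \<in> {0..T}" and e: "0 < (e::real)"
    obtain d where d: "d > 0" "\<And>s. s \<in> {0..T} \<Longrightarrow> dist s t < d \<Longrightarrow> dist (E n s) (E n t) < e"
      using Ec[of n] t e unfolding continuous_on_iff by blast
    show "\<exists>d>0. \<forall>s\<in>{0..T}. dist s t < d \<longrightarrow> dist (A n s) (A n t) < e"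
    proof (intro exI[of _ d] conjI d(1) ballI impI)
      fix s assume "s \<in> {0..T}" "dist s t < d"
      then show "dist (A n s) (A n t) < e" using d(2)[of s] AE[OF t, of s n] by (simp add: dist_real_def)
    qed
  qed
  have \<theta>c: "continuous_on {0..T} (\<lambda>t. inner (\<theta> t) (bas n))" for n
    using Ac[of n] by (rule continuous_on_eq) (simp add: \<theta>)
  have Cw: "\<theta> \<in> Cw_H T"
    by (rule Cw_H_from_modes[OF _ \<theta>(1) \<theta>M \<theta>c]) (simp only: \<theta>_def restrict_extensional)
  have \<theta>m[measurable]: "\<theta> \<in> borel_measurable ?L" by (rule Cw_H_D(3)[OF Cw])
  have Linf: "\<theta> \<in> LinfT_H T"
    unfolding LinfT_H_def using \<theta>(1) \<theta>M by (auto intro!: exI[of _ M] AE_I2)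
  have Am[measurable]: "A n \<in> borel_measurable ?L" for n
    by (rule continuous_imp_measurable_on_sets_lebesgue[OF Ac]) simp
  have AM: "\<bar>A n t\<bar> \<le> M" if "t \<in> {0..T}" for n t
    using abs_inner_bas_le[of "\<theta> t" n] \<theta>M[OF that] \<theta>(2)[OF that, of n] by simp
  have kN: "N \<le> k N" for N using k by (rule strict_mono_imp_increasing)
  define D where "D N m s = (l m * a N m s - \<gamma> m s / 2)\<^sup>2" for N m s
  define D' where "D' m s = (l m * A m s - \<gamma> m s / 2)\<^sup>2" for m s
  define dom where "dom m s = 2 * (l m)\<^sup>2 * M\<^sup>2 + (\<gamma> m s)\<^sup>2 / 2" for m s
  have dom: "integrable ?L (dom m)" for m unfolding dom_def using \<gamma>2 by auto
  have Dle: "D N m s \<le> dom m s" "D' m s \<le> dom m s" if "s \<in> {0..T}" for N m s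
    unfolding D_def D'_def dom_def by (rule abs_coeff_square_bound, rule aM[OF that] AM[OF that])+
  have D0: "0 \<le> D N m s" "0 \<le> D' m s" for N m s by (auto simp: D_def D'_def)
  have Dm[measurable]: "D N m \<in> borel_measurable ?L" "D' m \<in> borel_measurable ?L" for N m
    unfolding D_def D'_def by measurable
  have Di: "integrable ?L (D N m)" "integrable ?L (D' m)" for N m
  proof -
    have "integrable ?L f" if "f \<in> borel_measurable ?L" "\<And>s. 0 \<le> f s" "\<And>s. s \<in> {0..T} \<Longrightarrow> f s \<le> dom m s" for f
    proof (rule Bochner_Integration.integrable_bound[OF dom[of m] that(1)])
      show "AE s in ?L. norm (f s) \<le> norm (dom m s)"
      proof (rule AE_I2)
        fix s assume "s \<in> space ?L"
        then show "norm (f s) \<le> norm (dom m s)" using that(2)[of s] that(3)[of s] by simp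
      qed
    qed
    then show "integrable ?L (D N m)" "integrable ?L (D' m)" using Dm Dle D0 by blast+
  qed
  have Dlim: "(\<lambda>N. \<integral>s. D (k N) m s \<partial>lebesgue_on {0..t}) \<longlonglongrightarrow> (\<integral>s. D' m s \<partial>lebesgue_on {0..t})" if t: "t \<in> {0..T}" for m t
  proof (rule integral_dominated_convergence[where w="dom m"])
    show "integrable (lebesgue_on {0..t}) (dom m)" by (rule integrable_upto[OF dom]) (use t in auto)
    show "D' m \<in> borel_measurable (lebesgue_on {0..t})" "\<And>i. D (k i) m \<in> borel_measurable (lebesgue_on {0..t})"
      by (rule measurable_upto[OF Dm(2)] measurable_upto[OF Dm(1)]; use t in auto)+
    show "AE s in lebesgue_on {0..t}. (\<lambda>i. D (k i) m s) \<longlonglongrightarrow> D' m s"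
      unfolding D_def D'_def by (intro AE_I2 tendsto_intros A) (use t in auto)
    show "AE s in lebesgue_on {0..t}. norm (D (k i) m s) \<le> dom m s" for i
      by (rule AE_I2) (use t D0 Dle in auto)
  qed
  \<comment> \<open>The modes exhaust only the mean-zero part of the control. Keeping exactly its
    energy on the right-hand side, instead of the larger energy of g, lets it cancel against the
    completed square at the end.\<close>
  define gg where "gg s = (norm (mean_free (g s)))\<^sup>2" for s
  have ggm[measurable]: "(\<lambda>s. mean_free (g s)) \<in> borel_measurable ?L"
    unfolding mean_free_def by measurable
  have ggm': "gg \<in> borel_measurable ?L" unfolding gg_def by measurable
  have ggi: "integrable ?L gg"
    by (rule Bochner_Integration.integrable_bound[OF g2 ggm'])
      (auto simp: gg_def intro!: AE_I2 power_mono norm_mean_free_le)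
  have \<gamma>g: "(\<Sum>m<K. (\<gamma> m s)\<^sup>2) \<le> gg s" for K s
    using bessel_finite[OF orthonormal_bas, of "{..<K}" "mean_free (g s)"] inner_mean_free[OF bas_H0, of _ "g s"]
    by (simp add: \<gamma>_def gg_def inner_commute[of _ "bas _"])
  define RHS where "RHS t = (norm z0)\<^sup>2 + 1/2 * (\<integral>s. gg s \<partial>lebesgue_on {0..t})" for t
  \<comment> \<open>K modes are observed in Galerkin dimension N \<ge> K; all discarded terms are
    nonnegative. The limit in N is taken for fixed K, and K tends to infinity only
    afterwards.\<close>
  have enN: "(\<Sum>m<K. (a N m t)\<^sup>2) + 2 * (\<integral>s. (\<Sum>m<K. D N m s) \<partial>lebesgue_on {0..t}) \<le> RHS t"
    if t: "t \<in> {0..T}" and KN: "K \<le> N" for K N t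
  proof -
    have Dt: "integrable (lebesgue_on {0..t}) (D N m)" for m by (rule integrable_upto[OF Di(1)]) (use t in auto)
    have "(\<Sum>m<K. (a N m t)\<^sup>2) + 2 * (\<integral>s. (\<Sum>m<K. D N m s) \<partial>lebesgue_on {0..t}) \<le>
      (\<Sum>m<N. (a N m t)\<^sup>2) + 2 * (\<integral>s. (\<Sum>m<N. D N m s) \<partial>lebesgue_on {0..t})"
      using KN by (intro add_mono mult_left_mono sum_mono2 integral_mono Bochner_Integration.integrable_sum Dt D0) auto
    also have "\<dots> = (\<Sum>m<N. (inner z0 (bas m))\<^sup>2) + 1/2 * (\<integral>s. (\<Sum>m<N. (\<gamma> m s)\<^sup>2) \<partial>lebesgue_on {0..t})"
      using zen[OF t, of N] by (simp add: a_def D_def)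
    also have "\<dots> \<le> RHS t" unfolding RHS_def
    proof (intro add_mono mult_left_mono bessel_finite[OF orthonormal_bas] integral_mono)
      show "integrable (lebesgue_on {0..t}) (\<lambda>s. \<Sum>m<N. (\<gamma> m s)\<^sup>2)"
        by (intro Bochner_Integration.integrable_sum integrable_upto[OF \<gamma>2]) (use t in auto)
      show "integrable (lebesgue_on {0..t}) gg" by (rule integrable_upto[OF ggi]) (use t in auto)
    qed (use \<gamma>g in auto)
    finally show ?thesis .
  qed
  have enK: "(\<Sum>m<K. (A m t)\<^sup>2) + 2 * (\<integral>s. (\<Sum>m<K. D' m s) \<partial>lebesgue_on {0..t}) \<le> RHS t"
    if t: "t \<in> {0..T}" for K t
  proof -
    have Dt: "integrable (lebesgue_on {0..t}) (D N m)" "integrable (lebesgue_on {0..t}) (D' m)" for N m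
      by (rule integrable_upto[OF Di(1)] integrable_upto[OF Di(2)]; use t in auto)+
    have "(\<Sum>m<K. (A m t)\<^sup>2) + 2 * (\<Sum>m<K. \<integral>s. D' m s \<partial>lebesgue_on {0..t}) \<le> RHS t"
    proof (rule LIMSEQ_le_const2)
      show "(\<lambda>N. (\<Sum>m<K. (a (k N) m t)\<^sup>2) + 2 * (\<Sum>m<K. \<integral>s. D (k N) m s \<partial>lebesgue_on {0..t}))
        \<longlonglongrightarrow> (\<Sum>m<K. (A m t)\<^sup>2) + 2 * (\<Sum>m<K. \<integral>s. D' m s \<partial>lebesgue_on {0..t})"
        by (intro tendsto_intros A t Dlim)
      have "(\<Sum>m<K. (a (k N) m t)\<^sup>2) + 2 * (\<Sum>m<K. \<integral>s. D (k N) m s \<partial>lebesgue_on {0..t}) \<le> RHS t" if "K \<le> N" for N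
        using enN[OF t, of K "k N"] that kN[of N] Dt by simp
      then show "\<exists>N. \<forall>n\<ge>N. (\<Sum>m<K. (a (k n) m t)\<^sup>2) + 2 * (\<Sum>m<K. \<integral>s. D (k n) m s \<partial>lebesgue_on {0..t}) \<le> RHS t" by blast
    qed
    then show ?thesis using Dt by simp
  qed
  have RT: "RHS T \<le> M\<^sup>2"
  proof -
    have "(\<integral>s. gg s \<partial>?L) \<le> G2" unfolding G2_def
      by (rule integral_mono[OF ggi g2]) (auto simp: gg_def intro!: power_mono norm_mean_free_le)
    then show ?thesis unfolding RHS_def using M(2) by linarith
  qed
  have TT: "T \<in> {0..T}" using T by simp
  define C where "C = M\<^sup>2 + 1/2 * G2"
  \<comment> \<open>Recovers a dissipation bound from the completed square through u^2 \<le> 2 (u -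
    v/2)^2 + v^2/2, the difference being (u - v)^2. It is stated for arbitrary coefficients x to
    serve both the Galerkin solutions and their limit.\<close>
  have diss: "(\<integral>s. (\<Sum>m<K. (l m * x m s)\<^sup>2) \<partial>?L) \<le> C"
    if xi: "\<And>m. integrable ?L (\<lambda>s. (l m * x m s - \<gamma> m s / 2)\<^sup>2)" "\<And>m. integrable ?L (\<lambda>s. (l m * x m s)\<^sup>2)"
      and xe: "2 * (\<integral>s. (\<Sum>m<K. (l m * x m s - \<gamma> m s / 2)\<^sup>2) \<partial>?L) \<le> RHS T" for x :: "nat \<Rightarrow> real \<Rightarrow> real" and K
  proof -
    have "(\<integral>s. (\<Sum>m<K. (l m * x m s)\<^sup>2) \<partial>?L) \<le> (\<integral>s. 2 * (\<Sum>m<K. (l m * x m s - \<gamma> m s / 2)\<^sup>2) + 1/2 * (norm (g s))\<^sup>2 \<partial>?L)"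
    proof (rule integral_mono)
      show "integrable ?L (\<lambda>s. \<Sum>m<K. (l m * x m s)\<^sup>2)" by (intro Bochner_Integration.integrable_sum xi)
      show "integrable ?L (\<lambda>s. 2 * (\<Sum>m<K. (l m * x m s - \<gamma> m s / 2)\<^sup>2) + 1/2 * (norm (g s))\<^sup>2)"
        by (intro Bochner_Integration.integrable_add integrable_mult_right Bochner_Integration.integrable_sum xi g2)
      fix s
      have "(\<Sum>m<K. (l m * x m s)\<^sup>2) \<le> (\<Sum>m<K. 2 * (l m * x m s - \<gamma> m s / 2)\<^sup>2 + 1/2 * (\<gamma> m s)\<^sup>2)"
      proof (rule sum_mono)
        fix m
        have "u\<^sup>2 \<le> 2 * (u - v / 2)\<^sup>2 + 1/2 * v\<^sup>2" for u v :: real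
          using zero_le_power2[of "u - v"] by (simp add: power2_diff power_divide field_simps)
        then show "(l m * x m s)\<^sup>2 \<le> 2 * (l m * x m s - \<gamma> m s / 2)\<^sup>2 + 1/2 * (\<gamma> m s)\<^sup>2" .
      qed
      also have "\<dots> = 2 * (\<Sum>m<K. (l m * x m s - \<gamma> m s / 2)\<^sup>2) + 1/2 * (\<Sum>m<K. (\<gamma> m s)\<^sup>2)"
        by (simp only: sum.distrib sum_distrib_left[symmetric])
      also have "(\<Sum>m<K. (\<gamma> m s)\<^sup>2) \<le> (norm (g s))\<^sup>2"
        unfolding \<gamma>_def by (rule bessel_finite[OF orthonormal_bas]) simp
      finally show "(\<Sum>m<K. (l m * x m s)\<^sup>2) \<le> 2 * (\<Sum>m<K. (l m * x m s - \<gamma> m s / 2)\<^sup>2) + 1/2 * (norm (g s))\<^sup>2" by simp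
    qed
    also have "\<dots> = 2 * (\<integral>s. (\<Sum>m<K. (l m * x m s - \<gamma> m s / 2)\<^sup>2) \<partial>?L) + 1/2 * G2"
      using xi g2 by (simp add: G2_def)
    also have "\<dots> \<le> C" using xe RT by (simp add: C_def)
    finally show ?thesis .
  qed
  have bi: "integrable ?L (\<lambda>s. (l m * x s)\<^sup>2)" if "x \<in> borel_measurable ?L" "\<And>s. s \<in> {0..T} \<Longrightarrow> \<bar>x s\<bar> \<le> M" for x m
  proof (rule integrable_const_bound[of _ "(l m)\<^sup>2 * M\<^sup>2"])
    show "(\<lambda>s. (l m * x s)\<^sup>2) \<in> borel_measurable ?L" using that(1) by measurable
    show "AE s in ?L. norm ((l m * x s)\<^sup>2) \<le> (l m)\<^sup>2 * M\<^sup>2"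
    proof (rule AE_I2)
      fix s assume "s \<in> space ?L"
      then have "\<bar>x s\<bar> \<le> \<bar>M\<bar>" using that(2)[of s] by simp
      then have "(x s)\<^sup>2 \<le> M\<^sup>2" by (simp add: abs_le_square_iff)
      then show "norm ((l m * x s)\<^sup>2) \<le> (l m)\<^sup>2 * M\<^sup>2" by (simp add: power_mult_distrib mult_left_mono)
    qed
  qed
  have thHs: "\<theta> \<in> L2T_Hs T \<alpha>" "(\<integral>s. (norm_Hs \<alpha> (\<theta> s))\<^sup>2 \<partial>?L) \<le> C"
  proof -
    have e: "(lam m powr \<alpha> * inner (\<theta> s) (bas m))\<^sup>2 = (l m * A m s)\<^sup>2" if "s \<in> {0..T}" for m s
      using \<theta>(2)[OF that] by (simp add: l_def)
    have i: "integrable ?L (\<lambda>s. (lam m powr \<alpha> * inner (\<theta> s) (bas m))\<^sup>2)" for m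
      using bi[OF Am[of m] AM] by (rule Bochner_Integration.integrable_cong[THEN iffD1, OF refl, rotated]) (auto simp: e)
    have s: "(\<integral>s. (\<Sum>m<K. (lam m powr \<alpha> * inner (\<theta> s) (bas m))\<^sup>2) \<partial>?L) \<le> C" for K
    proof -
      have "(\<integral>s. (\<Sum>m<K. (lam m powr \<alpha> * inner (\<theta> s) (bas m))\<^sup>2) \<partial>?L) = (\<integral>s. (\<Sum>m<K. (l m * A m s)\<^sup>2) \<partial>?L)"
        by (intro Bochner_Integration.integral_cong refl sum.cong) (auto simp: e)
      also have "\<dots> \<le> C"
      proof (rule diss[OF _ bi[OF Am AM]])
        show "integrable ?L (\<lambda>s. (l m * A m s - \<gamma> m s / 2)\<^sup>2)" for m using Di(2)[of m] by (simp add: D'_def[abs_def])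
        have "0 \<le> (\<Sum>m<K. (A m T)\<^sup>2)" by (intro sum_nonneg) simp
        then show "2 * (\<integral>s. (\<Sum>m<K. (l m * A m s - \<gamma> m s / 2)\<^sup>2) \<partial>?L) \<le> RHS T"
          using enK[OF TT, of K] by (simp add: D'_def)
      qed auto
      finally show ?thesis .
    qed
    show "\<theta> \<in> L2T_Hs T \<alpha>" "(\<integral>s. (norm_Hs \<alpha> (\<theta> s))\<^sup>2 \<partial>?L) \<le> C"
      by (rule L2T_Hs_from_partial_sums[OF \<theta>(1) \<theta>m i s]; assumption)+
  qed
  have zHs: "(\<integral>s. (norm_Hs \<alpha> (z N s))\<^sup>2 \<partial>?L) \<le> C" "z N \<in> L2T_Hs T \<alpha>" for N
  proof -
    have i: "integrable ?L (\<lambda>s. (lam m powr \<alpha> * inner (z N s) (bas m))\<^sup>2)" for m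
      using bi[OF am[of N m] aM] by (simp add: a_def l_def)
    have s: "(\<integral>s. (\<Sum>m<K. (lam m powr \<alpha> * inner (z N s) (bas m))\<^sup>2) \<partial>?L) \<le> C" for K
    proof -
      have le: "(\<integral>s. (\<Sum>m<K'. (l m * a N m s)\<^sup>2) \<partial>?L) \<le> C" if "K' \<le> N" for K'
      proof (rule diss[OF _ bi[OF am aM]])
        show "integrable ?L (\<lambda>s. (l m * a N m s - \<gamma> m s / 2)\<^sup>2)" for m using Di(1)[of N m] by (simp add: D_def[abs_def])
        have "0 \<le> (\<Sum>m<K'. (a N m T)\<^sup>2)" by (intro sum_nonneg) simp
        then show "2 * (\<integral>s. (\<Sum>m<K'. (l m * a N m s - \<gamma> m s / 2)\<^sup>2) \<partial>?L) \<le> RHS T"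
          using enN[OF TT that] by (simp add: D_def)
      qed auto
      \<comment> \<open>A Galerkin solution has no modes from N on, so longer sums reduce to the
        range where the energy estimate is available.\<close>
      have "(\<integral>s. (\<Sum>m<K. (lam m powr \<alpha> * inner (z N s) (bas m))\<^sup>2) \<partial>?L) = (\<integral>s. (\<Sum>m<min K N. (l m * a N m s)\<^sup>2) \<partial>?L)"
      proof (intro Bochner_Integration.integral_cong refl)
        fix s assume "s \<in> space ?L"
        then have s: "s \<in> {0..T}" by simp
        show "(\<Sum>m<K. (lam m powr \<alpha> * inner (z N s) (bas m))\<^sup>2) = (\<Sum>m<min K N. (l m * a N m s)\<^sup>2)"
          unfolding l_def[symmetric] a_def[symmetric]
          by (rule sum.mono_neutral_right) (use a0[OF s] in auto)
      qed
      then show ?thesis using le[of "min K N"] by simp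
    qed
    show "(\<integral>s. (norm_Hs \<alpha> (z N s))\<^sup>2 \<partial>?L) \<le> C" "z N \<in> L2T_Hs T \<alpha>"
      by (rule L2T_Hs_from_partial_sums[OF zH zm i s]; assumption)+
  qed
  define d where "d N s = (norm (z (k N) s - \<theta> s))\<^sup>2" for N s
  have di: "integrable ?L (d N)" for N
  proof (rule integrable_const_bound[of _ "(M + M)\<^sup>2"])
    show "d N \<in> borel_measurable ?L" unfolding d_def by measurable
    show "AE s in ?L. norm (d N s) \<le> (M + M)\<^sup>2"
    proof (rule AE_I2)
      fix s assume "s \<in> space ?L"
      then have s: "s \<in> {0..T}" by simp
      have "norm (z (k N) s - \<theta> s) \<le> M + M" using norm_triangle_ineq4[of "z (k N) s" "\<theta> s"] zM[OF s, of "k N"] \<theta>M[OF s] by linarith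
      then have "(norm (z (k N) s - \<theta> s))\<^sup>2 \<le> (M + M)\<^sup>2" by (intro power_mono) auto
      then show "norm (d N s) \<le> (M + M)\<^sup>2" by (simp add: d_def)
    qed
  qed
  have C0: "0 \<le> C" using G20 by (simp add: C_def)
  have strong: "(\<lambda>N. \<integral>s. d N s \<partial>?L) \<longlonglongrightarrow> 0"
  proof (rule LIMSEQ_I)
    fix e :: real assume e: "0 < e"
    \<comment> \<open>The high modes cost at most \<epsilon> times 4 C, twice the dissipation bound
      of each of the two paths, and this choice keeps that below e/2. With K then fixed, the
      finitely many low modes converge by dominated convergence.\<close>
    define \<epsilon> where "\<epsilon> = e / (8 * (C + 1))"
    have \<epsilon>: "0 < \<epsilon>" using e C0 by (simp add: \<epsilon>_def)
    have small: "\<epsilon> * (4 * C) < e / 2"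
    proof -
      have "\<epsilon> * (4 * C) < \<epsilon> * (4 * (C + 1))" using \<epsilon> by simp
      also have "\<dots> = e / 2" using C0 by (simp add: \<epsilon>_def divide_simps del: distrib_left_numeral)
      finally show ?thesis .
    qed
    obtain K where K: "\<And>m. K \<le> m \<Longrightarrow> 1 \<le> \<epsilon> * lam m powr (2 * \<alpha>)" using lam_powr_unbounded[OF \<alpha> \<epsilon>] by blast
    have low_i: "integrable ?L (\<lambda>s. (a (k N) m s - A m s)\<^sup>2)" for N m
    proof (rule Bochner_Integration.integrable_bound[OF di[of N]])
      show "(\<lambda>s. (a (k N) m s - A m s)\<^sup>2) \<in> borel_measurable ?L" by measurable
      show "AE s in ?L. norm ((a (k N) m s - A m s)\<^sup>2) \<le> norm (d N s)"
      proof (rule AE_I2)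
        fix s assume "s \<in> space ?L"
        then have "inner (\<theta> s) (bas m) = A m s" by (intro \<theta>(2)) simp
        then show "norm ((a (k N) m s - A m s)\<^sup>2) \<le> norm (d N s)"
          using inner_bas_square_le[of "z (k N) s - \<theta> s" m] by (simp add: d_def a_def inner_diff_left)
      qed
    qed
    have "(\<lambda>N. \<integral>s. (a (k N) m s - A m s)\<^sup>2 \<partial>?L) \<longlonglongrightarrow> (\<integral>s. 0 \<partial>?L)" for m
    proof (rule integral_dominated_convergence[where w="\<lambda>_. (M + M)\<^sup>2"])
      show "AE s in ?L. (\<lambda>N. (a (k N) m s - A m s)\<^sup>2) \<longlonglongrightarrow> 0"
      proof (rule AE_I2)
        fix s assume "s \<in> space ?L"
        then have "(\<lambda>N. (a (k N) m s - A m s)\<^sup>2) \<longlonglongrightarrow> (A m s - A m s)\<^sup>2" by (intro tendsto_intros A) simp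
        then show "(\<lambda>N. (a (k N) m s - A m s)\<^sup>2) \<longlonglongrightarrow> 0" by simp
      qed
      show "AE s in ?L. norm ((a (k N) m s - A m s)\<^sup>2) \<le> (M + M)\<^sup>2" for N
      proof (rule AE_I2)
        fix s assume "s \<in> space ?L"
        then have s: "s \<in> {0..T}" by simp
        have "\<bar>a (k N) m s - A m s\<bar> \<le> \<bar>M + M\<bar>" using aM[OF s, of "k N" m] AM[OF s, of m] by linarith
        then show "norm ((a (k N) m s - A m s)\<^sup>2) \<le> (M + M)\<^sup>2" by (simp add: abs_le_square_iff del: abs_of_nonneg)
      qed
    qed auto
    then have "(\<lambda>N. \<Sum>m<K. \<integral>s. (a (k N) m s - A m s)\<^sup>2 \<partial>?L) \<longlonglongrightarrow> (\<Sum>m<K. (\<integral>s. 0 \<partial>?L))" by (intro tendsto_sum)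
    then have "(\<lambda>N. \<Sum>m<K. \<integral>s. (a (k N) m s - A m s)\<^sup>2 \<partial>?L) \<longlonglongrightarrow> 0" by simp
    from LIMSEQ_D[OF this, of "e / 2"] e
    obtain N0 where N0: "\<And>N. N \<ge> N0 \<Longrightarrow> \<bar>\<Sum>m<K. \<integral>s. (a (k N) m s - A m s)\<^sup>2 \<partial>?L\<bar> < e / 2" by auto
    have le: "(\<integral>s. d N s \<partial>?L) \<le> (\<Sum>m<K. \<integral>s. (a (k N) m s - A m s)\<^sup>2 \<partial>?L) + \<epsilon> * (4 * C)" for N
    proof -
      let ?h = "\<lambda>s. (\<Sum>m<K. (a (k N) m s - A m s)\<^sup>2) + \<epsilon> * (2 * (norm_Hs \<alpha> (z (k N) s))\<^sup>2 + 2 * (norm_Hs \<alpha> (\<theta> s))\<^sup>2)"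
      have hi: "integrable ?L (\<lambda>s. (norm_Hs \<alpha> (z (k N) s))\<^sup>2)" "integrable ?L (\<lambda>s. (norm_Hs \<alpha> (\<theta> s))\<^sup>2)"
        using zHs(2)[of "k N"] thHs(1) by (auto simp: L2T_Hs_def)
      have "(\<integral>s. d N s \<partial>?L) \<le> (\<integral>s. ?h s \<partial>?L)"
      proof (rule integral_mono_AE[OF di])
        show "integrable ?L ?h" using hi low_i by auto
        have "AE s in ?L. \<theta> s \<in> Hs \<alpha>" using thHs(1) by (simp add: L2T_Hs_def)
        moreover have "AE s in ?L. s \<in> {0..T}" by (rule AE_I2) simp
        ultimately show "AE s in ?L. d N s \<le> ?h s"
        proof eventually_elim
          case (elim s)
          have zs: "z (k N) s \<in> Hs \<alpha>" by (rule Hinf_Hs[OF zi[OF elim(2)]])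
          have "d N s \<le> (\<Sum>m<K. (inner (z (k N) s - \<theta> s) (bas m))\<^sup>2) + \<epsilon> * (norm_Hs \<alpha> (z (k N) s - \<theta> s))\<^sup>2"
            unfolding d_def by (rule norm_split_low_high[OF Hs_diff[OF zs elim(1)] K]) (use \<epsilon> in auto)
          also have "\<dots> \<le> ?h s"
          proof (intro add_mono mult_left_mono norm_Hs_diff_square_le[OF zs elim(1)])
            show "(\<Sum>m<K. (inner (z (k N) s - \<theta> s) (bas m))\<^sup>2) \<le> (\<Sum>m<K. (a (k N) m s - A m s)\<^sup>2)"
              by (simp add: inner_diff_left a_def \<theta>(2)[OF elim(2)])
          qed (use \<epsilon> in auto)
          finally show ?case .
        qed
      qed
      also have "\<dots> = (\<Sum>m<K. \<integral>s. (a (k N) m s - A m s)\<^sup>2 \<partial>?L) + \<epsilon> * (2 * (\<integral>s. (norm_Hs \<alpha> (z (k N) s))\<^sup>2 \<partial>?L) + 2 * (\<integral>s. (norm_Hs \<alpha> (\<theta> s))\<^sup>2 \<partial>?L))"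
        using hi low_i by simp
      also have "\<dots> \<le> (\<Sum>m<K. \<integral>s. (a (k N) m s - A m s)\<^sup>2 \<partial>?L) + \<epsilon> * (4 * C)"
        using zHs(1)[of "k N"] thHs(2) \<epsilon> by (intro add_left_mono mult_left_mono) auto
      finally show ?thesis .
    qed
    show "\<exists>no. \<forall>n\<ge>no. norm ((\<integral>s. d n s \<partial>?L) - 0) < e"
    proof (intro exI[of _ N0] allI impI)
      fix n assume "N0 \<le> n"
      moreover have "0 \<le> (\<integral>s. d n s \<partial>?L)" by (simp add: d_def)
      ultimately show "norm ((\<integral>s. d n s \<partial>?L) - 0) < e"
        using N0[of n] le[of n] small unfolding real_norm_def by linarith
    qed
  qed
  have \<theta>2: "integrable ?L (\<lambda>s. (norm (\<theta> s))\<^sup>2)"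
  proof (rule integrable_const_bound[of _ "M\<^sup>2"])
    show "AE s in ?L. norm ((norm (\<theta> s))\<^sup>2) \<le> M\<^sup>2"
      by (rule AE_I2) (use \<theta>M in \<open>auto intro!: power_mono\<close>)
  qed measurable
  have AEM: "AE s in ?L. norm (\<theta> s) \<le> M" by (rule AE_I2) (use \<theta>M in auto)
  note ti = integrable_mode_rhs[OF Cw AEM g]
  have modes: "mode_equations T \<alpha> g z0 \<theta>"
    unfolding mode_equations_def
  proof (intro allI ballI)
    fix n t assume t: "t \<in> {0..T}"
    then have tT: "t \<le> T" by simp
    have nl: "(\<lambda>N. \<integral>s. nonlin (z (k N) s) (bas n) \<partial>lebesgue_on {0..t}) \<longlonglongrightarrow> (\<integral>s. nonlin (\<theta> s) (bas n) \<partial>lebesgue_on {0..t})"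
      by (rule nonlin_integral_tendsto[OF zH zm \<theta>(1) \<theta>m \<theta>2 di[unfolded d_def] strong[unfolded d_def] tT bas_Hinf])
    have li: "(\<lambda>N. \<integral>s. a (k N) n s \<partial>lebesgue_on {0..t}) \<longlonglongrightarrow> (\<integral>s. A n s \<partial>lebesgue_on {0..t})"
    proof (rule integral_dominated_convergence[where w="\<lambda>_. M"])
      interpret t: finite_measure "lebesgue_on {0..t}" by (rule finite_measure_lebesgue_on) simp
      show "integrable (lebesgue_on {0..t}) (\<lambda>_. M)" by simp
      show "A n \<in> borel_measurable (lebesgue_on {0..t})" "\<And>i. a (k i) n \<in> borel_measurable (lebesgue_on {0..t})"
        by (rule measurable_upto[OF Am tT] measurable_upto[OF am tT])+
      show "AE s in lebesgue_on {0..t}. (\<lambda>i. a (k i) n s) \<longlonglongrightarrow> A n s" by (rule AE_I2) (use t A in auto)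
      show "AE s in lebesgue_on {0..t}. norm (a (k i) n s) \<le> M" for i by (rule AE_I2) (use t aM in auto)
    qed
    have i1: "integrable (lebesgue_on {0..t}) (\<lambda>s. nonlin (z N s) (bas n))" "integrable (lebesgue_on {0..t}) (a N n)" for N
    proof -
      have "continuous_on {0..T} (\<lambda>s. nonlin (mean_free (z N s)) (bas n))"
        by (rule continuous_on_compose2[OF continuous_nonlin[OF bas_Hinf] zc]) simp
      then have "continuous_on {0..T} (\<lambda>s. nonlin (z N s) (bas n))"
        by (rule continuous_on_eq) (simp add: mean_free_id zH)
      then show "integrable (lebesgue_on {0..t}) (\<lambda>s. nonlin (z N s) (bas n))"
        by (rule integrable_upto[OF continuous_imp_integrable_real tT])
      show "integrable (lebesgue_on {0..t}) (a N n)" by (rule integrable_upto[OF continuous_imp_integrable_real[OF ac] tT])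
    qed
    have i2: "integrable (lebesgue_on {0..t}) (\<lambda>s. nonlin (\<theta> s) (bas n))" "integrable (lebesgue_on {0..t}) (\<gamma> n)"
      "integrable (lebesgue_on {0..t}) (A n)"
      using integrable_upto[OF ti(1) tT] integrable_upto[OF ti(3) tT] integrable_upto[OF continuous_imp_integrable_real[OF Ac] tT]
      by (auto simp: \<gamma>_def[abs_def])
    have expand: "(\<integral>s. mode_rhs \<alpha> g (z N) n s \<partial>lebesgue_on {0..t}) = - (l n ^ 2 * (\<integral>s. a N n s \<partial>lebesgue_on {0..t}))
        - (\<integral>s. nonlin (z N s) (bas n) \<partial>lebesgue_on {0..t}) + l n * (\<integral>s. \<gamma> n s \<partial>lebesgue_on {0..t})" for N
      unfolding mode_rhs_def lam_powr_double l_def[symmetric] a_def[symmetric] \<gamma>_def[symmetric] using i1[of N] i2 by simp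
    have "(\<integral>s. mode_rhs \<alpha> g \<theta> n s \<partial>lebesgue_on {0..t}) = (\<integral>s. - (l n ^ 2 * A n s) - nonlin (\<theta> s) (bas n) + l n * \<gamma> n s \<partial>lebesgue_on {0..t})"
      by (intro Bochner_Integration.integral_cong refl) (use t \<theta>(2) in \<open>auto simp: mode_rhs_def lam_powr_double l_def \<gamma>_def\<close>)
    also have "\<dots> = - (l n ^ 2 * (\<integral>s. A n s \<partial>lebesgue_on {0..t}))
        - (\<integral>s. nonlin (\<theta> s) (bas n) \<partial>lebesgue_on {0..t}) + l n * (\<integral>s. \<gamma> n s \<partial>lebesgue_on {0..t})"
      using i2 by simp
    finally have expand': "(\<integral>s. mode_rhs \<alpha> g \<theta> n s \<partial>lebesgue_on {0..t}) = - (l n ^ 2 * (\<integral>s. A n s \<partial>lebesgue_on {0..t}))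
        - (\<integral>s. nonlin (\<theta> s) (bas n) \<partial>lebesgue_on {0..t}) + l n * (\<integral>s. \<gamma> n s \<partial>lebesgue_on {0..t})" .
    have "(\<lambda>N. inner z0 (bas n) + (\<integral>s. mode_rhs \<alpha> g (z (k N)) n s \<partial>lebesgue_on {0..t})) \<longlonglongrightarrow>
       inner z0 (bas n) + (\<integral>s. mode_rhs \<alpha> g \<theta> n s \<partial>lebesgue_on {0..t})"
      unfolding expand expand' by (intro tendsto_intros nl li)
    \<comment> \<open>The equation of mode n holds once the dimension k N exceeds n, hence
      eventually.\<close>
    moreover have "\<forall>\<^sub>F N in sequentially. inner z0 (bas n) + (\<integral>s. mode_rhs \<alpha> g (z (k N)) n s \<partial>lebesgue_on {0..t}) = a (k N) n t"
      using eventually_gt_at_top[of n]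
    proof eventually_elim
      case (elim N)
      then have "n < k N" using kN[of N] by linarith
      then show ?case using zeq[OF _ t] by (simp add: a_def)
    qed
    ultimately have "(\<lambda>N. a (k N) n t) \<longlonglongrightarrow> inner z0 (bas n) + (\<integral>s. mode_rhs \<alpha> g \<theta> n s \<partial>lebesgue_on {0..t})"
      by (rule Lim_transform_eventually)
    from LIMSEQ_unique[OF A[OF t] this]
    show "inner (\<theta> t) (bas n) = inner z0 (bas n) + (\<integral>s. mode_rhs \<alpha> g \<theta> n s \<partial>lebesgue_on {0..t})"
      by (simp add: \<theta>(2)[OF t])
  qed
  have sol: "weak_solution T \<alpha> g z0 \<theta>"
    by (rule mode_equations_imp_weak_solution[OF T \<alpha> z0 Linf thHs(1) Cw g modes])
  have init: "\<theta> 0 = z0"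
  proof (rule H0_eqI[OF \<theta>(1) z0])
    show "inner (\<theta> 0) (bas i) = inner z0 (bas i)" for i
    proof -
      have "(\<integral>s. mode_rhs \<alpha> g \<theta> i s \<partial>lebesgue_on {0..0}) = 0"
        using lebesgue_integral_eq_integral[OF integrable_upto[OF ti(4)[of \<alpha> i], of 0]] T by simp
      then show ?thesis using modes T unfolding mode_equations_def by auto
    qed
  qed (use T in simp)
  have "energy_inequality T \<alpha> g \<theta>"
    unfolding energy_inequality_def
  proof
    fix t assume t: "t \<in> {0..T}"
    then have tT: "t \<le> T" by simp
    let ?Lt = "lebesgue_on {0..t}"
    have ae: "AE s in ?Lt. \<theta> s \<in> Hs \<alpha>" using thHs(1) AE_upto[OF _ tT] by (auto simp: L2T_Hs_def)
    have sp: "AE s in ?Lt. s \<in> {0..T}" by (rule AE_I2) (use t in auto)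
    have nHs: "integrable ?Lt (\<lambda>s. (norm_Hs \<alpha> (\<theta> s))\<^sup>2)"
      using integrable_upto[OF _ tT] thHs(1) by (auto simp: L2T_Hs_def)
    have ggt: "integrable ?Lt gg" by (rule integrable_upto[OF ggi tT])
    have Lm: "(\<lambda>s. Lam \<alpha> (\<theta> s)) \<in> borel_measurable ?Lt"
      by (rule measurable_upto[OF _ tT]) (use thHs(1) in \<open>simp add: L2T_Hs_def\<close>)
    have gmt: "g \<in> borel_measurable ?Lt" by (rule measurable_upto[OF gm tT])
    define P where "P s = inner (Lam \<alpha> (\<theta> s)) (g s)" for s
    have Pm: "P \<in> borel_measurable ?Lt" unfolding P_def using Lm gmt by measurable
    have Pint: "integrable ?Lt P"
    proof (rule Bochner_Integration.integrable_bound[OF _ Pm])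
      show "integrable ?Lt (\<lambda>s. (norm_Hs \<alpha> (\<theta> s))\<^sup>2 + (norm (g s))\<^sup>2)"
        using nHs integrable_upto[OF g2 tT] by auto
      show "AE s in ?Lt. norm (P s) \<le> norm ((norm_Hs \<alpha> (\<theta> s))\<^sup>2 + (norm (g s))\<^sup>2)"
        using ae
      proof eventually_elim
        case (elim s)
        have "\<bar>P s\<bar> \<le> norm_Hs \<alpha> (\<theta> s) * norm (g s)"
          using Cauchy_Schwarz_ineq2[of "Lam \<alpha> (\<theta> s)" "g s"] by (simp add: P_def norm_Lam[OF elim])
        also have "\<dots> \<le> (norm_Hs \<alpha> (\<theta> s))\<^sup>2 + (norm (g s))\<^sup>2"
          using sum_squares_bound[of "norm_Hs \<alpha> (\<theta> s)" "norm (g s)"] mult_nonneg_nonneg[OF norm_Hs_nonneg norm_ge_zero, of \<alpha> "\<theta> s" "g s"]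
          by linarith
        finally show ?case by simp
      qed
    qed
    \<comment> \<open>The pointwise sum of the completed squares: the squared norm of
      \<open>Lam \<alpha> (\<theta> s)\<close> minus half the mean-zero part of the control. It is
      split into dissipation, work and control energy only after the limit in K.\<close>
    define S where "S s = (norm_Hs \<alpha> (\<theta> s))\<^sup>2 - P s + gg s / 4" for s
    have Si: "integrable ?Lt S" unfolding S_def using nHs Pint ggt by auto
    have Ssq: "S s = (norm (Lam \<alpha> (\<theta> s) - (1/2) *\<^sub>R mean_free (g s)))\<^sup>2" if "\<theta> s \<in> Hs \<alpha>" for s
    proof -
      have "P s = inner (Lam \<alpha> (\<theta> s)) (mean_free (g s))" unfolding P_def by (rule inner_mean_free[OF Lam_H0[OF that], symmetric])
      then show ?thesis
        by (simp add: S_def gg_def norm_Lam[OF that, symmetric] power2_norm_eq_inner inner_diff_left inner_diff_right inner_commute)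
    qed
    have DS: "AE s in ?Lt. (\<lambda>m. D' m s) sums S s"
      using ae sp
    proof eventually_elim
      case (elim s)
      have h: "Lam \<alpha> (\<theta> s) - (1/2) *\<^sub>R mean_free (g s) \<in> H0"
        by (intro H0_diff H0_scaleR Lam_H0 elim) simp
      have "inner (Lam \<alpha> (\<theta> s) - (1/2) *\<^sub>R mean_free (g s)) (bas m) = l m * A m s - \<gamma> m s / 2" for m
      proof -
        have "inner (mean_free (g s)) (bas m) = inner (g s) (bas m)"
          using inner_mean_free[OF bas_H0, of m "g s"] by (simp only: inner_commute)
        then show ?thesis
          by (simp add: inner_diff_left Lam_bas[OF elim(1)] \<theta>(2)[OF elim(2)] l_def \<gamma>_def)
      qed
      then show ?case using H0_norm_sums[OF h] by (simp add: D'_def Ssq[OF elim(1)])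
    qed
    have D't: "integrable ?Lt (D' m)" for m by (rule integrable_upto[OF Di(2) tT])
    have "(\<lambda>K. \<integral>s. (\<Sum>m<K. D' m s) \<partial>?Lt) \<longlonglongrightarrow> (\<integral>s. S s \<partial>?Lt)"
    proof (rule integral_dominated_convergence[OF _ _ Si])
      show "AE s in ?Lt. (\<lambda>K. \<Sum>m<K. D' m s) \<longlonglongrightarrow> S s" using DS by eventually_elim (simp add: sums_def)
      show "AE s in ?Lt. norm (\<Sum>m<K. D' m s) \<le> S s" for K
        using DS
      proof eventually_elim
        case (elim s)
        then have "(\<Sum>m<K. D' m s) \<le> S s" using sum_le_suminf[of "\<lambda>m. D' m s" "{..<K}"] D0 by (auto simp: sums_iff)
        then show ?case by (simp add: sum_nonneg D0)
      qed
    qed (use Si D't in auto)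
    moreover have "(\<lambda>K. \<Sum>m<K. (A m t)\<^sup>2) \<longlonglongrightarrow> (norm (\<theta> t))\<^sup>2"
      using H0_norm_sums[OF \<theta>(1)[OF t]] by (simp add: sums_def \<theta>(2)[OF t])
    ultimately have "(\<lambda>K. (\<Sum>m<K. (A m t)\<^sup>2) + 2 * (\<integral>s. (\<Sum>m<K. D' m s) \<partial>?Lt)) \<longlonglongrightarrow> (norm (\<theta> t))\<^sup>2 + 2 * (\<integral>s. S s \<partial>?Lt)"
      by (intro tendsto_intros)
    then have "(norm (\<theta> t))\<^sup>2 + 2 * (\<integral>s. S s \<partial>?Lt) \<le> RHS t"
      by (rule LIMSEQ_le_const2) (use enK[OF t] in blast)
    moreover have "(\<integral>s. S s \<partial>?Lt) = (\<integral>s. (norm_Hs \<alpha> (\<theta> s))\<^sup>2 \<partial>?Lt) - (\<integral>s. P s \<partial>?Lt) + (\<integral>s. gg s \<partial>?Lt) / 4"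
      unfolding S_def using nHs Pint ggt by simp
    ultimately show "1/2 * (norm (\<theta> t))\<^sup>2 + (\<integral>s. (norm_Hs \<alpha> (\<theta> s))\<^sup>2 \<partial>?Lt)
       \<le> 1/2 * (norm (\<theta> 0))\<^sup>2 + (\<integral>s. inner (Lam \<alpha> (\<theta> s)) (g s) \<partial>?Lt)"
      unfolding RHS_def init P_def by simp
  qed
  then show ?thesis using init sol by blast
qed

section \<open>Weak convergence of controls\<close>

lemma integrable_mult_of_squares:
  fixes f h :: "'a \<Rightarrow> real"
  assumes "f \<in> borel_measurable M" "h \<in> borel_measurable M"
    "integrable M (\<lambda>x. (f x)\<^sup>2)" "integrable M (\<lambda>x. (h x)\<^sup>2)"
  shows "integrable M (\<lambda>x. f x * h x)"
proof (rule Bochner_Integration.integrable_bound[of _ "\<lambda>x. (f x)\<^sup>2 + (h x)\<^sup>2"])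
  have "\<bar>a * b\<bar> \<le> a\<^sup>2 + b\<^sup>2" for a b :: real
    using sum_squares_bound[of "\<bar>a\<bar>" "\<bar>b\<bar>"] mult_nonneg_nonneg[of "\<bar>a\<bar>" "\<bar>b\<bar>"]
    by (simp add: abs_mult del: mult_nonneg_nonneg)
  then show "AE x in M. norm (f x * h x) \<le> norm ((f x)\<^sup>2 + (h x)\<^sup>2)" by (intro AE_I2) simp
qed (use assms in auto)

text \<open>Weak convergence of a bounded sequence may be tested on functions that approximate h in
  L2: Young's inequality bounds the remainder uniformly in n.\<close>

lemma tendsto_zero_by_approximation:
  fixes D :: "nat \<Rightarrow> 'a \<Rightarrow> real"
  assumes D: "\<And>n. D n \<in> borel_measurable M" "\<And>n. integrable M (\<lambda>x. (D n x)\<^sup>2)" "\<And>n. (\<integral>x. (D n x)\<^sup>2 \<partial>M) \<le> B"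
    and h: "h \<in> borel_measurable M" "integrable M (\<lambda>x. (h x)\<^sup>2)"
    and s: "\<And>i. s i \<in> borel_measurable M" "\<And>i. integrable M (\<lambda>x. (s i x)\<^sup>2)"
    and approx: "(\<lambda>i. \<integral>x. (h x - s i x)\<^sup>2 \<partial>M) \<longlonglongrightarrow> 0"
    and lim: "\<And>i::nat. (\<lambda>n. \<integral>x. s i x * D n x \<partial>M) \<longlonglongrightarrow> 0"
  shows "(\<lambda>n. \<integral>x. h x * D n x \<partial>M) \<longlonglongrightarrow> 0"
proof (rule LIMSEQ_I)
  fix e :: real assume e: "0 < e"
  have B: "0 \<le> B" using D(3)[of 0] by (rule order_trans[rotated]) simp
  define \<delta> where "\<delta> = e / (2 * (B + 1))"
  have \<delta>: "0 < \<delta>" using e B by (simp add: \<delta>_def)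
  have "\<delta> * B \<le> e / 2"
  proof -
    have "\<delta> * B \<le> \<delta> * (B + 1)" using \<delta> by simp
    also have "\<dots> = e / 2" using B by (simp add: \<delta>_def divide_simps del: distrib_left_numeral)
    finally show ?thesis .
  qed
  then have dB: "\<delta> * B / 2 \<le> e / 4" by linarith
  have "0 < e * \<delta> / 2" using e \<delta> by simp
  from LIMSEQ_D[OF approx this] obtain i where i: "(\<integral>x. (h x - s i x)\<^sup>2 \<partial>M) < e * \<delta> / 2" by auto
  have ab: "integrable M (\<lambda>x. (h x - s i x) * D n x)" for n
  proof (rule integrable_mult_of_squares)
    have "integrable M (\<lambda>x. (h x)\<^sup>2 - 2 * (h x * s i x) + (s i x)\<^sup>2)"
      using h s[of i] integrable_mult_of_squares[OF h(1) s(1)[of i] h(2) s(2)[of i]] by auto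
    then show "integrable M (\<lambda>x. (h x - s i x)\<^sup>2)" by (simp add: power2_diff algebra_simps)
  qed (use D h s in auto)
  have hs: "integrable M (\<lambda>x. (h x - s i x)\<^sup>2)"
  proof -
    have "integrable M (\<lambda>x. (h x)\<^sup>2 - 2 * (h x * s i x) + (s i x)\<^sup>2)"
      using h s[of i] integrable_mult_of_squares[OF h(1) s(1)[of i] h(2) s(2)[of i]] by auto
    then show "integrable M (\<lambda>x. (h x - s i x)\<^sup>2)" by (simp add: power2_diff algebra_simps)
  qed
  have rest: "\<bar>\<integral>x. (h x - s i x) * D n x \<partial>M\<bar> \<le> e / 2" for n
  proof -
    have "\<bar>\<integral>x. (h x - s i x) * D n x \<partial>M\<bar> \<le> (\<integral>x. \<bar>(h x - s i x) * D n x\<bar> \<partial>M)" by (rule integral_abs_bound)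
    also have "\<dots> \<le> (\<integral>x. inverse \<delta> / 2 * (h x - s i x)\<^sup>2 + \<delta> / 2 * (D n x)\<^sup>2 \<partial>M)"
    proof (rule integral_mono)
      show "integrable M (\<lambda>x. \<bar>(h x - s i x) * D n x\<bar>)" using ab by (rule integrable_abs)
      show "integrable M (\<lambda>x. inverse \<delta> / 2 * (h x - s i x)\<^sup>2 + \<delta> / 2 * (D n x)\<^sup>2)" using hs D by auto
      fix x
      have "0 \<le> inverse \<delta> / 2 * (\<bar>h x - s i x\<bar> - \<delta> * \<bar>D n x\<bar>)\<^sup>2" using \<delta> by simp
      also have "\<dots> = inverse \<delta> / 2 * (h x - s i x)\<^sup>2 + \<delta> / 2 * (D n x)\<^sup>2 - \<bar>h x - s i x\<bar> * \<bar>D n x\<bar>"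
        using \<delta> by (simp add: power2_diff power_mult_distrib) (simp add: field_simps power2_eq_square)
      finally show "\<bar>(h x - s i x) * D n x\<bar> \<le> inverse \<delta> / 2 * (h x - s i x)\<^sup>2 + \<delta> / 2 * (D n x)\<^sup>2"
        by (simp add: abs_mult)
    qed
    also have "\<dots> = inverse \<delta> / 2 * (\<integral>x. (h x - s i x)\<^sup>2 \<partial>M) + \<delta> / 2 * (\<integral>x. (D n x)\<^sup>2 \<partial>M)" using hs D by simp
    also have "\<dots> \<le> inverse \<delta> / 2 * (e * \<delta> / 2) + \<delta> / 2 * B"
      using i D(3)[of n] \<delta> by (intro add_mono mult_left_mono) auto
    also have "\<dots> \<le> e / 2"
    proof -
      have "inverse \<delta> / 2 * (e * \<delta> / 2) = e / 4" using \<delta> by (simp add: field_simps)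
      moreover have "\<delta> / 2 * B = \<delta> * B / 2" by simp
      ultimately show ?thesis using dB by linarith
    qed
    finally show ?thesis .
  qed
  from LIMSEQ_D[OF lim[of i], of "e / 2"] e
  obtain N where N: "\<And>n. n \<ge> N \<Longrightarrow> \<bar>\<integral>x. s i x * D n x \<partial>M\<bar> < e / 2" by auto
  show "\<exists>no. \<forall>n\<ge>no. norm ((\<integral>x. h x * D n x \<partial>M) - 0) < e"
  proof (intro exI[of _ N] allI impI)
    fix n assume "N \<le> n"
    have "(\<integral>x. h x * D n x \<partial>M) = (\<integral>x. s i x * D n x + (h x - s i x) * D n x \<partial>M)" by (simp add: algebra_simps)
    also have "\<dots> = (\<integral>x. s i x * D n x \<partial>M) + (\<integral>x. (h x - s i x) * D n x \<partial>M)"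
      by (rule Bochner_Integration.integral_add[OF _ ab]) (rule integrable_mult_of_squares[OF s(1) D(1) s(2) D(2)])
    finally show "norm ((\<integral>x. h x * D n x \<partial>M) - 0) < e"
      using N[OF \<open>N \<le> n\<close>] rest[of n] unfolding real_norm_def diff_0_right by linarith
  qed
qed

text \<open>Vanishing primitives are vanishing pairings with half-lines, an intersection-stable
  generator of the Borel sets. A Dynkin argument, completion by null sets and simple functions
  extend this to all square-integrable h, with the uniform L2 bound justifying the
  approximations.\<close>

lemma weak_L2_convergence:
  fixes D :: "nat \<Rightarrow> real \<Rightarrow> real"
  assumes T: "0 \<le> T"
    and D: "\<And>n. D n \<in> borel_measurable (lebesgue_on {0..T})" "\<And>n. integrable (lebesgue_on {0..T}) (\<lambda>x. (D n x)\<^sup>2)"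
      "\<And>n. (\<integral>x. (D n x)\<^sup>2 \<partial>lebesgue_on {0..T}) \<le> B"
    and prim: "\<And>t. t \<in> {0..T} \<Longrightarrow> (\<lambda>n. \<integral>x. D n x \<partial>lebesgue_on {0..t}) \<longlonglongrightarrow> 0"
    and h: "h \<in> borel_measurable (lebesgue_on {0..T})" "integrable (lebesgue_on {0..T}) (\<lambda>x. (h x)\<^sup>2)"
  shows "(\<lambda>n. \<integral>x. h x * D n x \<partial>lebesgue_on {0..T}) \<longlonglongrightarrow> 0"
proof -
  let ?M = "lebesgue_on {0..T}"
  interpret finite_measure ?M by (rule finite_measure_lebesgue_on) simp
  have D1: "integrable ?M (D n)" for n
    using integrable_mult_of_squares[of "\<lambda>_. 1" ?M "D n"] D by simp
  have Bm: "A \<in> sets ?M \<longleftrightarrow> A \<subseteq> {0..T} \<and> A \<in> sets lebesgue" for A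
    by (auto simp: sets_restrict_space_iff)
  have bm: "(indicator A :: real \<Rightarrow> real) \<in> borel_measurable ?M" if "A \<in> sets borel" for A
    by (rule measurable_restrict_space1, rule measurable_completion) (use that in simp)
  have ind2: "integrable ?M (\<lambda>x. (indicator A x :: real)\<^sup>2)" if "(indicator A :: real \<Rightarrow> real) \<in> borel_measurable ?M" for A
  proof (rule integrable_const_bound[of _ 1])
    show "(\<lambda>x. (indicator A x :: real)\<^sup>2) \<in> borel_measurable ?M" using that by measurable
  qed (auto simp: indicator_def intro!: AE_I2)
  have indD: "integrable ?M (\<lambda>x. indicator A x * D n x)" if "(indicator A :: real \<Rightarrow> real) \<in> borel_measurable ?M" for A n
    by (rule integrable_mult_of_squares[OF that D(1) ind2[OF that] D(2)])
  have borel: "(\<lambda>n. \<integral>x. indicator A x * D n x \<partial>?M) \<longlonglongrightarrow> 0" if "A \<in> sets borel" for A :: "real set"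
  proof -
    have "{..a} \<inter> {..b} = {..min a b}" for a b :: real by auto
    then have "Int_stable (range (\<lambda>a::real. {..a}))" unfolding Int_stable_def by auto
    moreover have "range (\<lambda>a::real. {..a}) \<subseteq> Pow UNIV" by simp
    moreover have "A \<in> sigma_sets UNIV (range (\<lambda>a::real. {..a}))"
      using that unfolding borel_eq_atMost by simp
    ultimately show ?thesis
    proof (induction A rule: sigma_sets_induct_disjoint)
      case (basic A)
      then obtain a where A: "A = {..a}" by auto
      show ?case
      proof (cases "a < 0")
        case True
        then have "(\<integral>x. indicator A x * D n x \<partial>?M) = 0" for n
          by (intro integral_eq_zero_AE AE_I2) (auto simp: A)
        then show ?thesis by simp
      next
        case False
        define t where "t = min a T"
        have t: "t \<in> {0..T}" using False T by (auto simp: t_def)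
        have "(\<integral>x. indicator A x * D n x \<partial>?M) = (\<integral>x. D n x \<partial>lebesgue_on {0..t})" for n
          unfolding integral_upto[of t T "D n", OF t[unfolded atLeastAtMost_iff, THEN conjunct2]]
          by (intro Bochner_Integration.integral_cong) (auto simp: A t_def)
        then show ?thesis using prim[OF t] by simp
      qed
    next
      case (compl A)
      have Ab: "A \<in> sets borel" using compl.hyps unfolding borel_eq_atMost by simp
      have "(\<integral>x. indicator (UNIV - A) x * D n x \<partial>?M) = (\<integral>x. D n x \<partial>?M) - (\<integral>x. indicator A x * D n x \<partial>?M)" for n
      proof -
        have "(\<integral>x. indicator (UNIV - A) x * D n x \<partial>?M) = (\<integral>x. D n x - indicator A x * D n x \<partial>?M)"
          by (intro Bochner_Integration.integral_cong) (auto simp: indicator_def)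
        then show ?thesis using D1 indD[OF bm[OF Ab]] by simp
      qed
      moreover have "(\<lambda>n. (\<integral>x. D n x \<partial>?M) - (\<integral>x. indicator A x * D n x \<partial>?M)) \<longlonglongrightarrow> 0 - 0"
        by (intro tendsto_diff compl.IH prim) (use T in auto)
      ultimately show ?case by simp
    next
      \<comment> \<open>Finite unions approximate the countable union in L2, and the uniform L2
        bound on D makes the error small for all n at once, so the two limits may be
        exchanged.\<close>
      case (union A)
      have Ab: "A i \<in> sets borel" for i using union.hyps unfolding borel_eq_atMost by auto
      define S where "S k x = (\<Sum>i<k. indicator (A i) x :: real)" for k :: nat and x
      have Su: "S k = indicator (\<Union>i<k. A i)" for k
      proof
        fix x
        show "S k x = indicator (\<Union>i<k. A i) x" unfolding S_def
          by (rule indicator_UN_disjoint[symmetric])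
            (use union.hyps in \<open>auto simp: disjoint_family_on_def\<close>)
      qed
      have Sm: "(indicator (\<Union>i<k. A i) :: real \<Rightarrow> real) \<in> borel_measurable ?M" for k by (rule bm) (use Ab in auto)
      have Um: "(indicator (\<Union>i. A i) :: real \<Rightarrow> real) \<in> borel_measurable ?M" by (rule bm) (use Ab in auto)
      show ?case
      proof (rule tendsto_zero_by_approximation[OF D, where s=S])
        show "(\<lambda>i. \<integral>x. (indicator (\<Union>i. A i) x - S i x)\<^sup>2 \<partial>?M) \<longlonglongrightarrow> 0"
        proof -
          have "(\<lambda>i. \<integral>x. (indicator (\<Union>i. A i) x - S i x)\<^sup>2 \<partial>?M) \<longlonglongrightarrow> (\<integral>x. 0 \<partial>?M)"
          proof (rule integral_dominated_convergence[where w="\<lambda>_. 1"])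
            show "AE x in ?M. (\<lambda>i. (indicator (\<Union>i. A i) x - S i x)\<^sup>2) \<longlonglongrightarrow> 0"
            proof (rule AE_I2)
              fix x
              have "(\<lambda>k. indicator (\<Union>i<k. A i) x :: real) \<longlonglongrightarrow> indicator (\<Union>i. A i) x"
                by (rule LIMSEQ_indicator_UN)
              then have "(\<lambda>i. (indicator (\<Union>i. A i) x - S i x)\<^sup>2) \<longlonglongrightarrow> (indicator (\<Union>i. A i) x - indicator (\<Union>i. A i) x)\<^sup>2"
                unfolding Su by (intro tendsto_intros)
              then show "(\<lambda>i. (indicator (\<Union>i. A i) x - S i x)\<^sup>2) \<longlonglongrightarrow> 0" by simp
            qed
            show "(\<lambda>x. (indicator (\<Union>i. A i) x - S i x)\<^sup>2) \<in> borel_measurable ?M" for i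
              unfolding Su by (intro borel_measurable_power borel_measurable_diff Um Sm)
            show "AE x in ?M. norm ((indicator (\<Union>i. A i) x - S i x)\<^sup>2) \<le> 1" for i
              unfolding Su by (auto simp: indicator_def intro!: AE_I2)
          qed auto
          then show ?thesis by simp
        qed
        show "(\<lambda>n. \<integral>x. S i x * D n x \<partial>?M) \<longlonglongrightarrow> 0" for i
        proof -
          have "(\<integral>x. S i x * D n x \<partial>?M) = (\<Sum>j<i. \<integral>x. indicator (A j) x * D n x \<partial>?M)" for n
            unfolding S_def sum_distrib_right
            by (rule Bochner_Integration.integral_sum) (rule indD[OF bm[OF Ab]])
          moreover have "(\<lambda>n. \<Sum>j<i. \<integral>x. indicator (A j) x * D n x \<partial>?M) \<longlonglongrightarrow> (\<Sum>j<i. 0)"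
            by (intro tendsto_sum union.IH)
          ultimately show ?thesis by simp
        qed
      qed (use Um Sm ind2 in \<open>auto simp: Su\<close>)
    qed (auto)
  qed
  have leb: "(\<lambda>n. \<integral>x. indicator A x * D n x \<partial>?M) \<longlonglongrightarrow> 0" if A: "A \<in> sets ?M" for A
  proof -
    have "A \<in> sets lebesgue" using A Bm by blast
    \<comment> \<open>A Lebesgue set differs from a Borel set by a subset of a Borel null set, so
      its pairing is that of the Borel set.\<close>
    then obtain S N N' where AN: "A = S \<union> N" "N \<subseteq> N'" "N' \<in> null_sets lborel" "S \<in> sets lborel"
      by (rule sets_completionE)
    have "AE x in lebesgue. x \<notin> N'" using AN(3) by (intro AE_completion AE_not_in)
    then have "AE x in lebesgue. x \<in> {0..T} \<longrightarrow> x \<notin> N'" by eventually_elim auto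
    then have ae: "AE x in ?M. x \<notin> N'" by (subst AE_restrict_space_iff) auto
    have Am: "(indicator A :: real \<Rightarrow> real) \<in> borel_measurable ?M" using A by simp
    have "(\<integral>x. indicator A x * D n x \<partial>?M) = (\<integral>x. indicator S x * D n x \<partial>?M)" for n
    proof (rule integral_cong_AE)
      show "AE x in ?M. indicator A x * D n x = indicator S x * D n x"
        using ae by eventually_elim (use AN(1,2) in \<open>auto simp: indicator_def\<close>)
    qed (use D(1)[of n] Am bm[of S] AN(4) in auto)
    then show ?thesis using borel[of S] AN(4) by simp
  qed
  obtain s where ss: "\<And>i. simple_function ?M (s i)" and sl: "\<And>x. x \<in> space ?M \<Longrightarrow> (\<lambda>i. s i x) \<longlonglongrightarrow> h x"
    and sb: "\<And>i x. x \<in> space ?M \<Longrightarrow> dist (s i x) 0 \<le> 2 * dist (h x) 0"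
    using borel_measurable_implies_sequence_metric[OF h(1), of 0] by blast
  have sm: "s i \<in> borel_measurable ?M" for i using ss by (rule borel_measurable_simple_function)
  have sq: "(s i x)\<^sup>2 \<le> 4 * (h x)\<^sup>2" if "x \<in> space ?M" for i x
  proof -
    have "\<bar>s i x\<bar> \<le> \<bar>2 * h x\<bar>" using sb[OF that, of i] by simp
    then have "(s i x)\<^sup>2 \<le> (2 * h x)\<^sup>2" by (simp only: abs_le_square_iff)
    then show ?thesis by (simp add: power_mult_distrib)
  qed
  show ?thesis
  proof (rule tendsto_zero_by_approximation[OF D h sm])
    show "integrable ?M (\<lambda>x. (s i x)\<^sup>2)" for i
      by (rule Bochner_Integration.integrable_bound[OF integrable_mult_right[OF h(2), of 4]])
        (use sm[of i] sq in \<open>auto intro!: AE_I2\<close>)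
    have "(\<lambda>i. \<integral>x. (h x - s i x)\<^sup>2 \<partial>?M) \<longlonglongrightarrow> (\<integral>x. 0 \<partial>?M)"
    \<comment> \<open>The simple functions satisfy |s| \<le> 2 |h|, and (h - s)^2 \<le> 2 h^2 + 2
      s^2 then gives the factor 2 + 8.\<close>
    proof (rule integral_dominated_convergence[where w="\<lambda>x. 10 * (h x)\<^sup>2"])
      show "AE x in ?M. (\<lambda>i. (h x - s i x)\<^sup>2) \<longlonglongrightarrow> 0"
      proof (rule AE_I2)
        fix x assume "x \<in> space ?M"
        then have "(\<lambda>i. (h x - s i x)\<^sup>2) \<longlonglongrightarrow> (h x - h x)\<^sup>2" by (intro tendsto_intros sl)
        then show "(\<lambda>i. (h x - s i x)\<^sup>2) \<longlonglongrightarrow> 0" by simp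
      qed
      show "AE x in ?M. norm ((h x - s i x)\<^sup>2) \<le> 10 * (h x)\<^sup>2" for i
      proof (rule AE_I2)
        fix x assume x: "x \<in> space ?M"
        have "(h x - s i x)\<^sup>2 \<le> 2 * (h x)\<^sup>2 + 2 * (s i x)\<^sup>2"
          using zero_le_power2[of "h x + s i x"] by (simp add: power2_sum power2_diff)
        then show "norm ((h x - s i x)\<^sup>2) \<le> 10 * (h x)\<^sup>2" using sq[OF x, of i] by simp
      qed
    qed (use h sm in auto)
    then show "(\<lambda>i. \<integral>x. (h x - s i x)\<^sup>2 \<partial>?M) \<longlonglongrightarrow> 0" by simp
    show "(\<lambda>n. \<integral>x. s i x * D n x \<partial>?M) \<longlonglongrightarrow> 0" for i
    proof -
      let ?R = "s i ` space ?M"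
      have fin: "finite ?R" using ss[of i] by (simp add: simple_function_def)
      have set: "s i -` {y} \<inter> space ?M \<in> sets ?M" for y using sm[of i] by (intro measurable_sets) auto
      have rep: "s i x * D n x = (\<Sum>y\<in>?R. y * (indicator (s i -` {y} \<inter> space ?M) x * D n x))" if "x \<in> space ?M" for x n
      proof -
        have "s i x = (\<Sum>y\<in>?R. indicator (s i -` {y} \<inter> space ?M) x *\<^sub>R y)"
          by (rule simple_function_indicator_representation_banach[OF ss that])
        then have "s i x * D n x = (\<Sum>y\<in>?R. indicator (s i -` {y} \<inter> space ?M) x *\<^sub>R y) * D n x"
          by (rule arg_cong[where f="\<lambda>u. u * D n x"])
        also have "\<dots> = (\<Sum>y\<in>?R. y * (indicator (s i -` {y} \<inter> space ?M) x * D n x))"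
          unfolding sum_distrib_right by (intro sum.cong refl) (simp add: mult_ac)
        finally show ?thesis .
      qed
      have "(\<integral>x. s i x * D n x \<partial>?M) = (\<Sum>y\<in>?R. y * (\<integral>x. indicator (s i -` {y} \<inter> space ?M) x * D n x \<partial>?M))" for n
      proof -
        have "(\<integral>x. s i x * D n x \<partial>?M) = (\<integral>x. (\<Sum>y\<in>?R. y * (indicator (s i -` {y} \<inter> space ?M) x * D n x)) \<partial>?M)"
          by (intro Bochner_Integration.integral_cong refl rep)
        also have "\<dots> = (\<Sum>y\<in>?R. \<integral>x. y * (indicator (s i -` {y} \<inter> space ?M) x * D n x) \<partial>?M)"
          by (intro Bochner_Integration.integral_sum integrable_mult_right indD borel_measurable_indicator set)
        finally show ?thesis by simp
      qed
      moreover have "(\<lambda>n. \<Sum>y\<in>?R. y * (\<integral>x. indicator (s i -` {y} \<inter> space ?M) x * D n x \<partial>?M)) \<longlonglongrightarrow> (\<Sum>y\<in>?R. y * 0)"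
        by (intro tendsto_sum tendsto_mult tendsto_const leb set)
      ultimately show ?thesis by simp
    qed
  qed
qed

section \<open>Energy and time reversal\<close>

lemma energy_inequality_of_class:
  assumes T: "0 < T" and \<alpha>: "0 < \<alpha>" and C0: "weak_strong_uniqueness_class T \<alpha> C0"
    and \<theta>: "\<theta> \<in> C0" and g: "g \<in> L2T T" and sol: "weak_solution T \<alpha> g (\<theta> 0) \<theta>"
  shows "energy_inequality T \<alpha> g \<theta>"
proof -
  have z0: "\<theta> 0 \<in> H0" using sol by (simp add: weak_solution_def)
  obtain \<eta> where \<eta>: "\<eta> 0 = \<theta> 0" "weak_solution T \<alpha> g (\<theta> 0) \<eta>" "energy_inequality T \<alpha> g \<eta>"
    using leray_solution_exists[OF T \<alpha> z0 g] by blast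
  \<comment> \<open>Here \<theta> is the member of the class and \<eta> the competitor obeying the
    energy inequality. The definition of the class says nothing about the energy of its members;
    they inherit the inequality from the competitor.\<close>
  have "\<theta> = \<eta>"
    using C0 g sol \<theta> \<eta> unfolding weak_strong_uniqueness_class_def by metis
  then show ?thesis using \<eta>(3) by simp
qed

text \<open>If \<open>\<partial>\<^sub>t\<theta> = -\<Lambda>\<^sup>2\<^sup>\<alpha>\<theta> - N(\<theta>) + \<Lambda>\<^sup>\<alpha>g\<close> with \<open>N\<close> even, then \<open>\<eta>(t) = -\<theta>(T - t)\<close> solves the same equation with the
  control \<open>(g - 2\<Lambda>\<^sup>\<alpha>\<theta>)(T - t)\<close>.\<close>

definition reversed_control :: "real \<Rightarrow> (real \<Rightarrow> torus_L2) \<Rightarrow> (real \<Rightarrow> torus_L2) \<Rightarrow> real \<Rightarrow> torus_L2" where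
  "reversed_control \<alpha> g \<theta> s = g s - 2 *\<^sub>R Lam \<alpha> (\<theta> s)"

lemma reversed_control_energy:
  assumes \<theta>: "\<theta> \<in> L2T_Hs T \<alpha>" and g: "g \<in> L2T T"
  shows "integrable (lebesgue_on {0..T}) (\<lambda>s. (norm (reversed_control \<alpha> g \<theta> s))\<^sup>2)"
    and "reversed_control \<alpha> g \<theta> \<in> borel_measurable (lebesgue_on {0..T})"
    and "(\<integral>s. (norm (reversed_control \<alpha> g \<theta> s))\<^sup>2 \<partial>lebesgue_on {0..T}) =
      (\<integral>s. (norm (g s))\<^sup>2 \<partial>lebesgue_on {0..T}) - 4 * (\<integral>s. inner (Lam \<alpha> (\<theta> s)) (g s) \<partial>lebesgue_on {0..T})
      + 4 * (\<integral>s. (norm_Hs \<alpha> (\<theta> s))\<^sup>2 \<partial>lebesgue_on {0..T})"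
proof -
  let ?M = "lebesgue_on {0..T}"
  have ae: "AE s in ?M. \<theta> s \<in> Hs \<alpha>" and L[measurable]: "(\<lambda>s. Lam \<alpha> (\<theta> s)) \<in> borel_measurable ?M"
    and n2: "integrable ?M (\<lambda>s. (norm_Hs \<alpha> (\<theta> s))\<^sup>2)"
    using \<theta> by (auto simp: L2T_Hs_def)
  have gm[measurable]: "g \<in> borel_measurable ?M" and g2: "integrable ?M (\<lambda>s. (norm (g s))\<^sup>2)"
    using g by (auto simp: L2T_def)
  have P: "integrable ?M (\<lambda>s. inner (Lam \<alpha> (\<theta> s)) (g s))"
  proof (rule Bochner_Integration.integrable_bound)
    show "integrable ?M (\<lambda>s. (norm_Hs \<alpha> (\<theta> s))\<^sup>2 + (norm (g s))\<^sup>2)" using n2 g2 by auto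
    show "AE s in ?M. norm (inner (Lam \<alpha> (\<theta> s)) (g s)) \<le> norm ((norm_Hs \<alpha> (\<theta> s))\<^sup>2 + (norm (g s))\<^sup>2)"
      using ae
    proof eventually_elim
      case (elim s)
      have "\<bar>inner (Lam \<alpha> (\<theta> s)) (g s)\<bar> \<le> norm_Hs \<alpha> (\<theta> s) * norm (g s)"
        using Cauchy_Schwarz_ineq2[of "Lam \<alpha> (\<theta> s)" "g s"] by (simp add: norm_Lam[OF elim])
      also have "\<dots> \<le> (norm_Hs \<alpha> (\<theta> s))\<^sup>2 + (norm (g s))\<^sup>2"
        using sum_squares_bound[of "norm_Hs \<alpha> (\<theta> s)" "norm (g s)"] mult_nonneg_nonneg[OF norm_Hs_nonneg norm_ge_zero, of \<alpha> "\<theta> s" "g s"]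
        by linarith
      finally show ?case by simp
    qed
  qed measurable
  have eq: "AE s in ?M. (norm (reversed_control \<alpha> g \<theta> s))\<^sup>2 =
      (norm (g s))\<^sup>2 - 4 * inner (Lam \<alpha> (\<theta> s)) (g s) + 4 * (norm_Hs \<alpha> (\<theta> s))\<^sup>2"
    using ae
  proof eventually_elim
    case (elim s)
    show ?case
      by (simp add: reversed_control_def norm_Lam[OF elim, symmetric] power2_norm_eq_inner
          inner_diff_left inner_diff_right inner_commute)
  qed
  show m[measurable]: "reversed_control \<alpha> g \<theta> \<in> borel_measurable ?M"
    unfolding reversed_control_def by measurable
  have i: "integrable ?M (\<lambda>s. (norm (g s))\<^sup>2 - 4 * inner (Lam \<alpha> (\<theta> s)) (g s) + 4 * (norm_Hs \<alpha> (\<theta> s))\<^sup>2)"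
    using g2 P n2 by auto
  have mm: "(\<lambda>s. (norm (reversed_control \<alpha> g \<theta> s))\<^sup>2) \<in> borel_measurable ?M" by measurable
  show "integrable ?M (\<lambda>s. (norm (reversed_control \<alpha> g \<theta> s))\<^sup>2)"
    by (rule integrable_cong_AE_imp[OF i mm]) (use eq in eventually_elim, simp)
  have "(\<integral>s. (norm (reversed_control \<alpha> g \<theta> s))\<^sup>2 \<partial>?M) =
      (\<integral>s. (norm (g s))\<^sup>2 - 4 * inner (Lam \<alpha> (\<theta> s)) (g s) + 4 * (norm_Hs \<alpha> (\<theta> s))\<^sup>2 \<partial>?M)"
    by (rule integral_cong_AE[OF mm _ eq]) (use i in auto)
  then show "(\<integral>s. (norm (reversed_control \<alpha> g \<theta> s))\<^sup>2 \<partial>?M) =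
      (\<integral>s. (norm (g s))\<^sup>2 \<partial>?M) - 4 * (\<integral>s. inner (Lam \<alpha> (\<theta> s)) (g s) \<partial>?M) + 4 * (\<integral>s. (norm_Hs \<alpha> (\<theta> s))\<^sup>2 \<partial>?M)"
    using g2 P n2 by simp
qed

section \<open>Passage to the closure\<close>

lemma X_convergence:
  assumes lim: "limitin (X_top T \<alpha>) \<theta>n \<theta> sequentially" and \<theta>: "\<theta> \<in> X_space T \<alpha>" and \<theta>n: "\<And>n. \<theta>n n \<in> X_space T \<alpha>"
  shows "(\<lambda>n. \<integral>t. (norm (\<theta>n n t - \<theta> t))\<^sup>2 \<partial>lebesgue_on {0..T}) \<longlonglongrightarrow> 0"
    and "t \<in> {0..T} \<Longrightarrow> h \<in> H0 \<Longrightarrow> (\<lambda>n. inner (\<theta>n n t) h) \<longlonglongrightarrow> inner (\<theta> t) h"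
proof -
  have ev: "\<forall>\<^sub>F n in sequentially. \<theta>n n \<in> U" if "openin (X_top T \<alpha>) U" "\<theta> \<in> U" for U
    using lim that by (simp add: limitin_def)
  show "(\<lambda>n. \<integral>t. (norm (\<theta>n n t - \<theta> t))\<^sup>2 \<partial>lebesgue_on {0..T}) \<longlonglongrightarrow> 0"
  proof (rule LIMSEQ_I)
    fix e :: real assume e: "0 < e"
    \<comment> \<open>The subbasic balls use the norm, hence the radius \<open>sqrt e\<close> for a
      bound on its square.\<close>
    let ?U = "{\<eta> \<in> X_space T \<alpha>. sqrt (\<integral>t. (norm (\<eta> t - \<theta> t))\<^sup>2 \<partial>lebesgue_on {0..T}) < sqrt e}"
    have "openin (X_top T \<alpha>) ?U"
      unfolding X_top_def
    proof (rule topology_generated_by_Basis, rule UnI1, rule UnI1, rule CollectI, intro exI conjI)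
      show "?U = ?U" ..
      show "\<theta> \<in> X_space T \<alpha>" by (rule \<theta>)
      show "0 < sqrt e" using e by simp
    qed
    from ev[OF this] have "\<forall>\<^sub>F n in sequentially. \<theta>n n \<in> ?U" using \<theta> e by simp
    then obtain N where N: "\<And>n. n \<ge> N \<Longrightarrow> \<theta>n n \<in> ?U" unfolding eventually_sequentially by blast
    show "\<exists>no. \<forall>n\<ge>no. norm ((\<integral>t. (norm (\<theta>n n t - \<theta> t))\<^sup>2 \<partial>lebesgue_on {0..T}) - 0) < e"
    proof (intro exI[of _ N] allI impI)
      fix n assume "N \<le> n"
      then have "(\<integral>t. (norm (\<theta>n n t - \<theta> t))\<^sup>2 \<partial>lebesgue_on {0..T}) < e" using N[of n] by simp
      then show "norm ((\<integral>t. (norm (\<theta>n n t - \<theta> t))\<^sup>2 \<partial>lebesgue_on {0..T}) - 0) < e" by simp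
    qed
  qed
  show "(\<lambda>n. inner (\<theta>n n t) h) \<longlonglongrightarrow> inner (\<theta> t) h" if t: "t \<in> {0..T}" and h: "h \<in> H0"
  proof (rule LIMSEQ_I)
    fix e :: real assume e: "0 < e"
    let ?U = "{\<eta> \<in> X_space T \<alpha>. (SUP t\<in>{0..T}. \<bar>inner (\<eta> t - \<theta> t) h\<bar>) < e}"
    have "openin (X_top T \<alpha>) ?U"
      unfolding X_top_def
    proof (rule topology_generated_by_Basis, rule UnI2, rule CollectI, intro exI conjI)
      show "?U = ?U" ..
      show "\<theta> \<in> X_space T \<alpha>" by (rule \<theta>)
      show "h \<in> H0" by (rule h)
      show "0 < e" by (rule e)
    qed
    moreover have "(SUP t\<in>{0..T}. \<bar>inner (\<theta> t - \<theta> t) h\<bar>) < e"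
      using t e by (subst cSUP_const[of "{0..T}" "0::real", simplified] | simp)+
    ultimately have "\<forall>\<^sub>F n in sequentially. \<theta>n n \<in> ?U" using \<theta> by (intro ev) auto
    then obtain N where N: "\<And>n. n \<ge> N \<Longrightarrow> \<theta>n n \<in> ?U" unfolding eventually_sequentially by blast
    show "\<exists>no. \<forall>n\<ge>no. norm (inner (\<theta>n n t) h - inner (\<theta> t) h) < e"
    proof (intro exI[of _ N] allI impI)
      fix n assume n: "N \<le> n"
      have "continuous_on {0..T} (\<lambda>t. inner (\<theta>n n t) h)" "continuous_on {0..T} (\<lambda>t. inner (\<theta> t) h)"
        using \<theta>n[of n] \<theta> h by (auto simp: X_space_def Cw_H_def)
      then have "continuous_on {0..T} (\<lambda>t. \<bar>inner (\<theta>n n t - \<theta> t) h\<bar>)"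
        unfolding inner_diff_left by (intro continuous_on_rabs continuous_on_diff)
      \<comment> \<open>The real supremum bounds its members only over a set bounded above, which
        weak continuity of both paths on the compact interval provides.\<close>
      then have "bdd_above ((\<lambda>t. \<bar>inner (\<theta>n n t - \<theta> t) h\<bar>) ` {0..T})"
        by (intro bounded_imp_bdd_above compact_imp_bounded compact_continuous_image) auto
      from cSUP_upper[OF t this] have "\<bar>inner (\<theta>n n t - \<theta> t) h\<bar> < e" using N[OF n] by simp
      then show "norm (inner (\<theta>n n t) h - inner (\<theta> t) h) < e" by (simp add: inner_diff_left)
    qed
  qed
qed

lemma X_space_D:
  assumes "\<theta> \<in> X_space T \<alpha>"
  shows "\<theta> \<in> Cw_H T" "\<theta> \<in> L2T_Hs T \<alpha>" "\<theta> \<in> borel_measurable (lebesgue_on {0..T})"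
    "integrable (lebesgue_on {0..T}) (\<lambda>s. (norm (\<theta> s))\<^sup>2)"
  using assms by (auto simp: X_space_def L2T_H_def L2T_def)

text \<open>Each mode equation can be solved for the primitive of the control, because
  \<open>lam j powr \<alpha>\<close> is positive. All other terms converge: the values at 0 and t
  weakly, the linear and the quadratic integral by strong convergence in \<open>L2([0,T];H)\<close>.
  So the paths alone determine the limit of the controls.\<close>

lemma weak_solution_controls_converge:
  assumes T: "0 < T" and \<alpha>: "0 < \<alpha>"
    and \<theta>: "\<theta> \<in> X_space T \<alpha>" and sol: "weak_solution T \<alpha> g (\<theta> 0) \<theta>" and g: "g \<in> L2T T"
    and \<theta>n: "\<And>n. \<theta>n n \<in> X_space T \<alpha>" and soln: "\<And>n. weak_solution T \<alpha> (gn n) (\<theta>n n 0) (\<theta>n n)" and gn: "\<And>n. gn n \<in> L2T T"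
    and c2: "(\<lambda>n. \<integral>s. (norm (\<theta>n n s - \<theta> s))\<^sup>2 \<partial>lebesgue_on {0..T}) \<longlonglongrightarrow> 0"
    and cw: "\<And>t h. t \<in> {0..T} \<Longrightarrow> h \<in> H0 \<Longrightarrow> (\<lambda>n. inner (\<theta>n n t) h) \<longlonglongrightarrow> inner (\<theta> t) h"
    and t: "t \<in> {0..T}"
  shows "(\<lambda>n. \<integral>s. inner (\<theta>n n s) (bas j) \<partial>lebesgue_on {0..t}) \<longlonglongrightarrow> (\<integral>s. inner (\<theta> s) (bas j) \<partial>lebesgue_on {0..t})"
    and "(\<lambda>n. \<integral>s. inner (gn n s) (bas j) \<partial>lebesgue_on {0..t}) \<longlonglongrightarrow> (\<integral>s. inner (g s) (bas j) \<partial>lebesgue_on {0..t})"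
proof -
  let ?M = "lebesgue_on {0..T}"
  interpret finite_measure ?M by (rule finite_measure_lebesgue_on) simp
  have tT: "t \<le> T" and T0: "0 \<in> {0..T}" using t T by auto
  note X = X_space_D[OF \<theta>] and Xn = X_space_D[OF \<theta>n]
  note H = Cw_H_D(1)[OF X(1)] and Hn = Cw_H_D(1)[OF Xn(1)]
  have d2: "integrable ?M (\<lambda>s. (norm (\<theta>n n s - \<theta> s))\<^sup>2)" for n
  proof (rule Bochner_Integration.integrable_bound)
    show "integrable ?M (\<lambda>s. 2 * (norm (\<theta>n n s))\<^sup>2 + 2 * (norm (\<theta> s))\<^sup>2)" using X Xn[of n] by auto
    show "(\<lambda>s. (norm (\<theta>n n s - \<theta> s))\<^sup>2) \<in> borel_measurable ?M" using X(3) Xn(3)[of n] by measurable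
    show "AE s in ?M. norm ((norm (\<theta>n n s - \<theta> s))\<^sup>2) \<le> norm (2 * (norm (\<theta>n n s))\<^sup>2 + 2 * (norm (\<theta> s))\<^sup>2)"
    proof (rule AE_I2)
      fix s
      have "(norm (\<theta>n n s - \<theta> s))\<^sup>2 \<le> (norm (\<theta>n n s) + norm (\<theta> s))\<^sup>2"
        by (intro power_mono norm_triangle_ineq4) simp
      also have "\<dots> \<le> 2 * (norm (\<theta>n n s))\<^sup>2 + 2 * (norm (\<theta> s))\<^sup>2"
        using zero_le_power2[of "norm (\<theta>n n s) - norm (\<theta> s)"] by (simp add: power2_sum power2_diff)
      finally show "norm ((norm (\<theta>n n s - \<theta> s))\<^sup>2) \<le> norm (2 * (norm (\<theta>n n s))\<^sup>2 + 2 * (norm (\<theta> s))\<^sup>2)" by simp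
    qed
  qed
  have nl: "(\<lambda>n. \<integral>s. nonlin (\<theta>n n s) (bas j) \<partial>lebesgue_on {0..t}) \<longlonglongrightarrow> (\<integral>s. nonlin (\<theta> s) (bas j) \<partial>lebesgue_on {0..t})"
    by (rule nonlin_integral_tendsto[OF Hn Xn(3) H X(3) X(4) d2 c2 tT bas_Hinf])
  have ii: "integrable (lebesgue_on {0..t}) (\<lambda>s. inner (\<theta> s) (bas j))" "integrable (lebesgue_on {0..t}) (\<lambda>s. inner (\<theta>n n s) (bas j))" for n
    by (rule integrable_upto[OF continuous_imp_integrable_real[OF Cw_H_D(2)[OF X(1)]] tT]
        integrable_upto[OF continuous_imp_integrable_real[OF Cw_H_D(2)[OF Xn(1)]] tT])+
  show li: "(\<lambda>n. \<integral>s. inner (\<theta>n n s) (bas j) \<partial>lebesgue_on {0..t}) \<longlonglongrightarrow> (\<integral>s. inner (\<theta> s) (bas j) \<partial>lebesgue_on {0..t})"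
  proof -
    let ?f = "\<lambda>n s. inner (\<theta>n n s - \<theta> s) (bas j)"
    have fi: "integrable ?M (?f n)" for n
      unfolding inner_diff_left
      by (intro Bochner_Integration.integrable_diff continuous_imp_integrable_real Cw_H_D(2) X Xn)
    have "(\<lambda>n. \<integral>s. (if s \<le> t then 1 else 0) * ?f n s \<partial>?M) \<longlonglongrightarrow> 0"
    proof (rule LIMSEQ_I)
      fix e :: real assume e: "0 < e"
      \<comment> \<open>Young's inequality bounds the L1 norm of the difference by \<delta> T/2 plus
        its squared L2 norm over 2 \<delta>; this \<delta> keeps the first term below e/2.\<close>
      define \<delta> where "\<delta> = e / (T + 1)"
      have \<delta>: "0 < \<delta>" using e T by (simp add: \<delta>_def)
      have dT: "\<delta> / 2 * T < e / 2"
      proof -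
        have "\<delta> * T < \<delta> * (T + 1)" using \<delta> by simp
        also have "\<dots> = e" using T by (simp add: \<delta>_def)
        finally show ?thesis by simp
      qed
      have "0 < e * \<delta>" using e \<delta> by simp
      from LIMSEQ_D[OF c2 this] obtain N where N: "\<And>n. n \<ge> N \<Longrightarrow> (\<integral>s. (norm (\<theta>n n s - \<theta> s))\<^sup>2 \<partial>?M) < e * \<delta>" by auto
      show "\<exists>no. \<forall>n\<ge>no. norm ((\<integral>s. (if s \<le> t then 1 else 0) * ?f n s \<partial>?M) - 0) < e"
      proof (intro exI[of _ N] allI impI)
        fix n assume n: "N \<le> n"
        have "\<bar>\<integral>s. (if s \<le> t then 1 else 0) * ?f n s \<partial>?M\<bar> \<le> (\<integral>s. \<bar>?f n s\<bar> \<partial>?M)"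
          using abs_integral_upto_le[OF fi tT, of n] unfolding integral_upto[OF tT]
          by (simp add: if_distrib[of "\<lambda>x. x * _"] cong: if_cong)
        also have "\<dots> \<le> (\<integral>s. \<delta> / 2 + inverse \<delta> / 2 * (norm (\<theta>n n s - \<theta> s))\<^sup>2 \<partial>?M)"
        proof (rule integral_mono)
          show "integrable ?M (\<lambda>s. \<bar>?f n s\<bar>)" using fi by (rule integrable_abs)
          show "integrable ?M (\<lambda>s. \<delta> / 2 + inverse \<delta> / 2 * (norm (\<theta>n n s - \<theta> s))\<^sup>2)" using d2 by auto
          fix s
          have "\<bar>?f n s\<bar> \<le> norm (\<theta>n n s - \<theta> s)" by (rule abs_inner_bas_le)
          also have "\<dots> \<le> \<delta> / 2 + inverse \<delta> / 2 * (norm (\<theta>n n s - \<theta> s))\<^sup>2"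
          proof -
            have "0 \<le> inverse \<delta> / 2 * (norm (\<theta>n n s - \<theta> s) - \<delta>)\<^sup>2" using \<delta> by simp
            also have "\<dots> = \<delta> / 2 + inverse \<delta> / 2 * (norm (\<theta>n n s - \<theta> s))\<^sup>2 - norm (\<theta>n n s - \<theta> s)"
              using \<delta> by (simp add: power2_eq_square field_simps)
            finally show ?thesis by simp
          qed
          finally show "\<bar>?f n s\<bar> \<le> \<delta> / 2 + inverse \<delta> / 2 * (norm (\<theta>n n s - \<theta> s))\<^sup>2" .
        qed
        also have "\<dots> = \<delta> / 2 * T + inverse \<delta> / 2 * (\<integral>s. (norm (\<theta>n n s - \<theta> s))\<^sup>2 \<partial>?M)"
          using d2 T by (simp add: measure_restrict_space)
        also have "\<dots> < e"
        proof -
          have "inverse \<delta> / 2 * (\<integral>s. (norm (\<theta>n n s - \<theta> s))\<^sup>2 \<partial>?M) \<le> inverse \<delta> / 2 * (e * \<delta>)"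
            using N[OF n] \<delta> by (intro mult_left_mono) auto
          also have "\<dots> = e / 2" using \<delta> by simp
          finally show ?thesis using dT by linarith
        qed
        finally show "norm ((\<integral>s. (if s \<le> t then 1 else 0) * ?f n s \<partial>?M) - 0) < e" by simp
      qed
    qed
    moreover have "(\<integral>s. (if s \<le> t then 1 else 0) * ?f n s \<partial>?M) = (\<integral>s. inner (\<theta>n n s) (bas j) \<partial>lebesgue_on {0..t}) - (\<integral>s. inner (\<theta> s) (bas j) \<partial>lebesgue_on {0..t})" for n
    proof -
      have "(\<integral>s. (if s \<le> t then 1 else 0) * ?f n s \<partial>?M) = (\<integral>s. ?f n s \<partial>lebesgue_on {0..t})"
        unfolding integral_upto[OF tT] by (intro Bochner_Integration.integral_cong) auto
      then show ?thesis using ii by (simp add: inner_diff_left)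
    qed
    ultimately show ?thesis by (simp add: LIM_zero_cancel)
  qed
  define l where "l = lam j powr \<alpha>"
  have l: "0 < l" using lam_pos[of j] by (simp add: l_def)
  have expand: "l * (\<integral>s. inner (f s) (bas j) \<partial>lebesgue_on {0..t}) = inner (\<eta> t) (bas j) - inner (\<eta> 0) (bas j)
      + l\<^sup>2 * (\<integral>s. inner (\<eta> s) (bas j) \<partial>lebesgue_on {0..t}) + (\<integral>s. nonlin (\<eta> s) (bas j) \<partial>lebesgue_on {0..t})"
    if s: "weak_solution T \<alpha> f (\<eta> 0) \<eta>" and f: "f \<in> L2T T" for f \<eta>
  proof -
    have r: "\<eta> \<in> LinfT_H T" "\<eta> \<in> Cw_H T" using s by (auto simp: weak_solution_def)
    obtain C where "AE s in ?M. norm (\<eta> s) \<le> C" using LinfT_H_bound[OF r(1)] by blast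
    note i = integrable_mode_rhs[OF r(2) this f]
    have "inner (\<eta> t) (bas j) = inner (\<eta> 0) (bas j) + (\<integral>s. mode_rhs \<alpha> f \<eta> j s \<partial>lebesgue_on {0..t})"
      using weak_solution_imp_mode_equations[OF T s] t unfolding mode_equations_def by blast
    also have "(\<integral>s. mode_rhs \<alpha> f \<eta> j s \<partial>lebesgue_on {0..t}) = - (l\<^sup>2 * (\<integral>s. inner (\<eta> s) (bas j) \<partial>lebesgue_on {0..t}))
        - (\<integral>s. nonlin (\<eta> s) (bas j) \<partial>lebesgue_on {0..t}) + l * (\<integral>s. inner (f s) (bas j) \<partial>lebesgue_on {0..t})"
      unfolding mode_rhs_def lam_powr_double l_def[symmetric]
      using integrable_upto[OF i(1) tT] integrable_upto[OF i(2) tT] integrable_upto[OF i(3) tT] by simp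
    finally show ?thesis by simp
  qed
  have "(\<lambda>n. l * (\<integral>s. inner (gn n s) (bas j) \<partial>lebesgue_on {0..t})) \<longlonglongrightarrow> l * (\<integral>s. inner (g s) (bas j) \<partial>lebesgue_on {0..t})"
    unfolding expand[OF sol g] expand[OF soln gn] by (intro tendsto_intros cw t T0 bas_H0 li nl)
  then show "(\<lambda>n. \<integral>s. inner (gn n s) (bas j) \<partial>lebesgue_on {0..t}) \<longlonglongrightarrow> (\<integral>s. inner (g s) (bas j) \<partial>lebesgue_on {0..t})"
    using l by (simp add: tendsto_mult_left_iff)
qed

text \<open>Since \<open>2 F F\<^sub>n - F\<^sup>2 \<le> F\<^sub>n\<^sup>2\<close>, weak convergence of finitely many modes of the controls suffices.\<close>

lemma reversed_energy_lower_semicontinuous: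
  assumes T: "0 < T" and \<alpha>: "0 < \<alpha>"
    and \<theta>: "\<theta> \<in> X_space T \<alpha>" and sol: "weak_solution T \<alpha> g (\<theta> 0) \<theta>" and gH: "g \<in> L2T_H T"
    and \<theta>n: "\<And>n. \<theta>n n \<in> X_space T \<alpha>" and soln: "\<And>n. weak_solution T \<alpha> (gn n) (\<theta>n n 0) (\<theta>n n)" and gn: "\<And>n. gn n \<in> L2T T"
    and lim: "limitin (X_top T \<alpha>) \<theta>n \<theta> sequentially"
    and B: "\<And>n. (norm (\<theta>n n T))\<^sup>2 + 1/2 * (\<integral>s. (norm (reversed_control \<alpha> (gn n) (\<theta>n n) s))\<^sup>2 \<partial>lebesgue_on {0..T}) \<le> B"
  shows "(norm (\<theta> T))\<^sup>2 + 1/2 * (\<integral>s. (norm (reversed_control \<alpha> g \<theta> s))\<^sup>2 \<partial>lebesgue_on {0..T}) \<le> B"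
proof -
  let ?M = "lebesgue_on {0..T}"
  have g: "g \<in> L2T T" and gae: "AE s in ?M. g s \<in> H0" using gH by (auto simp: L2T_H_def)
  note X = X_space_D[OF \<theta>] and Xn = X_space_D[OF \<theta>n]
  note E = reversed_control_energy[OF X(2) g] and En = reversed_control_energy[OF Xn(2) gn]
  note conv = weak_solution_controls_converge[OF T \<alpha> \<theta> sol g \<theta>n soln gn X_convergence[OF lim \<theta> \<theta>n]]
  define F where "F j s = inner (reversed_control \<alpha> g \<theta> s) (bas j)" for j s
  define Fn where "Fn n j s = inner (reversed_control \<alpha> (gn n) (\<theta>n n) s) (bas j)" for n j s
  have [measurable]: "F j \<in> borel_measurable ?M" "Fn n j \<in> borel_measurable ?M" for j n
    using E(2) En(2)[of n] unfolding F_def[abs_def] Fn_def[abs_def] by measurable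
  have [measurable]: "reversed_control \<alpha> g \<theta> \<in> borel_measurable ?M" by (rule E(2))
  have [measurable]: "reversed_control \<alpha> (gn n) (\<theta>n n) \<in> borel_measurable ?M" for n by (rule En(2))
  have F2: "integrable ?M (\<lambda>s. (F j s)\<^sup>2)" for j
    by (rule Bochner_Integration.integrable_bound[OF E(1)]) (auto simp: F_def inner_bas_square_le)
  have Fn2: "integrable ?M (\<lambda>s. (Fn n j s)\<^sup>2)" for n j
    by (rule Bochner_Integration.integrable_bound[OF En(1)[of n n]]) (auto simp: Fn_def inner_bas_square_le)
  have FFn: "integrable ?M (\<lambda>s. F j s * Fn n j s)" for n j
    by (rule integrable_mult_of_squares) (use F2 Fn2 in auto)
  \<comment> \<open>Dropping the squared norm at time T leaves a uniform L2 bound on the reversed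
    controls, the boundedness that weak convergence requires.\<close>
  have rcB: "(\<integral>s. (norm (reversed_control \<alpha> (gn n) (\<theta>n n) s))\<^sup>2 \<partial>?M) \<le> 2 * B" for n
    using B[of n] zero_le_power2[of "norm (\<theta>n n T)"] by linarith
  have D2i: "integrable ?M (\<lambda>s. (Fn n j s - F j s)\<^sup>2)" for n j
    using F2[of j] Fn2[of n j] FFn[of j n] by (simp add: power2_diff mult.assoc mult.commute[of "Fn n j _"])
  have D2: "(\<integral>s. (Fn n j s - F j s)\<^sup>2 \<partial>?M) \<le> 4 * B + 2 * (\<integral>s. (norm (reversed_control \<alpha> g \<theta> s))\<^sup>2 \<partial>?M)" for n j
  proof -
    have "(\<integral>s. (Fn n j s - F j s)\<^sup>2 \<partial>?M) \<le> (\<integral>s. 2 * (norm (reversed_control \<alpha> (gn n) (\<theta>n n) s))\<^sup>2 + 2 * (norm (reversed_control \<alpha> g \<theta> s))\<^sup>2 \<partial>?M)"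
    proof (rule integral_mono)
      show "integrable ?M (\<lambda>s. 2 * (norm (reversed_control \<alpha> (gn n) (\<theta>n n) s))\<^sup>2 + 2 * (norm (reversed_control \<alpha> g \<theta> s))\<^sup>2)"
        using E(1) En(1)[of n] by auto
      fix s
      have "(Fn n j s - F j s)\<^sup>2 \<le> 2 * (Fn n j s)\<^sup>2 + 2 * (F j s)\<^sup>2"
        using zero_le_power2[of "Fn n j s + F j s"] by (simp add: power2_sum power2_diff)
      also have "\<dots> \<le> 2 * (norm (reversed_control \<alpha> (gn n) (\<theta>n n) s))\<^sup>2 + 2 * (norm (reversed_control \<alpha> g \<theta> s))\<^sup>2"
        unfolding F_def Fn_def by (intro add_mono mult_left_mono inner_bas_square_le) auto
      finally show "(Fn n j s - F j s)\<^sup>2 \<le> 2 * (norm (reversed_control \<alpha> (gn n) (\<theta>n n) s))\<^sup>2 + 2 * (norm (reversed_control \<alpha> g \<theta> s))\<^sup>2" .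
    qed (rule D2i)
    also have "\<dots> = 2 * (\<integral>s. (norm (reversed_control \<alpha> (gn n) (\<theta>n n) s))\<^sup>2 \<partial>?M) + 2 * (\<integral>s. (norm (reversed_control \<alpha> g \<theta> s))\<^sup>2 \<partial>?M)"
      using E(1) En(1)[of n] by simp
    finally show ?thesis using rcB[of n] by linarith
  qed
  have expand: "integrable ?M (\<lambda>s. inner (reversed_control \<alpha> f \<eta> s) (bas j)) \<and>
      (\<forall>t\<in>{0..T}. (\<integral>s. inner (reversed_control \<alpha> f \<eta> s) (bas j) \<partial>lebesgue_on {0..t}) =
      (\<integral>s. inner (f s) (bas j) \<partial>lebesgue_on {0..t}) - 2 * lam j powr \<alpha> * (\<integral>s. inner (\<eta> s) (bas j) \<partial>lebesgue_on {0..t}))"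
    if s: "weak_solution T \<alpha> f (\<eta> 0) \<eta>" and f: "f \<in> L2T T" and \<eta>: "\<eta> \<in> X_space T \<alpha>" for f \<eta> j
  proof -
    have r: "\<eta> \<in> LinfT_H T" "\<eta> \<in> Cw_H T" using s by (auto simp: weak_solution_def)
    obtain C where "AE s in ?M. norm (\<eta> s) \<le> C" using LinfT_H_bound[OF r(1)] by blast
    note i = integrable_mode_rhs[OF r(2) this f]
    note m = reversed_control_energy(2)[OF X_space_D(2)[OF \<eta>] f]
    have "AE s in ?M. \<eta> s \<in> Hs \<alpha>" using X_space_D(2)[OF \<eta>] by (auto simp: L2T_Hs_def)
    then have eq: "AE s in ?M. inner (reversed_control \<alpha> f \<eta> s) (bas j) = inner (f s) (bas j) - 2 * lam j powr \<alpha> * inner (\<eta> s) (bas j)"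
      by eventually_elim (simp add: reversed_control_def inner_diff_left Lam_bas)
    have ii: "integrable ?M (\<lambda>s. inner (f s) (bas j) - 2 * lam j powr \<alpha> * inner (\<eta> s) (bas j))"
      using i(2,3) by auto
    have mm: "(\<lambda>s. inner (reversed_control \<alpha> f \<eta> s) (bas j)) \<in> borel_measurable ?M" using m by measurable
    have ri: "integrable ?M (\<lambda>s. inner (reversed_control \<alpha> f \<eta> s) (bas j))"
      by (rule integrable_cong_AE_imp[OF ii mm]) (use eq in eventually_elim, simp)
    moreover have "(\<integral>s. inner (reversed_control \<alpha> f \<eta> s) (bas j) \<partial>lebesgue_on {0..t}) =
      (\<integral>s. inner (f s) (bas j) \<partial>lebesgue_on {0..t}) - 2 * lam j powr \<alpha> * (\<integral>s. inner (\<eta> s) (bas j) \<partial>lebesgue_on {0..t})"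
      if "t \<in> {0..T}" for t
    proof -
      have tT: "t \<le> T" using that by simp
      have "(\<integral>s. inner (reversed_control \<alpha> f \<eta> s) (bas j) \<partial>lebesgue_on {0..t}) =
        (\<integral>s. inner (f s) (bas j) - 2 * lam j powr \<alpha> * inner (\<eta> s) (bas j) \<partial>lebesgue_on {0..t})"
        by (rule integral_cong_AE[OF _ _ AE_upto[OF eq tT]])
          (use integrable_upto[OF ri tT] integrable_upto[OF ii tT] in auto)
      then show ?thesis using integrable_upto[OF i(3) tT] integrable_upto[OF i(2) tT] by simp
    qed
    ultimately show ?thesis by blast
  qed
  \<comment> \<open>In each mode the reversed control is a fixed combination of control and path,
    and the primitives of both have been shown to converge.\<close>
  have prim: "(\<lambda>n. \<integral>s. Fn n j s - F j s \<partial>lebesgue_on {0..t}) \<longlonglongrightarrow> 0" if t: "t \<in> {0..T}" for j t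
  proof -
    have tT: "t \<le> T" using t by simp
    note e = expand[OF sol g \<theta>, of j] and en = expand[OF soln gn \<theta>n, of _ j]
    have "(\<integral>s. Fn n j s - F j s \<partial>lebesgue_on {0..t}) =
      ((\<integral>s. inner (gn n s) (bas j) \<partial>lebesgue_on {0..t}) - 2 * lam j powr \<alpha> * (\<integral>s. inner (\<theta>n n s) (bas j) \<partial>lebesgue_on {0..t}))
      - ((\<integral>s. inner (g s) (bas j) \<partial>lebesgue_on {0..t}) - 2 * lam j powr \<alpha> * (\<integral>s. inner (\<theta> s) (bas j) \<partial>lebesgue_on {0..t}))" for n
      using integrable_upto[OF conjunct1[OF e] tT] integrable_upto[OF conjunct1[OF en] tT, of n]
        conjunct2[OF e] conjunct2[OF en, of n] t
      unfolding F_def Fn_def by simp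
    moreover have "(\<lambda>n. ((\<integral>s. inner (gn n s) (bas j) \<partial>lebesgue_on {0..t}) - 2 * lam j powr \<alpha> * (\<integral>s. inner (\<theta>n n s) (bas j) \<partial>lebesgue_on {0..t}))
      - ((\<integral>s. inner (g s) (bas j) \<partial>lebesgue_on {0..t}) - 2 * lam j powr \<alpha> * (\<integral>s. inner (\<theta> s) (bas j) \<partial>lebesgue_on {0..t}))) \<longlonglongrightarrow>
      ((\<integral>s. inner (g s) (bas j) \<partial>lebesgue_on {0..t}) - 2 * lam j powr \<alpha> * (\<integral>s. inner (\<theta> s) (bas j) \<partial>lebesgue_on {0..t}))
      - ((\<integral>s. inner (g s) (bas j) \<partial>lebesgue_on {0..t}) - 2 * lam j powr \<alpha> * (\<integral>s. inner (\<theta> s) (bas j) \<partial>lebesgue_on {0..t}))"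
      by (intro tendsto_diff tendsto_mult tendsto_const conv t)
    ultimately show ?thesis by simp
  qed
  have wk: "(\<lambda>n. \<integral>s. F j s * (Fn n j s - F j s) \<partial>?M) \<longlonglongrightarrow> 0" for j
    by (rule weak_L2_convergence[OF _ _ D2i D2 prim]) (use T F2 in auto)
  have ptw: "(\<Sum>j<K. (inner (\<theta> T) (bas j))\<^sup>2) + 1/2 * (\<Sum>j<K. \<integral>s. (F j s)\<^sup>2 \<partial>?M) \<le> B" for K
  proof (rule LIMSEQ_le_const2)
    let ?a = "\<lambda>n. (\<Sum>j<K. (inner (\<theta>n n T) (bas j))\<^sup>2) + (\<Sum>j<K. \<integral>s. F j s * (Fn n j s - F j s) \<partial>?M) + 1/2 * (\<Sum>j<K. \<integral>s. (F j s)\<^sup>2 \<partial>?M)"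
    have "?a \<longlonglongrightarrow> (\<Sum>j<K. (inner (\<theta> T) (bas j))\<^sup>2) + (\<Sum>j<K. 0) + 1/2 * (\<Sum>j<K. \<integral>s. (F j s)\<^sup>2 \<partial>?M)"
      by (intro tendsto_add tendsto_sum tendsto_power tendsto_const wk X_convergence(2)[OF lim \<theta> \<theta>n]) (use T in auto)
    then show "?a \<longlonglongrightarrow> (\<Sum>j<K. (inner (\<theta> T) (bas j))\<^sup>2) + 1/2 * (\<Sum>j<K. \<integral>s. (F j s)\<^sup>2 \<partial>?M)" by simp
    have "?a n \<le> B" for n
    proof -
      have i1: "integrable ?M (\<lambda>s. F j s * (Fn n j s - F j s))" for j
        using F2[of j] FFn[of j n] by (simp add: right_diff_distrib power2_eq_square)
      have "2 * (\<Sum>j<K. \<integral>s. F j s * (Fn n j s - F j s) \<partial>?M) + (\<Sum>j<K. \<integral>s. (F j s)\<^sup>2 \<partial>?M)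
          = (\<integral>s. 2 * (\<Sum>j<K. F j s * (Fn n j s - F j s)) + (\<Sum>j<K. (F j s)\<^sup>2) \<partial>?M)"
        using F2 i1 by simp
      also have "\<dots> \<le> (\<integral>s. (norm (reversed_control \<alpha> (gn n) (\<theta>n n) s))\<^sup>2 \<partial>?M)"
      proof (rule integral_mono)
        show "integrable ?M (\<lambda>s. 2 * (\<Sum>j<K. F j s * (Fn n j s - F j s)) + (\<Sum>j<K. (F j s)\<^sup>2))"
          using F2 i1 by auto
        fix s
        have "2 * (\<Sum>j<K. F j s * (Fn n j s - F j s)) + (\<Sum>j<K. (F j s)\<^sup>2) = (\<Sum>j<K. 2 * (F j s * (Fn n j s - F j s)) + (F j s)\<^sup>2)"
          by (simp add: sum.distrib sum_distrib_left)
        also have "\<dots> \<le> (\<Sum>j<K. (Fn n j s)\<^sup>2)"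
        proof (rule sum_mono)
          fix j
          have "0 \<le> (Fn n j s - F j s)\<^sup>2" by simp
          then show "2 * (F j s * (Fn n j s - F j s)) + (F j s)\<^sup>2 \<le> (Fn n j s)\<^sup>2"
            by (simp add: power2_eq_square algebra_simps)
        qed
        also have "\<dots> \<le> (norm (reversed_control \<alpha> (gn n) (\<theta>n n) s))\<^sup>2"
          unfolding Fn_def by (rule bessel_finite[OF orthonormal_bas]) simp
        finally show "2 * (\<Sum>j<K. F j s * (Fn n j s - F j s)) + (\<Sum>j<K. (F j s)\<^sup>2) \<le> (norm (reversed_control \<alpha> (gn n) (\<theta>n n) s))\<^sup>2" .
      qed (rule En(1))
      finally show ?thesis
        using B[of n] bessel_finite[OF orthonormal_bas finite_lessThan, of "\<theta>n n T" K] by simp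
    qed
    then show "\<exists>N. \<forall>n\<ge>N. ?a n \<le> B" by blast
  qed
  have ae: "AE s in ?M. \<theta> s \<in> Hs \<alpha>" using X(2) by (auto simp: L2T_Hs_def)
  \<comment> \<open>The modes exhaust the norm of mean-zero values, which is why the control has to
    lie in \<open>L2T_H\<close>.\<close>
  have rcH: "AE s in ?M. reversed_control \<alpha> g \<theta> s \<in> H0"
    using ae gae by eventually_elim (auto simp: reversed_control_def intro!: H0_diff H0_scaleR Lam_H0)
  have "(\<lambda>K. \<integral>s. (\<Sum>j<K. (F j s)\<^sup>2) \<partial>?M) \<longlonglongrightarrow> (\<integral>s. (norm (reversed_control \<alpha> g \<theta> s))\<^sup>2 \<partial>?M)"
  proof (rule integral_dominated_convergence[OF _ _ E(1)])
    show "AE s in ?M. (\<lambda>K. \<Sum>j<K. (F j s)\<^sup>2) \<longlonglongrightarrow> (norm (reversed_control \<alpha> g \<theta> s))\<^sup>2"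
      using rcH by eventually_elim (use H0_norm_sums in \<open>auto simp: sums_def F_def\<close>)
    show "AE s in ?M. norm (\<Sum>j<K. (F j s)\<^sup>2) \<le> (norm (reversed_control \<alpha> g \<theta> s))\<^sup>2" for K
      unfolding F_def by (rule AE_I2) (simp add: sum_nonneg bessel_finite[OF orthonormal_bas])
  qed measurable
  then have l2: "(\<lambda>K. \<Sum>j<K. \<integral>s. (F j s)\<^sup>2 \<partial>?M) \<longlonglongrightarrow> (\<integral>s. (norm (reversed_control \<alpha> g \<theta> s))\<^sup>2 \<partial>?M)"
    using F2 by simp
  have l1: "(\<lambda>K. \<Sum>j<K. (inner (\<theta> T) (bas j))\<^sup>2) \<longlonglongrightarrow> (norm (\<theta> T))\<^sup>2"
    using H0_norm_sums[OF Cw_H_D(1)[OF X(1), of T]] T by (simp add: sums_def)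
  show ?thesis
    by (rule LIMSEQ_le_const2[OF tendsto_add[OF l1 tendsto_mult[OF tendsto_const l2]]]) (use ptw in blast)
qed

text \<open>The given control bounds the rate of \<theta> from above, so convergence of the rates
  makes the approximants eventually cheaper than R + \<epsilon>, and the infimum supplies controls
  of at most that cost. The energy inequality of the class turns these costs into bounds on the
  reversed energy. The slack \<epsilon> is what an order limit leaves.\<close>

lemma reversed_energy_le_of_closure:
  assumes T: "0 < T" and \<alpha>: "0 < \<alpha>" and C0: "weak_strong_uniqueness_class T \<alpha> C0"
    and \<theta>: "\<theta> \<in> rate_closure T \<alpha> C0" and g: "g \<in> L2T_H T" and sol: "weak_solution T \<alpha> g (\<theta> 0) \<theta>"
  shows "(norm (\<theta> T))\<^sup>2 + 1/2 * (\<integral>s. (norm (reversed_control \<alpha> g \<theta> s))\<^sup>2 \<partial>lebesgue_on {0..T})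
    \<le> (norm (\<theta> 0))\<^sup>2 + 1/2 * (\<integral>s. (norm (g s))\<^sup>2 \<partial>lebesgue_on {0..T})"
proof (rule field_le_epsilon)
  let ?M = "lebesgue_on {0..T}"
  define R where "R = (norm (\<theta> 0))\<^sup>2 + 1/2 * (\<integral>s. (norm (g s))\<^sup>2 \<partial>?M)"
  have R0: "0 \<le> R" unfolding R_def by (intro add_nonneg_nonneg mult_nonneg_nonneg integral_nonneg) auto
  fix \<epsilon> :: real assume \<epsilon>: "0 < \<epsilon>"
  obtain \<theta>n where \<theta>n: "\<And>n. \<theta>n n \<in> C0" and lim: "limitin (X_top T \<alpha>) \<theta>n \<theta> sequentially"
    and rate: "(\<lambda>n. rate T \<alpha> (\<theta>n n)) \<longlonglongrightarrow> rate T \<alpha> \<theta>" and \<theta>X: "\<theta> \<in> X_space T \<alpha>"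
    using \<theta> unfolding rate_closure_def by blast
  have "rate T \<alpha> \<theta> \<le> ennreal ((norm (\<theta> 0))\<^sup>2) + ennreal (1/2 * (\<integral>s. (norm (g s))\<^sup>2 \<partial>?M))"
    unfolding rate_def I_dyna_def using g sol by (intro add_left_mono INF_lower) auto
  also have "\<dots> = ennreal R"
    unfolding R_def by (intro ennreal_plus[symmetric] mult_nonneg_nonneg integral_nonneg) auto
  also have "\<dots> < ennreal (R + \<epsilon>)" using R0 \<epsilon> by (simp add: ennreal_lessI)
  finally have "\<forall>\<^sub>F n in sequentially. rate T \<alpha> (\<theta>n n) < ennreal (R + \<epsilon>)"
    by (rule order_tendstoD(2)[OF rate])
  then obtain N where N: "\<And>n. N \<le> n \<Longrightarrow> rate T \<alpha> (\<theta>n n) < ennreal (R + \<epsilon>)"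
    unfolding eventually_sequentially by blast
  \<comment> \<open>Shifting the sequence makes the cost bound hold for every index.\<close>
  define \<eta> where "\<eta> n = \<theta>n (n + N)" for n
  have \<eta>C: "\<eta> n \<in> C0" for n by (simp add: \<eta>_def \<theta>n)
  have \<eta>X: "\<eta> n \<in> X_space T \<alpha>" for n
    using \<eta>C C0 unfolding weak_strong_uniqueness_class_def by blast
  have "\<exists>f. f \<in> L2T_H T \<and> weak_solution T \<alpha> f (\<eta> n 0) (\<eta> n) \<and> (norm (\<eta> n 0))\<^sup>2 + 1/2 * (\<integral>s. (norm (f s))\<^sup>2 \<partial>?M) \<le> R + \<epsilon>" for n
  \<comment> \<open>If every admissible control were dearer, so would be the infimum; this also
    rules out an empty set of controls, whose infimum is infinite.\<close>
  proof (rule ccontr)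
    assume neg: "\<not> ?thesis"
    let ?a = "(norm (\<eta> n 0))\<^sup>2"
    have "ennreal (R + \<epsilon> - ?a) \<le> I_dyna T \<alpha> (\<eta> n)"
      unfolding I_dyna_def
    proof (rule INF_greatest)
      fix f assume "f \<in> {f \<in> L2T_H T. weak_solution T \<alpha> f (\<eta> n 0) (\<eta> n)}"
      then have "R + \<epsilon> - ?a \<le> 1/2 * (\<integral>s. (norm (f s))\<^sup>2 \<partial>?M)" using neg by force
      then show "ennreal (R + \<epsilon> - ?a) \<le> ennreal (1/2 * (\<integral>t. (norm (f t))\<^sup>2 \<partial>?M))" by (rule ennreal_leI)
    qed
    then have "ennreal ?a + ennreal (R + \<epsilon> - ?a) \<le> rate T \<alpha> (\<eta> n)"
      unfolding rate_def by (rule add_left_mono)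
    \<comment> \<open>Truncation by \<open>ennreal\<close> is harmless: if ?a exceeds R +
      \<epsilon>, the second summand is 0 and the first alone suffices.\<close>
    moreover have "ennreal (R + \<epsilon>) \<le> ennreal ?a + ennreal (R + \<epsilon> - ?a)"
      by (cases "?a \<le> R + \<epsilon>") (simp_all add: ennreal_plus[symmetric] ennreal_neg ennreal_leI del: ennreal_plus)
    ultimately have "ennreal (R + \<epsilon>) \<le> rate T \<alpha> (\<eta> n)" by (rule order_trans[rotated])
    also have "\<dots> < ennreal (R + \<epsilon>)" unfolding \<eta>_def by (rule N) simp
    finally show False by simp
  qed
  then obtain f where f: "\<And>n. f n \<in> L2T_H T" and fs: "\<And>n. weak_solution T \<alpha> (f n) (\<eta> n 0) (\<eta> n)"
    and fb: "\<And>n. (norm (\<eta> n 0))\<^sup>2 + 1/2 * (\<integral>s. (norm (f n s))\<^sup>2 \<partial>?M) \<le> R + \<epsilon>" by metis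
  have f2: "f n \<in> L2T T" for n using f[of n] by (simp add: L2T_H_def)
  have "(norm (\<theta> T))\<^sup>2 + 1/2 * (\<integral>s. (norm (reversed_control \<alpha> g \<theta> s))\<^sup>2 \<partial>?M) \<le> R + \<epsilon>"
  proof (rule reversed_energy_lower_semicontinuous[OF T \<alpha> \<theta>X sol g \<eta>X fs f2])
    show "limitin (X_top T \<alpha>) \<eta> \<theta> sequentially"
      unfolding \<eta>_def[abs_def] by (rule limitin_sequentially_offset[OF lim])
    fix n
    have T': "T \<in> {0..T}" using T by simp
    have "1/2 * (norm (\<eta> n T))\<^sup>2 + (\<integral>s. (norm_Hs \<alpha> (\<eta> n s))\<^sup>2 \<partial>?M)
        \<le> 1/2 * (norm (\<eta> n 0))\<^sup>2 + (\<integral>s. inner (Lam \<alpha> (\<eta> n s)) (f n s) \<partial>?M)"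
      using energy_inequality_of_class[OF T \<alpha> C0 \<eta>C f2 fs, of n] T' unfolding energy_inequality_def by blast
    then show "(norm (\<eta> n T))\<^sup>2 + 1/2 * (\<integral>s. (norm (reversed_control \<alpha> (f n) (\<eta> n) s))\<^sup>2 \<partial>?M) \<le> R + \<epsilon>"
      using fb[of n] unfolding reversed_control_energy(3)[OF X_space_D(2)[OF \<eta>X] f2] by argo
  qed
  then show "(norm (\<theta> T))\<^sup>2 + 1/2 * (\<integral>s. (norm (reversed_control \<alpha> g \<theta> s))\<^sup>2 \<partial>?M)
    \<le> (norm (\<theta> 0))\<^sup>2 + 1/2 * (\<integral>s. (norm (g s))\<^sup>2 \<partial>?M) + \<epsilon>" by (simp add: R_def)
qed

section \<open>Reflection of the time interval\<close>

lemma lebesgue_reflection: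
  fixes T :: real
  shows "(\<lambda>s. T - s) \<in> measurable lebesgue lebesgue" "distr lebesgue lebesgue (\<lambda>s. T - s) = lebesgue"
proof -
  have "(\<lambda>s. T + (-1) * s) \<in> measurable lebesgue lebesgue"
    using lebesgue_affine_measurable[of "\<lambda>_. -1 :: real" T] by simp
  then show "(\<lambda>s. T - s) \<in> measurable lebesgue lebesgue" by simp
  have "lebesgue = density (distr lebesgue lebesgue (\<lambda>s. T + (-1) * s)) (\<lambda>_. ennreal \<bar>-1\<bar>)"
    by (rule lebesgue_real_affine) simp
  then show "distr lebesgue lebesgue (\<lambda>s. T - s) = lebesgue" by (simp add: density_1)
qed

lemma measurable_reflection [measurable]:
  fixes T :: real
  shows "(\<lambda>s. T - s) \<in> measurable (lebesgue_on {0..T}) (lebesgue_on {0..T})"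
  by (intro measurable_restrict_space3 lebesgue_reflection) auto

lemma distr_reflection:
  fixes T :: real
  shows "distr (lebesgue_on {0..T}) (lebesgue_on {0..T}) (\<lambda>s. T - s) = lebesgue_on {0..T}"
proof (rule measure_eqI)
  fix A assume "A \<in> sets (distr (lebesgue_on {0..T}) (lebesgue_on {0..T}) (\<lambda>s. T - s))"
  then have A: "A \<in> sets (lebesgue_on {0..T})" "A \<in> sets lebesgue" "A \<subseteq> {0..T}"
    by (auto simp: sets_restrict_space_iff)
  have v: "(\<lambda>s. T - s) -` A \<subseteq> {0..T}" using A(3) by force
  then have vA: "(\<lambda>s. T - s) -` A \<inter> {0..T} = (\<lambda>s. T - s) -` A" by auto
  have "emeasure (distr (lebesgue_on {0..T}) (lebesgue_on {0..T}) (\<lambda>s. T - s)) A = emeasure (lebesgue_on {0..T}) ((\<lambda>s. T - s) -` A)"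
    by (subst emeasure_distr[OF measurable_reflection A(1)]) (simp add: vA)
  also have "\<dots> = emeasure lebesgue ((\<lambda>s. T - s) -` A)"
    by (rule emeasure_restrict_space) (use v in auto)
  also have "\<dots> = emeasure (distr lebesgue lebesgue (\<lambda>s. T - s)) A"
    by (subst emeasure_distr[OF lebesgue_reflection(1) A(2)]) simp
  also have "\<dots> = emeasure (lebesgue_on {0..T}) A"
    unfolding lebesgue_reflection(2) by (rule emeasure_restrict_space[symmetric]) (use A in auto)
  finally show "emeasure (distr (lebesgue_on {0..T}) (lebesgue_on {0..T}) (\<lambda>s. T - s)) A = emeasure (lebesgue_on {0..T}) A" .
qed simp

lemma AE_reflection:
  fixes T :: real
  assumes "AE s in lebesgue_on {0..T}. P s" shows "AE s in lebesgue_on {0..T}. P (T - s)"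
  by (rule AE_distrD[OF measurable_reflection]) (simp only: distr_reflection assms)

lemma integrable_reflection:
  fixes f :: "real \<Rightarrow> real"
  assumes "integrable (lebesgue_on {0..T}) f"
  shows "integrable (lebesgue_on {0..T}) (\<lambda>s. f (T - s))"
  by (rule integrable_distr[OF measurable_reflection]) (simp only: distr_reflection assms)

lemma integral_reflection:
  fixes f :: "real \<Rightarrow> real"
  assumes "f \<in> borel_measurable (lebesgue_on {0..T})"
  shows "(\<integral>s. f (T - s) \<partial>lebesgue_on {0..T}) = (\<integral>s. f s \<partial>lebesgue_on {0..T})"
  using integral_distr[OF measurable_reflection assms] by (simp only: distr_reflection)

text \<open>Reflection turns an initial segment into a final one, whose integral is a difference of
  two integrals from zero, the form in which the mode equations are stated.\<close>

lemma integral_upto_reflection: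
  fixes f :: "real \<Rightarrow> real"
  assumes f: "integrable (lebesgue_on {0..T}) f" and t: "t \<in> {0..T}"
  shows "(\<integral>s. f (T - s) \<partial>lebesgue_on {0..t}) =
    (\<integral>s. f s \<partial>lebesgue_on {0..T}) - (\<integral>s. f s \<partial>lebesgue_on {0..T - t})"
proof -
  let ?M = "lebesgue_on {0..T}"
  have [measurable]: "(\<lambda>s. s) \<in> borel_measurable ?M" "f \<in> borel_measurable ?M"
    using f id_borel_measurable_lebesgue_on by (auto simp: id_def)
  have i: "integrable ?M (\<lambda>r. if r < T - t then f r else 0)"
    by (rule Bochner_Integration.integrable_bound[OF f]) auto
  have "(\<integral>s. f (T - s) \<partial>lebesgue_on {0..t}) = (\<integral>s. (if s \<le> t then f (T - s) else 0) \<partial>?M)"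
    using t by (intro integral_upto) auto
  also have "\<dots> = (\<integral>s. (if T - s < T - t then 0 else f (T - s)) \<partial>?M)"
    by (intro Bochner_Integration.integral_cong) auto
  also have "\<dots> = (\<integral>r. (if r < T - t then 0 else f r) \<partial>?M)"
    by (rule integral_reflection) measurable
  also have "\<dots> = (\<integral>r. f r - (if r < T - t then f r else 0) \<partial>?M)"
    by (intro Bochner_Integration.integral_cong) auto
  also have "\<dots> = (\<integral>r. f r \<partial>?M) - (\<integral>r. (if r < T - t then f r else 0) \<partial>?M)"
    using f i by simp
  also have "(\<integral>r. (if r < T - t then f r else 0) \<partial>?M) = (\<integral>r. f r \<partial>lebesgue_on {0..T - t})"
    using t by (intro integral_upto_strict[symmetric] f) auto
  finally show ?thesis .
qed

text \<open>The minus sign and the reversal of time cancel in the time derivative, so the linear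
  diffusion acquires the wrong sign, which the shift of the control repairs, while the quadratic
  term keeps its sign. The last two identities say that reversal exchanges the energy of the control
  with that of the reversed control.\<close>

lemma reversed_weak_solution:
  assumes T: "0 < T" and \<alpha>: "0 < \<alpha>"
    and \<theta>: "\<theta> \<in> X_space T \<alpha>" and g: "g \<in> L2T_H T" and sol: "weak_solution T \<alpha> g (\<theta> 0) \<theta>"
    and \<eta>: "time_reversal T \<theta> \<in> X_space T \<alpha>"
  defines "h \<equiv> \<lambda>s. reversed_control \<alpha> g \<theta> (T - s)"
  shows "h \<in> L2T_H T"
    and "weak_solution T \<alpha> h (time_reversal T \<theta> 0) (time_reversal T \<theta>)"
    and "(\<integral>s. (norm (h s))\<^sup>2 \<partial>lebesgue_on {0..T}) = (\<integral>s. (norm (reversed_control \<alpha> g \<theta> s))\<^sup>2 \<partial>lebesgue_on {0..T})"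
    and "(\<integral>s. (norm (reversed_control \<alpha> h (time_reversal T \<theta>) s))\<^sup>2 \<partial>lebesgue_on {0..T}) = (\<integral>s. (norm (g s))\<^sup>2 \<partial>lebesgue_on {0..T})"
proof -
  let ?M = "lebesgue_on {0..T}" and ?\<eta> = "time_reversal T \<theta>"
  have g2: "g \<in> L2T T" and gae: "AE s in ?M. g s \<in> H0" using g by (auto simp: L2T_H_def)
  note X = X_space_D[OF \<theta>] and Y = X_space_D[OF \<eta>]
  note E = reversed_control_energy[OF X(2) g2]
  have r: "\<theta> \<in> LinfT_H T" using sol by (auto simp: weak_solution_def)
  have rev: "?\<eta> s = - \<theta> (T - s)" if "s \<in> {0..T}" for s using that by (simp add: time_reversal_def)
  have M: "AE s in ?M. s \<in> {0..T}" by (rule AE_I2) simp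
  have ae: "AE s in ?M. \<theta> s \<in> Hs \<alpha>" using X(2) by (auto simp: L2T_Hs_def)
  have [measurable]: "reversed_control \<alpha> g \<theta> \<in> borel_measurable ?M" by (rule E(2))
  have hm[measurable]: "h \<in> borel_measurable ?M" unfolding h_def by measurable
  have h2: "h \<in> L2T T"
    using integrable_reflection[OF E(1)] hm by (simp add: L2T_def h_def)
  have "AE s in ?M. reversed_control \<alpha> g \<theta> s \<in> H0"
    using ae gae by eventually_elim (auto simp: reversed_control_def intro!: H0_diff H0_scaleR Lam_H0)
  then have "AE s in ?M. h s \<in> H0" unfolding h_def by (rule AE_reflection)
  then show "h \<in> L2T_H T" using h2 by (simp add: L2T_H_def)
  show "(\<integral>s. (norm (h s))\<^sup>2 \<partial>?M) = (\<integral>s. (norm (reversed_control \<alpha> g \<theta> s))\<^sup>2 \<partial>?M)"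
    unfolding h_def by (rule integral_reflection) measurable
  show "weak_solution T \<alpha> h (?\<eta> 0) ?\<eta>"
  proof (rule mode_equations_imp_weak_solution[OF T \<alpha> Cw_H_D(1)[OF Y(1)] _ Y(2,1) h2])
    show "0 \<in> {0..T}" using T by simp
    obtain C where C: "AE s in ?M. \<theta> s \<in> H0 \<and> norm (\<theta> s) \<le> C" using r by (auto simp: LinfT_H_def)
    have "AE s in ?M. ?\<eta> s \<in> H0 \<and> norm (?\<eta> s) \<le> C"
      using AE_reflection[OF C] M by eventually_elim (auto simp: rev H0_uminus)
    then show "?\<eta> \<in> LinfT_H T" using Y(3) by (auto simp: LinfT_H_def)
    obtain C where "AE s in ?M. norm (\<theta> s) \<le> C" using LinfT_H_bound[OF r] by blast
    note i = integrable_mode_rhs(4)[OF X(1) this g2, of \<alpha>]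
    obtain D where "AE s in ?M. norm (?\<eta> s) \<le> D" using LinfT_H_bound[OF \<open>?\<eta> \<in> LinfT_H T\<close>] by blast
    note j = integrable_mode_rhs(4)[OF Y(1) this h2, of \<alpha>]
    have eq: "AE s in ?M. mode_rhs \<alpha> h ?\<eta> n s = mode_rhs \<alpha> g \<theta> n (T - s)" for n
      using AE_reflection[OF ae] M
    proof eventually_elim
      case (elim s)
      have "nonlin (- \<theta> (T - s)) (bas n) = nonlin (\<theta> (T - s)) (bas n)"
        using nonlin_scaleR[OF Hs_H0[OF elim(1)] bas_Hinf, of "-1"] by simp
      then show ?case
        unfolding mode_rhs_def lam_powr_double
        using elim by (simp add: rev h_def reversed_control_def inner_diff_left Lam_bas power2_eq_square algebra_simps)
    qed
    show "mode_equations T \<alpha> h (?\<eta> 0) ?\<eta>"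
      unfolding mode_equations_def
    proof (intro allI ballI)
      fix n t assume t: "t \<in> {0..T}"
      then have tT: "t \<le> T" by simp
      have "(\<integral>s. mode_rhs \<alpha> h ?\<eta> n s \<partial>lebesgue_on {0..t}) = (\<integral>s. mode_rhs \<alpha> g \<theta> n (T - s) \<partial>lebesgue_on {0..t})"
        by (rule integral_cong_AE[OF _ _ AE_upto[OF eq tT]])
          (use integrable_upto[OF j tT] integrable_upto[OF integrable_reflection[OF i] tT] in auto)
      also have "\<dots> = (\<integral>s. mode_rhs \<alpha> g \<theta> n s \<partial>?M) - (\<integral>s. mode_rhs \<alpha> g \<theta> n s \<partial>lebesgue_on {0..T - t})"
        by (rule integral_upto_reflection[OF i t])
      finally have e: "(\<integral>s. mode_rhs \<alpha> h ?\<eta> n s \<partial>lebesgue_on {0..t}) = \<dots>" .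
      have "inner (\<theta> r) (bas n) = inner (\<theta> 0) (bas n) + (\<integral>s. mode_rhs \<alpha> g \<theta> n s \<partial>lebesgue_on {0..r})"
        if "r \<in> {0..T}" for r
        using weak_solution_imp_mode_equations[OF T sol] that unfolding mode_equations_def by blast
      from this[of T] this[of "T - t"] show "inner (?\<eta> t) (bas n) = inner (?\<eta> 0) (bas n) + (\<integral>s. mode_rhs \<alpha> h ?\<eta> n s \<partial>lebesgue_on {0..t})"
        using t T by (simp add: e rev)
    qed
  qed
  \<comment> \<open>At time s the shift by \<open>Lam \<alpha>\<close> of the reversed path undoes
    the one contained in h, since \<open>Lam \<alpha>\<close> is odd; what remains is g (T -
    s).\<close>
  have rc: "AE s in ?M. (norm (reversed_control \<alpha> h ?\<eta> s))\<^sup>2 = (norm (g (T - s)))\<^sup>2"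
    using AE_reflection[OF ae] M
    by eventually_elim (simp add: reversed_control_def h_def rev Lam_uminus)
  have gm[measurable]: "g \<in> borel_measurable ?M" using g2 by (simp add: L2T_def)
  have [measurable]: "reversed_control \<alpha> h ?\<eta> \<in> borel_measurable ?M"
    by (rule reversed_control_energy(2)[OF Y(2) h2])
  have "(\<integral>s. (norm (reversed_control \<alpha> h ?\<eta> s))\<^sup>2 \<partial>?M) = (\<integral>s. (norm (g (T - s)))\<^sup>2 \<partial>?M)"
    by (rule integral_cong_AE[OF _ _ rc]) measurable
  also have "\<dots> = (\<integral>s. (norm (g s))\<^sup>2 \<partial>?M)" by (rule integral_reflection) measurable
  finally show "(\<integral>s. (norm (reversed_control \<alpha> h ?\<eta> s))\<^sup>2 \<partial>?M) = (\<integral>s. (norm (g s))\<^sup>2 \<partial>?M)" .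
qed

text \<open>The rate minimises over mean-zero controls, whereas a weak solution may be driven by any
  square-integrable one. Values of \<open>Lam \<alpha>\<close> have mean zero, so projecting the
  control preserves both the equation and the work done.\<close>

lemma weak_solution_mean_free_control:
  assumes T: "0 < T" and \<alpha>: "0 < \<alpha>" and g: "g \<in> L2T T" and sol: "weak_solution T \<alpha> g \<theta>0 \<theta>"
  shows "(\<lambda>s. mean_free (g s)) \<in> L2T_H T" "weak_solution T \<alpha> (\<lambda>s. mean_free (g s)) \<theta>0 \<theta>"
    and "(\<integral>s. inner (Lam \<alpha> (\<theta> s)) (mean_free (g s)) \<partial>lebesgue_on {0..T}) = (\<integral>s. inner (Lam \<alpha> (\<theta> s)) (g s) \<partial>lebesgue_on {0..T})"
proof -
  let ?M = "lebesgue_on {0..T}"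
  have gm[measurable]: "g \<in> borel_measurable ?M" and g2: "integrable ?M (\<lambda>s. (norm (g s))\<^sup>2)"
    using g by (auto simp: L2T_def)
  have mm[measurable]: "(\<lambda>s. mean_free (g s)) \<in> borel_measurable ?M"
    by (rule measurable_compose[OF gm borel_measurable_continuous_onI[OF continuous_mean_free]])
  have "integrable ?M (\<lambda>s. (norm (mean_free (g s)))\<^sup>2)"
    by (rule Bochner_Integration.integrable_bound[OF g2]) (auto intro!: power_mono norm_mean_free_le)
  then have L: "(\<lambda>s. mean_free (g s)) \<in> L2T T" by (simp add: L2T_def)
  then show "(\<lambda>s. mean_free (g s)) \<in> L2T_H T" by (simp add: L2T_H_def)
  have "inner (mean_free (g s)) (bas n) = inner (g s) (bas n)" for s n
    using inner_mean_free[OF bas_H0, of n "g s"] by (simp add: inner_commute)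
  then have "mode_rhs \<alpha> (\<lambda>s. mean_free (g s)) \<theta> = mode_rhs \<alpha> g \<theta>" by (intro ext) (simp add: mode_rhs_def)
  then have "mode_equations T \<alpha> (\<lambda>s. mean_free (g s)) \<theta>0 \<theta>"
    using weak_solution_imp_mode_equations[OF T sol] by (simp add: mode_equations_def)
  then show "weak_solution T \<alpha> (\<lambda>s. mean_free (g s)) \<theta>0 \<theta>"
    using sol by (intro mode_equations_imp_weak_solution T \<alpha> L) (auto simp: weak_solution_def)
  have ae: "AE s in ?M. \<theta> s \<in> Hs \<alpha>" and [measurable]: "(\<lambda>s. Lam \<alpha> (\<theta> s)) \<in> borel_measurable ?M"
    using sol by (auto simp: weak_solution_def L2T_Hs_def)
  from ae have "AE s in ?M. inner (Lam \<alpha> (\<theta> s)) (mean_free (g s)) = inner (Lam \<alpha> (\<theta> s)) (g s)"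
    by eventually_elim (simp add: inner_mean_free Lam_H0)
  then show "(\<integral>s. inner (Lam \<alpha> (\<theta> s)) (mean_free (g s)) \<partial>?M) = (\<integral>s. inner (Lam \<alpha> (\<theta> s)) (g s) \<partial>?M)"
    by (intro integral_cong_AE) measurable
qed

theorem theorem1p4:
  fixes T \<alpha> :: real
    and C0 R :: "(real \<Rightarrow> torus_L2) set"
    and \<theta> g :: "real \<Rightarrow> torus_L2"
  assumes T: "0 < T"
    and alpha: "0 < \<alpha>" "\<alpha> < 1"
    and C0: "C0 \<subseteq> X_space T \<alpha>" "weak_strong_uniqueness_class T \<alpha> C0"
    and nonempty: "\<exists>R'. R' \<noteq> {} \<and> R' \<subseteq> rate_closure T \<alpha> C0 \<and> time_reversible T R'"
    and R: "R \<subseteq> rate_closure T \<alpha> C0" "time_reversible T R"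
    and theta: "\<theta> \<in> R"
    and g: "g \<in> L2T T"
    and sol: "weak_solution T \<alpha> g (\<theta> 0) \<theta>"
  shows "1/2 * (norm (\<theta> T))\<^sup>2 + (\<integral>s. (norm_Hs \<alpha> (\<theta> s))\<^sup>2 \<partial>lebesgue_on {0..T})
    = 1/2 * (norm (\<theta> 0))\<^sup>2 + (\<integral>s. inner (Lam \<alpha> (\<theta> s)) (g s) \<partial>lebesgue_on {0..T})"
proof -
  define f where "f s = mean_free (g s)" for s
  note f = weak_solution_mean_free_control[OF T alpha(1) g sol, folded f_def]
  let ?\<eta> = "time_reversal T \<theta>"
  \<comment> \<open>Reversibility of R puts the reversed path into the closure and therefore into
    \<open>X_space\<close>, which supplies its regularity.\<close>
  have \<eta>R: "?\<eta> \<in> R" using R(2) theta unfolding time_reversible_def by blast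
  have cl: "\<theta> \<in> rate_closure T \<alpha> C0" "?\<eta> \<in> rate_closure T \<alpha> C0" using \<eta>R theta R(1) by auto
  then have X: "\<theta> \<in> X_space T \<alpha>" "?\<eta> \<in> X_space T \<alpha>" by (auto simp: rate_closure_def)
  note rev = reversed_weak_solution[OF T alpha(1) X(1) f(1,2) X(2)]
  have ends: "norm (?\<eta> 0) = norm (\<theta> T)" "norm (?\<eta> T) = norm (\<theta> 0)"
    using T by (simp_all add: time_reversal_def)
  have "f \<in> L2T T" using f(1) by (simp add: L2T_H_def)
  note E = reversed_control_energy(3)[OF X_space_D(2)[OF X(1)] this]
  \<comment> \<open>Here a and b are the squared norms at T and 0, G the energy of the control, P
    the work and N the dissipation. The two hypotheses are the inequality for \<theta> and the one
    for its reversal, whose sides have been exchanged.\<close>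
  have "1/2 * a + N = 1/2 * b + P"
    if "a + 1/2 * (G - 4 * P + 4 * N) \<le> b + 1/2 * G" "b + 1/2 * G \<le> a + 1/2 * (G - 4 * P + 4 * N)"
    for a b G P N :: real
    using that by argo
  then show ?thesis
    using reversed_energy_le_of_closure[OF T alpha(1) C0(2) cl(1) f(1,2)]
      reversed_energy_le_of_closure[OF T alpha(1) C0(2) cl(2) rev(1,2)]
    unfolding rev(3,4) ends E f(3) by blast
qed

end
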